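(* Let $Q$, $R$ and $S$ be Gorenstein Artin local rings with the same residue field $\mathsf k$, and with respective Cohen presentations $\widetilde Q/I_Q$, $\widetilde R/I_R$ and $\widetilde S/I_S$. Let $m=\operatorname{edim}(R)$ and $n=\operatorname{edim}(S)$. If $Q\simeq R\#_{\mathsf k}S$ is a non-trivial decomposition, then $$\mu(I_Q)=\mu(I_R)+\mu(I_S)+mn+\phi(m,n),$$ where $\phi(m,n)=1$ when $m,n\geq 2$, $\phi(1,1)=-1$, and $\phi(m,n)=0$ otherwise.
   Context: $\operatorname{edim}(T)$ is the minimal number of generators of the maximal ideal of a local ring $T$; $\mu(I)$ is the minimal number of generators of $I$. A Cohen presentation of a local ring $T$ is a quotient $\widetilde T/I_T\simeq T$ with $(\widetilde T,\mathfrak m_{\widetilde T},\mathsf k)$ a complete regular local ring and $I_T\subset\mathfrak m_{\widetilde T}^2$ an ideal. Fibre product: for local rings $(R,\mathfrak m_R,\mathsf k)$, $(S,\mathfrak m_S,\mathsf k)$ with natural projections $\pi_R,\pi_S$ onto $\mathsf k$, $R\times_{\mathsf k}S=\{(r,s)\in R\times S:\pi_R(r)=\pi_S(s)\}$. Connected sum: if $R,S$ are Gorenstein Artin local rings with residue field $\mathsf k$, different from $\mathsf k$, and $\operatorname{soc}(R)=\langle\delta_R\rangle$, $\operatorname{soc}(S)=\langle\delta_S\rangle$ (where $\operatorname{soc}(T)$ is the annihilator of the maximal ideal of $T$), then a connected sum of $R$ and $S$ over $\mathsf k$ is $R\#_{\mathsf k}S=(R\times_{\mathsf k}S)/\langle(\delta_R,0)-(0,\delta_S)\rangle$.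 It depends on the chosen socle generators; $Q\simeq R\#_{\mathsf k}S$ means that this holds for some choice. The decomposition $Q\simeq R\#_{\mathsf k}S$ is called non-trivial if $R\not\simeq Q\not\simeq S$.
   Formalization: Added: if the maximal ideal of R (or S) has square zero, that ring contains a field. Without it the claim fails: R = Z/p², S = F_p[x]/(x³), δ_R = p, δ_S = x² give a non-trivial Q with μ(I_Q) = 1, while the formula gives 2. *)

theory Defs
  imports "HOL-Algebra.Algebra" "HOL-Library.Extended_Nat"
begin

text \<open>Local rings are commutative and Noetherian.\<close>

locale local_ring = cring R + noetherian_ring R for R (structure) +
  assumes unique_maximal: "\<exists>!M. maximalideal M R"

definition max_ideal :: "('a, 'm) ring_scheme \<Rightarrow> 'a set"
  where "max_ideal R = (THE M. maximalideal M R)"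

text \<open>As \<^term>\<open>k\<close> is a field, the kernel of a surjection of a local ring onto \<^term>\<open>k\<close> is the
  maximal ideal; such a \<^term>\<open>p\<close> is the natural projection once the residue field is identified
  with \<^term>\<open>k\<close>.\<close>

definition residue_projection ::
    "('a, 'm) ring_scheme \<Rightarrow> ('k, 'l) ring_scheme \<Rightarrow> ('a \<Rightarrow> 'k) \<Rightarrow> bool"
  where "residue_projection R k p \<longleftrightarrow> p \<in> ring_hom R k \<and> p ` carrier R = carrier k"

text \<open>Powers of ideals are taken in the monoid of ideals, so the zeroth power is the whole ring.\<close>

definition ideal_power :: "('a, 'm) ring_scheme \<Rightarrow> 'a set \<Rightarrow> nat \<Rightarrow> 'a set"
  where "ideal_power R I n = I [^]\<^bsub>ideals_set R\<^esub> n"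

text \<open>This is only meaningful for finitely generated ideals, in particular in Noetherian rings.\<close>

definition min_gens :: "('a, 'm) ring_scheme \<Rightarrow> 'a set \<Rightarrow> nat"
  where "min_gens R I = (LEAST n. \<exists>A \<subseteq> carrier R. finite A \<and> card A = n \<and> Idl\<^bsub>R\<^esub> A = I)"

definition edim :: "('a, 'm) ring_scheme \<Rightarrow> nat"
  where "edim R = min_gens R (max_ideal R)"

definition prime_chain :: "('a, 'm) ring_scheme \<Rightarrow> (nat \<Rightarrow> 'a set) \<Rightarrow> nat \<Rightarrow> bool"
  where "prime_chain R P n \<longleftrightarrow> (\<forall>i\<le>n. primeideal (P i) R) \<and> (\<forall>i<n. P i \<subset> P (Suc i))"

definition krull_dim :: "('a, 'm) ring_scheme \<Rightarrow> enat"
  where "krull_dim R = Sup {enat n | n. \<exists>P. prime_chain R P n}"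

locale regular_local_ring = local_ring +
  assumes regular: "krull_dim R = enat (edim R)"

text \<open>Completeness: the canonical map to the inverse limit of the quotients by the powers of the
  maximal ideal is injective and surjective. An element of the inverse limit is represented by a
  sequence of lifts of its components.\<close>

locale complete_local_ring = local_ring +
  assumes separated: "(\<Inter>n. ideal_power R (max_ideal R) n) = {\<zero>}"
    and complete: "\<lbrakk>\<And>n. x n \<in> carrier R;
        \<And>n. x (Suc n) \<ominus> x n \<in> ideal_power R (max_ideal R) n\<rbrakk>
      \<Longrightarrow> \<exists>y \<in> carrier R. \<forall>n. x n \<ominus> y \<in> ideal_power R (max_ideal R) n"

text \<open>That \<^term>\<open>T'\<close> has the same residue field as \<^term>\<open>T\<close> is a consequence of the isomorphism.\<close>

definition cohen_presentation ::
    "('a, 'm) ring_scheme \<Rightarrow> ('b, 'n) ring_scheme \<Rightarrow> 'b set \<Rightarrow> bool"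
  where "cohen_presentation T T' I \<longleftrightarrow>
    regular_local_ring T' \<and> complete_local_ring T' \<and> ideal I T' \<and>
    I \<subseteq> ideal_power T' (max_ideal T') 2 \<and> T' Quot I \<simeq> T"

locale artin_local_ring = local_ring +
  assumes descending_chain: "\<lbrakk>\<And>n. ideal (I n) R; \<And>n. I (Suc n) \<subseteq> I n\<rbrakk>
    \<Longrightarrow> \<exists>N. \<forall>n\<ge>N. I n = I (N::nat)"

definition soc :: "('a, 'm) ring_scheme \<Rightarrow> 'a set"
  where "soc R = {a \<in> carrier R. \<forall>x \<in> max_ideal R. x \<otimes>\<^bsub>R\<^esub> a = \<zero>\<^bsub>R\<^esub>}"

text \<open>An Artin local ring is Gorenstein when its socle is one-dimensional over the residue field.
  The maximal ideal kills the socle, so this says that the socle is generated by one nonzero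
  element.\<close>

locale gorenstein_artin_local_ring = artin_local_ring +
  assumes simple_socle: "\<exists>d \<in> carrier R. d \<noteq> \<zero> \<and> soc R = Idl {d}"

definition fibre_product ::
    "('a, 'm) ring_scheme \<Rightarrow> ('a \<Rightarrow> 'k) \<Rightarrow> ('b, 'n) ring_scheme \<Rightarrow> ('b \<Rightarrow> 'k) \<Rightarrow> ('a \<times> 'b) ring"
  where "fibre_product R p S q =
    (RDirProd R S)\<lparr>carrier := {(r, s). r \<in> carrier R \<and> s \<in> carrier S \<and> p r = q s}\<rparr>"

definition connected_sum ::
    "('a, 'm) ring_scheme \<Rightarrow> ('a \<Rightarrow> 'k) \<Rightarrow> 'a \<Rightarrow> ('b, 'n) ring_scheme \<Rightarrow> ('b \<Rightarrow> 'k) \<Rightarrow> 'b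
      \<Rightarrow> ('a \<times> 'b) set ring"
  where "connected_sum R p d S q e =
    (let P = fibre_product R p S q
     in P Quot (Idl\<^bsub>P\<^esub> {(d, \<zero>\<^bsub>S\<^esub>) \<ominus>\<^bsub>P\<^esub> (\<zero>\<^bsub>R\<^esub>, e)}))"

definition is_connected_sum ::
    "('c, 'o) ring_scheme \<Rightarrow> ('k, 'l) ring_scheme \<Rightarrow>
      ('a, 'm) ring_scheme \<Rightarrow> ('a \<Rightarrow> 'k) \<Rightarrow> ('b, 'n) ring_scheme \<Rightarrow> ('b \<Rightarrow> 'k) \<Rightarrow> bool"
  where "is_connected_sum Q k R p S q \<longleftrightarrow>
    \<not> R \<simeq> k \<and> \<not> S \<simeq> k \<and>
    (\<exists>d \<in> carrier R. \<exists>e \<in> carrier S.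
       soc R = Idl\<^bsub>R\<^esub> {d} \<and> soc S = Idl\<^bsub>S\<^esub> {e} \<and> Q \<simeq> connected_sum R p d S q e)"

text \<open>A pitfall: if the square of the maximal ideal of \<^term>\<open>R\<close> is zero and \<^term>\<open>R\<close> contains a
  field, then every connected sum of \<^term>\<open>R\<close> and \<^term>\<open>S\<close> is isomorphic to \<^term>\<open>S\<close>, hence
  trivial. In mixed characteristic this fails: identifying \<open>p\<close> with \<open>x^2\<close> in the fibre product of
  \<open>Z/p^2\<close> and \<open>F_p[x]/(x^3)\<close> gives a chain ring of length 3 and characteristic \<open>p^2\<close>,
  which is isomorphic to neither summand.\<close>

definition nontrivial_connected_sum ::
    "('c, 'o) ring_scheme \<Rightarrow> ('k, 'l) ring_scheme \<Rightarrow>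
      ('a, 'm) ring_scheme \<Rightarrow> ('a \<Rightarrow> 'k) \<Rightarrow> ('b, 'n) ring_scheme \<Rightarrow> ('b \<Rightarrow> 'k) \<Rightarrow> bool"
  where "nontrivial_connected_sum Q k R p S q \<longleftrightarrow>
    is_connected_sum Q k R p S q \<and> \<not> R \<simeq> Q \<and> \<not> Q \<simeq> S"

definition phi :: "nat \<Rightarrow> nat \<Rightarrow> int"
  where "phi m n = (if m \<ge> 2 \<and> n \<ge> 2 then 1 else if m = 1 \<and> n = 1 then -1 else 0)"

end

theory Submission
  imports Defs "HOL-Algebra.Algebra" "HOL-Library.Extended_Nat"
begin

text \<open>
  The number of relations of a Cohen presentation is an invariant of the presented ring. Lift minimal
  generators of the maximal ideal of \<open>T\<close> to the regular ring. There they form a regular sequence,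
  which has only Koszul relations as syzygies, and therefore the minimal number of generators of the
  defining ideal is the length of the syzygies of the generators in \<open>T\<close> modulo the Koszul
  relations (\<open>cohen_presentation_min_gens\<close>). That a regular local ring has this property rests on
  Krull's principal ideal theorem (\<open>prime_between_containing\<close>).

  It remains to compare lengths. The connected sum \<open>Q\<close> is a quotient of the fibre product \<open>P\<close> of
  \<open>R\<close> and \<open>S\<close>, and generators of the two maximal ideals together generate that of \<open>Q\<close>. The length
  of the syzygies over \<open>Q\<close> follows from rank and nullity. The Koszul relations are first counted
  over \<open>P\<close> by projecting blocks of coordinates to \<open>R\<close> and \<open>S\<close> (\<open>koszul_length\<close>). In the passage
  to \<open>Q\<close> one loses the part of the Koszul module inside the kernel. This part has one dimension for
  each generator of \<open>R\<close> if there are at least two of them, and likewise for \<open>S\<close>: over a Gorenstein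
  ring with at least two generators, duality shows that the vectors with a single entry, taken from
  the socle, are combinations of Koszul relations (\<open>soc_single_koszul\<close>). The case distinction
  in this count is the source of \<open>phi\<close> (\<open>koszul_homology_Q\<close>).

  The count needs the socles inside the squares of the maximal ideals, and this is where
  non-triviality enters. If the square of the maximal ideal of \<open>R\<close> is zero, then \<open>R\<close> has a coefficient
  field (\<open>coefficient_field\<close>). Its inclusion lifts \<open>S\<close> to a complement of the kernel in \<open>P\<close>, so that
  \<open>S\<close> is isomorphic to \<open>Q\<close> (\<open>trivial_if_square_zero\<close>).
\<close>

section \<open>Composition series in modular families of sets\<close>

text \<open>Submodules, ideals and saturated ideals all form families of this kind, so composition
  series are treated once for all of them.\<close>

locale modular_family =
  fixes L :: "'a set set" and join :: "'a set \<Rightarrow> 'a set \<Rightarrow> 'a set"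
  assumes inter_closed: "\<lbrakk>A \<in> L; B \<in> L\<rbrakk> \<Longrightarrow> A \<inter> B \<in> L"
    and join_closed: "\<lbrakk>A \<in> L; B \<in> L\<rbrakk> \<Longrightarrow> join A B \<in> L"
    and join_upper1: "\<lbrakk>A \<in> L; B \<in> L\<rbrakk> \<Longrightarrow> A \<subseteq> join A B"
    and join_upper2: "\<lbrakk>A \<in> L; B \<in> L\<rbrakk> \<Longrightarrow> B \<subseteq> join A B"
    and join_least: "\<lbrakk>A \<in> L; B \<in> L; C \<in> L; A \<subseteq> C; B \<subseteq> C\<rbrakk> \<Longrightarrow> join A B \<subseteq> C"
    and modular_law: "\<lbrakk>A \<in> L; B \<in> L; C \<in> L; A \<subseteq> C\<rbrakk> \<Longrightarrow> join A B \<inter> C \<subseteq> join A (B \<inter> C)"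

definition covers :: "'a set set \<Rightarrow> 'a set \<Rightarrow> 'a set \<Rightarrow> bool"
  where "covers L A B \<longleftrightarrow> A \<in> L \<and> B \<in> L \<and> A \<subset> B \<and>
    (\<forall>C\<in>L. A \<subseteq> C \<longrightarrow> C \<subseteq> B \<longrightarrow> C = A \<or> C = B)"

inductive series :: "'a set set \<Rightarrow> 'a set \<Rightarrow> 'a set \<Rightarrow> nat \<Rightarrow> bool" for L
  where refl: "A \<in> L \<Longrightarrow> series L A A 0"
  | step: "\<lbrakk>series L A B n; covers L B C\<rbrakk> \<Longrightarrow> series L A C (Suc n)"

definition len :: "'a set set \<Rightarrow> 'a set \<Rightarrow> 'a set \<Rightarrow> nat"
  where "len L A B = (THE n. series L A B n)"

definition finlen :: "'a set set \<Rightarrow> 'a set \<Rightarrow> 'a set \<Rightarrow> bool"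
  where "finlen L A B \<longleftrightarrow> (\<exists>n. series L A B n)"

lemma series_subset: "series L A B n \<Longrightarrow> A \<subseteq> B"
  by (induction rule: series.induct) (auto simp: covers_def)

lemma series_mem: "series L A B n \<Longrightarrow> A \<in> L \<and> B \<in> L"
  by (induction rule: series.induct) (auto simp: covers_def)

lemma series_trans:
  assumes "series L B C j" "series L A B i"
  shows "series L A C (i + j)"
  using assms by (induction rule: series.induct) (auto intro: series.intros)

lemma series_covers: "covers L A B \<Longrightarrow> series L A B 1"
  using series.step[OF series.refl, of A L B] by (auto simp: covers_def)

context modular_family
begin

lemma join_absorb: "\<lbrakk>A \<in> L; B \<in> L; A \<subseteq> B\<rbrakk> \<Longrightarrow> join A B = B"
  using join_least[of A B B] join_upper2[of A B] by auto

lemma join_commute: "\<lbrakk>A \<in> L; B \<in> L\<rbrakk> \<Longrightarrow> join A B = join B A"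
  by (intro equalityI join_least join_closed join_upper1 join_upper2)

lemma modular: "\<lbrakk>A \<in> L; B \<in> L; C \<in> L; A \<subseteq> C\<rbrakk> \<Longrightarrow> join A B \<inter> C = join A (B \<inter> C)"
  using join_least[of A "B \<inter> C" "join A B \<inter> C"] join_upper1[of A B] join_upper2[of A B]
  by (intro equalityI modular_law) (auto simp: inter_closed join_closed)

text \<open>The two halves of the diamond isomorphism between the intervals from \<open>C \<inter> B\<close> to \<open>C\<close> and
  from \<open>B\<close> to \<open>B + C\<close>, for covering pairs.\<close>

lemma covers_inter:
  assumes cov: "covers L B D" and "C \<in> L" "C \<subseteq> D" "\<not> C \<subseteq> B"
  shows "covers L (C \<inter> B) C" "join B C = D"
proof -
  have [simp]: "B \<in> L" "D \<in> L" and "B \<subset> D" using cov by (auto simp: covers_def)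
  have max: "Y = B \<or> Y = D" if "Y \<in> L" "B \<subseteq> Y" "Y \<subseteq> D" for Y
    using cov that by (auto simp: covers_def)
  show jD: "join B C = D"
    using max[of "join B C"] assms \<open>B \<subset> D\<close> join_upper1[of B C] join_upper2[of B C]
      join_least[of B C D] join_closed[of B C] by auto
  have "Y = C \<inter> B \<or> Y = C" if Y: "Y \<in> L" "C \<inter> B \<subseteq> Y" "Y \<subseteq> C" for Y
  proof -
    have mX: "join Y B \<inter> C = join Y (B \<inter> C)"
      using Y assms by (intro modular) auto
    also have "\<dots> = join (B \<inter> C) Y"
      using Y assms by (intro join_commute) (auto simp: inter_closed)
    also have "\<dots> = Y"
      using Y assms by (intro join_absorb) (auto simp: inter_closed)
    finally have eq: "join Y B \<inter> C = Y" .
    have "join Y B = B \<or> join Y B = D"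
      using Y assms \<open>B \<subset> D\<close> by (intro max join_closed join_upper2 join_least) auto
    then show ?thesis using eq assms by auto
  qed
  then show "covers L (C \<inter> B) C"
    using assms by (auto simp: covers_def inter_closed)
qed

lemma covers_join:
  assumes cov: "covers L B D" and "C \<in> L"
  shows "join C B = join C D \<or> covers L (join C B) (join C D)"
proof -
  have [simp]: "B \<in> L" "D \<in> L" "C \<in> L" and "B \<subset> D" using assms by (auto simp: covers_def)
  have max: "Y = B \<or> Y = D" if "Y \<in> L" "B \<subseteq> Y" "Y \<subseteq> D" for Y
    using cov that by (auto simp: covers_def)
  have sub: "join C B \<subseteq> join C D"
    using join_upper1[of C D] join_upper2[of C D] \<open>B \<subset> D\<close>
    by (intro join_least) (auto simp: join_closed)
  have "Y = join C B \<or> Y = join C D"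
    if Y: "Y \<in> L" "join C B \<subseteq> Y" "Y \<subseteq> join C D" for Y
  proof -
    have CX: "C \<subseteq> Y" "B \<subseteq> Y"
      using Y join_upper1[of C B] join_upper2[of C B] by auto
    have "Y = join C D \<inter> Y" using Y by auto
    also have "\<dots> = join C (D \<inter> Y)" using Y CX by (intro modular) auto
    finally have "Y = join C (D \<inter> Y)" .
    moreover have "D \<inter> Y = B \<or> D \<inter> Y = D"
      using Y CX \<open>B \<subset> D\<close> by (intro max) (auto simp: inter_closed)
    ultimately show ?thesis by auto
  qed
  then show ?thesis using sub by (auto simp: covers_def join_closed)
qed

lemma series_diamond:
  assumes "series L A B n" "C \<in> L" "C \<inter> B = A"
  shows "series L C (join C B) n"
  using assms
proof (induction rule: series.induct)
  case (refl A)
  then have "join C A = C" using join_absorb[of A C] join_commute[of A C] by auto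
  then show ?case using refl by (auto intro: series.refl)
next
  case (step A B n D)
  have mem: "A \<in> L" "B \<in> L" "D \<in> L" "B \<subset> D"
    using step.hyps by (auto simp: covers_def dest: series_mem)
  have "C \<inter> B = A"
    using step.prems series_subset[OF step.hyps(1)] mem by auto
  then have IH: "series L C (join C B) n"
    using step.IH step.prems by auto
  have "join C B \<noteq> join C D"
  proof
    assume "join C B = join C D"
    then have "D = join B C \<inter> D"
      using join_upper2[of C D] join_commute[of C B] mem step.prems by auto
    also have "\<dots> = join B A"
      using modular[of B C D] mem step.prems by auto
    also have "\<dots> = B"
      using join_absorb[of A B] join_commute[of A B] mem series_subset[OF step.hyps(1)] by auto
    finally show False using mem by auto
  qed
  then show ?case
    using covers_join[OF step.hyps(2)] step.prems IH by (auto intro: series.step)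
qed

text \<open>This makes lengths add up along chains. Together with the uniqueness of the length it is
  the Jordan-Hoelder theorem.\<close>

lemma series_split:
  assumes "series L A B n" "C \<in> L" "A \<subseteq> C" "C \<subseteq> B"
  shows "\<exists>i j. i + j = n \<and> series L A C i \<and> series L C B j"
  using assms
proof (induction arbitrary: C rule: series.induct)
  case (refl A)
  then have "C = A" by auto
  then show ?case using refl by (auto intro: series.refl)
next
  case (step A B n D)
  have mem: "A \<in> L" "B \<in> L" "D \<in> L" "B \<subset> D" "A \<subseteq> B"
    using step.hyps by (auto simp: covers_def dest: series_mem series_subset)
  show ?case
  proof (cases "C \<subseteq> B")
    case True
    then obtain i j where "i + j = n" "series L A C i" "series L C B j"
      using step by blast
    then show ?thesis using series.step[OF _ step.hyps(2), of C j] by (metis add_Suc_right)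
  next
    case False
    obtain i j where ij: "i + j = n" "series L A (C \<inter> B) i" "series L (C \<inter> B) B j"
      using step.IH[of "C \<inter> B"] step.prems mem by (auto simp: inter_closed)
    have "covers L (C \<inter> B) C" "join C B = D"
      using covers_inter[OF step.hyps(2)] step.prems False mem join_commute[of C B] by auto
    then have "series L A C (Suc i)" "series L C D j"
      using series.step[OF ij(2)] series_diamond[OF ij(3), of C] step.prems by auto
    then show ?thesis using ij(1) by (metis add_Suc)
  qed
qed

lemma series_self: "series L A A n \<Longrightarrow> n = 0"
  by (erule series.cases) (auto simp: covers_def dest: series_subset)

lemma series_unique:
  assumes "series L A B n" "series L A B n'"
  shows "n = n'"
  using assms
proof (induction arbitrary: n' rule: series.induct)
  case (refl A)
  then show ?case using series_self by auto
next
  case (step A B n D)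
  have mem: "B \<in> L" "A \<subseteq> B" "B \<subset> D" and max: "\<And>Y. Y \<in> L \<Longrightarrow> B \<subseteq> Y \<Longrightarrow> Y \<subseteq> D \<Longrightarrow> Y = B \<or> Y = D"
    using step.hyps by (auto simp: covers_def dest: series_subset)
  obtain i j where ij: "i + j = n'" "series L A B i" "series L B D j"
    using series_split[OF step.prems, of B] mem by auto
  have "j = 1"
    using ij(3)
  proof (cases rule: series.cases)
    case refl
    then show ?thesis using mem by auto
  next
    case (step Y k)
    have "Y = B"
      using max[of Y] step series_subset[OF step(2)] by (auto simp: covers_def)
    then show ?thesis using step series_self by auto
  qed
  then show ?case using ij step.IH by auto
qed

lemma series_len: "series L A B n \<Longrightarrow> len L A B = n"
  unfolding len_def using series_unique by (intro the_equality) auto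

lemma len_self: "A \<in> L \<Longrightarrow> len L A A = 0"
  by (intro series_len series.refl)

lemma finlen_split:
  assumes "finlen L A B" "C \<in> L" "A \<subseteq> C" "C \<subseteq> B"
  shows "finlen L A C" "finlen L C B" "len L A B = len L A C + len L C B"
proof -
  obtain n where n: "series L A B n" using assms by (auto simp: finlen_def)
  obtain i j where ij: "i + j = n" "series L A C i" "series L C B j"
    using series_split[OF n assms(2-)] by auto
  show "finlen L A C" "finlen L C B" "len L A B = len L A C + len L C B"
    using ij n series_len by (auto simp: finlen_def)
qed

lemma len_zero_imp_eq: "finlen L A B \<Longrightarrow> len L A B = 0 \<Longrightarrow> A = B"
  unfolding finlen_def using series_len by (auto elim: series.cases)

end

text \<open>An order isomorphism between intervals carries composition series to composition series.\<close>

lemma series_transport: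
  assumes "series L A B n"
    and F: "\<And>C. \<lbrakk>C \<in> L; A \<subseteq> C; C \<subseteq> B\<rbrakk> \<Longrightarrow> F C \<in> L' \<and> G (F C) = C"
    and G: "\<And>C. \<lbrakk>C \<in> L'; F A \<subseteq> C; C \<subseteq> F B\<rbrakk> \<Longrightarrow> G C \<in> L \<and> A \<subseteq> G C \<and> F (G C) = C"
    and F_mono: "\<And>C D. C \<subseteq> D \<Longrightarrow> F C \<subseteq> F D"
    and G_mono: "\<And>C D. C \<subseteq> D \<Longrightarrow> G C \<subseteq> G D"
  shows "series L' (F A) (F B) n"
  using assms(1-3)
proof (induction rule: series.induct)
  case (refl A)
  then show ?case by (auto intro: series.refl)
next
  case (step A B n D)
  have mem: "A \<in> L" "B \<in> L" "D \<in> L" "A \<subseteq> B" "B \<subset> D"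
    and max: "\<And>Y. Y \<in> L \<Longrightarrow> B \<subseteq> Y \<Longrightarrow> Y \<subseteq> D \<Longrightarrow> Y = B \<or> Y = D"
    using step.hyps by (auto simp: covers_def dest: series_subset series_mem)
  have "F A \<subseteq> F B" "F B \<subseteq> F D" using mem F_mono by auto
  have "series L' (F A) (F B) n"
  proof (rule step.IH)
    show "F C \<in> L' \<and> G (F C) = C" if "C \<in> L" "A \<subseteq> C" "C \<subseteq> B" for C
      using that step.prems(1) mem by auto
    show "G C \<in> L \<and> A \<subseteq> G C \<and> F (G C) = C" if "C \<in> L'" "F A \<subseteq> C" "C \<subseteq> F B" for C
      using that step.prems(2) \<open>F B \<subseteq> F D\<close> by auto
  qed
  moreover have "covers L' (F B) (F D)"
    unfolding covers_def
  proof (intro conjI ballI impI)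
    show "F B \<in> L'" "F D \<in> L'" using step.prems(1) mem by auto
    show "F B \<subset> F D"
      using \<open>F B \<subseteq> F D\<close> step.prems(1)[of B] step.prems(1)[of D] mem by fastforce
    fix C assume C: "C \<in> L'" "F B \<subseteq> C" "C \<subseteq> F D"
    have GC: "G C \<in> L" "F (G C) = C" using step.prems(2)[of C] C \<open>F A \<subseteq> F B\<close> by auto
    have "G (F B) \<subseteq> G C" "G C \<subseteq> G (F D)" using C G_mono by auto
    then have "G C = B \<or> G C = D"
      using step.prems(1)[of B] step.prems(1)[of D] mem GC by (intro max) auto
    then show "C = F B \<or> C = F D" using GC by auto
  qed
  ultimately show ?case by (rule series.step)
qed

section \<open>Groups with operators\<close>

text \<open>The operators stand for multiplications by scalars, so ideals and submodules of free
  modules over different rings are all stable subgroups.\<close>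

definition submods :: "('a, 'm) ring_scheme \<Rightarrow> ('a \<Rightarrow> 'a) set \<Rightarrow> 'a set set"
  where "submods G Op = {H. H \<subseteq> carrier G \<and> \<zero>\<^bsub>G\<^esub> \<in> H \<and> (\<forall>x\<in>H. \<forall>y\<in>H. x \<oplus>\<^bsub>G\<^esub> y \<in> H) \<and>
    (\<forall>x\<in>H. \<ominus>\<^bsub>G\<^esub> x \<in> H) \<and> (\<forall>f\<in>Op. \<forall>x\<in>H. f x \<in> H)}"

definition span :: "('a, 'm) ring_scheme \<Rightarrow> ('a \<Rightarrow> 'a) set \<Rightarrow> 'a set \<Rightarrow> 'a set"
  where "span G Op S = \<Inter>{H \<in> submods G Op. S \<subseteq> H}"

text \<open>The two groups may be modules over different rings, linked by a surjection of rings.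
  Operators have to be matched in both directions, so that images and preimages of stable
  subgroups are stable.\<close>

definition semilinear :: "('a, 'm) ring_scheme \<Rightarrow> ('a \<Rightarrow> 'a) set \<Rightarrow> ('b, 'n) ring_scheme \<Rightarrow>
    ('b \<Rightarrow> 'b) set \<Rightarrow> ('a \<Rightarrow> 'b) \<Rightarrow> bool"
  where "semilinear G Op H Op' f \<longleftrightarrow> f \<in> carrier G \<rightarrow> carrier H \<and>
    (\<forall>x\<in>carrier G. \<forall>y\<in>carrier G. f (x \<oplus>\<^bsub>G\<^esub> y) = f x \<oplus>\<^bsub>H\<^esub> f y) \<and>
    (\<forall>u\<in>Op. \<exists>u'\<in>Op'. \<forall>x\<in>carrier G. f (u x) = u' (f x)) \<and>
    (\<forall>u'\<in>Op'. \<exists>u\<in>Op. \<forall>x\<in>carrier G. f (u x) = u' (f x))"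

locale op_group = abelian_group G for G :: "('a, 'm) ring_scheme" (structure) +
  fixes Op :: "('a \<Rightarrow> 'a) set"
  assumes op_closed: "\<lbrakk>u \<in> Op; x \<in> carrier G\<rbrakk> \<Longrightarrow> u x \<in> carrier G"
    and op_add: "\<lbrakk>u \<in> Op; x \<in> carrier G; y \<in> carrier G\<rbrakk> \<Longrightarrow> u (x \<oplus> y) = u x \<oplus> u y"

lemma mem_set_add: "x \<in> A <+>\<^bsub>G\<^esub> B \<longleftrightarrow> (\<exists>a\<in>A. \<exists>b\<in>B. x = a \<oplus>\<^bsub>G\<^esub> b)"
  by (auto simp: set_add_def set_mult_def)

lemma submodsD:
  assumes "H \<in> submods G Op"
  shows "H \<subseteq> carrier G" "\<zero>\<^bsub>G\<^esub> \<in> H" "x \<in> H \<Longrightarrow> x \<in> carrier G"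
    "\<lbrakk>x \<in> H; y \<in> H\<rbrakk> \<Longrightarrow> x \<oplus>\<^bsub>G\<^esub> y \<in> H"
    "x \<in> H \<Longrightarrow> \<ominus>\<^bsub>G\<^esub> x \<in> H"
    "\<lbrakk>u \<in> Op; x \<in> H\<rbrakk> \<Longrightarrow> u x \<in> H"
    "\<lbrakk>x \<in> H; y \<in> H\<rbrakk> \<Longrightarrow> x \<ominus>\<^bsub>G\<^esub> y \<in> H"
  using assms by (auto simp: submods_def a_minus_def)

lemma submodsI:
  assumes "H \<subseteq> carrier G" "\<zero>\<^bsub>G\<^esub> \<in> H" "\<And>x y. \<lbrakk>x \<in> H; y \<in> H\<rbrakk> \<Longrightarrow> x \<oplus>\<^bsub>G\<^esub> y \<in> H"
    "\<And>x. x \<in> H \<Longrightarrow> \<ominus>\<^bsub>G\<^esub> x \<in> H" "\<And>u x. \<lbrakk>u \<in> Op; x \<in> H\<rbrakk> \<Longrightarrow> u x \<in> H"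
  shows "H \<in> submods G Op"
  using assms by (auto simp: submods_def)

context op_group
begin

lemma op_zero: "u \<in> Op \<Longrightarrow> u \<zero> = \<zero>"
  using op_add[of u \<zero> \<zero>] op_closed[of u \<zero>] by simp

lemma zero_submod: "{\<zero>} \<in> submods G Op"
  by (auto simp: submods_def op_zero)

lemma carrier_submod: "carrier G \<in> submods G Op"
  by (auto simp: submods_def op_closed)

lemma inter_submod: "\<lbrakk>A \<in> submods G Op; B \<in> submods G Op\<rbrakk> \<Longrightarrow> A \<inter> B \<in> submods G Op"
  by (auto simp: submods_def)

lemma Inter_submod: "\<lbrakk>\<And>A. A \<in> F \<Longrightarrow> A \<in> submods G Op; F \<noteq> {}\<rbrakk> \<Longrightarrow> \<Inter>F \<in> submods G Op"
  by (auto simp: submods_def) fast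

lemma sum_submod:
  assumes A: "A \<in> submods G Op" and B: "B \<in> submods G Op"
  shows "set_add G A B \<in> submods G Op"
proof -
  have "(a \<oplus> b) \<oplus> (a' \<oplus> b') \<in> set_add G A B" if "a \<in> A" "b \<in> B" "a' \<in> A" "b' \<in> B" for a b a' b'
  proof -
    have "(a \<oplus> b) \<oplus> (a' \<oplus> b') = (a \<oplus> a') \<oplus> (b \<oplus> b')"
      using that submodsD(3)[OF A] submodsD(3)[OF B] by (simp add: a_ac)
    then show ?thesis
      using submodsD(4)[OF A that(1,3)] submodsD(4)[OF B that(2,4)] unfolding mem_set_add by blast
  qed
  moreover have "\<ominus> (a \<oplus> b) \<in> set_add G A B" if "a \<in> A" "b \<in> B" for a b
  proof -
    have "\<ominus> (a \<oplus> b) = \<ominus> a \<oplus> \<ominus> b"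
      using that submodsD(3)[OF A] submodsD(3)[OF B] by (simp add: minus_add)
    then show ?thesis
      using submodsD(5)[OF A that(1)] submodsD(5)[OF B that(2)] unfolding mem_set_add by blast
  qed
  moreover have "u (a \<oplus> b) \<in> set_add G A B" if "u \<in> Op" "a \<in> A" "b \<in> B" for a b u
  proof -
    have "u (a \<oplus> b) = u a \<oplus> u b"
      using that submodsD(3)[OF A] submodsD(3)[OF B] by (simp add: op_add)
    then show ?thesis
      using submodsD(6)[OF A that(1,2)] submodsD(6)[OF B that(1,3)] unfolding mem_set_add by blast
  qed
  moreover have "\<zero> \<in> set_add G A B"
    using submodsD(2)[OF A] submodsD(2)[OF B] r_zero[OF zero_closed] unfolding mem_set_add by metis
  moreover have "a \<oplus> b \<in> carrier G" if "a \<in> A" "b \<in> B" for a b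
    using that submodsD(3)[OF A] submodsD(3)[OF B] by simp
  ultimately show ?thesis
    by (intro submodsI subsetI; (elim mem_set_add[THEN iffD1, elim_format] bexE)?; simp)
qed

sublocale modular_family "submods G Op" "set_add G"
proof
  fix A B assume A: "A \<in> submods G Op" and B: "B \<in> submods G Op"
  show "A \<inter> B \<in> submods G Op" "set_add G A B \<in> submods G Op"
    using A B by (auto intro: inter_submod sum_submod)
  show "A \<subseteq> set_add G A B"
  proof
    fix x assume "x \<in> A"
    then show "x \<in> set_add G A B"
      using submodsD(2)[OF B] r_zero[OF submodsD(3)[OF A]] unfolding mem_set_add by metis
  qed
  show "B \<subseteq> set_add G A B"
  proof
    fix x assume "x \<in> B"
    then show "x \<in> set_add G A B"
      using submodsD(2)[OF A] l_zero[OF submodsD(3)[OF B]] unfolding mem_set_add by metis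
  qed
  fix C assume C: "C \<in> submods G Op" 
  show "set_add G A B \<subseteq> C" if "A \<subseteq> C" "B \<subseteq> C"
    using that submodsD(4)[OF C] unfolding mem_set_add by (smt (verit) mem_set_add subsetD subsetI)
  show "(set_add G A B) \<inter> C \<subseteq> set_add G A (B \<inter> C)" if "A \<subseteq> C"
  proof (clarsimp simp: mem_set_add)
    fix a b assume ab: "a \<in> A" "b \<in> B" "a \<oplus> b \<in> C"
    have "b = \<ominus> a \<oplus> (a \<oplus> b)"
      using ab submodsD(3)[OF A] submodsD(3)[OF B] by (simp add: r_neg1)
    then have "b \<in> C" using ab that submodsD(4,5)[OF C] by (metis subsetD)
    then show "\<exists>a'\<in>A. \<exists>b'\<in>B \<inter> C. a \<oplus> b = a' \<oplus> b'" using ab by auto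
  qed
qed

lemma span_submod: "S \<subseteq> carrier G \<Longrightarrow> span G Op S \<in> submods G Op"
  unfolding span_def using carrier_submod by (intro Inter_submod) auto

lemma span_superset: "S \<subseteq> span G Op S"
  by (auto simp: span_def)

lemma span_least: "\<lbrakk>H \<in> submods G Op; S \<subseteq> H\<rbrakk> \<Longrightarrow> span G Op S \<subseteq> H"
  by (auto simp: span_def)

end

locale op_hom = G: op_group G Op + H: op_group H Op'
  for G :: "('a, 'm) ring_scheme" (structure) and Op
    and H :: "('b, 'n) ring_scheme" (structure) and Op' +
  fixes f assumes semilinear: "semilinear G Op H Op' f"
begin

lemma f_closed: "x \<in> carrier G \<Longrightarrow> f x \<in> carrier H"
  using semilinear by (auto simp: semilinear_def)

lemma f_add: "\<lbrakk>x \<in> carrier G; y \<in> carrier G\<rbrakk> \<Longrightarrow> f (x \<oplus> y) = f x \<oplus>\<^bsub>H\<^esub> f y"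
  using semilinear by (auto simp: semilinear_def)

lemma f_zero: "f \<zero> = \<zero>\<^bsub>H\<^esub>"
  using f_add[of \<zero> \<zero>] f_closed[of \<zero>] by simp

lemma f_minus: "x \<in> carrier G \<Longrightarrow> f (\<ominus> x) = \<ominus>\<^bsub>H\<^esub> f x"
  using f_add[of "\<ominus> x" x] f_closed[of x] f_closed[of "\<ominus> x"] f_zero
  by (intro H.minus_equality[symmetric]) (simp_all add: G.l_neg)

lemma f_diff: "\<lbrakk>x \<in> carrier G; y \<in> carrier G\<rbrakk> \<Longrightarrow> f (x \<ominus> y) = f x \<ominus>\<^bsub>H\<^esub> f y"
  by (simp add: a_minus_def f_add f_minus)

lemma op_forward: "u \<in> Op \<Longrightarrow> \<exists>u'\<in>Op'. \<forall>x\<in>carrier G. f (u x) = u' (f x)"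
  using semilinear unfolding semilinear_def by (elim conjE) (drule (1) bspec)

lemma op_backward: "u' \<in> Op' \<Longrightarrow> \<exists>u\<in>Op. \<forall>x\<in>carrier G. f (u x) = u' (f x)"
  using semilinear unfolding semilinear_def by (elim conjE) (drule (1) bspec)

lemma image_submod:
  assumes M: "M \<in> submods G Op"
  shows "f ` M \<in> submods H Op'"
proof -
  have "u' (f x) \<in> f ` M" if h: "u' \<in> Op'" "x \<in> M" for u' x
  proof -
    obtain u where "u \<in> Op" "f (u x) = u' (f x)"
      using op_backward[OF h(1)] submodsD(3)[OF M h(2)] by auto
    then show ?thesis using submodsD(6)[OF M _ h(2)] by (intro image_eqI[where x = "u x"]) auto
  qed
  moreover have "f x \<oplus>\<^bsub>H\<^esub> f y \<in> f ` M" if "x \<in> M" "y \<in> M" for x y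
    using that submodsD(3,4)[OF M] by (intro image_eqI[where x = "x \<oplus> y"]) (auto simp: f_add)
  moreover have "\<ominus>\<^bsub>H\<^esub> f x \<in> f ` M" if "x \<in> M" for x
    using that submodsD(3,5)[OF M] by (intro image_eqI[where x = "\<ominus> x"]) (auto simp: f_minus)
  moreover have "\<zero>\<^bsub>H\<^esub> \<in> f ` M" using f_zero submodsD(2)[OF M] by (intro image_eqI[where x = "\<zero>"]) auto
  ultimately show ?thesis
    using submodsD(3)[OF M] f_closed by (intro submodsI) blast+
qed

lemma vimage_submod:
  assumes N: "N \<in> submods H Op'"
  shows "{x \<in> carrier G. f x \<in> N} \<in> submods G Op"
proof -
  have "f (u x) \<in> N" if h: "u \<in> Op" "x \<in> carrier G" "f x \<in> N" for u x
  proof -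
    obtain u' where "u' \<in> Op'" "f (u x) = u' (f x)"
      using op_forward[OF h(1)] h(2) by auto
    then show ?thesis using submodsD(6)[OF N] h(3) by metis
  qed
  then show ?thesis
    using submodsD[OF N] by (auto simp: submods_def f_zero f_add f_minus G.op_closed)
qed

definition "ker = {x \<in> carrier G. f x = \<zero>\<^bsub>H\<^esub>}"

lemma ker_submod: "ker \<in> submods G Op"
  using vimage_submod[OF H.zero_submod] by (simp add: ker_def)

lemma image_span:
  assumes "S \<subseteq> carrier G"
  shows "f ` span G Op S = span H Op' (f ` S)"
proof
  have "span H Op' (f ` S) \<in> submods H Op'"
    using assms f_closed by (intro H.span_submod) auto
  then show "f ` span G Op S \<subseteq> span H Op' (f ` S)"
    using G.span_least[OF vimage_submod, of "span H Op' (f ` S)" S] H.span_superset[of "f ` S"] assms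
    by auto
  show "span H Op' (f ` S) \<subseteq> f ` span G Op S"
    using G.span_superset[of S] G.span_submod[OF assms] by (intro H.span_least image_submod) auto
qed

lemma image_interval:
  assumes A: "A \<in> submods G Op" and B: "B \<in> submods G Op" and "A \<subseteq> B" and ker: "ker \<inter> B \<subseteq> A"
  shows "series (submods G Op) A B n \<longleftrightarrow> series (submods H Op') (f ` A) (f ` B) n"
proof -
  let ?G = "\<lambda>D. {x \<in> B. f x \<in> D}"
  have GF: "?G (f ` C) = C" if C: "C \<in> submods G Op" "A \<subseteq> C" "C \<subseteq> B" for C
  proof -
    have "x \<in> C" if "x \<in> B" "y \<in> C" "f x = f y" for x y
    proof -
      have xy: "x \<in> carrier G" "y \<in> carrier G"
        using that submodsD(3)[OF B] submodsD(3)[OF C(1)] by auto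
      have "x \<ominus> y \<in> B" using that C submodsD(7)[OF B] by auto
      moreover have "f (x \<ominus> y) = \<zero>\<^bsub>H\<^esub>"
        using xy that(3) f_closed[of y] by (simp add: f_diff) (simp add: H.r_neg a_minus_def)
      ultimately have "x \<ominus> y \<in> C" using ker C xy by (auto simp: ker_def)
      then have "(x \<ominus> y) \<oplus> y \<in> C" using submodsD(4)[OF C(1)] that by auto
      then show ?thesis using xy by (simp add: a_minus_def G.a_assoc G.l_neg)
    qed
    then show ?thesis using C by auto
  qed
  have FG: "?G D \<in> submods G Op \<and> f ` ?G D = D" if D: "D \<in> submods H Op'" "D \<subseteq> f ` B" for D
  proof -
    have "?G D = {x \<in> carrier G. f x \<in> D} \<inter> B" using submodsD(1)[OF B] by auto
    moreover have "f ` ?G D = D" using D by auto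
    ultimately show ?thesis using vimage_submod[OF D(1)] B G.inter_submod by metis
  qed
  show ?thesis
  proof
    assume "series (submods G Op) A B n"
    then show "series (submods H Op') (f ` A) (f ` B) n"
    proof (rule series_transport[where F = "(`) f" and G = ?G])
      show "f ` C \<in> submods H Op' \<and> ?G (f ` C) = C"
        if "C \<in> submods G Op" "A \<subseteq> C" "C \<subseteq> B" for C
        using GF that image_submod by auto
      show "?G C \<in> submods G Op \<and> A \<subseteq> ?G C \<and> f ` ?G C = C"
        if "C \<in> submods H Op'" "f ` A \<subseteq> C" "C \<subseteq> f ` B" for C
        using FG that \<open>A \<subseteq> B\<close> by auto
    qed auto
  next
    assume "series (submods H Op') (f ` A) (f ` B) n"
    then have "series (submods G Op) (?G (f ` A)) (?G (f ` B)) n"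
    proof (rule series_transport[where F = ?G and G = "(`) f"])
      show "?G C \<in> submods G Op \<and> f ` ?G C = C"
        if "C \<in> submods H Op'" "f ` A \<subseteq> C" "C \<subseteq> f ` B" for C
        using FG that by auto
      show "f ` C \<in> submods H Op' \<and> f ` A \<subseteq> f ` C \<and> ?G (f ` C) = C"
        if "C \<in> submods G Op" "?G (f ` A) \<subseteq> C" "C \<subseteq> ?G (f ` B)" for C
        using GF[of C] that image_submod[of C] GF[OF A _ \<open>A \<subseteq> B\<close>] GF[OF B \<open>A \<subseteq> B\<close>] by auto
    qed auto
    then show "series (submods G Op) A B n"
      using GF[OF A _ \<open>A \<subseteq> B\<close>] GF[OF B \<open>A \<subseteq> B\<close>] by auto
  qed
qed

text \<open>Since \<open>A\<close> contains what \<open>B\<close> has of the kernel, taking images is a bijection between the two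
  intervals, with preimages as its inverse.\<close>

lemma len_interval:
  assumes "A \<in> submods G Op" "B \<in> submods G Op" "A \<subseteq> B" "ker \<inter> B \<subseteq> A"
  shows "len (submods G Op) A B = len (submods H Op') (f ` A) (f ` B)"
    "finlen (submods G Op) A B \<longleftrightarrow> finlen (submods H Op') (f ` A) (f ` B)"
  using image_interval[OF assms] by (auto simp: len_def finlen_def)

end

definition fin :: "('a, 'm) ring_scheme \<Rightarrow> ('a \<Rightarrow> 'a) set \<Rightarrow> 'a set \<Rightarrow> bool"
  where "fin G Op M \<longleftrightarrow> finlen (submods G Op) {\<zero>\<^bsub>G\<^esub>} M"

definition lg :: "('a, 'm) ring_scheme \<Rightarrow> ('a \<Rightarrow> 'a) set \<Rightarrow> 'a set \<Rightarrow> nat"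
  where "lg G Op M = len (submods G Op) {\<zero>\<^bsub>G\<^esub>} M"

lemma (in op_group) fin_sub:
  assumes "fin G Op B" "A \<in> submods G Op" "A \<subseteq> B"
  shows "fin G Op A" "finlen (submods G Op) A B" "lg G Op B = lg G Op A + len (submods G Op) A B"
  using finlen_split[of "{\<zero>}" B A] assms submodsD(2)[OF assms(2)] by (auto simp: fin_def lg_def)

lemma (in op_group) lg_mono: "\<lbrakk>fin G Op B; A \<in> submods G Op; A \<subseteq> B\<rbrakk> \<Longrightarrow> lg G Op A \<le> lg G Op B"
  using fin_sub(3)[of B A] by simp

lemma (in op_group) lg_eq_imp_eq: "\<lbrakk>fin G Op B; A \<in> submods G Op; A \<subseteq> B; lg G Op A = lg G Op B\<rbrakk> \<Longrightarrow> A = B"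
  using fin_sub(2,3)[of B A] len_zero_imp_eq[of A B] by simp

lemma (in op_group) fin_zero: "fin G Op {\<zero>}" "lg G Op {\<zero>} = 0"
  using len_self[OF zero_submod] series.refl[OF zero_submod] by (auto simp: fin_def lg_def finlen_def)

lemma (in op_hom) rank_nullity:
  assumes B: "B \<in> submods G Op" and "fin G Op B \<or> fin G Op (B \<inter> ker) \<and> fin H Op' (f ` B)"
  shows "fin G Op B" "fin H Op' (f ` B)" "fin G Op (B \<inter> ker)" "lg G Op B = lg G Op (B \<inter> ker) + lg H Op' (f ` B)"
proof -
  let ?L = "submods G Op" and ?L' = "submods H Op'"
  have K: "B \<inter> ker \<in> ?L" using B ker_submod by (auto intro: G.inter_submod)
  have "f ` (B \<inter> ker) = {\<zero>\<^bsub>H\<^esub>}"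
    using submodsD(2)[OF K] by (force simp: ker_def)
  then have iv: "len ?L (B \<inter> ker) B = lg H Op' (f ` B)" "finlen ?L (B \<inter> ker) B \<longleftrightarrow> fin H Op' (f ` B)"
    using len_interval[OF K B] by (auto simp: lg_def fin_def)
  show 1: "fin G Op B"
    using assms(2) iv(2) series_trans unfolding fin_def finlen_def by metis
  show "fin H Op' (f ` B)" "fin G Op (B \<inter> ker)" "lg G Op B = lg G Op (B \<inter> ker) + lg H Op' (f ` B)"
    using G.fin_sub[OF 1 K] iv by auto
qed

section \<open>Ideals and free modules as groups with operators\<close>

definition mults :: "('a, 'm) ring_scheme \<Rightarrow> ('a \<Rightarrow> 'a) set"
  where "mults R = (\<lambda>a x. a \<otimes>\<^bsub>R\<^esub> x) ` carrier R"

text \<open>The free module with basis \<open>I\<close>, as a ring record in order to reuse its notation for sums.\<close>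

definition tuples :: "('a, 'm) ring_scheme \<Rightarrow> 'i set \<Rightarrow> ('i \<Rightarrow> 'a) ring"
  where "tuples R I = \<lparr>carrier = (\<Pi>\<^sub>E i\<in>I. carrier R), monoid.mult = (\<lambda>v w. \<lambda>i\<in>I. v i \<otimes>\<^bsub>R\<^esub> w i),
    monoid.one = (\<lambda>i\<in>I. \<one>\<^bsub>R\<^esub>), ring.zero = (\<lambda>i\<in>I. \<zero>\<^bsub>R\<^esub>), ring.add = (\<lambda>v w. \<lambda>i\<in>I. v i \<oplus>\<^bsub>R\<^esub> w i)\<rparr>"

definition scals :: "('a, 'm) ring_scheme \<Rightarrow> 'i set \<Rightarrow> (('i \<Rightarrow> 'a) \<Rightarrow> ('i \<Rightarrow> 'a)) set"
  where "scals R I = (\<lambda>a v. \<lambda>i\<in>I. a \<otimes>\<^bsub>R\<^esub> v i) ` carrier R"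

definition single :: "('a, 'm) ring_scheme \<Rightarrow> 'i set \<Rightarrow> 'i \<Rightarrow> 'a \<Rightarrow> 'i \<Rightarrow> 'a"
  where "single R I i c = (\<lambda>l\<in>I. if l = i then c else \<zero>\<^bsub>R\<^esub>)"

definition tuples_in :: "('a, 'm) ring_scheme \<Rightarrow> 'i set \<Rightarrow> 'i set \<Rightarrow> 'a set \<Rightarrow> ('i \<Rightarrow> 'a) set"
  where "tuples_in R K I A =
    {v \<in> carrier (tuples R K). (\<forall>i\<in>K \<inter> I. v i \<in> A) \<and> (\<forall>i\<in>K - I. v i = \<zero>\<^bsub>R\<^esub>)}"

definition lin :: "('a, 'm) ring_scheme \<Rightarrow> 'i set \<Rightarrow> ('i \<Rightarrow> 'a) \<Rightarrow> ('i \<Rightarrow> 'a) \<Rightarrow> 'a"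
  where "lin R I x v = (\<Oplus>\<^bsub>R\<^esub>i\<in>I. v i \<otimes>\<^bsub>R\<^esub> x i)"

lemma tuples_simps [simp]:
  "carrier (tuples R I) = (\<Pi>\<^sub>E i\<in>I. carrier R)" "\<zero>\<^bsub>tuples R I\<^esub> = (\<lambda>i\<in>I. \<zero>\<^bsub>R\<^esub>)"
  "v \<oplus>\<^bsub>tuples R I\<^esub> w = (\<lambda>i\<in>I. v i \<oplus>\<^bsub>R\<^esub> w i)"
  by (simp_all add: tuples_def)

context cring
begin

lemma op_group_mults: "op_group R (mults R)"
  by unfold_locales (auto simp: mults_def r_distr)

lemma submods_mults: "submods R (mults R) = {I. ideal I R}"
proof (intro equalityI subsetI)
  fix I assume I: "I \<in> submods R (mults R)"
  have "a \<otimes> x \<in> I" if "a \<in> carrier R" "x \<in> I" for a x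
    using submodsD(6)[OF I _ that(2), of "\<lambda>x. a \<otimes> x"] that by (auto simp: mults_def)
  moreover from this have "x \<otimes> a \<in> I" if "a \<in> carrier R" "x \<in> I" for a x
    using that submodsD(3)[OF I that(2)] by (simp add: m_comm[of x])
  moreover have "subgroup I (add_monoid R)"
    using submodsD[OF I] by (intro add.subgroupI) (auto simp: a_inv_def)
  ultimately show "I \<in> {I. ideal I R}" by (auto intro!: idealI ring_axioms)
next
  fix I assume "I \<in> {I. ideal I R}"
  then interpret ideal I R by simp
  show "I \<in> submods R (mults R)"
    by (intro submodsI) (auto simp: mults_def I_l_closed)
qed

lemma ideal_iff_submod: "ideal I R \<longleftrightarrow> I \<in> submods R (mults R)"
  by (simp add: submods_mults)

lemma abelian_group_tuples: "abelian_group (tuples R I)"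
proof (rule abelian_groupI)
  fix v assume v: "v \<in> carrier (tuples R I)"
  show "\<exists>w\<in>carrier (tuples R I). w \<oplus>\<^bsub>tuples R I\<^esub> v = \<zero>\<^bsub>tuples R I\<^esub>"
    using v by (intro bexI[of _ "\<lambda>i\<in>I. \<ominus> v i"]) (auto simp: PiE_def Pi_def l_neg fun_eq_iff)
  show "\<zero>\<^bsub>tuples R I\<^esub> \<oplus>\<^bsub>tuples R I\<^esub> v = v"
    using v by (auto simp: PiE_def Pi_def extensional_def fun_eq_iff)
qed (auto simp: PiE_def Pi_def fun_eq_iff a_ac)

lemma op_group_tuples: "op_group (tuples R I) (scals R I)"
  by (intro op_group.intro op_group_axioms.intro abelian_group_tuples)
     (auto simp: scals_def PiE_def Pi_def fun_eq_iff r_distr)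

lemma tuples_minus:
  assumes "v \<in> carrier (tuples R I)"
  shows "\<ominus>\<^bsub>tuples R I\<^esub> v = (\<lambda>i\<in>I. \<ominus> v i)"
proof -
  interpret T: abelian_group "tuples R I" by (rule abelian_group_tuples)
  show ?thesis
    using assms by (intro T.minus_equality) (auto simp: PiE_def Pi_def l_neg fun_eq_iff)
qed

lemma tuples_diff:
  assumes "v \<in> carrier (tuples R I)" "w \<in> carrier (tuples R I)"
  shows "v \<ominus>\<^bsub>tuples R I\<^esub> w = (\<lambda>i\<in>I. v i \<ominus> w i)"
  using assms tuples_minus[of w] by (auto simp: a_minus_def fun_eq_iff)

lemma single_closed: "c \<in> carrier R \<Longrightarrow> single R I i c \<in> carrier (tuples R I)"
  by (auto simp: single_def)

lemma scal_single:
  "a \<in> carrier R \<Longrightarrow> c \<in> carrier R \<Longrightarrow> (\<lambda>l\<in>I. a \<otimes> single R I i c l) = single R I i (a \<otimes> c)"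
  by (auto simp: single_def fun_eq_iff)

lemma scal_submod:
  assumes "M \<in> submods (tuples R I) (scals R I)" "a \<in> carrier R" "v \<in> M"
  shows "(\<lambda>l\<in>I. a \<otimes> v l) \<in> M"
  using submodsD(6)[OF assms(1) _ assms(3), of "\<lambda>v. \<lambda>l\<in>I. a \<otimes> v l"] assms(2)
  by (auto simp: scals_def)

lemma mem_if_singles_mem:
  assumes M: "M \<in> submods (tuples R I) (scals R I)" and "finite I"
    and v: "v \<in> carrier (tuples R I)" and s: "\<And>i. i \<in> I \<Longrightarrow> single R I i (v i) \<in> M"
  shows "v \<in> M"
proof -
  have "(\<lambda>l\<in>I. if l \<in> J then v l else \<zero>) \<in> M" if "finite J" "J \<subseteq> I" for J
    using that
  proof (induction J rule: finite_induct)
    case empty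
    then show ?case using submodsD(2)[OF M] by (simp add: restrict_def)
  next
    case (insert j J)
    have eq: "(\<lambda>l\<in>I. if l \<in> insert j J then v l else \<zero>) =
        single R I j (v j) \<oplus>\<^bsub>tuples R I\<^esub> (\<lambda>l\<in>I. if l \<in> J then v l else \<zero>)"
      using insert v by (auto simp: single_def fun_eq_iff PiE_def Pi_def)
    show ?case
      unfolding eq by (rule submodsD(4)[OF M]) (use insert.IH insert.prems s in blast)+
  qed
  from this[OF \<open>finite I\<close>] have "(\<lambda>l\<in>I. if l \<in> I then v l else \<zero>) \<in> M" by simp
  moreover have "(\<lambda>l\<in>I. if l \<in> I then v l else \<zero>) = v"
    using v by (auto simp: fun_eq_iff PiE_def Pi_def extensional_def)
  ultimately show ?thesis by simp
qed

lemma lin_closed: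
  "x \<in> I \<rightarrow> carrier R \<Longrightarrow> v \<in> I \<rightarrow> carrier R \<Longrightarrow> lin R I x v \<in> carrier R"
  unfolding lin_def by (intro finsum_closed) auto

lemma lin_add:
  assumes "x \<in> I \<rightarrow> carrier R" "v \<in> I \<rightarrow> carrier R" "w \<in> I \<rightarrow> carrier R"
  shows "lin R I x (\<lambda>i\<in>I. v i \<oplus> w i) = lin R I x v \<oplus> lin R I x w"
proof -
  have "lin R I x (\<lambda>i\<in>I. v i \<oplus> w i) = (\<Oplus>i\<in>I. v i \<otimes> x i \<oplus> w i \<otimes> x i)"
    unfolding lin_def using assms by (intro finsum_cong') (auto simp: l_distr Pi_def)
  also have "\<dots> = lin R I x v \<oplus> lin R I x w"
    unfolding lin_def using assms by (intro finsum_addf) auto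
  finally show ?thesis .
qed

lemma lin_scal:
  assumes "finite I" "x \<in> I \<rightarrow> carrier R" "v \<in> I \<rightarrow> carrier R" "a \<in> carrier R"
  shows "lin R I x (\<lambda>i\<in>I. a \<otimes> v i) = a \<otimes> lin R I x v"
proof -
  have "lin R I x (\<lambda>i\<in>I. a \<otimes> v i) = (\<Oplus>i\<in>I. a \<otimes> (v i \<otimes> x i))"
    unfolding lin_def using assms by (intro finsum_cong') (auto simp: m_assoc Pi_def)
  also have "\<dots> = a \<otimes> lin R I x v"
    unfolding lin_def using assms by (intro finsum_rdistr[symmetric]) auto
  finally show ?thesis .
qed

lemma lin_single:
  assumes "finite I" "x \<in> I \<rightarrow> carrier R" "i \<in> I" "c \<in> carrier R"
  shows "lin R I x (single R I i c) = c \<otimes> x i"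
proof -
  have "lin R I x (single R I i c) = (\<Oplus>l\<in>I. if i = l then c \<otimes> x l else \<zero>)"
    unfolding lin_def using assms by (intro finsum_cong') (auto simp: single_def Pi_def)
  also have "\<dots> = c \<otimes> x i"
    using assms by (intro finsum_singleton) auto
  finally show ?thesis .
qed

lemma lin_hom:
  assumes "finite I" "x \<in> I \<rightarrow> carrier R"
  shows "op_hom (tuples R I) (scals R I) R (mults R) (lin R I x)"
proof (intro op_hom.intro op_hom_axioms.intro op_group_tuples op_group_mults)
  show "semilinear (tuples R I) (scals R I) R (mults R) (lin R I x)"
    unfolding semilinear_def scals_def mults_def
    using assms by (auto simp: lin_add lin_scal PiE_def Pi_def intro!: lin_closed)
qed

lemma coord_hom:
  assumes "i \<in> I"
  shows "op_hom (tuples R I) (scals R I) R (mults R) (\<lambda>v. v i)"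
proof (intro op_hom.intro op_hom_axioms.intro op_group_tuples op_group_mults)
  show "semilinear (tuples R I) (scals R I) R (mults R) (\<lambda>v. v i)"
    unfolding semilinear_def scals_def mults_def
    using assms by (auto simp: PiE_def Pi_def)
qed

lemma tuples_in_submod:
  assumes "ideal A R"
  shows "tuples_in R K I A \<in> submods (tuples R K) (scals R K)"
proof -
  interpret ideal A R by fact
  have sub: "tuples_in R K I A \<subseteq> carrier (tuples R K)" by (auto simp: tuples_in_def)
  show ?thesis
  proof (rule submodsI)
    fix v assume v: "v \<in> tuples_in R K I A"
    show "\<ominus>\<^bsub>tuples R K\<^esub> v \<in> tuples_in R K I A"
      using v tuples_minus[of v] sub by (auto simp: tuples_in_def split: if_splits)
  next
    fix u v assume "u \<in> scals R K" "v \<in> tuples_in R K I A"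
    then show "u v \<in> tuples_in R K I A"
      by (auto simp: tuples_in_def scals_def I_l_closed dest: PiE_mem)
  qed (use sub in \<open>auto simp: tuples_in_def split: if_splits\<close>)
qed

lemma tuples_in_length:
  assumes A: "ideal A R" "fin R (mults R) A" and "finite I" "I \<subseteq> K"
  shows "fin (tuples R K) (scals R K) (tuples_in R K I A) \<and>
    lg (tuples R K) (scals R K) (tuples_in R K I A) = card I * lg R (mults R) A"
  using assms(3,4)
proof (induction I rule: finite_induct)
  case empty
  interpret T: op_group "tuples R K" "scals R K" by (rule op_group_tuples)
  have "tuples_in R K {} A = {\<zero>\<^bsub>tuples R K\<^esub>}"
    by (auto simp: tuples_in_def fun_eq_iff PiE_def Pi_def extensional_def)
  then show ?case using T.fin_zero by simp
next
  case (insert i I)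
  interpret ideal A R by fact
  interpret h: op_hom "tuples R K" "scals R K" R "mults R" "\<lambda>v. v i"
    using insert.prems by (intro coord_hom) auto
  let ?B = "tuples_in R K (insert i I) A"
  have "?B \<inter> h.ker = tuples_in R K I A"
    using insert.hyps insert.prems by (auto simp: h.ker_def tuples_in_def split: if_splits)
  moreover have "(\<lambda>v. v i) ` ?B = A"
  proof
    show "A \<subseteq> (\<lambda>v. v i) ` ?B"
    proof
      fix a assume "a \<in> A"
      then have "single R K i a \<in> ?B" "single R K i a i = a"
        using insert.prems by (auto simp: tuples_in_def single_def)
      then show "a \<in> (\<lambda>v. v i) ` ?B" by (metis image_eqI)
    qed
  qed (use insert.prems in \<open>auto simp: tuples_in_def\<close>)
  moreover have "I \<subseteq> K" using insert.prems by simp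
  ultimately show ?case
    using h.rank_nullity[OF tuples_in_submod[OF A(1), of K "insert i I"]] insert.IH insert.hyps A(2)
    by simp
qed

lemma tuples_in_all: "tuples_in R K K (carrier R) = carrier (tuples R K)"
  by (auto simp: tuples_in_def)

lemma tuples_length:
  assumes "fin R (mults R) (carrier R)" "finite K"
  shows "fin (tuples R K) (scals R K) (carrier (tuples R K))"
    "lg (tuples R K) (scals R K) (carrier (tuples R K)) = card K * lg R (mults R) (carrier R)"
  using tuples_in_length[OF oneideal assms(1,2) order_refl] by (simp_all only: tuples_in_all)

end

locale ring_epi = R: cring R + W: cring W for R :: "('a, 'm) ring_scheme" (structure)
    and W :: "('b, 'n) ring_scheme" (structure) +
  fixes \<phi> assumes hom: "\<phi> \<in> ring_hom R W" and surj: "\<phi> ` carrier R = carrier W"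
begin

lemma ring_hom_cring: "ring_hom_cring R W \<phi>"
  by unfold_locales (rule hom)

sublocale hom: ring_hom_cring R W \<phi>
  by (rule ring_hom_cring)

lemma mults_hom: "op_hom R (mults R) W (mults W) \<phi>"
proof (intro op_hom.intro op_hom_axioms.intro R.op_group_mults W.op_group_mults)
  show "semilinear R (mults R) W (mults W) \<phi>"
    unfolding semilinear_def mults_def using surj[symmetric] by auto
qed

lemma tuples_hom:
  assumes "I \<subseteq> K"
  shows "op_hom (tuples R K) (scals R K) (tuples W I) (scals W I) (\<lambda>v. \<lambda>i\<in>I. \<phi> (v i))"
proof (intro op_hom.intro op_hom_axioms.intro R.op_group_tuples W.op_group_tuples)
  have [simp]: "i \<in> K" if "i \<in> I" for i using that assms by auto
  show "semilinear (tuples R K) (scals R K) (tuples W I) (scals W I) (\<lambda>v. \<lambda>i\<in>I. \<phi> (v i))"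
    unfolding semilinear_def scals_def surj[symmetric] by (auto simp: fun_eq_iff PiE_def Pi_def)
qed

lemma map_single:
  assumes "i \<in> K" "I \<subseteq> K" "c \<in> carrier R"
  shows "(\<lambda>l\<in>I. \<phi> (single R K i c l)) = (if i \<in> I then single W I i (\<phi> c) else \<zero>\<^bsub>tuples W I\<^esub>)"
  using assms by (auto simp: single_def fun_eq_iff)

lemma lin_map:
  assumes "x \<in> I \<rightarrow> carrier R" "v \<in> I \<rightarrow> carrier R"
  shows "\<phi> (lin R I x v) = lin W I (\<lambda>i. \<phi> (x i)) (\<lambda>i. \<phi> (v i))"
  unfolding lin_def using assms by (auto simp: Pi_def intro!: W.finsum_cong')

end

section \<open>Local rings, minimal generators and finite length\<close>

definition colon :: "('a, 'm) ring_scheme \<Rightarrow> 'a set \<Rightarrow> 'a \<Rightarrow> 'a set"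
  where "colon R I z = {a \<in> carrier R. a \<otimes>\<^bsub>R\<^esub> z \<in> I}"

lemma (in ring) genideal_of_ideal: "ideal I R \<Longrightarrow> Idl I = I"
  using genideal_minimal[of I I] genideal_self[of I] additive_subgroup.a_subset[OF ideal.axioms(1)]
  by blast

lemma (in cring) modular_ideals: "modular_family (submods R (mults R)) (set_add R)"
proof -
  interpret self: op_group R "mults R" by (rule op_group_mults)
  show ?thesis by (rule self.modular_family_axioms)
qed

lemma (in cring) ideal_sum_upper:
  assumes "ideal I R" "ideal J R"
  shows "I \<subseteq> set_add R I J" "J \<subseteq> set_add R I J"
  using modular_family.join_upper1[OF modular_ideals, of I J]
    modular_family.join_upper2[OF modular_ideals, of I J] assms by (simp_all add: ideal_iff_submod)

lemma (in cring) colon_ideal: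
  assumes "ideal I R" "z \<in> carrier R"
  shows "ideal (colon R I z) R"
proof -
  interpret ideal I R by fact
  show ?thesis
    unfolding ideal_iff_submod colon_def using assms
    by (intro submodsI) (auto simp: l_distr l_minus mults_def m_assoc I_l_closed)
qed

lemma (in cring) ideal_plus_principal:
  assumes "ideal I R" "a \<in> carrier R"
  shows "Idl (I \<union> {a}) = set_add R I (PIdl a)"
proof -
  have P: "ideal (PIdl a) R" "a \<in> PIdl a"
    using assms cgenideal_ideal cgenideal_self by auto
  have carr: "I \<union> {a} \<subseteq> carrier R" "I \<union> PIdl a \<subseteq> carrier R"
    using assms ideal.Icarr[OF assms(1)] ideal.Icarr[OF P(1)] by auto
  have gen: "ideal (Idl (I \<union> {a})) R" "I \<union> {a} \<subseteq> Idl (I \<union> {a})"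
    using genideal_ideal[OF carr(1)] genideal_self[OF carr(1)] by auto
  have "Idl (I \<union> {a}) = Idl (I \<union> PIdl a)"
  proof
    show "Idl (I \<union> {a}) \<subseteq> Idl (I \<union> PIdl a)"
      using genideal_self[OF carr(2)] P genideal_ideal[OF carr(2)] by (intro genideal_minimal) auto
    have "PIdl a \<subseteq> Idl (I \<union> {a})" using gen by (intro cgenideal_minimal) auto
    then show "Idl (I \<union> PIdl a) \<subseteq> Idl (I \<union> {a})"
      using gen by (intro genideal_minimal) auto
  qed
  then show ?thesis using union_genideal[OF assms(1) P(1)] by simp
qed

lemma (in cring) mem_ideal_plus_principal:
  assumes "ideal I R" "a \<in> carrier R"
  shows "x \<in> Idl (I \<union> {a}) \<longleftrightarrow> (\<exists>i\<in>I. \<exists>b\<in>carrier R. x = i \<oplus> b \<otimes> a)"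
  unfolding ideal_plus_principal[OF assms] mem_set_add cgenideal_def by auto

lemma (in cring) lin_image:
  assumes "finite K" "x \<in> K \<rightarrow> carrier R"
  shows "lin R K x ` carrier (tuples R K) = Idl (x ` K)"
proof
  interpret h: op_hom "tuples R K" "scals R K" R "mults R" "lin R K x"
    using assms by (rule lin_hom)
  have carr: "x ` K \<subseteq> carrier R" using assms by auto
  interpret J: ideal "Idl (x ` K)" R using carr by (rule genideal_ideal)
  have "lin R K x v \<in> Idl (x ` K)" if v: "v \<in> carrier (tuples R K)" for v
  proof -
    have "v \<in> {v \<in> carrier (tuples R K). lin R K x v \<in> Idl (x ` K)}"
    proof (rule mem_if_singles_mem[OF _ assms(1) v])
      show "{v \<in> carrier (tuples R K). lin R K x v \<in> Idl (x ` K)} \<in> submods (tuples R K) (scals R K)"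
        using J.is_ideal by (intro h.vimage_submod) (simp add: ideal_iff_submod)
      fix i assume i: "i \<in> K"
      then have "v i \<in> carrier R" "x i \<in> Idl (x ` K)"
        using v genideal_self[OF carr] by auto
      then show "single R K i (v i) \<in> {v \<in> carrier (tuples R K). lin R K x v \<in> Idl (x ` K)}"
        using i assms single_closed[of "v i" K i] by (simp add: lin_single J.I_l_closed)
    qed
    then show ?thesis by simp
  qed
  then show "lin R K x ` carrier (tuples R K) \<subseteq> Idl (x ` K)" by blast
  show "Idl (x ` K) \<subseteq> lin R K x ` carrier (tuples R K)"
  proof (rule genideal_minimal)
    show "ideal (lin R K x ` carrier (tuples R K)) R"
      unfolding ideal_iff_submod by (intro h.image_submod h.G.carrier_submod)
    show "x ` K \<subseteq> lin R K x ` carrier (tuples R K)"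
    proof clarify
      fix i assume "i \<in> K"
      then have "lin R K x (single R K i \<one>) = x i" using assms by (auto simp: lin_single Pi_def)
      then show "x i \<in> lin R K x ` carrier (tuples R K)"
        using single_closed[of \<one> K i] by (metis image_eqI one_closed)
    qed
  qed
qed

lemma (in noetherian_ring) maximal_ideal_in_family:
  assumes "\<F> \<noteq> {}" "\<And>I. I \<in> \<F> \<Longrightarrow> ideal I R"
  obtains M where "M \<in> \<F>" "\<And>J. \<lbrakk>J \<in> \<F>; M \<subseteq> J\<rbrakk> \<Longrightarrow> J = M"
proof -
  have "\<exists>M\<in>\<F>. \<forall>J\<in>\<F>. M \<subseteq> J \<longrightarrow> J = M"
  proof (rule subset_Zorn_nonempty[OF assms(1)])
    fix C assume C: "C \<noteq> {}" "subset.chain \<F> C"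
    then have "subset.chain {I. ideal I R} C"
      using assms(2) by (auto simp: pred_on.chain_def)
    then have "\<Union>C \<in> C" using ideal_chain_is_trivial C by auto
    then show "\<Union>C \<in> \<F>" using C by (auto simp: pred_on.chain_def)
  qed
  then show ?thesis using that by blast
qed

text \<open>A colon ideal \<open>(I : z)\<close> that is maximal among those with \<open>z\<close> outside \<open>I\<close> is prime: it is an
  associated prime of the quotient by \<open>I\<close>.\<close>

lemma associated_prime:
  fixes R (structure)
  assumes "cring R" "noetherian_ring R" "ideal I R" "I \<noteq> carrier R"
  obtains z where "z \<in> carrier R" "z \<notin> I" "primeideal (colon R I z) R"
proof -
  interpret cring R by fact
  interpret noetherian_ring R by fact
  interpret I: ideal I R by fact
  let ?F = "colon R I ` (carrier R - I)"
  have "?F \<noteq> {}" using assms(4) I.Icarr by auto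
  then obtain M where M: "M \<in> ?F" "\<And>J. J \<in> ?F \<Longrightarrow> M \<subseteq> J \<Longrightarrow> J = M"
    by (rule maximal_ideal_in_family) (use colon_ideal[OF assms(3)] in auto)
  then obtain z where z: "z \<in> carrier R" "z \<notin> I" "M = colon R I z" by auto
  have "primeideal (colon R I z) R"
  proof (rule primeidealI[OF colon_ideal[OF assms(3) z(1)] cring_axioms])
    have "\<one> \<notin> colon R I z" using z by (auto simp: colon_def)
    then show "carrier R \<noteq> colon R I z" using one_closed by metis
    fix a b assume ab: "a \<in> carrier R" "b \<in> carrier R" "a \<otimes> b \<in> colon R I z"
    show "a \<in> colon R I z \<or> b \<in> colon R I z"
    proof (cases "b \<otimes> z \<in> I")
      case False
      have "M \<subseteq> colon R I (b \<otimes> z)"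
      proof
        fix t assume "t \<in> M"
        then have t: "t \<in> carrier R" "t \<otimes> z \<in> I" using z by (auto simp: colon_def)
        have "t \<otimes> (b \<otimes> z) = b \<otimes> (t \<otimes> z)" using t z ab by (simp add: m_lcomm)
        then show "t \<in> colon R I (b \<otimes> z)" using t ab I.I_l_closed by (simp add: colon_def)
      qed
      then have "colon R I (b \<otimes> z) = M" using False z ab by (intro M(2)) auto
      moreover have "a \<in> colon R I (b \<otimes> z)" using ab z by (auto simp: colon_def m_assoc)
      ultimately show ?thesis using z by auto
    qed (use ab in \<open>auto simp: colon_def\<close>)
  qed
  then show ?thesis using z that by blast
qed

context local_ring
begin

abbreviation "\<mm> \<equiv> max_ideal R"

lemma maximalideal_max_ideal: "maximalideal \<mm> R"
  unfolding max_ideal_def using unique_maximal by (rule theI')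

lemma ideal_max_ideal: "ideal \<mm> R"
  using maximalideal_max_ideal by (rule maximalideal.axioms)

lemma primeideal_max_ideal: "primeideal \<mm> R"
  using maximalideal_max_ideal by (rule maximalideal_prime)

lemma max_ideal_unique: "maximalideal M R \<Longrightarrow> M = \<mm>"
  using unique_maximal maximalideal_max_ideal by auto

lemma max_ideal_closed: "a \<in> \<mm> \<Longrightarrow> a \<in> carrier R"
  using ideal.Icarr[OF ideal_max_ideal] .

lemma one_notin_max_ideal: "\<one> \<notin> \<mm>"
  using ideal.one_imp_carrier[OF ideal_max_ideal] maximalideal.I_notcarr[OF maximalideal_max_ideal] by auto

lemma proper_ideal_le_max_ideal:
  assumes I: "ideal I R" "I \<noteq> carrier R"
  shows "I \<subseteq> \<mm>"
proof -
  let ?F = "{J. ideal J R \<and> I \<subseteq> J \<and> J \<noteq> carrier R}"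
  have "?F \<noteq> {}" using I by auto
  then obtain M where M: "M \<in> ?F" "\<And>J. J \<in> ?F \<Longrightarrow> M \<subseteq> J \<Longrightarrow> J = M"
    by (rule maximal_ideal_in_family) auto
  have "maximalideal M R"
  proof (rule maximalidealI)
    show "ideal M R" "carrier R \<noteq> M" using M(1) by auto
    show "J = M \<or> J = carrier R" if "ideal J R" "M \<subseteq> J" "J \<subseteq> carrier R" for J
      using M(1) M(2)[of J] that by auto
  qed
  then show ?thesis using M max_ideal_unique by auto
qed

lemma Units_iff: "a \<in> carrier R \<Longrightarrow> a \<in> Units R \<longleftrightarrow> a \<notin> \<mm>"
proof
  assume a: "a \<in> carrier R" "a \<notin> \<mm>"
  then have "PIdl a = carrier R"
    using proper_ideal_le_max_ideal[OF cgenideal_ideal] cgenideal_self by blast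
  then obtain b where "b \<in> carrier R" "\<one> = b \<otimes> a" using one_closed unfolding cgenideal_def by blast
  then show "a \<in> Units R" using a m_comm unfolding Units_def by auto
next
  assume "a \<in> Units R"
  then show "a \<notin> \<mm>"
    using ideal.I_l_closed[OF ideal_max_ideal, of a "inv a"] one_notin_max_ideal by auto
qed

lemma one_minus_Units: "a \<in> \<mm> \<Longrightarrow> \<one> \<ominus> a \<in> Units R"
proof -
  assume a: "a \<in> \<mm>"
  interpret M: ideal \<mm> R by (rule ideal_max_ideal)
  have "\<one> \<ominus> a \<notin> \<mm>"
  proof
    assume "\<one> \<ominus> a \<in> \<mm>"
    then have "(\<one> \<ominus> a) \<oplus> a \<in> \<mm>" using a by simp
    then show False using a one_notin_max_ideal by (simp add: a_minus_def a_assoc l_neg)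
  qed
  then show ?thesis using a Units_iff by simp
qed

lemma one_minus_cancel:
  assumes "ideal K R" "a \<in> \<mm>" "y \<in> carrier R" "y \<ominus> a \<otimes> y \<in> K"
  shows "y \<in> K"
proof -
  have u: "\<one> \<ominus> a \<in> Units R" using assms one_minus_Units by auto
  have "a \<in> carrier R" using assms max_ideal_closed by auto
  then have "y \<ominus> a \<otimes> y = (\<one> \<ominus> a) \<otimes> y"
    using assms by (simp add: a_minus_def l_distr l_minus)
  then have "inv (\<one> \<ominus> a) \<otimes> ((\<one> \<ominus> a) \<otimes> y) \<in> K"
    using assms u ideal.I_l_closed by fastforce
  moreover have "inv (\<one> \<ominus> a) \<otimes> ((\<one> \<ominus> a) \<otimes> y) = y"
    using u assms(3) Units_inv_closed[OF u] Units_closed[OF u] by (simp add: m_assoc[symmetric])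
  ultimately show ?thesis by simp
qed

text \<open>Choose \<open>K\<close> maximal among the ideals that contain \<open>N\<close> but not \<open>I\<close>. If \<open>a i\<close> were outside \<open>K\<close>
  for some \<open>a\<close> in the maximal ideal and \<open>i\<close> in \<open>I\<close>, then \<open>i = k + b a i\<close> for some \<open>k\<close> in \<open>K\<close>, and
  \<open>1 - b a\<close> is a unit. So \<open>K\<close> contains the product of the maximal ideal with \<open>I\<close>, and hence \<open>I\<close>.\<close>

lemma Nakayama:
  assumes N: "ideal N R" and I: "ideal I R" and sub: "I \<subseteq> set_add R N (\<mm> \<cdot> I)"
  shows "I \<subseteq> N"
proof (rule ccontr)
  assume not: "\<not> I \<subseteq> N"
  interpret N: ideal N R by fact
  interpret I: ideal I R by fact
  let ?S = "set_add R N I"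
  interpret S: ideal ?S R using N I by (rule add_ideals)
  have NS: "N \<subseteq> ?S" "I \<subseteq> ?S"
    using ideal_sum_upper[OF N I] by auto
  let ?F = "{J. ideal J R \<and> N \<subseteq> J \<and> J \<subset> ?S}"
  have "N \<in> ?F" using N NS not by auto
  then have "?F \<noteq> {}" by blast
  then obtain K where K: "K \<in> ?F" "\<And>J. J \<in> ?F \<Longrightarrow> K \<subseteq> J \<Longrightarrow> J = K"
    by (rule maximal_ideal_in_family) auto
  interpret K: ideal K R using K by auto
  have "a \<otimes> i \<in> K" if a: "a \<in> \<mm>" and i: "i \<in> I" for a i
  proof (rule ccontr)
    assume no: "a \<otimes> i \<notin> K"
    have ai: "a \<in> carrier R" "i \<in> carrier R" "a \<otimes> i \<in> ?S"
      using a i max_ideal_closed I.Icarr NS S.I_l_closed by auto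
    let ?J = "Idl (K \<union> {a \<otimes> i})"
    have J: "ideal ?J R" "K \<subseteq> ?J" "a \<otimes> i \<in> ?J"
      using genideal_ideal[of "K \<union> {a \<otimes> i}"] genideal_self[of "K \<union> {a \<otimes> i}"] ai K.a_subset by auto
    moreover have "?J \<subseteq> ?S"
      using K ai S.is_ideal by (intro genideal_minimal) auto
    ultimately have "?J = ?S" using K no by blast
    then have "i \<in> ?J" using NS i by auto
    then obtain k b where kb: "k \<in> K" "b \<in> carrier R" "i = k \<oplus> b \<otimes> (a \<otimes> i)"
      using mem_ideal_plus_principal[OF K.is_ideal, of "a \<otimes> i" i] ai by auto
    have "i \<ominus> (b \<otimes> a) \<otimes> i = k"
    proof -
      have "i \<ominus> (b \<otimes> a) \<otimes> i = (k \<oplus> b \<otimes> (a \<otimes> i)) \<ominus> b \<otimes> (a \<otimes> i)"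
        using kb(3) ai kb(2) by (simp add: m_assoc)
      also have "\<dots> = k" using kb(2) ai K.Icarr[OF kb(1)] by (simp add: a_minus_def a_assoc r_neg)
      finally show ?thesis .
    qed
    then have "i \<in> K"
      using one_minus_cancel[OF K.is_ideal, of "b \<otimes> a" i] kb ai a
        ideal.I_l_closed[OF ideal_max_ideal a kb(2)] by simp
    then show False using no ai K.I_l_closed by auto
  qed
  note prods = this
  have "s \<in> K" if "s \<in> \<mm> \<cdot> I" for s
    using that by (induction rule: ideal_prod.induct) (auto simp: prods)
  then have "\<mm> \<cdot> I \<subseteq> K" by blast
  then have "set_add R N (\<mm> \<cdot> I) \<subseteq> K" using K by (auto simp: mem_set_add subset_iff)
  then have "?S \<subseteq> K" using sub K by (auto simp: mem_set_add subset_iff)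
  then show False using K by auto
qed

lemma covers_ideal_plus_principal:
  assumes N: "ideal N R" and a: "a \<in> carrier R" and m: "\<And>t. t \<in> \<mm> \<Longrightarrow> t \<otimes> a \<in> N"
  shows "N = Idl (N \<union> {a}) \<or> covers (submods R (mults R)) N (Idl (N \<union> {a}))"
proof (cases "a \<in> N")
  case True
  then have "Idl (N \<union> {a}) = N"
    using N genideal_minimal[OF N, of "N \<union> {a}"] genideal_self[of "N \<union> {a}"] a ideal.Icarr[OF N] by auto
  then show ?thesis by simp
next
  case False
  interpret N: ideal N R by fact
  have carr: "N \<union> {a} \<subseteq> carrier R" using a N.Icarr by auto
  have J: "ideal (Idl (N \<union> {a})) R" "N \<union> {a} \<subseteq> Idl (N \<union> {a})"
    using genideal_ideal[OF carr] genideal_self[OF carr] by auto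
  have "C = N \<or> C = Idl (N \<union> {a})" if C: "ideal C R" "N \<subseteq> C" "C \<subseteq> Idl (N \<union> {a})" for C
  proof (rule disjCI)
    interpret C: ideal C R by fact
    assume "C \<noteq> Idl (N \<union> {a})"
    show "C = N"
    proof (rule ccontr)
      assume "C \<noteq> N"
      then obtain c where c: "c \<in> C" "c \<notin> N" using C by auto
      then obtain n b where nb: "n \<in> N" "b \<in> carrier R" "c = n \<oplus> b \<otimes> a"
        using mem_ideal_plus_principal[OF N a] C by blast
      have b: "b \<in> Units R"
        using Units_iff nb c m by auto
      have "b \<otimes> a = \<ominus> n \<oplus> c" using nb a N.Icarr[OF nb(1)] by (simp add: r_neg1)
      moreover have "\<ominus> n \<in> C" using nb C C.a_inv_closed by auto
      ultimately have "b \<otimes> a \<in> C" using c C.a_closed by metis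
      then have "inv b \<otimes> (b \<otimes> a) \<in> C" using b C.I_l_closed by auto
      moreover have "inv b \<otimes> (b \<otimes> a) = a"
        using b a nb by (simp add: m_assoc[symmetric])
      ultimately have "Idl (N \<union> {a}) \<subseteq> C" using C by (intro genideal_minimal) auto
      then show False using C \<open>C \<noteq> Idl (N \<union> {a})\<close> by auto
    qed
  qed
  moreover have "N \<subset> Idl (N \<union> {a})" using J False by blast
  ultimately show ?thesis
    using N J(1) unfolding covers_def by (simp add: ideal_iff_submod)
qed

lemma series_le_generators:
  assumes N: "ideal N R" and "finite A" "A \<subseteq> carrier R" "\<And>t a. \<lbrakk>t \<in> \<mm>; a \<in> A\<rbrakk> \<Longrightarrow> t \<otimes> a \<in> N"
  shows "\<exists>j\<le>card A. series (submods R (mults R)) N (Idl (N \<union> A)) j"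
  using assms(2-4)
proof (induction A rule: finite_induct)
  case empty
  have "Idl N = N"
    using N by (rule genideal_of_ideal)
  then show ?case using N by (auto simp: ideal_iff_submod intro: series.refl)
next
  case (insert a A)
  then obtain j where j: "j \<le> card A" "series (submods R (mults R)) N (Idl (N \<union> A)) j"
    by auto
  have carr: "N \<union> A \<subseteq> carrier R" "N \<union> insert a A \<subseteq> carrier R"
    using insert.prems ideal.Icarr[OF N] by auto
  interpret I: ideal "Idl (N \<union> A)" R by (rule genideal_ideal[OF carr(1)])
  have sup: "N \<union> A \<subseteq> Idl (N \<union> A)" using carr by (intro genideal_self)
  have carr': "Idl (N \<union> A) \<union> {a} \<subseteq> carrier R" using I.Icarr carr by auto
  have "Idl (Idl (N \<union> A) \<union> {a}) = Idl (N \<union> insert a A)"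
  proof
    show "Idl (Idl (N \<union> A) \<union> {a}) \<subseteq> Idl (N \<union> insert a A)"
      using genideal_ideal[OF carr(2)] genideal_self[OF carr(2)] genideal_minimal[of "Idl (N \<union> insert a A)" "N \<union> A"]
      by (intro genideal_minimal) auto
    show "Idl (N \<union> insert a A) \<subseteq> Idl (Idl (N \<union> A) \<union> {a})"
      using genideal_ideal[OF carr'] genideal_self[OF carr'] sup by (intro genideal_minimal) auto
  qed
  moreover have "Idl (N \<union> A) = Idl (Idl (N \<union> A) \<union> {a}) \<or>
      covers (submods R (mults R)) (Idl (N \<union> A)) (Idl (Idl (N \<union> A) \<union> {a}))"
    using insert.prems sup by (intro covers_ideal_plus_principal I.is_ideal) auto
  ultimately have "Idl (N \<union> A) = Idl (N \<union> insert a A) \<or>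
      covers (submods R (mults R)) (Idl (N \<union> A)) (Idl (N \<union> insert a A))" by simp
  then show ?case
    using j series.step[OF j(2)] insert.hyps by (auto intro: le_SucI)
qed

lemma generators_le_series:
  assumes "series (submods R (mults R)) N B n"
  shows "\<exists>A\<subseteq>B. finite A \<and> card A \<le> n \<and> B = Idl (N \<union> A)"
  using assms
proof (induction rule: series.induct)
  case (refl N)
  then have N: "ideal N R" by (simp add: ideal_iff_submod)
  have "Idl N = N"
    using N by (rule genideal_of_ideal)
  then show ?case by auto
next
  case (step N B n C)
  then obtain A where A: "A \<subseteq> B" "finite A" "card A \<le> n" "B = Idl (N \<union> A)" by auto
  have C: "ideal C R" "ideal B R" "ideal N R" "B \<subset> C" "N \<subseteq> B"
    using step.hyps(2) series_mem[OF step.hyps(1)] series_subset[OF step.hyps(1)]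
    by (auto simp: covers_def ideal_iff_submod)
  then obtain c where c: "c \<in> C" "c \<notin> B" by auto
  have carr: "N \<union> insert c A \<subseteq> carrier R" using C A c ideal.Icarr[OF C(1)] by blast
  have J: "ideal (Idl (N \<union> insert c A)) R" "N \<union> insert c A \<subseteq> Idl (N \<union> insert c A)"
    using genideal_ideal[OF carr] genideal_self[OF carr] by auto
  have "Idl (N \<union> insert c A) \<subseteq> C" using C A c by (intro genideal_minimal) auto
  moreover have "B \<subseteq> Idl (N \<union> insert c A)"
    unfolding A(4) using J by (intro genideal_minimal) auto
  ultimately have "Idl (N \<union> insert c A) = C"
    using step.hyps(2) J c by (auto simp: covers_def ideal_iff_submod)
  moreover have "card (insert c A) \<le> Suc n"
    using A by (simp add: card_insert_if)
  ultimately show ?case using A c C by (intro exI[of _ "insert c A"]) auto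
qed

lemma prod_max_ideal:
  assumes "ideal I R"
  shows "ideal (\<mm> \<cdot> I) R" "\<mm> \<cdot> I \<subseteq> I"
  using ideal_prod_is_ideal[OF ideal_max_ideal assms] ideal_prod_inter[OF ideal_max_ideal assms] by auto

lemma idl_with_prod_max_ideal:
  assumes I: "ideal I R" and "A \<subseteq> carrier R" and eq: "Idl (\<mm> \<cdot> I \<union> A) = I"
  shows "Idl A = I"
proof
  have A: "ideal (Idl A) R" "A \<subseteq> Idl A" using assms genideal_ideal genideal_self by auto
  have carr: "\<mm> \<cdot> I \<union> A \<subseteq> carrier R"
    using prod_max_ideal[OF I] ideal.Icarr[OF I] assms(2) by auto
  then show "Idl A \<subseteq> I"
    using genideal_self[OF carr] eq I by (intro genideal_minimal) auto
  have sum: "ideal (set_add R (Idl A) (\<mm> \<cdot> I)) R" "Idl A \<subseteq> set_add R (Idl A) (\<mm> \<cdot> I)"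
     "\<mm> \<cdot> I \<subseteq> set_add R (Idl A) (\<mm> \<cdot> I)"
    using add_ideals[OF A(1) prod_max_ideal(1)[OF I]] A(1) prod_max_ideal(1)[OF I]
      ideal_sum_upper[OF A(1) prod_max_ideal(1)[OF I]] by simp_all
  have "I \<subseteq> set_add R (Idl A) (\<mm> \<cdot> I)"
    using sum A by (subst eq[symmetric], intro genideal_minimal) auto
  then show "I \<subseteq> Idl A" by (rule Nakayama[OF A(1) I])
qed

lemma len_le_generators:
  assumes I: "ideal I R" and "finite A" "A \<subseteq> carrier R" and eq: "Idl (\<mm> \<cdot> I \<union> A) = I"
  shows "finlen (submods R (mults R)) (\<mm> \<cdot> I) I" "len (submods R (mults R)) (\<mm> \<cdot> I) I \<le> card A"
proof -
  have carr: "\<mm> \<cdot> I \<union> A \<subseteq> carrier R"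
    using prod_max_ideal[OF I] ideal.Icarr[OF I] assms by auto
  then have "t \<otimes> a \<in> \<mm> \<cdot> I" if "t \<in> \<mm>" "a \<in> A" for t a
    using that genideal_self[OF carr] eq by (intro ideal_prod.prod) auto
  then obtain j where "j \<le> card A" "series (submods R (mults R)) (\<mm> \<cdot> I) I j"
    using series_le_generators[OF prod_max_ideal(1)[OF I] assms(2,3)] eq by auto
  then show "finlen (submods R (mults R)) (\<mm> \<cdot> I) I" "len (submods R (mults R)) (\<mm> \<cdot> I) I \<le> card A"
    using modular_family.series_len[OF modular_ideals]
    by (auto simp: finlen_def)
qed

lemma idl_with_prod_max_idealI:
  assumes I: "ideal I R" and A: "A \<subseteq> carrier R" "Idl A = I"
  shows "Idl (\<mm> \<cdot> I \<union> A) = I"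
proof
  have carr: "\<mm> \<cdot> I \<union> A \<subseteq> carrier R"
    using prod_max_ideal[OF I] ideal.Icarr[OF I] A by auto
  show "Idl (\<mm> \<cdot> I \<union> A) \<subseteq> I"
    using I prod_max_ideal[OF I] genideal_self[OF A(1)] A by (intro genideal_minimal) auto
  show "I \<subseteq> Idl (\<mm> \<cdot> I \<union> A)"
    using genideal_ideal[OF carr] genideal_self[OF carr] by (subst A(2)[symmetric], intro genideal_minimal) auto
qed

text \<open>Modulo the product with the maximal ideal every generator adds at most one to the length,
  and by Nakayama's lemma generators modulo this product are generators.\<close>

theorem min_gens_eq_len:
  assumes I: "ideal I R"
  shows "finlen (submods R (mults R)) (\<mm> \<cdot> I) I"
    "min_gens R I = len (submods R (mults R)) (\<mm> \<cdot> I) I"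
    "\<exists>A\<subseteq>carrier R. finite A \<and> card A = min_gens R I \<and> Idl A = I"
proof -
  let ?L = "submods R (mults R)"
  let ?P = "\<lambda>n. \<exists>A\<subseteq>carrier R. finite A \<and> card A = n \<and> Idl A = I"
  obtain A where A: "A \<subseteq> carrier R" "finite A" "Idl A = I" using finetely_gen[OF I] by auto
  show fin: "finlen ?L (\<mm> \<cdot> I) I"
    using len_le_generators[OF I A(2,1) idl_with_prod_max_idealI[OF I A(1,3)]] by auto
  then obtain n where "series ?L (\<mm> \<cdot> I) I n" by (auto simp: finlen_def)
  then have n: "series ?L (\<mm> \<cdot> I) I (len ?L (\<mm> \<cdot> I) I)"
    using modular_family.series_len[OF modular_ideals] by auto
  obtain B where B: "B \<subseteq> I" "finite B" "card B \<le> len ?L (\<mm> \<cdot> I) I" "I = Idl (\<mm> \<cdot> I \<union> B)"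
    using generators_le_series[OF n] by auto
  have carrB: "B \<subseteq> carrier R" using B ideal.Icarr[OF I] by auto
  then have "Idl B = I" using idl_with_prod_max_ideal[OF I] B by metis
  then have PB: "?P (card B)" using B carrB by blast
  have le: "len ?L (\<mm> \<cdot> I) I \<le> j" if "?P j" for j
    using that len_le_generators(2)[OF I _ _ idl_with_prod_max_idealI[OF I]] by auto
  have least: "?P (min_gens R I)" unfolding min_gens_def using PB by (rule LeastI)
  have "min_gens R I \<le> card B" unfolding min_gens_def using PB by (rule Least_le)
  then show "min_gens R I = len ?L (\<mm> \<cdot> I) I" using le[OF least] B(3) by (metis le_antisym le_trans)
  show "\<exists>A\<subseteq>carrier R. finite A \<and> card A = min_gens R I \<and> Idl A = I" by (rule least)
qed

lemma min_gens_family: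
  assumes I: "ideal I R"
  obtains x :: "nat \<Rightarrow> 'a" where "x \<in> UNIV \<rightarrow> carrier R" "Idl (x ` {..<min_gens R I}) = I"
proof -
  obtain A where A: "A \<subseteq> carrier R" "finite A" "card A = min_gens R I" "Idl A = I"
    using min_gens_eq_len(3)[OF I] by auto
  obtain f where f: "bij_betw f {..<min_gens R I} A"
    using A bij_betw_from_nat_into_finite by (metis A(2,3) ex_bij_betw_nat_finite atLeast0LessThan)
  define x where "x = (\<lambda>i. if i < min_gens R I then f i else \<zero>)"
  have "x ` {..<min_gens R I} = A" using f by (auto simp: x_def bij_betw_def)
  moreover have "x \<in> UNIV \<rightarrow> carrier R" using bij_betwE[OF f] A(1) by (auto simp: x_def subset_iff)
  ultimately show ?thesis using that A by auto
qed

lemma minimal_generators_coeffs: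
  assumes I: "ideal I R" and "finite K" and x: "x \<in> K \<rightarrow> carrier R" "Idl (x ` K) = I"
    and card: "card K \<le> min_gens R I"
    and c: "c \<in> K \<rightarrow> carrier R" "lin R K x c \<in> \<mm> \<cdot> I" and i: "i \<in> K"
  shows "c i \<in> \<mm>"
proof (rule ccontr)
  assume "c i \<notin> \<mm>"
  then have u: "c i \<in> Units R" using c i Units_iff by auto
  let ?K = "K - {i}" and ?A = "x ` (K - {i})"
  have K: "K = insert i ?K" "i \<notin> ?K" "finite ?K" using i assms(2) by auto
  have xi: "x i \<in> carrier R" "c i \<in> carrier R" using x c i by auto
  have xc: "x \<in> ?K \<rightarrow> carrier R" "c \<in> ?K \<rightarrow> carrier R" using x c by auto
  have carr: "\<mm> \<cdot> I \<union> ?A \<subseteq> carrier R"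
    using prod_max_ideal[OF I] ideal.Icarr[OF I] x by auto
  interpret J: ideal "Idl (\<mm> \<cdot> I \<union> ?A)" R by (rule genideal_ideal[OF carr])
  have sup: "\<mm> \<cdot> I \<union> ?A \<subseteq> Idl (\<mm> \<cdot> I \<union> ?A)" by (rule genideal_self[OF carr])
  have "lin R ?K x c = lin R ?K x (restrict c ?K)"
    unfolding lin_def using xc by (intro finsum_cong') (auto simp: Pi_def)
  also have "\<dots> \<in> Idl ?A"
  proof -
    have "restrict c ?K \<in> carrier (tuples R ?K)" using xc(2) by simp
    then show ?thesis unfolding lin_image[OF K(3) xc(1), symmetric] by (rule imageI)
  qed
  also have "Idl ?A \<subseteq> Idl (\<mm> \<cdot> I \<union> ?A)"
    using sup by (intro genideal_minimal J.is_ideal) auto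
  finally have rest: "lin R ?K x c \<in> Idl (\<mm> \<cdot> I \<union> ?A)" .
  have "lin R K x c = c i \<otimes> x i \<oplus> lin R ?K x c"
    unfolding lin_def using xi xc by (subst K(1), intro finsum_insert K) auto
  then have "c i \<otimes> x i = lin R K x c \<ominus> lin R ?K x c"
    using xi lin_closed[OF xc] by (simp add: a_minus_def a_assoc r_neg)
  then have "c i \<otimes> x i \<in> Idl (\<mm> \<cdot> I \<union> ?A)"
    using rest c sup unfolding a_minus_def by auto
  then have "inv (c i) \<otimes> (c i \<otimes> x i) \<in> Idl (\<mm> \<cdot> I \<union> ?A)" using u J.I_l_closed by auto
  moreover have "inv (c i) \<otimes> (c i \<otimes> x i) = x i" using u xi by (simp add: m_assoc[symmetric])
  ultimately have "x ` K \<subseteq> Idl (\<mm> \<cdot> I \<union> ?A)" using sup by auto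
  then have "I \<subseteq> Idl (\<mm> \<cdot> I \<union> ?A)"
    by (subst x(2)[symmetric], intro genideal_minimal J.is_ideal)
  moreover have "Idl (\<mm> \<cdot> I \<union> ?A) \<subseteq> I"
    using prod_max_ideal[OF I] genideal_self[of "x ` K"] x by (intro genideal_minimal I) auto
  ultimately have "len (submods R (mults R)) (\<mm> \<cdot> I) I \<le> card ?A"
    using len_le_generators(2)[OF I, of ?A] K carr by auto
  also have "\<dots> \<le> card ?K" by (rule card_image_le[OF K(3)])
  also have "\<dots> < card K" using i assms(2) by (intro psubset_card_mono) auto
  finally show False using card min_gens_eq_len(2)[OF I] by simp
qed

end

lemma (in primeideal) pow_mem:
  assumes a: "a \<in> carrier R" and "a [^] (n::nat) \<in> I"
  shows "a \<in> I"
  using assms(2)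
proof (induction n)
  case 0
  then have "I = carrier R" by (intro one_imp_carrier) simp
  then show ?case using a by simp
next
  case (Suc n)
  have "a [^] n \<in> I \<or> a \<in> I"
    by (rule I_prime) (use a Suc.prems in simp_all)
  then show ?case using Suc.IH by blast
qed

context artin_local_ring
begin

text \<open>The ideals of the powers of \<open>a\<close> become stationary, so \<open>a^N = b a a^N\<close> for some \<open>b\<close>, and
  \<open>1 - b a\<close> is a unit.\<close>

lemma nilpotent:
  assumes a: "a \<in> \<mm>"
  shows "\<exists>n::nat. a [^] n = \<zero>"
proof -
  have ac: "a \<in> carrier R" using a max_ideal_closed by auto
  have "PIdl (a [^] Suc n) \<subseteq> PIdl (a [^] n)" for n :: nat
    using ac by (intro cgenideal_minimal cgenideal_ideal) (auto simp: cgenideal_def m_comm)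
  then obtain N where N: "\<And>n. n \<ge> N \<Longrightarrow> PIdl (a [^] n) = PIdl (a [^] (N::nat))"
    using descending_chain[of "\<lambda>n. PIdl (a [^] n)"] cgenideal_ideal ac by auto
  have "a [^] N \<in> PIdl (a [^] Suc N)" using N[of "Suc N"] cgenideal_self ac by auto
  then obtain b where b: "b \<in> carrier R" "a [^] N = b \<otimes> a [^] Suc N" by (auto simp: cgenideal_def)
  have z: "a [^] N \<ominus> (b \<otimes> a) \<otimes> a [^] N = \<zero>"
    using b ac by (simp add: m_assoc m_comm[of "a [^] N"] r_neg a_minus_def) 
  have m: "b \<otimes> a \<in> \<mm>" using a b ideal.I_l_closed[OF ideal_max_ideal] by auto
  have "a [^] N \<in> {\<zero>}"
    by (rule one_minus_cancel[OF zeroideal m]) (use ac z in simp_all)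
  then show ?thesis by auto
qed

text \<open>An ideal \<open>I\<close> maximal among those of infinite colength has an associated prime \<open>(I : z)\<close>. It
  is the maximal ideal, whose elements are nilpotent, so \<open>I + (z)\<close> covers \<open>I\<close> and has finite
  colength.\<close>

lemma finite_length: "fin R (mults R) (carrier R)"
proof -
  let ?F = "{I. ideal I R \<and> \<not> finlen (submods R (mults R)) I (carrier R)}"
  have "?F = {}"
  proof (rule ccontr)
    assume "?F \<noteq> {}"
    then obtain M where M: "M \<in> ?F" "\<And>J. J \<in> ?F \<Longrightarrow> M \<subseteq> J \<Longrightarrow> J = M"
      by (rule maximal_ideal_in_family) auto
    interpret M: ideal M R using M by simp
    have "M \<noteq> carrier R"
      using M series.refl[of M "submods R (mults R)"] by (auto simp: finlen_def ideal_iff_submod)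
    then obtain z where z: "z \<in> carrier R" "z \<notin> M" "primeideal (colon R M z) R"
      using associated_prime[OF cring_axioms noetherian_ring_axioms M.is_ideal] by blast
    interpret P: primeideal "colon R M z" R by fact
    have kill: "t \<otimes> z \<in> M" if t: "t \<in> \<mm>" for t
    proof -
      obtain n :: nat where n: "t [^] n = \<zero>" using nilpotent[OF t] by auto
      have tc: "t \<in> carrier R" using t max_ideal_closed by auto
      have "\<zero> \<in> colon R M z" by (rule P.zero_closed)
      then have "t \<in> colon R M z" using P.pow_mem[OF tc, of n] n by simp
      then show ?thesis unfolding colon_def by blast
    qed
    have "M \<union> {z} \<subseteq> carrier R" using z(1) M.a_subset by simp
    then have "M \<noteq> Idl (M \<union> {z})" using genideal_self[of "M \<union> {z}"] z(2) by auto
    then have cov: "covers (submods R (mults R)) M (Idl (M \<union> {z}))"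
      using covers_ideal_plus_principal[OF M.is_ideal z(1) kill] by simp
    then have "Idl (M \<union> {z}) \<notin> ?F" using M(2)[of "Idl (M \<union> {z})"] by (auto simp: covers_def)
    then have "finlen (submods R (mults R)) (Idl (M \<union> {z})) (carrier R)"
      using cov by (auto simp: covers_def ideal_iff_submod)
    then obtain n where "series (submods R (mults R)) (Idl (M \<union> {z})) (carrier R) n"
      by (auto simp: finlen_def)
    then have "finlen (submods R (mults R)) M (carrier R)"
      using series_trans[OF _ series_covers[OF cov]] by (auto simp: finlen_def)
    then show False using M by simp
  qed
  then show ?thesis using zeroideal by (auto simp: fin_def)
qed

end

section \<open>Krull's principal ideal theorem\<close>

lemma (in ring) minus_zero_eqI:
  "\<lbrakk>a \<ominus> b = \<zero>; a \<in> carrier R; b \<in> carrier R\<rbrakk> \<Longrightarrow> a = b"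
  by simp

text \<open>Ideals that contain \<open>P\<close> and are saturated with respect to the complement of \<open>p\<close> stand for
  the ideals of the localisation at \<open>p\<close> of the quotient by \<open>P\<close>.\<close>

locale prime_pair = cring R + noetherian_ring R + P: primeideal P R + p: primeideal p R
  for R (structure) and P and p +
  assumes P_le_p: "P \<subseteq> p"
begin

definition saturated :: "'a set set"
  where "saturated = {I. ideal I R \<and> P \<subseteq> I \<and> (\<forall>s\<in>carrier R - p. \<forall>a\<in>carrier R. s \<otimes> a \<in> I \<longrightarrow> a \<in> I)}"

text \<open>The saturation of \<open>N + K c\<close>.\<close>

definition adj :: "'a set \<Rightarrow> 'a set \<Rightarrow> 'a \<Rightarrow> 'a set"
  where "adj N K c = {a \<in> carrier R. \<exists>s\<in>carrier R - p. \<exists>n\<in>N. \<exists>k\<in>K. s \<otimes> a = n \<oplus> k \<otimes> c}"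

lemma adjI: "\<lbrakk>a \<in> carrier R; s \<in> carrier R; s \<notin> p; n \<in> N; k \<in> K; s \<otimes> a = n \<oplus> k \<otimes> c\<rbrakk> \<Longrightarrow> a \<in> adj N K c"
  unfolding adj_def by blast

lemma adjE:
  assumes "a \<in> adj N K c"
  obtains s n k where "a \<in> carrier R" "s \<in> carrier R" "s \<notin> p" "n \<in> N" "k \<in> K" "s \<otimes> a = n \<oplus> k \<otimes> c"
  using assms unfolding adj_def by blast

lemma saturatedD:
  assumes "I \<in> saturated"
  shows "ideal I R" "P \<subseteq> I" "\<lbrakk>s \<in> carrier R; s \<notin> p; a \<in> carrier R; s \<otimes> a \<in> I\<rbrakk> \<Longrightarrow> a \<in> I"
  using assms by (auto simp: saturated_def)

lemma compl_mult: "\<lbrakk>s \<in> carrier R; s \<notin> p; t \<in> carrier R; t \<notin> p\<rbrakk> \<Longrightarrow> s \<otimes> t \<notin> p"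
  using p.I_prime by blast

lemma one_notin_p: "\<one> \<notin> p"
  using p.one_imp_carrier p.I_notcarr by auto

lemma inter_saturated: "\<lbrakk>A \<in> saturated; B \<in> saturated\<rbrakk> \<Longrightarrow> A \<inter> B \<in> saturated"
  by (auto simp: saturated_def intro: i_intersect)

lemma carrier_saturated: "carrier R \<in> saturated"
  using oneideal P.Icarr by (auto simp: saturated_def)

lemma P_saturated: "P \<in> saturated"
  using P.is_ideal P.I_prime P_le_p by (auto simp: saturated_def)

lemma colon_saturated:
  assumes "I \<in> saturated" "z \<in> carrier R"
  shows "colon R I z \<in> saturated"
proof -
  interpret I: ideal I R using saturatedD[OF assms(1)] by simp
  have "a \<otimes> z \<in> I" if "s \<in> carrier R" "s \<notin> p" "a \<in> carrier R" "s \<otimes> a \<otimes> z \<in> I" for s a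
    using that saturatedD(3)[OF assms(1), of s "a \<otimes> z"] assms(2) by (simp add: m_assoc)
  moreover have "t \<otimes> z \<in> I" if "t \<in> P" for t
    using that saturatedD(2)[OF assms(1)] assms(2) I.I_r_closed by auto
  ultimately show ?thesis
    using colon_ideal[OF I.is_ideal assms(2)] P.Icarr
    unfolding saturated_def by (auto simp: colon_def)
qed

lemma adj_saturated:
  assumes N: "N \<in> saturated" and K: "ideal K R" and c: "c \<in> carrier R"
  shows "adj N K c \<in> saturated"
proof -
  interpret N: ideal N R using saturatedD[OF N] by simp
  interpret K: ideal K R by fact
  have "\<zero> \<in> adj N K c"
    by (rule adjI[of _ \<one> \<zero> _ \<zero>]) (use c one_notin_p in auto)
  moreover have "a \<oplus> b \<in> adj N K c" if h: "a \<in> adj N K c" "b \<in> adj N K c" for a b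
  proof -
    obtain s n k where a: "a \<in> carrier R" "s \<in> carrier R" "s \<notin> p" "n \<in> N" "k \<in> K" "s \<otimes> a = n \<oplus> k \<otimes> c"
      using h(1) by (rule adjE)
    obtain t l j where b: "b \<in> carrier R" "t \<in> carrier R" "t \<notin> p" "l \<in> N" "j \<in> K" "t \<otimes> b = l \<oplus> j \<otimes> c"
      using h(2) by (rule adjE)
    have car: "n \<in> carrier R" "k \<in> carrier R" "l \<in> carrier R" "j \<in> carrier R"
      using a b N.Icarr K.Icarr by auto
    have "(s \<otimes> t) \<otimes> (a \<oplus> b) = t \<otimes> (s \<otimes> a) \<oplus> s \<otimes> (t \<otimes> b)"
      using a(1,2) b(1,2) by algebra
    also have "\<dots> = (t \<otimes> n \<oplus> s \<otimes> l) \<oplus> (t \<otimes> k \<oplus> s \<otimes> j) \<otimes> c"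
      unfolding a(6) b(6) using a(1,2) b(1,2) car c by algebra
    finally show ?thesis
      using a b compl_mult by (intro adjI[of _ "s \<otimes> t"]) (auto intro: N.I_l_closed K.I_l_closed)
  qed
  moreover have "x \<otimes> a \<in> adj N K c" if h: "x \<in> carrier R" "a \<in> adj N K c" for x a
  proof -
    obtain s n k where a: "a \<in> carrier R" "s \<in> carrier R" "s \<notin> p" "n \<in> N" "k \<in> K" "s \<otimes> a = n \<oplus> k \<otimes> c"
      using h(2) by (rule adjE)
    have car: "n \<in> carrier R" "k \<in> carrier R" using a N.Icarr K.Icarr by auto
    have "s \<otimes> (x \<otimes> a) = x \<otimes> (s \<otimes> a)" using a(1,2) h(1) by algebra
    also have "\<dots> = (x \<otimes> n) \<oplus> (x \<otimes> k) \<otimes> c"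
      unfolding a(6) using a(1,2) car c h(1) by algebra
    finally show ?thesis
      using a h(1) by (intro adjI[of _ s]) (auto intro: N.I_l_closed K.I_l_closed)
  qed
  moreover from this have "\<ominus> a \<in> adj N K c" if "a \<in> adj N K c" for a
  proof -
    have "a \<in> carrier R" using that by (auto simp: adj_def)
    then have "\<ominus> a = (\<ominus> \<one>) \<otimes> a" by algebra
    then show ?thesis
      using \<open>\<And>x a. \<lbrakk>x \<in> carrier R; a \<in> adj N K c\<rbrakk> \<Longrightarrow> x \<otimes> a \<in> adj N K c\<close>[of "\<ominus> \<one>" a] that by simp
  qed
  moreover have "adj N K c \<subseteq> carrier R" by (auto simp: adj_def)
  ultimately have "ideal (adj N K c) R"
    unfolding ideal_iff_submod by (intro submodsI) (auto simp: mults_def)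
  moreover have "P \<subseteq> adj N K c"
  proof
    fix a assume "a \<in> P"
    then have "a \<in> N" "a \<in> carrier R" using saturatedD(2)[OF N] by auto
    then show "a \<in> adj N K c"
      using c one_notin_p by (intro adjI[of _ \<one> a _ \<zero>]) auto
  qed
  moreover have "a \<in> adj N K c"
    if h: "s \<in> carrier R" "s \<notin> p" "a \<in> carrier R" "s \<otimes> a \<in> adj N K c" for s a
  proof -
    obtain t n k where t: "t \<in> carrier R" "t \<notin> p" "n \<in> N" "k \<in> K" "t \<otimes> (s \<otimes> a) = n \<oplus> k \<otimes> c"
      using h(4) by (rule adjE)
    have "(t \<otimes> s) \<otimes> a = n \<oplus> k \<otimes> c" using t h by (simp add: m_assoc)
    then show ?thesis using t h compl_mult by (intro adjI[of _ "t \<otimes> s"]) auto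
  qed
  ultimately show ?thesis unfolding saturated_def by blast
qed

lemma adj_upper1:
  assumes "N \<in> saturated" "ideal K R" "c \<in> carrier R"
  shows "N \<subseteq> adj N K c"
proof
  fix a assume "a \<in> N"
  then have "a \<in> N" "a \<in> carrier R" using ideal.Icarr[OF saturatedD(1)[OF assms(1)]] by auto
  moreover have "\<zero> \<in> K" by (rule additive_subgroup.zero_closed[OF ideal.axioms(1)[OF assms(2)]])
  ultimately show "a \<in> adj N K c"
    using assms one_notin_p by (intro adjI[of _ \<one> a _ \<zero>]) auto
qed

lemma adj_upper2:
  assumes "N \<in> saturated" "ideal K R" "c \<in> carrier R" "k \<in> K"
  shows "k \<otimes> c \<in> adj N K c"
proof -
  have "\<zero> \<in> N" by (rule additive_subgroup.zero_closed[OF ideal.axioms(1)[OF saturatedD(1)[OF assms(1)]]])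
  moreover have "k \<in> carrier R" by (rule ideal.Icarr[OF assms(2,4)])
  ultimately show ?thesis
    using assms one_notin_p by (intro adjI[of _ \<one> \<zero> _ k]) auto
qed

lemma adj_least:
  assumes C: "C \<in> saturated" and "N \<subseteq> C" "\<And>k. k \<in> K \<Longrightarrow> k \<otimes> c \<in> C"
  shows "adj N K c \<subseteq> C"
proof
  interpret C: ideal C R using saturatedD[OF C] by simp
  fix a assume "a \<in> adj N K c"
  then obtain s n k where a: "a \<in> carrier R" "s \<in> carrier R" "s \<notin> p" "n \<in> N" "k \<in> K" "s \<otimes> a = n \<oplus> k \<otimes> c"
    by (rule adjE)
  then have "s \<otimes> a \<in> C" using assms by auto
  then show "a \<in> C" using saturatedD(3)[OF C] a by blast
qed

lemma modular_family_saturated: "modular_family saturated (\<lambda>A B. adj A B \<one>)"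
proof
  fix A B assume AB: "A \<in> saturated" "B \<in> saturated"
  note B = saturatedD(1)[OF AB(2)]
  show "A \<inter> B \<in> saturated" using AB by (rule inter_saturated)
  show "adj A B \<one> \<in> saturated" using AB B by (intro adj_saturated) auto
  show "A \<subseteq> adj A B \<one>" using AB B by (intro adj_upper1) auto
  show "B \<subseteq> adj A B \<one>"
    using adj_upper2[OF AB(1) B one_closed] ideal.Icarr[OF B] by (metis r_one subsetI)
  fix C assume C: "C \<in> saturated"
  show "adj A B \<one> \<subseteq> C" if "A \<subseteq> C" "B \<subseteq> C"
    using that ideal.Icarr[OF B] by (intro adj_least C) auto
  show "adj A B \<one> \<inter> C \<subseteq> adj A (B \<inter> C) \<one>" if AC: "A \<subseteq> C"
  proof
    fix a assume a: "a \<in> adj A B \<one> \<inter> C"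
    then obtain s n k where *: "a \<in> carrier R" "s \<in> carrier R" "s \<notin> p" "n \<in> A" "k \<in> B" "s \<otimes> a = n \<oplus> k \<otimes> \<one>"
      using adjE[of a A B \<one>] by auto
    interpret C: ideal C R using saturatedD[OF C] by simp
    have car: "n \<in> carrier R" "k \<in> carrier R"
      using * ideal.Icarr[OF B] AC C.Icarr by auto
    have "k \<otimes> \<one> = s \<otimes> a \<ominus> n" unfolding *(6) using car by algebra
    moreover have "s \<otimes> a \<in> C" "n \<in> C"
      using C.I_l_closed[of a s] a * AC by auto
    ultimately have "k \<in> C" using car unfolding a_minus_def by auto
    then show "a \<in> adj A (B \<inter> C) \<one>" using * by (intro adjI[of _ s n _ k]) auto
  qed
qed

sublocale sat: modular_family saturated "\<lambda>A B. adj A B \<one>"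
  by (rule modular_family_saturated)

abbreviation "colength N \<equiv> len saturated N (carrier R)"
abbreviation "fin_colength N \<equiv> finlen saturated N (carrier R)"

text \<open>Multiplication by \<open>c\<close> identifies the quotient by \<open>(N : c)\<close> with \<open>N + (c)\<close> modulo \<open>N\<close>.\<close>

lemma colength_adj_colon:
  assumes N: "N \<in> saturated" and c: "c \<in> carrier R" and fin: "fin_colength N"
  shows "colength N = colength (adj N (carrier R) c) + colength (colon R N c)"
proof -
  let ?M = "adj N (carrier R) c"
  have M: "?M \<in> saturated" "N \<subseteq> ?M" "?M \<subseteq> carrier R"
    using adj_saturated[OF N oneideal c] adj_upper1[OF N oneideal c] by (auto simp: adj_def)
  interpret N: ideal N R using saturatedD[OF N] by simp
  have split: "finlen saturated N ?M" "colength N = len saturated N ?M + colength ?M"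
    using sat.finlen_split[OF fin M] by auto
  then obtain n where n: "series saturated N ?M n" by (auto simp: finlen_def)
  have FG: "adj N (colon R C c) c = C" if C: "C \<in> saturated" "N \<subseteq> C" "C \<subseteq> ?M" for C
  proof
    interpret C: ideal C R using saturatedD[OF C(1)] by simp
    show "adj N (colon R C c) c \<subseteq> C"
      using C by (intro adj_least) (auto simp: colon_def)
    show "C \<subseteq> adj N (colon R C c) c"
    proof
      fix a assume a: "a \<in> C"
      then have "a \<in> ?M" using C by auto
      then obtain s l k where *: "a \<in> carrier R" "s \<in> carrier R" "s \<notin> p" "l \<in> N" "k \<in> carrier R" "s \<otimes> a = l \<oplus> k \<otimes> c"
        by (rule adjE)
      have lc: "l \<in> carrier R" using * by auto
      have "k \<otimes> c = s \<otimes> a \<ominus> l" unfolding *(6) using lc * c by algebra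
      moreover have "s \<otimes> a \<in> C" "l \<in> C" using C.I_l_closed[OF a *(2)] *(4) C(2) by auto
      ultimately have "k \<otimes> c \<in> C" unfolding a_minus_def by auto
      then show "a \<in> adj N (colon R C c) c"
        using * by (intro adjI[of _ s l _ k]) (auto simp: colon_def)
    qed
  qed
  have GF: "colon R (adj N C c) c = C" if C: "C \<in> saturated" "colon R N c \<subseteq> C" for C
  proof
    interpret C: ideal C R using saturatedD[OF C(1)] by simp
    show "C \<subseteq> colon R (adj N C c) c"
      using adj_upper2[OF N C.is_ideal c] by (auto simp: colon_def)
    show "colon R (adj N C c) c \<subseteq> C"
    proof
      fix a assume "a \<in> colon R (adj N C c) c"
      then have a: "a \<in> carrier R" "a \<otimes> c \<in> adj N C c" by (auto simp: colon_def)
      obtain s l k where *: "s \<in> carrier R" "s \<notin> p" "l \<in> N" "k \<in> C" "s \<otimes> (a \<otimes> c) = l \<oplus> k \<otimes> c"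
        using a(2) by (rule adjE)
      have car: "l \<in> carrier R" "k \<in> carrier R" using * by auto
      have "(s \<otimes> a \<ominus> k) \<otimes> c = s \<otimes> (a \<otimes> c) \<ominus> k \<otimes> c" using a(1) *(1) car c by algebra
      also have "\<dots> = \<one> \<otimes> l" unfolding *(5) using \<open>k \<in> carrier R\<close> car c by algebra
      also have "\<dots> = l" using car by simp
      finally have "s \<otimes> a \<ominus> k \<in> colon R N c" using * car a by (auto simp: colon_def)
      then have "(s \<otimes> a \<ominus> k) \<oplus> k \<in> C" using C * by auto
      moreover have "(s \<otimes> a \<ominus> k) \<oplus> k = s \<otimes> a" using a(1) *(1) car by algebra
      ultimately show "a \<in> C" using saturatedD(3)[OF C(1), of s a] * a by simp
    qed
  qed
  have "series saturated (colon R N c) (colon R ?M c) n"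
    using n
  proof (rule series_transport[where F = "\<lambda>C. colon R C c" and G = "\<lambda>C. adj N C c"])
    show "colon R C c \<in> saturated \<and> adj N (colon R C c) c = C"
      if "C \<in> saturated" "N \<subseteq> C" "C \<subseteq> ?M" for C
      using FG[OF that] colon_saturated[OF that(1) c] by simp
    show "adj N C c \<in> saturated \<and> N \<subseteq> adj N C c \<and> colon R (adj N C c) c = C"
      if "C \<in> saturated" "colon R N c \<subseteq> C" "C \<subseteq> colon R ?M c" for C
      using GF[OF that(1,2)] adj_saturated[OF N _ c] adj_upper1[OF N _ c] saturatedD(1)[OF that(1)] by simp
  qed (auto simp: colon_def adj_def)
  moreover have "colon R ?M c = carrier R"
    using adj_upper2[OF N oneideal c] by (auto simp: colon_def)
  ultimately have "len saturated N ?M = colength (colon R N c)"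
    using sat.series_len n by metis
  then show ?thesis using split by simp
qed

lemma colength_antimono:
  assumes "A \<in> saturated" "B \<in> saturated" "A \<subseteq> B" "fin_colength A"
  shows "colength B \<le> colength A" "colength A = colength B \<Longrightarrow> A = B"
proof -
  have "B \<subseteq> carrier R" using ideal.Icarr[OF saturatedD(1)[OF assms(2)]] by auto
  then have *: "finlen saturated A B" "colength A = len saturated A B + colength B"
    using sat.finlen_split[OF assms(4,2,3)] by auto
  show "colength B \<le> colength A" using * by simp
  show "colength A = colength B \<Longrightarrow> A = B" using * sat.len_zero_imp_eq[OF *(1)] by simp
qed

lemma covers_adj:
  assumes N: "N \<in> saturated" and z: "z \<in> carrier R" "z \<notin> N" and q: "colon R N z = p"
  shows "covers saturated N (adj N (carrier R) z)"
proof -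
  interpret N: ideal N R using saturatedD[OF N] by simp
  have M: "adj N (carrier R) z \<in> saturated" "N \<subseteq> adj N (carrier R) z"
    using adj_saturated[OF N oneideal z(1)] adj_upper1[OF N oneideal z(1)] by auto
  have "z \<in> adj N (carrier R) z"
    using adj_upper2[OF N oneideal z(1), of \<one>] z by simp
  moreover have "C = N \<or> C = adj N (carrier R) z"
    if C: "C \<in> saturated" "N \<subseteq> C" "C \<subseteq> adj N (carrier R) z" for C
  proof (cases "C = N")
    case False
    interpret C: ideal C R using saturatedD[OF C(1)] by simp
    obtain w where w: "w \<in> C" "w \<notin> N" using C False by auto
    then have "w \<in> adj N (carrier R) z" using C by auto
    then obtain s n b where *: "w \<in> carrier R" "s \<in> carrier R" "s \<notin> p" "n \<in> N" "b \<in> carrier R" "s \<otimes> w = n \<oplus> b \<otimes> z"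
      by (rule adjE)
    have "b \<notin> p"
    proof
      assume "b \<in> p"
      then have "b \<otimes> z \<in> N" using q by (auto simp: colon_def)
      then have "s \<otimes> w \<in> N" using * by auto
      then show False using saturatedD(3)[OF N, of s w] * w by auto
    qed
    have nc: "n \<in> carrier R" using * by auto
    have "b \<otimes> z = s \<otimes> w \<ominus> n" unfolding *(6) using nc * z by algebra
    moreover have "s \<otimes> w \<in> C" "n \<in> C" using C.I_l_closed[OF w(1) *(2)] *(4) C(2) by auto
    ultimately have "b \<otimes> z \<in> C" unfolding a_minus_def by auto
    then have "z \<in> C" using saturatedD(3)[OF C(1), of b z] * z \<open>b \<notin> p\<close> by auto
    then have "adj N (carrier R) z \<subseteq> C"
      using C by (intro adj_least C) (auto intro: C.I_l_closed)
    then show ?thesis using C by auto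
  qed simp
  ultimately show ?thesis using N M z unfolding covers_def by blast
qed

text \<open>Primes above \<open>N\<close> inside \<open>p\<close> contain \<open>x\<close>, so \<open>p\<close> is the only one. A saturated ideal maximal
  among the counterexamples has \<open>p\<close> as an associated prime, and is therefore covered by a
  saturated ideal of finite colength.\<close>

lemma fin_colength_if_minimal:
  assumes x: "x \<in> carrier R"
    and min: "\<And>q. \<lbrakk>primeideal q R; P \<subseteq> q; x \<in> q; q \<subseteq> p\<rbrakk> \<Longrightarrow> q = p"
    and N: "N \<in> saturated" "x [^] (k::nat) \<in> N"
  shows "fin_colength N"
proof (rule ccontr)
  assume not: "\<not> fin_colength N"
  let ?F = "{I \<in> saturated. x [^] k \<in> I \<and> \<not> fin_colength I}"
  have "?F \<noteq> {}" using N not by auto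
  then obtain M where M: "M \<in> ?F" "\<And>J. J \<in> ?F \<Longrightarrow> M \<subseteq> J \<Longrightarrow> J = M"
    by (rule maximal_ideal_in_family) (auto simp: saturated_def)
  have Ms: "M \<in> saturated" "x [^] k \<in> M" using M(1) by auto
  have "M \<noteq> carrier R"
    using M series.refl[OF carrier_saturated] by (auto simp: finlen_def)
  then obtain z where z: "z \<in> carrier R" "z \<notin> M" "primeideal (colon R M z) R"
    using associated_prime[OF cring_axioms noetherian_ring_axioms saturatedD(1)[OF Ms(1)]] by blast
  have Mq: "M \<subseteq> colon R M z"
    using ideal.I_r_closed[OF saturatedD(1)[OF Ms(1)]] ideal.Icarr[OF saturatedD(1)[OF Ms(1)]] z(1)
    by (auto simp: colon_def)
  have "colon R M z = p"
  proof (rule min[OF z(3)])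
    show "P \<subseteq> colon R M z" using Mq saturatedD(2)[OF Ms(1)] by auto
    show "x \<in> colon R M z"
      using primeideal.pow_mem[OF z(3) x] Ms(2) Mq by blast
    show "colon R M z \<subseteq> p"
    proof
      fix t assume "t \<in> colon R M z"
      then show "t \<in> p" using saturatedD(3)[OF Ms(1), of t z] z(1,2) unfolding colon_def by blast
    qed
  qed
  then have cov: "covers saturated M (adj M (carrier R) z)"
    by (rule covers_adj[OF Ms(1) z(1,2)])
  have "adj M (carrier R) z \<notin> ?F"
    using M(2)[of "adj M (carrier R) z"] cov by (auto simp: covers_def)
  then have "fin_colength (adj M (carrier R) z)" using cov Ms(2) by (auto simp: covers_def)
  then obtain n where "series saturated (adj M (carrier R) z) (carrier R) n" by (auto simp: finlen_def)
  then have "fin_colength M"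
    using series_trans[OF _ series_covers[OF cov]] by (auto simp: finlen_def)
  then show False using M by simp
qed

text \<open>Modulo \<open>P\<close> this is Krull's principal ideal theorem, by Kaplansky's count of lengths.
  Without such a prime, saturated ideals that contain a power of \<open>x\<close> have finite colength. Take
  \<open>y\<close> in \<open>P1\<close> but not in \<open>P\<close>, a power \<open>u\<close> of \<open>x\<close> that is high enough for \<open>t u^2\<close> in the
  saturation of \<open>(y)\<close> to imply the same of \<open>t u\<close>, and the saturation \<open>N\<close> of \<open>(u^2, u y)\<close>. Up to
  saturation, \<open>N + (u)\<close>, \<open>(N : u)\<close>, \<open>N + (y)\<close> and \<open>(N : y)\<close> are \<open>(u)\<close>, \<open>(u, y)\<close>, \<open>(u^2, y)\<close> and
  \<open>(u)\<close>, so \<open>(u^2, y)\<close> and \<open>(u, y)\<close> have the same colength. Hence \<open>u\<close> lies in the saturation of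
  \<open>(u^2, y)\<close>, which is impossible.\<close>

theorem prime_between_containing:
  assumes P1: "primeideal P1 R" "P \<subset> P1" "P1 \<subset> p" and x: "x \<in> p"
  shows "\<exists>q. primeideal q R \<and> P \<subset> q \<and> q \<subset> p \<and> x \<in> q"
proof (rule ccontr)
  assume none: "\<not> ?thesis"
  interpret P1: primeideal P1 R by fact
  have xc: "x \<in> carrier R" using x p.Icarr by auto
  have xP1: "x \<notin> P1" using none P1 by blast
  have min: "q = p" if "primeideal q R" "P \<subseteq> q" "x \<in> q" "q \<subseteq> p" for q
    using none that xP1 P1 by blast
  obtain y where y: "y \<in> P1" "y \<notin> P" using P1 by auto
  have yc: "y \<in> carrier R" using y by auto
  let ?R = "carrier R"
  let ?Y = "adj P ?R y"
  have Y: "?Y \<in> saturated" using adj_saturated[OF P_saturated oneideal yc] .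
  obtain M where M: "M \<in> range (\<lambda>k. colon R ?Y (x [^] Suc k))"
    "\<And>J. J \<in> range (\<lambda>k. colon R ?Y (x [^] Suc k)) \<Longrightarrow> M \<subseteq> J \<Longrightarrow> J = M"
    by (rule maximal_ideal_in_family[of "range (\<lambda>k. colon R ?Y (x [^] Suc k))"])
      (use colon_ideal[OF saturatedD(1)[OF Y]] xc in auto)
  then obtain k where k: "M = colon R ?Y (x [^] Suc k)" by auto
  define u where "u = x [^] Suc k"
  have uc: "u \<in> carrier R" using xc by (simp add: u_def)
  have up: "u \<in> p" using x xc p.I_l_closed by (simp add: u_def)
  have uP1: "u \<notin> P1" using P1.pow_mem[OF xc, of "Suc k"] xP1 by (auto simp: u_def)
  have uu: "u \<otimes> u = x [^] Suc (Suc (k + k))"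
    unfolding u_def nat_pow_mult[OF xc] by simp
  have stable: "t \<otimes> u \<in> ?Y" if t: "t \<in> carrier R" "t \<otimes> (u \<otimes> u) \<in> ?Y" for t
  proof -
    have "M \<subseteq> colon R ?Y (u \<otimes> u)"
    proof
      fix a assume "a \<in> M"
      then have a: "a \<in> carrier R" "a \<otimes> u \<in> ?Y" by (auto simp: k colon_def u_def)
      have "a \<otimes> (u \<otimes> u) = u \<otimes> (a \<otimes> u)" using a(1) uc by algebra
      then show "a \<in> colon R ?Y (u \<otimes> u)"
        using a uc ideal.I_l_closed[OF saturatedD(1)[OF Y]] by (auto simp: colon_def)
    qed
    then have "colon R ?Y (u \<otimes> u) = M" unfolding uu by (intro M(2) range_eqI[where x = "Suc (k + k)"]) auto
    then show ?thesis using t by (auto simp: k u_def colon_def)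
  qed
  let ?N1 = "adj P ?R (u \<otimes> u)"
  let ?N = "adj ?N1 ?R (u \<otimes> y)"
  have N1: "?N1 \<in> saturated" using adj_saturated[OF P_saturated oneideal] uc by simp
  have N: "?N \<in> saturated" using adj_saturated[OF N1 oneideal] uc yc by simp
  interpret N: ideal ?N R using saturatedD(1)[OF N] .
  have u2N: "u \<otimes> u \<in> ?N"
    using adj_upper2[OF P_saturated oneideal, of "u \<otimes> u" \<one>] adj_upper1[OF N1 oneideal, of "u \<otimes> y"] uc yc by auto
  have uyN: "u \<otimes> y \<in> ?N"
    using adj_upper2[OF N1 oneideal, of "u \<otimes> y" \<one>] uc yc by auto
  have memN: "\<exists>s m a b. s \<in> carrier R \<and> s \<notin> p \<and> m \<in> P \<and> a \<in> carrier R \<and> b \<in> carrier R \<and>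
      s \<otimes> t = m \<oplus> (a \<otimes> (u \<otimes> u) \<oplus> b \<otimes> (u \<otimes> y))" if h: "t \<in> ?N" for t
  proof -
    obtain s n b where 1: "t \<in> carrier R" "s \<in> carrier R" "s \<notin> p" "n \<in> ?N1" "b \<in> carrier R" "s \<otimes> t = n \<oplus> b \<otimes> (u \<otimes> y)"
      using h by (rule adjE)
    obtain s' m a where 2: "n \<in> carrier R" "s' \<in> carrier R" "s' \<notin> p" "m \<in> P" "a \<in> carrier R" "s' \<otimes> n = m \<oplus> a \<otimes> (u \<otimes> u)"
      using 1(4) by (rule adjE)
    have mc: "m \<in> carrier R" using 2 by auto
    have "(s' \<otimes> s) \<otimes> t = s' \<otimes> (s \<otimes> t)" using 1(1,2) 2(2) by algebra
    also have "\<dots> = s' \<otimes> n \<oplus> s' \<otimes> (b \<otimes> (u \<otimes> y))"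
      unfolding 1(6) using 1(5) 2(1,2) uc yc by algebra
    also have "\<dots> = m \<oplus> (a \<otimes> (u \<otimes> u) \<oplus> (s' \<otimes> b) \<otimes> (u \<otimes> y))"
      unfolding 2(6) using 1(5) 2(2,5) mc uc yc by algebra
    finally show ?thesis
      using 1 2 compl_mult by (intro exI[of _ "s' \<otimes> s"] exI[of _ m] exI[of _ a] exI[of _ "s' \<otimes> b"]) auto
  qed
  have fin: "fin_colength I" if "I \<in> saturated" "?N \<subseteq> I" for I
    using that u2N fin_colength_if_minimal[OF xc min, of I "Suc (Suc (k + k))"] by (auto simp: uu)
  let ?Au = "adj ?N ?R u" and ?Ay = "adj ?N ?R y"
  have Au: "?Au \<in> saturated" "?N \<subseteq> ?Au" and Ay: "?Ay \<in> saturated" "?N \<subseteq> ?Ay"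
    using adj_saturated[OF N oneideal] adj_upper1[OF N oneideal] uc yc by auto
  have colons: "colon R ?N u \<in> saturated" "colon R ?N y \<in> saturated" "?N \<subseteq> colon R ?N y"
    using colon_saturated[OF N] uc yc N.I_r_closed by (auto simp: colon_def)
  \<comment> \<open>First inclusion: \<open>(N : y)\<close> lies in \<open>N + (u)\<close>.\<close>
  have "colon R ?N y \<subseteq> ?Au"
  proof
    fix t assume "t \<in> colon R ?N y"
    then have t: "t \<in> carrier R" "t \<otimes> y \<in> ?N" by (auto simp: colon_def)
    obtain s m a b where 1: "s \<in> carrier R" "s \<notin> p" "m \<in> P" "a \<in> carrier R" "b \<in> carrier R"
      "s \<otimes> (t \<otimes> y) = m \<oplus> (a \<otimes> (u \<otimes> u) \<oplus> b \<otimes> (u \<otimes> y))"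
      using memN[OF t(2)] by blast
    have mc: "m \<in> carrier R" using 1 by auto
    have "\<one> \<otimes> (a \<otimes> (u \<otimes> u)) = (m \<oplus> (a \<otimes> (u \<otimes> u) \<oplus> b \<otimes> (u \<otimes> y))) \<ominus> m \<ominus> b \<otimes> (u \<otimes> y)"
      using 1(4,5) mc uc yc by algebra
    also have "\<dots> = \<ominus> m \<oplus> (s \<otimes> t \<ominus> b \<otimes> u) \<otimes> y"
      unfolding 1(6)[symmetric] using 1(1,4,5) mc uc yc t(1) by algebra
    finally have eq: "\<one> \<otimes> (a \<otimes> (u \<otimes> u)) = \<ominus> m \<oplus> (s \<otimes> t \<ominus> b \<otimes> u) \<otimes> y" .
    have "a \<otimes> (u \<otimes> u) \<in> ?Y"
      by (rule adjI[OF _ one_closed one_notin_p _ _ eq]) (use 1(1,3,4,5) t(1) uc in simp_all)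
    then have "a \<otimes> u \<in> ?Y" using stable 1 by auto
    then obtain s' m' c where 2: "s' \<in> carrier R" "s' \<notin> p" "m' \<in> P" "c \<in> carrier R" "s' \<otimes> (a \<otimes> u) = m' \<oplus> c \<otimes> y"
      by (rule adjE)
    have mc': "m' \<in> carrier R" using 2 by auto
    define w where "w = s' \<otimes> s \<otimes> t \<ominus> (s' \<otimes> b \<oplus> c) \<otimes> u"
    have wc: "w \<in> carrier R" using 1 2 t uc by (simp add: w_def)
    have "w \<otimes> y = s' \<otimes> (s \<otimes> (t \<otimes> y)) \<ominus> (s' \<otimes> b \<oplus> c) \<otimes> u \<otimes> y"
      unfolding w_def using 1(1,5) 2(1,4) t(1) uc yc by algebra
    also have "\<dots> = s' \<otimes> m \<oplus> (s' \<otimes> (a \<otimes> u)) \<otimes> u \<ominus> c \<otimes> u \<otimes> y"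
      unfolding 1(6) using 1(4,5) 2(1,4) mc uc yc by algebra
    also have "\<dots> = s' \<otimes> m \<oplus> u \<otimes> m'"
      unfolding 2(5) using 2(1,4) mc mc' uc yc by algebra
    finally have "w \<otimes> y \<in> P" using 1 2 uc P.I_l_closed by auto
    then have "w \<in> P" using P.I_prime[OF wc yc] y by auto
    then have wN: "w \<in> ?N" using saturatedD(2)[OF N] by auto
    have eq': "(s' \<otimes> s) \<otimes> t = w \<oplus> (s' \<otimes> b \<oplus> c) \<otimes> u"
      unfolding w_def using 1(1,5) 2(1,4) t(1) uc by algebra
    show "t \<in> ?Au"
      by (rule adjI[OF t(1) _ _ wN _ eq']) (use 1(1,2,5) 2(1,2,4) compl_mult in simp_all)
  qed
  then have "colength ?Au \<le> colength (colon R ?N y)"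
    using colons Au fin by (intro colength_antimono) auto
  \<comment> \<open>Second inclusion: \<open>N + (y)\<close> lies in \<open>(N : u)\<close>.\<close>
  moreover have sub: "?Ay \<subseteq> colon R ?N u"
  proof (rule adj_least[OF colons(1)])
    show "?N \<subseteq> colon R ?N u" using uc N.I_r_closed by (auto simp: colon_def)
    fix b assume b: "b \<in> carrier R"
    have "b \<otimes> y \<otimes> u = b \<otimes> (u \<otimes> y)" using b uc yc by algebra
    then show "b \<otimes> y \<in> colon R ?N u" using b yc uyN N.I_l_closed by (auto simp: colon_def)
  qed
  moreover have "colength ?Au + colength (colon R ?N u) = colength ?Ay + colength (colon R ?N y)"
    using colength_adj_colon[OF N uc] colength_adj_colon[OF N yc] fin[OF N] by simp
  moreover have "colength (colon R ?N u) \<le> colength ?Ay"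
    using sub Ay colons fin by (intro colength_antimono) auto
  ultimately have "colength ?Ay = colength (colon R ?N u)" by linarith
  then have "?Ay = colon R ?N u"
    using sub Ay colons fin by (intro colength_antimono) auto
  moreover have "u \<in> colon R ?N u" using u2N uc by (auto simp: colon_def)
  ultimately have "u \<in> ?Ay" by simp
  then obtain s n b where 1: "s \<in> carrier R" "s \<notin> p" "n \<in> ?N" "b \<in> carrier R" "s \<otimes> u = n \<oplus> b \<otimes> y"
    by (rule adjE)
  obtain s' m a c where 2: "s' \<in> carrier R" "s' \<notin> p" "m \<in> P" "a \<in> carrier R" "c \<in> carrier R"
      "s' \<otimes> n = m \<oplus> (a \<otimes> (u \<otimes> u) \<oplus> c \<otimes> (u \<otimes> y))"
    using memN[OF 1(3)] by blast
  have car: "m \<in> carrier R" "n \<in> carrier R" using 1 2 by auto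
  define w where "w = s' \<otimes> s \<ominus> a \<otimes> u"
  have wc: "w \<in> carrier R" using 1 2 uc by (simp add: w_def)
  have "w \<otimes> u = s' \<otimes> (s \<otimes> u) \<ominus> a \<otimes> (u \<otimes> u)"
    unfolding w_def using 1(1) 2(1,4) uc by algebra
  also have "\<dots> = s' \<otimes> n \<oplus> s' \<otimes> b \<otimes> y \<ominus> a \<otimes> (u \<otimes> u)"
    unfolding 1(5) using 1(4) 2(1,4) car uc yc by algebra
  also have "\<dots> = m \<oplus> (c \<otimes> u \<oplus> s' \<otimes> b) \<otimes> y"
    unfolding 2(6) using 1(4) 2(1,4,5) car uc yc by algebra
  finally have "w \<otimes> u \<in> P1"
    using y 1 2 uc P1(2) P1.I_l_closed by auto
  then have "w \<in> p" using P1.I_prime[OF wc uc] uP1 \<open>P1 \<subset> p\<close> by auto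
  moreover have "s' \<otimes> s = w \<oplus> a \<otimes> u" unfolding w_def using 1(1) 2(1,4) uc by algebra
  ultimately have "s' \<otimes> s \<in> p" using up 2 p.I_l_closed by auto
  then show False using compl_mult 1 2 by auto
qed

end

section \<open>Regular local rings and Koszul relations\<close>

lemma (in cring) idl_insert:
  assumes "A \<subseteq> carrier R" "a \<in> carrier R"
  shows "Idl (insert a A) = Idl (Idl A \<union> {a})"
proof
  have I: "ideal (Idl A) R" "A \<subseteq> Idl A" using assms genideal_ideal genideal_self by auto
  have carr: "insert a A \<subseteq> carrier R" "Idl A \<union> {a} \<subseteq> carrier R"
    using assms additive_subgroup.a_subset[OF ideal.axioms(1)[OF I(1)]] by auto
  show "Idl (insert a A) \<subseteq> Idl (Idl A \<union> {a})"
    using genideal_ideal[OF carr(2)] genideal_self[OF carr(2)] I by (intro genideal_minimal) auto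
  have "Idl A \<subseteq> Idl (insert a A)"
    using genideal_ideal[OF carr(1)] genideal_self[OF carr(1)] by (intro genideal_minimal) auto
  then show "Idl (Idl A \<union> {a}) \<subseteq> Idl (insert a A)"
    using genideal_ideal[OF carr(1)] genideal_self[OF carr(1)] by (intro genideal_minimal) auto
qed

text \<open>Exchanging the primes of the chain from the top downwards moves an element of the top prime
  into all of them, at the cost of one step.\<close>

lemma prime_chain_containing:
  assumes "cring R" "noetherian_ring R" "prime_chain R c (Suc n)" "x \<in> c (Suc n)"
  shows "\<exists>c'. prime_chain R c' n \<and> x \<in> c' 0 \<and> c 0 \<subset> c' 0 \<and> c' n = c (Suc n)"
  using assms(3,4)
proof (induction n arbitrary: c)
  case 0
  then show ?case by (intro exI[of _ "\<lambda>i. c (Suc i)"]) (auto simp: prime_chain_def)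
next
  case (Suc n)
  have "c n \<subset> c (Suc n)" "c (Suc n) \<subset> c (Suc (Suc n))"
    "primeideal (c n) R" "primeideal (c (Suc (Suc n))) R"
    using Suc.prems by (auto simp: prime_chain_def)
  then interpret prime_pair R "c n" "c (Suc (Suc n))"
    using assms(1,2) by (intro prime_pair.intro prime_pair_axioms.intro) auto
  obtain q where q: "primeideal q R" "c n \<subset> q" "q \<subset> c (Suc (Suc n))" "x \<in> q"
    using prime_between_containing[of "c (Suc n)" x] Suc.prems by (auto simp: prime_chain_def)
  let ?d = "c(Suc n := q)"
  have d1: "prime_chain R ?d (Suc n)"
    using Suc.prems q unfolding prime_chain_def by (auto simp: less_Suc_eq)
  have d2: "x \<in> ?d (Suc n)" using q by simp
  from Suc.IH[OF d1 d2]
  obtain c' where c': "prime_chain R c' n" "x \<in> c' 0" "?d 0 \<subset> c' 0" "c' n = ?d (Suc n)"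
    by blast
  let ?e = "c'(Suc n := c (Suc (Suc n)))"
  have d3: "prime_chain R ?e (Suc n)"
    using c' q Suc.prems unfolding prime_chain_def by (auto simp: less_Suc_eq le_Suc_eq)
  show ?case using c'(2,3) by (intro exI[of _ ?e] conjI d3) simp_all
qed

context local_ring
begin

text \<open>The generators are moved one after the other into the bottom prime of chains of decreasing
  length, down to the maximal ideal alone. On the way back Nakayama's lemma identifies each
  bottom prime with the ideal generated by the elements moved so far. So these ideals are prime,
  and the next element is a nonzerodivisor modulo each of them.\<close>

lemma regular_sequence_if_prime_chain:
  fixes x :: "nat \<Rightarrow> 'a"
  assumes x: "x \<in> UNIV \<rightarrow> carrier R" "Idl (x ` {..<e}) = \<mm>"
    and c: "prime_chain R c n" "c n = \<mm>" "Idl (x ` {..<i}) \<subseteq> c 0" "i + n = e"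
  shows "c 0 = Idl (x ` {..<i}) \<and>
    (\<forall>l. i \<le> l \<and> l \<le> e \<longrightarrow> primeideal (Idl (x ` {..<l})) R \<and> (l < e \<longrightarrow> x l \<notin> Idl (x ` {..<l})))"
  using c
proof (induction n arbitrary: c i)
  case 0
  then have "i = e" by simp
  then show ?case using 0 x primeideal_max_ideal by auto
next
  case (Suc n)
  have xc: "x j \<in> carrier R" "x ` A \<subseteq> carrier R" for j A using x by auto
  have lt: "i < e" using Suc.prems by simp
  have xc0: "x i \<in> c (Suc n)"
    using Suc.prems x lt genideal_self[OF xc(2), of "{..<e}"] by auto
  obtain c' where c': "prime_chain R c' n" "x i \<in> c' 0" "c 0 \<subset> c' 0" "c' n = c (Suc n)"
    using prime_chain_containing[OF cring_axioms noetherian_ring_axioms Suc.prems(1) xc0] by blast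
  interpret C': primeideal "c' 0" R using c' by (auto simp: prime_chain_def)
  interpret C: primeideal "c 0" R using Suc.prems by (auto simp: prime_chain_def)
  let ?J = "Idl (x ` {..<i})"
  interpret J: ideal ?J R using xc by (intro genideal_ideal)
  have JS: "Idl (x ` {..<Suc i}) = Idl (?J \<union> {x i})"
    using idl_insert[of "x ` {..<i}" "x i"] xc by (simp add: lessThan_Suc)
  have "?J \<union> {x i} \<subseteq> c' 0" using Suc.prems c' by auto
  then have "Idl (x ` {..<Suc i}) \<subseteq> c' 0" unfolding JS by (intro genideal_minimal C'.is_ideal)
  then have IH: "c' 0 = Idl (x ` {..<Suc i})"
    "\<And>l. Suc i \<le> l \<Longrightarrow> l \<le> e \<Longrightarrow> primeideal (Idl (x ` {..<l})) R \<and> (l < e \<longrightarrow> x l \<notin> Idl (x ` {..<l}))"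
    using Suc.IH[of c' "Suc i"] c' Suc.prems by auto
  have xi: "x i \<notin> c 0"
  proof
    assume "x i \<in> c 0"
    then have "c' 0 \<subseteq> c 0"
      unfolding IH(1) JS using Suc.prems by (intro genideal_minimal C.is_ideal) auto
    then show False using c' by auto
  qed
  have xm: "x i \<in> \<mm>" using x lt genideal_self[OF xc(2), of "{..<e}"] by auto
  have "c 0 \<subseteq> set_add R ?J (\<mm> \<cdot> c 0)"
  proof
    fix y assume y: "y \<in> c 0"
    then have "y \<in> Idl (?J \<union> {x i})" using c' IH JS by auto
    then obtain j a where ja: "j \<in> ?J" "a \<in> carrier R" "y = j \<oplus> a \<otimes> x i"
      using mem_ideal_plus_principal[OF J.is_ideal xc(1)] by blast
    have "a \<otimes> x i = y \<ominus> j"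
      using ja xc(1)[of i] J.Icarr[OF ja(1)] by (simp add: a_minus_def a_comm[of j] a_assoc r_neg)
    moreover have "j \<in> c 0" using ja Suc.prems by auto
    ultimately have "a \<otimes> x i \<in> c 0" using y unfolding a_minus_def by auto
    then have "a \<in> c 0" using C.I_prime[of a "x i"] xi xc ja by auto
    then have "x i \<otimes> a \<in> \<mm> \<cdot> c 0" using xm by (intro ideal_prod.prod)
    then show "y \<in> set_add R ?J (\<mm> \<cdot> c 0)"
      using ja xc m_comm[of a "x i"] unfolding mem_set_add by auto
  qed
  then have "c 0 \<subseteq> ?J" by (rule Nakayama[OF J.is_ideal C.is_ideal])
  then have eq: "c 0 = ?J" using Suc.prems by auto
  have "primeideal (Idl (x ` {..<l})) R \<and> (l < e \<longrightarrow> x l \<notin> Idl (x ` {..<l}))"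
    if "i \<le> l" "l \<le> e" for l
  proof (cases "l = i")
    case True
    then show ?thesis using eq xi C.primeideal by auto
  qed (use IH(2) that in auto)
  then show ?case using eq by auto
qed

end

lemma (in regular_local_ring) prime_chain_of_edim:
  shows "\<exists>c. prime_chain R c (edim R) \<and> c (edim R) = \<mm>"
proof -
  let ?S = "{enat n | n. \<exists>c. prime_chain R c n}"
  have "\<exists>n c. edim R \<le> n \<and> prime_chain R c n"
  proof (cases "edim R")
    case 0
    have "prime_chain R (\<lambda>_. \<mm>) 0" using primeideal_max_ideal by (auto simp: prime_chain_def)
    then show ?thesis using 0 by auto
  next
    case (Suc e)
    have "enat e < Sup ?S" using regular Suc by (simp add: krull_dim_def)
    then obtain n c where "enat e < enat n" "prime_chain R c n" by (auto simp: less_Sup_iff)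
    then show ?thesis using Suc by (metis Suc_leI enat_ord_simps(2))
  qed
  then obtain n c where "edim R \<le> n" "prime_chain R c n" by auto
  then have c: "prime_chain R c (edim R)" by (auto simp: prime_chain_def)
  let ?c = "c(edim R := \<mm>)"
  have "c (edim R) \<subseteq> \<mm>"
  proof (rule proper_ideal_le_max_ideal)
    interpret primeideal "c (edim R)" R using c by (auto simp: prime_chain_def)
    show "ideal (c (edim R)) R" "c (edim R) \<noteq> carrier R" using is_ideal I_notcarr by auto
  qed
  then have "prime_chain R ?c (edim R)"
    using c primeideal_max_ideal unfolding prime_chain_def
    by (metis fun_upd_apply less_irrefl psubset_subset_trans)
  then show ?thesis by (intro exI[of _ ?c]) auto
qed

text \<open>The trivial relation \<open>x_j e_i - x_i e_j\<close>.\<close>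

definition kos :: "('a, 'm) ring_scheme \<Rightarrow> 'i set \<Rightarrow> ('i \<Rightarrow> 'a) \<Rightarrow> 'i \<Rightarrow> 'i \<Rightarrow> 'i \<Rightarrow> 'a"
  where "kos R K x i j = single R K i (x j) \<ominus>\<^bsub>tuples R K\<^esub> single R K j (x i)"

definition koszul :: "('a, 'm) ring_scheme \<Rightarrow> 'i set \<Rightarrow> ('i \<Rightarrow> 'a) \<Rightarrow> ('i \<Rightarrow> 'a) set"
  where "koszul R K x = span (tuples R K) (scals R K) {kos R K x i j | i j. i \<in> K \<and> j \<in> K}"

definition syz :: "('a, 'm) ring_scheme \<Rightarrow> 'i set \<Rightarrow> ('i \<Rightarrow> 'a) \<Rightarrow> ('i \<Rightarrow> 'a) set"
  where "syz R K x = {v \<in> carrier (tuples R K). lin R K x v = \<zero>\<^bsub>R\<^esub>}"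

context cring
begin

lemma kos_eq:
  assumes "x i \<in> carrier R" "x j \<in> carrier R"
  shows "kos R K x i j = (\<lambda>l\<in>K. (if l = i then x j else \<zero>) \<ominus> (if l = j then x i else \<zero>))"
  unfolding kos_def using assms single_closed by (auto simp: tuples_diff single_def fun_eq_iff)

lemma kos_closed: "x \<in> K \<rightarrow> carrier R \<Longrightarrow> i \<in> K \<Longrightarrow> j \<in> K \<Longrightarrow> kos R K x i j \<in> carrier (tuples R K)"
  by (subst kos_eq) (auto simp: Pi_def)

lemma kos_syz:
  assumes "finite K" "x \<in> K \<rightarrow> carrier R" "i \<in> K" "j \<in> K"
  shows "kos R K x i j \<in> syz R K x"
proof -
  interpret h: op_hom "tuples R K" "scals R K" R "mults R" "lin R K x"
    using assms by (intro lin_hom)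
  have xc: "x i \<in> carrier R" "x j \<in> carrier R" using assms by auto
  have "lin R K x (kos R K x i j) = x j \<otimes> x i \<ominus> x i \<otimes> x j"
    unfolding kos_def using xc single_closed[of "x j" K i] single_closed[of "x i" K j] assms
    by (subst h.f_diff) (simp_all add: lin_single)
  also have "\<dots> = \<zero>" using xc by (simp add: m_comm r_neg a_minus_def)
  finally show ?thesis using kos_closed[OF assms(2-4)] by (simp add: syz_def)
qed

lemma syz_submod:
  assumes "finite K" "x \<in> K \<rightarrow> carrier R"
  shows "syz R K x \<in> submods (tuples R K) (scals R K)"
proof -
  interpret h: op_hom "tuples R K" "scals R K" R "mults R" "lin R K x"
    using assms by (rule lin_hom)
  show ?thesis using h.ker_submod unfolding h.ker_def syz_def .
qed

lemma kos_set_closed: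
  assumes "x \<in> K \<rightarrow> carrier R"
  shows "{kos R K x i j | i j. i \<in> K \<and> j \<in> K} \<subseteq> carrier (tuples R K)"
proof clarify
  fix i j assume "i \<in> K" "j \<in> K"
  then show "kos R K x i j \<in> carrier (tuples R K)" by (rule kos_closed[OF assms])
qed

lemma koszul_submod:
  assumes "x \<in> K \<rightarrow> carrier R"
  shows "koszul R K x \<in> submods (tuples R K) (scals R K)"
  unfolding koszul_def by (rule op_group.span_submod[OF op_group_tuples kos_set_closed[OF assms]])

lemma kos_koszul: "i \<in> K \<Longrightarrow> j \<in> K \<Longrightarrow> kos R K x i j \<in> koszul R K x"
  unfolding koszul_def by (rule subsetD[OF op_group.span_superset[OF op_group_tuples]]) blast

lemma koszul_least:
  assumes "M \<in> submods (tuples R K) (scals R K)" "\<And>i j. i \<in> K \<Longrightarrow> j \<in> K \<Longrightarrow> kos R K x i j \<in> M"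
  shows "koszul R K x \<subseteq> M"
  unfolding koszul_def
  by (rule op_group.span_least[OF op_group_tuples assms(1)]) (use assms(2) in blast)

lemma koszul_le_syz:
  assumes "finite K" "x \<in> K \<rightarrow> carrier R"
  shows "koszul R K x \<subseteq> syz R K x"
  using assms by (intro koszul_least syz_submod kos_syz)

lemma koszul_combination:
  assumes x: "x \<in> K \<rightarrow> carrier R" and "finite I" "I \<subseteq> K" "i \<in> K" "i \<notin> I" "c \<in> I \<rightarrow> carrier R"
  shows "(\<lambda>l\<in>K. if l = i then lin R I x c else if l \<in> I then \<ominus> (c l \<otimes> x i) else \<zero>) \<in> koszul R K x"
  using assms(2-)
proof (induction I rule: finite_induct)
  case empty
  have "(\<lambda>l\<in>K. if l = i then lin R {} x c else if l \<in> {} then \<ominus> (c l \<otimes> x i) else \<zero>) = \<zero>\<^bsub>tuples R K\<^esub>"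
    by (auto simp: lin_def fun_eq_iff)
  then show ?case using submodsD(2)[OF koszul_submod[OF x]] by metis
next
  case (insert j I)
  let ?u = "\<lambda>I. (\<lambda>l\<in>K. if l = i then lin R I x c else if l \<in> I then \<ominus> (c l \<otimes> x i) else \<zero>)"
  have c: "c j \<in> carrier R" "c \<in> I \<rightarrow> carrier R" and jK: "j \<in> K" "j \<noteq> i" and IK: "I \<subseteq> K"
    using insert.prems by auto
  have xI: "x \<in> I \<rightarrow> carrier R" "x i \<in> carrier R" "x j \<in> carrier R" using x IK insert.prems by auto
  have lc: "lin R I x c \<in> carrier R" using xI c by (intro lin_closed)
  have "lin R (insert j I) x c = c j \<otimes> x j \<oplus> lin R I x c"
    unfolding lin_def using insert.hyps xI c by (intro finsum_insert) auto
  then have eq: "?u (insert j I) = (\<lambda>l\<in>K. c j \<otimes> kos R K x i j l) \<oplus>\<^bsub>tuples R K\<^esub> ?u I"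
    using insert.hyps insert.prems xI c lc jK
    by (auto simp: kos_eq fun_eq_iff a_minus_def r_minus Pi_def)
  have mem: "(\<lambda>l\<in>K. c j \<otimes> kos R K x i j l) \<in> koszul R K x"
    using c jK insert.prems kos_koszul koszul_submod[OF x] by (intro scal_submod) auto
  have mem': "?u I \<in> koszul R K x" by (rule insert.IH) (use insert.prems in auto)
  show ?case
    by (rule ssubst[OF eq, of "\<lambda>z. z \<in> koszul R K x"], rule submodsD(4)[OF koszul_submod[OF x] mem mem'])
qed

text \<open>Syzygies of a regular sequence: the last coefficient lies in the ideal of the previous
  elements, so a combination of Koszul relations clears it.\<close>

lemma syz_le_koszul_if_regular:
  fixes x :: "nat \<Rightarrow> 'a"
  assumes x: "x \<in> UNIV \<rightarrow> carrier R"
    and reg: "\<And>l. l < e \<Longrightarrow> primeideal (Idl (x ` {..<l})) R \<and> x l \<notin> Idl (x ` {..<l})"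
  shows "syz R {..<e} x \<subseteq> koszul R {..<e} x"
proof -
  let ?K = "{..<e}"
  have xK: "x \<in> ?K \<rightarrow> carrier R" and xc: "\<And>i. x i \<in> carrier R" using x by auto
  interpret h: op_hom "tuples R ?K" "scals R ?K" R "mults R" "lin R ?K x"
    using xK by (intro lin_hom) auto
  have main: "v \<in> koszul R ?K x"
    if "i \<le> e" "v \<in> syz R ?K x" "\<And>l. i \<le> l \<Longrightarrow> l < e \<Longrightarrow> v l = \<zero>" for i v
    using that
  proof (induction i arbitrary: v)
    case 0
    then have "v = \<zero>\<^bsub>tuples R ?K\<^esub>"
      by (auto simp: syz_def fun_eq_iff PiE_def extensional_def)
    then show ?case using submodsD(2)[OF koszul_submod[OF xK]] by metis
  next
    case (Suc i)
    have i: "i \<in> ?K" "i < e" using Suc.prems by auto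
    have v: "v \<in> carrier (tuples R ?K)" "lin R ?K x v = \<zero>" using Suc.prems by (auto simp: syz_def)
    have vc: "v l \<in> carrier R" if "l < e" for l using v that by auto
    let ?J = "Idl (x ` {..<i})"
    have Jp: "primeideal ?J R" and xi: "x i \<notin> ?J" using reg i by auto
    interpret J: primeideal ?J R by (rule Jp)
    have li: "lin R {..<i} x v \<in> carrier R" using xc vc i by (intro lin_closed) auto
    have lin_i: "lin R {..<i} x v \<in> ?J"
    proof -
      have "lin R {..<i} x v = lin R {..<i} x (restrict v {..<i})"
        unfolding lin_def using xc vc i by (intro finsum_cong') auto
      moreover have "restrict v {..<i} \<in> carrier (tuples R {..<i})" using vc i by auto
      ultimately show ?thesis using lin_image[of "{..<i}" x] xc by auto
    qed
    have "\<zero> = lin R ?K x v" using v by simp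
    also have "\<dots> = (\<Oplus>l\<in>insert i {..<i}. v l \<otimes> x l)"
      unfolding lin_def using xc vc i Suc.prems(3)
      by (intro add.finprod_mono_neutral_cong) auto
    also have "\<dots> = v i \<otimes> x i \<oplus> lin R {..<i} x v"
      unfolding lin_def using xc vc i by (intro finsum_insert) auto
    finally have "v i \<otimes> x i = \<ominus> lin R {..<i} x v"
      using li vc[OF i(2)] xc[of i] by (metis minus_equality m_closed)
    then have "v i \<otimes> x i \<in> ?J" using lin_i by auto
    then have "v i \<in> ?J" using J.I_prime[of "v i" "x i"] xi xc vc[OF i(2)] by auto
    then obtain c where c: "c \<in> carrier (tuples R {..<i})" "v i = lin R {..<i} x c"
      using lin_image[of "{..<i}" x] xc by blast
    have cc: "c \<in> {..<i} \<rightarrow> carrier R" using c(1) by auto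
    let ?u = "\<lambda>l\<in>?K. if l = i then lin R {..<i} x c else if l \<in> {..<i} then \<ominus> (c l \<otimes> x i) else \<zero>"
    have u: "?u \<in> koszul R ?K x"
      using i cc by (intro koszul_combination[OF xK]) auto
    then have us: "?u \<in> syz R ?K x" using koszul_le_syz[OF _ xK] by auto
    have uc: "?u \<in> carrier (tuples R ?K)" using us by (simp add: syz_def)
    let ?w = "v \<ominus>\<^bsub>tuples R ?K\<^esub> ?u"
    have "?w \<in> syz R ?K x" using Suc.prems(2) us submodsD(7)[OF syz_submod[OF _ xK]] by auto
    moreover have "?w l = \<zero>" if "i \<le> l" "l < e" for l
      using that Suc.prems(3)[of l] i c(2) vc[OF i(2)] unfolding tuples_diff[OF v(1) uc]
      by (cases "l = i") (auto simp: r_neg a_minus_def)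
    ultimately have w: "?w \<in> koszul R ?K x" using Suc.IH[of ?w] Suc.prems(1) by simp
    have eq: "v = ?w \<oplus>\<^bsub>tuples R ?K\<^esub> ?u"
      using v(1) uc by (simp add: h.G.minus_eq h.G.a_assoc h.G.l_neg del: tuples_simps)
    show ?case
      by (rule ssubst[OF eq, of "\<lambda>z. z \<in> koszul R ?K x"], rule submodsD(4)[OF koszul_submod[OF xK] w u])
  qed
  show ?thesis
  proof
    fix v assume "v \<in> syz R ?K x"
    then show "v \<in> koszul R ?K x" by (rule main[OF order_refl]) simp
  qed
qed

lemma lin_mem:
  assumes "ideal J R" "finite K" "x \<in> K \<rightarrow> carrier R" "v \<in> carrier (tuples R K)"
    and "\<And>i. i \<in> K \<Longrightarrow> v i \<otimes> x i \<in> J"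
  shows "lin R K x v \<in> J"
proof -
  interpret h: op_hom "tuples R K" "scals R K" R "mults R" "lin R K x"
    using assms by (intro lin_hom)
  have "v \<in> {v \<in> carrier (tuples R K). lin R K x v \<in> J}"
  proof (rule mem_if_singles_mem[OF h.vimage_submod assms(2,4)])
    show "J \<in> submods R (mults R)" using assms(1) by (simp add: ideal_iff_submod)
    fix i assume i: "i \<in> K"
    then have vi: "v i \<in> carrier R" using assms(4) by auto
    then show "single R K i (v i) \<in> {v \<in> carrier (tuples R K). lin R K x v \<in> J}"
      using single_closed[OF vi, of K i] lin_single[OF assms(2,3) i vi] assms(5)[OF i] by simp
  qed
  then show ?thesis by simp
qed

end

context ring_epi
begin

lemma kos_map:
  assumes "x \<in> K \<rightarrow> carrier R" "I \<subseteq> K" "i \<in> I" "j \<in> I"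
  shows "(\<lambda>l\<in>I. \<phi> (kos R K x i j l)) = kos W I (\<lambda>l. \<phi> (x l)) i j"
proof -
  have "x i \<in> carrier R" "x j \<in> carrier R" using assms by auto
  then show ?thesis
    using assms by (subst R.kos_eq W.kos_eq; auto)+ (auto simp: fun_eq_iff a_minus_def)
qed

lemma koszul_map:
  assumes "x \<in> K \<rightarrow> carrier R"
  shows "(\<lambda>v. \<lambda>l\<in>K. \<phi> (v l)) ` koszul R K x = koszul W K (\<lambda>l. \<phi> (x l))"
proof -
  interpret h: op_hom "tuples R K" "scals R K" "tuples W K" "scals W K" "\<lambda>v. \<lambda>l\<in>K. \<phi> (v l)"
    by (rule tuples_hom) simp
  have "(\<lambda>v. \<lambda>l\<in>K. \<phi> (v l)) ` {kos R K x i j | i j. i \<in> K \<and> j \<in> K} =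
      {kos W K (\<lambda>l. \<phi> (x l)) i j | i j. i \<in> K \<and> j \<in> K}"
    using kos_map[OF assms order_refl] by (auto simp: image_iff) metis+
  moreover have "{kos R K x i j | i j. i \<in> K \<and> j \<in> K} \<subseteq> carrier (tuples R K)"
    by (rule R.kos_set_closed[OF assms])
  ultimately show ?thesis unfolding koszul_def by (simp add: h.image_span)
qed

end

section \<open>Relations of a presentation and Koszul homology\<close>

lemma (in cring) lin_commute:
  assumes "x \<in> I \<rightarrow> carrier R" "v \<in> I \<rightarrow> carrier R"
  shows "lin R I x v = lin R I v x"
  unfolding lin_def using assms by (intro finsum_cong') (auto simp: m_comm Pi_def)

lemma (in cring) ideal_power_two:
  assumes "ideal I R" shows "ideal_power R I 2 = I \<cdot> I"
proof -
  interpret M: comm_monoid "ideals_set R" by (rule ideals_set_is_comm_monoid)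
  have "I \<in> carrier (ideals_set R)" using assms by (simp add: ideals_set_def)
  then show ?thesis
    unfolding ideal_power_def by (simp add: numeral_2_eq_2) (simp add: ideals_set_def)
qed

text \<open>A relation among the images of the generators, lifted to the source and evaluated at the
  generators, gives an element of the kernel. All elements of the kernel arise in this way, and
  those coming from Koszul relations are the ones that vanish modulo the product of the kernel
  with the maximal ideal.\<close>

lemma (in ring_epi) min_gens_kernel:
  assumes "local_ring R" and K: "finite K" "x \<in> K \<rightarrow> carrier R" "Idl (x ` K) = max_ideal R"
    and reg: "syz R K x \<subseteq> koszul R K x"
    and I: "I = {a \<in> carrier R. \<phi> a = \<zero>\<^bsub>W\<^esub>}" "I \<subseteq> max_ideal R"
  shows "finlen (submods (tuples W K) (scals W K)) (koszul W K (\<lambda>l. \<phi> (x l))) (syz W K (\<lambda>l. \<phi> (x l)))"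
    "min_gens R I = len (submods (tuples W K) (scals W K)) (koszul W K (\<lambda>l. \<phi> (x l))) (syz W K (\<lambda>l. \<phi> (x l)))"
proof -
  interpret local_ring R by fact
  interpret g: op_hom "tuples R K" "scals R K" R "mults R" "lin R K x"
    using K by (intro R.lin_hom)
  let ?pr = "\<lambda>v. \<lambda>l\<in>K. \<phi> (v l)"
  interpret pr: op_hom "tuples R K" "scals R K" "tuples W K" "scals W K" ?pr
    by (rule tuples_hom) simp
  interpret q: op_hom R "mults R" W "mults W" \<phi> by (rule mults_hom)
  let ?y = "\<lambda>l. \<phi> (x l)"
  have y: "?y \<in> K \<rightarrow> carrier W" using K(2) by auto
  have Ii: "ideal I R" using q.ker_submod I by (simp add: q.ker_def R.ideal_iff_submod)
  interpret Ii: ideal I R by (rule Ii)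
  let ?J = "\<mm> \<cdot> I"
  have J: "ideal ?J R" "?J \<subseteq> I" using prod_max_ideal[OF Ii] by auto
  interpret J: ideal ?J R by (rule J)
  let ?Z = "{v \<in> carrier (tuples R K). lin R K x v \<in> I}"
  let ?A = "{v \<in> carrier (tuples R K). lin R K x v \<in> ?J}"
  let ?G = "submods (tuples R K) (scals R K)"
  have Z: "?Z \<in> ?G" "?A \<in> ?G" "?A \<subseteq> ?Z"
    using g.vimage_submod[of I] g.vimage_submod[of ?J] Ii J by (auto simp: R.ideal_iff_submod)
  have img: "lin R K x ` carrier (tuples R K) = \<mm>"
    using R.lin_image[OF K(1,2)] K(3) by simp
  have imgsub: "lin R K x ` {v \<in> carrier (tuples R K). lin R K x v \<in> N} = N" if N: "N \<subseteq> \<mm>" for N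
  proof
    show "N \<subseteq> lin R K x ` {v \<in> carrier (tuples R K). lin R K x v \<in> N}"
    proof
      fix a assume a: "a \<in> N"
      then have "a \<in> lin R K x ` carrier (tuples R K)" unfolding img using N by (rule rev_subsetD)
      then obtain v where "v \<in> carrier (tuples R K)" "a = lin R K x v" by (rule imageE)
      then show "a \<in> lin R K x ` {v \<in> carrier (tuples R K). lin R K x v \<in> N}"
        using a by (intro image_eqI[of _ _ v]) simp_all
    qed
  qed blast
  have imgZ: "lin R K x ` ?Z = I" using imgsub[OF I(2)] .
  have imgA: "lin R K x ` ?A = ?J" using imgsub[OF subset_trans[OF J(2) I(2)]] .
  have "g.ker \<inter> ?Z \<subseteq> ?A" using J.zero_closed by (auto simp: g.ker_def)
  then have 1: "len ?G ?A ?Z = min_gens R I" "finlen ?G ?A ?Z"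
    using g.len_interval[OF Z(2,1,3)] min_gens_eq_len(1,2)[OF Ii] unfolding imgZ imgA by auto
  have Iv: "v \<in> ?A" if v: "v \<in> tuples_in R K K I" for v
  proof -
    have vc: "v \<in> carrier (tuples R K)" using v by (simp add: tuples_in_def)
    have "v i \<otimes> x i \<in> ?J" if i: "i \<in> K" for i
    proof -
      have "x i \<in> \<mm>" using K(3) i R.genideal_self[of "x ` K"] K(2) by auto
      moreover have vi: "v i \<in> I" using v i by (simp add: tuples_in_def)
      ultimately have "x i \<otimes> v i \<in> ?J" by (intro ideal_prod.prod)
      then show ?thesis using R.m_comm[OF Pi_mem[OF K(2) i] Ii.Icarr[OF vi]] by simp
    qed
    then show ?thesis using R.lin_mem[OF J(1) K(1,2) vc] vc by simp
  qed
  have zero: "?pr v = \<zero>\<^bsub>tuples W K\<^esub> \<longleftrightarrow> v \<in> tuples_in R K K I" if "v \<in> carrier (tuples R K)" for v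
  proof -
    have vK: "v l \<in> carrier R" if "l \<in> K" for l
      using \<open>v \<in> carrier (tuples R K)\<close> that by (simp add: PiE_iff)
    have "?pr v = \<zero>\<^bsub>tuples W K\<^esub> \<longleftrightarrow> (\<forall>l\<in>K. \<phi> (v l) = \<zero>\<^bsub>W\<^esub>)"
      by (simp add: fun_eq_iff restrict_def Ball_def)
    also have "\<dots> \<longleftrightarrow> (\<forall>l\<in>K. v l \<in> I)" unfolding I(1) using vK by blast
    also have "\<dots> \<longleftrightarrow> v \<in> tuples_in R K K I" using that by (simp add: tuples_in_def)
    finally show ?thesis .
  qed
  have "pr.ker \<inter> ?Z \<subseteq> ?A"
  proof
    fix v assume "v \<in> pr.ker \<inter> ?Z"
    then have v: "v \<in> carrier (tuples R K)" "?pr v = \<zero>\<^bsub>tuples W K\<^esub>" by (simp_all add: pr.ker_def)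
    show "v \<in> ?A" by (rule Iv[OF zero[OF v(1), THEN iffD1, OF v(2)]])
  qed
  moreover have "?pr ` ?Z = syz W K ?y"
  proof
    have map: "lin W K ?y (?pr v) = \<phi> (lin R K x v)" if v: "v \<in> carrier (tuples R K)" for v
    proof -
      have vK: "v \<in> K \<rightarrow> carrier R" using v by auto
      have "lin W K ?y (?pr v) = lin W K ?y (\<lambda>l. \<phi> (v l))"
        unfolding lin_def using vK K(2) by (intro W.finsum_cong') auto
      then show ?thesis using lin_map[OF K(2) vK] by simp
    qed
    show "?pr ` ?Z \<subseteq> syz W K ?y"
    proof (rule image_subsetI)
      fix v assume "v \<in> ?Z"
      then have v: "v \<in> carrier (tuples R K)" "lin R K x v \<in> I" by blast+
      have "\<phi> (lin R K x v) = \<zero>\<^bsub>W\<^esub>" using v(2) unfolding I(1) by blast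
      then have "lin W K ?y (?pr v) = \<zero>\<^bsub>W\<^esub>" unfolding map[OF v(1)] .
      then show "?pr v \<in> syz W K ?y" unfolding syz_def using pr.f_closed[OF v(1)] by blast
    qed
    show "syz W K ?y \<subseteq> ?pr ` ?Z"
    proof
      fix w assume w: "w \<in> syz W K ?y"
      have "\<exists>a. a \<in> carrier R \<and> \<phi> a = w i" if i: "i \<in> K" for i
      proof -
        have "w i \<in> \<phi> ` carrier R" using w i surj by (auto simp: syz_def)
        then show ?thesis by auto
      qed
      then obtain s where s: "\<And>i. i \<in> K \<Longrightarrow> s i \<in> carrier R \<and> \<phi> (s i) = w i" by metis
      let ?v = "\<lambda>i\<in>K. s i"
      have v: "?v \<in> carrier (tuples R K)" using s by auto
      have pv: "?pr ?v = w" using s w by (auto simp: syz_def fun_eq_iff PiE_def extensional_def)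
      have "lin W K ?y w = \<zero>\<^bsub>W\<^esub>" using w unfolding syz_def by blast
      then have "\<phi> (lin R K x ?v) = \<zero>\<^bsub>W\<^esub>" using map[OF v] unfolding pv by argo
      then have "lin R K x ?v \<in> I" unfolding I(1) using g.f_closed[OF v] by blast
      then have vZ: "?v \<in> ?Z" using v by blast
      show "w \<in> ?pr ` ?Z"
        unfolding pv[symmetric] by (rule imageI[OF vZ, of ?pr])
    qed
  qed
  moreover have "?pr ` ?A = koszul W K ?y"
  proof
    have kA: "koszul R K x \<subseteq> ?A"
      using R.koszul_le_syz[OF K(1,2)] J.zero_closed by (auto simp: syz_def)
    then show "koszul W K ?y \<subseteq> ?pr ` ?A"
      unfolding koszul_map[OF K(2), symmetric] by (rule image_mono)
    have prod: "\<exists>w \<in> tuples_in R K K I. lin R K x w = a" if "a \<in> ?J" for a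
      using that
    proof (induction rule: ideal_prod.induct)
      case (prod a b)
      then obtain c where c: "c \<in> carrier (tuples R K)" "a = lin R K x c" using img by auto
      have ab: "a \<in> carrier R" "b \<in> carrier R" using prod max_ideal_closed by auto
      have "lin R K x (\<lambda>i\<in>K. b \<otimes> c i) = b \<otimes> a"
        using R.lin_scal[OF K(1,2), of c b] c ab by auto
      moreover have "(\<lambda>i\<in>K. b \<otimes> c i) \<in> tuples_in R K K I"
        using c ab prod(2) Ii.I_r_closed by (auto simp: tuples_in_def)
      moreover have "b \<otimes> a = a \<otimes> b" using ab by (rule R.m_comm[rotated])
      ultimately show ?case by metis
    next
      case (sum a b)
      then obtain v w where vw: "v \<in> tuples_in R K K I" "lin R K x v = a" "w \<in> tuples_in R K K I" "lin R K x w = b"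
        by auto
      have vwc: "v \<in> carrier (tuples R K)" "w \<in> carrier (tuples R K)" using vw by (auto simp: tuples_in_def)
      have "v \<oplus>\<^bsub>tuples R K\<^esub> w \<in> tuples_in R K K I"
        using vw by (intro submodsD(4)[OF R.tuples_in_submod[OF Ii]])
      moreover have "lin R K x (v \<oplus>\<^bsub>tuples R K\<^esub> w) = a \<oplus> b" using g.f_add[OF vwc] vw(2,4) by argo
      ultimately show ?case by blast
    qed
    show "?pr ` ?A \<subseteq> koszul W K ?y"
    proof clarify
      fix v assume v: "v \<in> carrier (tuples R K)" "lin R K x v \<in> ?J"
      obtain w where w: "w \<in> tuples_in R K K I" "lin R K x w = lin R K x v" using prod[OF v(2)] by blast
      have wc: "w \<in> carrier (tuples R K)" using w by (simp add: tuples_in_def)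
      let ?d = "v \<ominus>\<^bsub>tuples R K\<^esub> w"
      have dc: "?d \<in> carrier (tuples R K)" using v wc by (simp del: tuples_simps)
      have "lin R K x ?d = \<zero>"
        using g.f_diff[OF v(1) wc] w g.f_closed[OF v(1)] by (simp add: R.r_neg a_minus_def)
      then have "?d \<in> koszul R K x" using reg dc unfolding syz_def by blast
      then have "?pr ?d \<in> koszul W K ?y" unfolding koszul_map[OF K(2), symmetric] by (rule imageI)
      moreover have "?pr ?d = ?pr v"
      proof -
        have "?pr ?d = ?pr v \<ominus>\<^bsub>tuples W K\<^esub> ?pr w" by (rule pr.f_diff[OF v(1) wc])
        also have "?pr w = \<zero>\<^bsub>tuples W K\<^esub>" using zero[OF wc] w(1) by simp
        also have "?pr v \<ominus>\<^bsub>tuples W K\<^esub> \<zero>\<^bsub>tuples W K\<^esub> = ?pr v"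
          using pr.H.minus_equality[OF pr.H.r_zero[OF pr.H.zero_closed]] pr.H.zero_closed
          by (simp only: a_minus_def pr.H.r_zero[OF pr.f_closed[OF v(1)]])
        finally show ?thesis .
      qed
      ultimately show "?pr v \<in> koszul W K ?y" by simp
    qed
  qed
  ultimately show "finlen (submods (tuples W K) (scals W K)) (koszul W K ?y) (syz W K ?y)"
    "min_gens R I = len (submods (tuples W K) (scals W K)) (koszul W K ?y) (syz W K ?y)"
    using pr.len_interval[OF Z(2,1,3)] 1 by auto
qed

lemma koszul_cong: "(\<And>i. i \<in> K \<Longrightarrow> x i = y i) \<Longrightarrow> koszul R K x = koszul R K y"
  unfolding koszul_def kos_def by (intro arg_cong[of _ _ "span (tuples R K) (scals R K)"]) (auto, metis+)

lemma (in cring) syz_cong: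
  assumes "\<And>i. i \<in> K \<Longrightarrow> x i = y i" "y \<in> K \<rightarrow> carrier R"
  shows "syz R K x = syz R K y"
proof -
  have "lin R K x v = lin R K y v" if "v \<in> carrier (tuples R K)" for v
    unfolding lin_def using assms that by (intro finsum_cong') (auto simp: PiE_def Pi_def)
  then show ?thesis by (auto simp: syz_def simp del: tuples_simps)
qed

lemma ring_epi_of_iso:
  assumes "cring R" "cring W" "ideal I R" "R Quot I \<simeq> W"
  obtains \<phi> where "ring_epi R W \<phi>" "I = {a \<in> carrier R. \<phi> a = \<zero>\<^bsub>W\<^esub>}"
proof -
  interpret R: cring R by fact
  interpret W: cring W by fact
  interpret I: ideal I R by fact
  obtain f where f: "f \<in> ring_iso (R Quot I) W" using assms(4) by (auto simp: is_ring_iso_def)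
  interpret Q: ring "R Quot I" by (rule I.quotient_is_ring)
  have fh: "f \<in> ring_hom (R Quot I) W" "bij_betw f (carrier (R Quot I)) (carrier W)"
    using f by (auto simp: ring_iso_def)
  interpret f: ring_hom_ring "R Quot I" W f
    using fh by unfold_locales auto
  let ?\<phi> = "f \<circ> (+>\<^bsub>R\<^esub>) I"
  have carr: "carrier (R Quot I) = (+>\<^bsub>R\<^esub>) I ` carrier R"
    by (auto simp: FactRing_def A_RCOSETS_def')
  have "ring_epi R W ?\<phi>"
  proof (intro ring_epi.intro ring_epi_axioms.intro assms)
    show "?\<phi> \<in> ring_hom R W" using ring_hom_trans[OF I.rcos_ring_hom fh(1)] .
    show "?\<phi> ` carrier R = carrier W" using fh(2) unfolding image_comp[symmetric] carr[symmetric] by (auto simp: bij_betw_def)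
  qed
  moreover have "?\<phi> a = \<zero>\<^bsub>W\<^esub> \<longleftrightarrow> a \<in> I" if a: "a \<in> carrier R" for a
  proof -
    have "?\<phi> a = \<zero>\<^bsub>W\<^esub> \<longleftrightarrow> f (I +>\<^bsub>R\<^esub> a) = f \<zero>\<^bsub>R Quot I\<^esub>" by simp
    also have "\<dots> \<longleftrightarrow> I +>\<^bsub>R\<^esub> a = \<zero>\<^bsub>R Quot I\<^esub>"
      using a carr by (intro inj_on_eq_iff[OF bij_betw_imp_inj_on[OF fh(2)]] Q.zero_closed) auto
    also have "\<dots> \<longleftrightarrow> a \<in> I"
      using a I.rcos_const_imp_mem R.a_rcos_zero[OF I.is_ideal] by (auto simp: FactRing_def)
    finally show ?thesis .
  qed
  ultimately show ?thesis using that[of ?\<phi>] I.a_subset by auto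
qed

lemma (in ring_epi) map_max_ideal:
  assumes "local_ring R" "local_ring W" and ker: "\<And>a. \<lbrakk>a \<in> carrier R; \<phi> a = \<zero>\<^bsub>W\<^esub>\<rbrakk> \<Longrightarrow> a \<in> max_ideal R"
    and a: "a \<in> carrier R"
  shows "\<phi> a \<in> max_ideal W \<longleftrightarrow> a \<in> max_ideal R"
proof
  interpret lR: local_ring R by fact
  interpret lW: local_ring W by fact
  show "a \<in> max_ideal R" if "\<phi> a \<in> max_ideal W"
  proof (rule ccontr)
    assume "a \<notin> max_ideal R"
    then have u: "a \<in> Units R" using a lR.Units_iff by simp
    then obtain b where b: "b \<in> carrier R" "a \<otimes> b = \<one>" by (auto simp: Units_def)
    then have "\<phi> a \<otimes>\<^bsub>W\<^esub> \<phi> b = \<one>\<^bsub>W\<^esub>" using a hom.hom_mult[of a b] hom.hom_one by simp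
    moreover have "\<phi> a \<otimes>\<^bsub>W\<^esub> \<phi> b \<in> max_ideal W"
      using that ideal.I_r_closed[OF lW.ideal_max_ideal] b by auto
    ultimately show False using lW.one_notin_max_ideal by simp
  qed
  show "\<phi> a \<in> max_ideal W" if am: "a \<in> max_ideal R"
  proof (rule ccontr)
    assume "\<phi> a \<notin> max_ideal W"
    then have "\<phi> a \<in> Units W" using a lW.Units_iff by simp
    then obtain c where c: "c \<in> carrier W" "\<phi> a \<otimes>\<^bsub>W\<^esub> c = \<one>\<^bsub>W\<^esub>" by (auto simp: Units_def)
    then obtain b where b: "b \<in> carrier R" "c = \<phi> b" using surj by auto
    have "\<phi> (\<one> \<ominus> a \<otimes> b) = \<zero>\<^bsub>W\<^esub>"
      using a b c by (simp add: a_minus_def W.r_neg)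
    then have "\<one> \<ominus> a \<otimes> b \<in> max_ideal R" using ker a b by simp
    moreover have ab: "a \<otimes> b \<in> max_ideal R" using am b ideal.I_r_closed[OF lR.ideal_max_ideal] by auto
    ultimately have "(\<one> \<ominus> a \<otimes> b) \<oplus> a \<otimes> b \<in> max_ideal R"
      using ideal.axioms(1)[OF lR.ideal_max_ideal] additive_subgroup.a_closed by fastforce
    moreover have "(\<one> \<ominus> a \<otimes> b) \<oplus> a \<otimes> b = \<one>"
      using a b by (simp add: a_minus_def R.a_assoc R.l_neg)
    ultimately show False using lR.one_notin_max_ideal by simp
  qed
qed

lemma (in local_ring) min_gens_le_card:
  assumes "finite A" "A \<subseteq> carrier R" "Idl A = I"
  shows "min_gens R I \<le> card A"
  unfolding min_gens_def using assms by (intro Least_le) auto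

text \<open>The length on the right depends on \<open>T\<close> alone: it is the length of the first Koszul homology
  of minimal generators of the maximal ideal. The lifted generators generate the maximal ideal of
  the regular ring, so that their syzygies are Koszul relations.\<close>

theorem cohen_presentation_min_gens:
  fixes x :: "nat \<Rightarrow> 'a" and T :: "('a, 'm) ring_scheme" and T' :: "('b, 'n) ring_scheme"
  assumes T: "local_ring T" and pres: "cohen_presentation T T' I"
    and x: "x \<in> UNIV \<rightarrow> carrier T" "Idl\<^bsub>T\<^esub> (x ` {..<edim T}) = max_ideal T"
  shows "finlen (submods (tuples T {..<edim T}) (scals T {..<edim T})) (koszul T {..<edim T} x) (syz T {..<edim T} x)"
    "min_gens T' I = len (submods (tuples T {..<edim T}) (scals T {..<edim T}))
      (koszul T {..<edim T} x) (syz T {..<edim T} x)"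
proof -
  interpret T: local_ring T by fact
  interpret T': regular_local_ring T' using pres by (simp add: cohen_presentation_def)
  have I: "ideal I T'" "I \<subseteq> T'.\<mm> \<cdot>\<^bsub>T'\<^esub> T'.\<mm>" "T' Quot I \<simeq> T"
    using pres T'.ideal_power_two[OF T'.ideal_max_ideal] by (auto simp: cohen_presentation_def)
  have I1: "I \<subseteq> T'.\<mm>" using I(2) T'.prod_max_ideal(2)[OF T'.ideal_max_ideal] by simp
  obtain \<phi> where \<phi>: "ring_epi T' T \<phi>" "I = {a \<in> carrier T'. \<phi> a = \<zero>\<^bsub>T\<^esub>}"
    using ring_epi_of_iso[OF T'.cring_axioms T.cring_axioms I(1,3)] by blast
  interpret ring_epi T' T \<phi> by fact
  interpret lin: op_hom T' "mults T'" T "mults T" \<phi> by (rule mults_hom)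
  let ?e = "edim T" and ?K = "{..<edim T}"
  have max: "\<phi> a \<in> T.\<mm> \<longleftrightarrow> a \<in> T'.\<mm>" if "a \<in> carrier T'" for a
    using map_max_ideal[OF T'.local_ring_axioms T, of a] \<phi>(2) I1 that by blast
  have "\<exists>a\<in>carrier T'. \<phi> a = x i" for i using x(1) surj by (metis PiE UNIV_I imageE)
  then obtain u where u: "\<And>i. u i \<in> carrier T'" "\<And>i. \<phi> (u i) = x i" by metis
  have uc: "u \<in> UNIV \<rightarrow> carrier T'" "u \<in> ?K \<rightarrow> carrier T'" "u ` ?K \<subseteq> carrier T'" using u by auto
  have gen: "Idl\<^bsub>T'\<^esub> (u ` ?K) = T'.\<mm>"
  proof
    have J: "ideal (Idl\<^bsub>T'\<^esub> (u ` ?K)) T'" "u ` ?K \<subseteq> Idl\<^bsub>T'\<^esub> (u ` ?K)"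
      using T'.genideal_ideal[OF uc(3)] T'.genideal_self[OF uc(3)] by auto
    have "x ` ?K \<subseteq> carrier T" using x(1) by auto
    then have "x i \<in> T.\<mm>" if "i < ?e" for i using x(2) T.genideal_self[of "x ` ?K"] that by auto
    then have "u i \<in> T'.\<mm>" if "i < ?e" for i using max[OF u(1)[of i]] u(2)[of i] that by simp
    then have "u ` ?K \<subseteq> T'.\<mm>" by auto
    then show "Idl\<^bsub>T'\<^esub> (u ` ?K) \<subseteq> T'.\<mm>" by (intro T'.genideal_minimal T'.ideal_max_ideal)
    have "T'.\<mm> \<subseteq> set_add T' (Idl\<^bsub>T'\<^esub> (u ` ?K)) (T'.\<mm> \<cdot>\<^bsub>T'\<^esub> T'.\<mm>)"
    proof
      fix a assume a: "a \<in> T'.\<mm>"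
      then have ac: "a \<in> carrier T'" by (rule T'.max_ideal_closed)
      have "\<phi> a \<in> Idl\<^bsub>T\<^esub> (x ` ?K)" using max[OF ac] a x(2) by simp
      also have "x ` ?K = (\<lambda>i. \<phi> (u i)) ` ?K" using u by auto
      finally obtain c where c: "c \<in> carrier (tuples T ?K)" "\<phi> a = lin T ?K (\<lambda>i. \<phi> (u i)) c"
        using T.lin_image[of ?K "\<lambda>i. \<phi> (u i)"] x(1) u(2) by (auto simp del: tuples_simps)
      have "\<exists>b\<in>carrier T'. \<phi> b = c i" if "i \<in> ?K" for i
        using c(1) surj that by (metis PiE_mem imageE tuples_simps(1))
      then obtain C where C: "\<And>i. i \<in> ?K \<Longrightarrow> C i \<in> carrier T' \<and> \<phi> (C i) = c i" by metis
      let ?C = "restrict C ?K"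
      have Cc: "?C \<in> carrier (tuples T' ?K)" "?C \<in> ?K \<rightarrow> carrier T'" using C by auto
      have lc: "lin T' ?K u ?C \<in> Idl\<^bsub>T'\<^esub> (u ` ?K)"
        using T'.lin_image[of ?K u] uc(2) Cc(1) by (metis finite_lessThan imageI)
      then have lcc: "lin T' ?K u ?C \<in> carrier T'" using ideal.Icarr[OF J(1)] by simp
      have "\<phi> (lin T' ?K u ?C) = lin T ?K (\<lambda>i. \<phi> (u i)) (\<lambda>i. \<phi> (?C i))"
        by (rule lin_map[OF uc(2) Cc(2)])
      also have "\<dots> = lin T ?K (\<lambda>i. \<phi> (u i)) c"
        unfolding lin_def using C u c(1) x(1) by (intro T.finsum_cong') (auto simp: PiE_iff Pi_iff)
      finally have "\<phi> (a \<ominus>\<^bsub>T'\<^esub> lin T' ?K u ?C) = \<zero>\<^bsub>T\<^esub>"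
        using lin.f_diff[OF ac lcc] lin.f_closed[OF ac] c(2) by (simp add: T.r_neg a_minus_def)
      then have "a \<ominus>\<^bsub>T'\<^esub> lin T' ?K u ?C \<in> T'.\<mm> \<cdot>\<^bsub>T'\<^esub> T'.\<mm>"
        using \<phi>(2) I(2) ac lcc by auto
      moreover have "a = lin T' ?K u ?C \<oplus>\<^bsub>T'\<^esub> (a \<ominus>\<^bsub>T'\<^esub> lin T' ?K u ?C)"
        using ac lcc by (simp add: a_minus_def T'.a_lcomm T'.r_neg)
      ultimately show "a \<in> set_add T' (Idl\<^bsub>T'\<^esub> (u ` ?K)) (T'.\<mm> \<cdot>\<^bsub>T'\<^esub> T'.\<mm>)"
        using lc unfolding mem_set_add by blast
    qed
    then show "T'.\<mm> \<subseteq> Idl\<^bsub>T'\<^esub> (u ` ?K)"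
      by (rule T'.Nakayama[OF J(1) T'.ideal_max_ideal])
  qed
  have e: "edim T' = ?e"
  proof (rule antisym)
    have "edim T' \<le> card (u ` ?K)"
      unfolding edim_def[of T'] using T'.min_gens_le_card[OF _ uc(3) gen] by simp
    also have "\<dots> \<le> ?e" using card_image_le[of ?K u] by simp
    finally show "edim T' \<le> ?e" .
    obtain A where A: "A \<subseteq> carrier T'" "finite A" "card A = edim T'" "Idl\<^bsub>T'\<^esub> A = T'.\<mm>"
      using T'.min_gens_eq_len(3)[OF T'.ideal_max_ideal] by (auto simp: edim_def)
    have pA: "\<phi> ` A \<subseteq> carrier T" using A by auto
    have "Idl\<^bsub>T\<^esub> (\<phi> ` A) = T.\<mm>"
    proof
      show "Idl\<^bsub>T\<^esub> (\<phi> ` A) \<subseteq> T.\<mm>"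
        using A T'.genideal_self[OF A(1)] max by (intro T.genideal_minimal T.ideal_max_ideal) auto
      let ?N = "{a \<in> carrier T'. \<phi> a \<in> Idl\<^bsub>T\<^esub> (\<phi> ` A)}"
      have "ideal ?N T'"
        using lin.vimage_submod[of "Idl\<^bsub>T\<^esub> (\<phi> ` A)"] T.genideal_ideal[OF pA]
        by (simp add: T.ideal_iff_submod T'.ideal_iff_submod)
      then have "T'.\<mm> \<subseteq> ?N"
        unfolding A(4)[symmetric] using A(1) T.genideal_self[OF pA] by (intro T'.genideal_minimal) auto
      then show "T.\<mm> \<subseteq> Idl\<^bsub>T\<^esub> (\<phi> ` A)"
        using max surj T.max_ideal_closed by (smt (verit) imageE mem_Collect_eq subset_iff)
    qed
    then have "?e \<le> card (\<phi> ` A)"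
      unfolding edim_def[of T] using A pA by (intro T.min_gens_le_card) auto
    then show "?e \<le> edim T'" using card_image_le[OF A(2), of \<phi>] A(3) by simp
  qed
  obtain c where c: "prime_chain T' c ?e" "c ?e = T'.\<mm>" using T'.prime_chain_of_edim e by auto
  interpret c0: primeideal "c 0" T' using c(1) by (auto simp: prime_chain_def)
  have "Idl\<^bsub>T'\<^esub> (u ` {..<0}) \<subseteq> c 0" by (intro T'.genideal_minimal c0.is_ideal) auto
  then have "\<forall>l. 0 \<le> l \<and> l \<le> ?e \<longrightarrow> primeideal (Idl\<^bsub>T'\<^esub> (u ` {..<l})) T' \<and> (l < ?e \<longrightarrow> u l \<notin> Idl\<^bsub>T'\<^esub> (u ` {..<l}))"
    using T'.regular_sequence_if_prime_chain[OF uc(1) gen c] by simp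
  then have "syz T' ?K u \<subseteq> koszul T' ?K u"
    by (intro T'.syz_le_koszul_if_regular uc(1)) auto
  note * = min_gens_kernel[OF T'.local_ring_axioms _ uc(2) gen this \<phi>(2) I1]
  have "koszul T ?K (\<lambda>l. \<phi> (u l)) = koszul T ?K x" "syz T ?K (\<lambda>l. \<phi> (u l)) = syz T ?K x"
    by (simp_all add: u)
  then show "finlen (submods (tuples T ?K) (scals T ?K)) (koszul T ?K x) (syz T ?K x)"
    "min_gens T' I = len (submods (tuples T ?K) (scals T ?K)) (koszul T ?K x) (syz T ?K x)"
    using * by simp_all
qed


section \<open>Duality over Gorenstein Artin rings\<close>

lemma (in cring) multiples_hom:
  assumes "u \<in> carrier (tuples R K)"
  shows "op_hom R (mults R) (tuples R K) (scals R K) (\<lambda>b. \<lambda>l\<in>K. b \<otimes> u l)"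
proof (intro op_hom.intro op_hom_axioms.intro op_group_mults op_group_tuples)
  have [simp]: "u l \<in> carrier R" if "l \<in> K" for l using assms that by auto
  show "semilinear R (mults R) (tuples R K) (scals R K) (\<lambda>b. \<lambda>l\<in>K. b \<otimes> u l)"
    unfolding semilinear_def mults_def scals_def by (auto simp: fun_eq_iff l_distr m_assoc)
qed

context gorenstein_artin_local_ring
begin

lemma soc_ideal: "ideal (soc R) R"
  and soc_length: "fin R (mults R) (soc R)" "lg R (mults R) (soc R) = 1"
  and soc_nonzero: "soc R \<noteq> {\<zero>}"
proof -
  obtain d where d: "d \<in> carrier R" "d \<noteq> \<zero>" "soc R = Idl {d}" using simple_socle by auto
  have m: "t \<otimes> d \<in> {\<zero>}" if "t \<in> \<mm>" for t
    using that d genideal_self[of "{d}"] by (auto simp: soc_def)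
  have I: "ideal (Idl {d}) R" "d \<in> Idl {d}" using d genideal_ideal[of "{d}"] genideal_self[of "{d}"] by auto
  then show "ideal (soc R) R" "soc R \<noteq> {\<zero>}" using d by auto
  have "Idl ({\<zero>} \<union> {d}) = Idl {d}"
  proof
    show "Idl ({\<zero>} \<union> {d}) \<subseteq> Idl {d}"
      using I additive_subgroup.zero_closed[OF ideal.axioms(1)[OF I(1)]] by (intro genideal_minimal) auto
    show "Idl {d} \<subseteq> Idl ({\<zero>} \<union> {d})"
      using genideal_ideal[of "{\<zero>} \<union> {d}"] genideal_self[of "{\<zero>} \<union> {d}"] d(1)
      by (intro genideal_minimal) auto
  qed
  then have "covers (submods R (mults R)) {\<zero>} (soc R)"
    using covers_ideal_plus_principal[OF zeroideal d(1) m] I(2) d by auto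
  then have s: "series (submods R (mults R)) {\<zero>} (soc R) 1" by (rule series_covers)
  then show "fin R (mults R) (soc R)" "lg R (mults R) (soc R) = 1"
    using modular_family.series_len[OF modular_ideals s] by (auto simp: fin_def lg_def finlen_def)
qed

text \<open>The annihilator of a submodule of a free module under the standard pairing.\<close>

definition "dual K M = {f \<in> carrier (tuples R K). \<forall>v\<in>M. lin R K f v = \<zero>}"

lemma dual_submod:
  assumes "finite K" "M \<subseteq> carrier (tuples R K)"
  shows "dual K M \<in> submods (tuples R K) (scals R K)"
proof -
  interpret T: op_group "tuples R K" "scals R K" by (rule op_group_tuples)
  have ker: "{f \<in> carrier (tuples R K). lin R K f v = \<zero>} \<in> submods (tuples R K) (scals R K)" if "v \<in> M" for v
  proof -
    have v: "v \<in> K \<rightarrow> carrier R" using that assms by auto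
    have "lin R K f v = lin R K v f" if "f \<in> carrier (tuples R K)" for f
    proof -
      have "f \<in> K \<rightarrow> carrier R" using that by auto
      then show ?thesis using lin_commute[OF v, of f] by simp
    qed
    then have "{f \<in> carrier (tuples R K). lin R K f v = \<zero>} = syz R K v"
      unfolding syz_def by (auto simp del: tuples_simps)
    then show ?thesis using syz_submod[OF assms(1) v] by simp
  qed
  have "dual K M = carrier (tuples R K) \<inter> (\<Inter>v\<in>M. {f \<in> carrier (tuples R K). lin R K f v = \<zero>})"
    by (auto simp: dual_def)
  moreover have "M \<noteq> {} \<Longrightarrow> (\<Inter>v\<in>M. {f \<in> carrier (tuples R K). lin R K f v = \<zero>}) \<in> submods (tuples R K) (scals R K)"
    by (intro T.Inter_submod) (use ker in auto)
  ultimately show ?thesis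
    using T.carrier_submod T.inter_submod by (cases "M = {}") (auto simp del: tuples_simps)
qed

lemma fin_tuples: "finite K \<Longrightarrow> fin (tuples R K) (scals R K) (carrier (tuples R K))"
  by (rule tuples_length(1)[OF finite_length])

lemma fin_submod_tuples:
  assumes "finite K" "M \<in> submods (tuples R K) (scals R K)"
  shows "fin (tuples R K) (scals R K) M"
  using op_group.fin_sub(1)[OF op_group_tuples fin_tuples[OF assms(1)] assms(2)] submodsD(1)[OF assms(2)] by simp

text \<open>A functional that kills the smaller submodule sends the larger one into the socle, which
  has length one. So the annihilators of a covering pair differ by at most one step.\<close>

lemma dual_covers:
  assumes K: "finite K" and cov: "covers (submods (tuples R K) (scals R K)) M M'"
  shows "lg (tuples R K) (scals R K) (dual K M) \<le> lg (tuples R K) (scals R K) (dual K M') + 1"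
proof -
  let ?L = "submods (tuples R K) (scals R K)"
  interpret T: op_group "tuples R K" "scals R K" by (rule op_group_tuples)
  have M: "M \<in> ?L" "M' \<in> ?L" "M \<subset> M'" and max: "\<And>C. C \<in> ?L \<Longrightarrow> M \<subseteq> C \<Longrightarrow> C \<subseteq> M' \<Longrightarrow> C = M \<or> C = M'"
    using cov by (auto simp: covers_def)
  note Mc = submodsD(1)[OF M(1)] submodsD(1)[OF M(2)]
  obtain w where w: "w \<in> M'" "w \<notin> M" using M by auto
  have wc: "w \<in> carrier (tuples R K)" "w \<in> K \<rightarrow> carrier R" using w Mc by auto
  interpret e: op_hom "tuples R K" "scals R K" R "mults R" "lin R K w"
    using K wc by (intro lin_hom)
  have span: "span (tuples R K) (scals R K) (insert u M) = M'" if u: "u \<in> M'" "u \<notin> M" for u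
  proof -
    have "insert u M \<subseteq> carrier (tuples R K)" using u Mc by auto
    then have 1: "span (tuples R K) (scals R K) (insert u M) \<in> ?L" by (rule T.span_submod)
    have 2: "insert u M \<subseteq> span (tuples R K) (scals R K) (insert u M)" by (rule T.span_superset)
    have 3: "span (tuples R K) (scals R K) (insert u M) \<subseteq> M'"
      by (rule T.span_least[OF M(2)]) (use u M in auto)
    show ?thesis using max[OF 1 _ 3] 2 u by auto
  qed
  have tw: "(\<lambda>l\<in>K. t \<otimes> w l) \<in> M" if t: "t \<in> \<mm>" for t
  proof (rule ccontr)
    assume no: "(\<lambda>l\<in>K. t \<otimes> w l) \<notin> M"
    have tc: "t \<in> carrier R" using t max_ideal_closed by auto
    have tM': "(\<lambda>l\<in>K. t \<otimes> w l) \<in> M'" by (rule scal_submod[OF M(2) tc w(1)])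
    let ?tw = "\<lambda>l\<in>K. t \<otimes> w l"
    interpret c: op_hom R "mults R" "tuples R K" "scals R K" "\<lambda>b. \<lambda>l\<in>K. b \<otimes> ?tw l"
      by (rule multiples_hom[OF subsetD[OF Mc(2) tM']])
    let ?D = "(\<lambda>b. \<lambda>l\<in>K. b \<otimes> ?tw l) ` carrier R"
    have D: "?D \<in> ?L" by (rule c.image_submod[OF op_group.carrier_submod[OF op_group_mults]])
    have DM: "?D \<subseteq> M'" using scal_submod[OF M(2) _ tM'] by auto
    have one: "?tw \<in> ?D"
      using wc(1) tc by (intro image_eqI[of _ _ \<one>]) (auto simp: fun_eq_iff PiE_iff)
    have "set_add (tuples R K) M ?D = M'"
      using max[OF T.sum_submod[OF M(1) D]] T.join_upper1[OF M(1) D] T.join_upper2[OF M(1) D]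
        T.join_least[OF M(1) D M(2) _ DM] M(3) one no by auto
    then obtain m b where mb: "m \<in> M" "b \<in> carrier R" "w = m \<oplus>\<^bsub>tuples R K\<^esub> (\<lambda>l\<in>K. b \<otimes> ?tw l)"
      using w(1) unfolding mem_set_add[symmetric] by (auto simp: mem_set_add)
    have bt: "b \<otimes> t \<in> \<mm>" using ideal.I_l_closed[OF ideal_max_ideal t mb(2)] .
    have u: "\<one> \<ominus> b \<otimes> t \<in> Units R" by (rule one_minus_Units[OF bt])
    have ml: "(\<one> \<ominus> b \<otimes> t) \<otimes> w l = m l" if l: "l \<in> K" for l
    proof -
      have c: "w l \<in> carrier R" "m l \<in> carrier R" using l wc(1) mb(1) Mc(1) by (auto simp: PiE_iff)
      have "w l = m l \<oplus> b \<otimes> (t \<otimes> w l)" using fun_cong[OF mb(3), of l] l by simp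
      then have "m l = w l \<ominus> b \<otimes> (t \<otimes> w l)"
        using c mb(2) tc by (metis add.inv_solve_right' a_minus_def m_closed)
      then show ?thesis using c mb(2) tc by (simp add: l_distr a_minus_def l_minus m_assoc)
    qed
    have "(\<lambda>l\<in>K. inv (\<one> \<ominus> b \<otimes> t) \<otimes> m l) \<in> M"
      by (rule scal_submod[OF M(1) _ mb(1)]) (use u in auto)
    moreover have "(\<lambda>l\<in>K. inv (\<one> \<ominus> b \<otimes> t) \<otimes> m l) = w"
    proof (rule ext)
      fix l show "(\<lambda>l\<in>K. inv (\<one> \<ominus> b \<otimes> t) \<otimes> m l) l = w l"
      proof (cases "l \<in> K")
        case True
        then have "w l \<in> carrier R" using wc by auto
        then have "inv (\<one> \<ominus> b \<otimes> t) \<otimes> ((\<one> \<ominus> b \<otimes> t) \<otimes> w l) = w l"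
          using u Units_inv_closed[OF u] Units_closed[OF u] by (simp add: m_assoc[symmetric])
        then show ?thesis using True ml by simp
      next
        case False
        then show ?thesis using wc by (auto simp: PiE_def extensional_def)
      qed
    qed
    ultimately show False using w by simp
  qed
  have dM: "dual K M \<in> ?L" "dual K M' \<in> ?L" using dual_submod[OF K] Mc by auto
  have finM: "fin (tuples R K) (scals R K) (dual K M)" by (rule fin_submod_tuples[OF K dM(1)])
  have lw: "lin R K f w = lin R K w f" if "f \<in> carrier (tuples R K)" for f
  proof -
    have "f \<in> K \<rightarrow> carrier R" using that by auto
    then show ?thesis using lin_commute[OF wc(2), of f] by simp
  qed
  have "dual K M \<inter> e.ker \<subseteq> dual K M'"
  proof
    fix f assume f: "f \<in> dual K M \<inter> e.ker"
    then have fc: "f \<in> carrier (tuples R K)" "f \<in> K \<rightarrow> carrier R" by (auto simp: dual_def)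
    have "insert w M \<subseteq> syz R K f"
      using f lw[OF fc(1)] wc(1) Mc by (auto simp: syz_def dual_def e.ker_def simp del: tuples_simps)
    then have "M' \<subseteq> syz R K f"
      unfolding span[OF w, symmetric] by (rule T.span_least[OF syz_submod[OF K fc(2)]])
    then show "f \<in> dual K M'" using fc(1) by (auto simp: dual_def syz_def)
  qed
  moreover have "dual K M \<inter> e.ker \<in> ?L" by (rule T.inter_submod[OF dM(1) e.ker_submod])
  ultimately have 1: "lg (tuples R K) (scals R K) (dual K M \<inter> e.ker) \<le> lg (tuples R K) (scals R K) (dual K M')"
    by (intro T.lg_mono[OF fin_submod_tuples[OF K dM(2)]])
  have "lin R K w ` dual K M \<subseteq> soc R"
  proof clarify
    fix f assume f: "f \<in> dual K M"
    then have fc: "f \<in> carrier (tuples R K)" "f \<in> K \<rightarrow> carrier R" by (auto simp: dual_def)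
    have "t \<otimes> lin R K w f = \<zero>" if t: "t \<in> \<mm>" for t
    proof -
      have tc: "t \<in> carrier R" using t max_ideal_closed by auto
      have "\<zero> = lin R K f (\<lambda>l\<in>K. t \<otimes> w l)" using f tw[OF t] by (simp add: dual_def)
      also have "\<dots> = t \<otimes> lin R K f w" by (rule lin_scal[OF K fc(2) wc(2) tc])
      finally show ?thesis using lw[OF fc(1)] by simp
    qed
    then show "lin R K w f \<in> soc R" using e.f_closed[OF fc(1)] by (simp add: soc_def)
  qed
  moreover have "lin R K w ` dual K M \<in> submods R (mults R)" by (rule e.image_submod[OF dM(1)])
  ultimately have "lg R (mults R) (lin R K w ` dual K M) \<le> 1"
    using op_group.lg_mono[OF op_group_mults soc_length(1)] soc_length(2) by metis
  then show ?thesis using 1 e.rank_nullity(4)[OF dM(1)] finM by linarith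
qed

lemma dual_series:
  assumes K: "finite K" and "series (submods (tuples R K) (scals R K)) M M' n"
  shows "lg (tuples R K) (scals R K) (dual K M) \<le> lg (tuples R K) (scals R K) (dual K M') + n"
  using assms(2)
proof (induction rule: series.induct)
  case (step A B n C)
  then show ?case using dual_covers[OF K step.hyps(2)] by linarith
qed simp

text \<open>Counting along a composition series from above and from below forces equality, so
  \<^term>\<open>dual\<close> is strictly decreasing: this is the self-injectivity of the ring.\<close>

lemma exists_separating_functional:
  assumes K: "finite K" and M: "M \<in> submods (tuples R K) (scals R K)"
    and w: "w \<in> carrier (tuples R K)" "w \<notin> M"
  obtains f where "f \<in> dual K M" "lin R K f w \<noteq> \<zero>"
proof (rule ccontr)
  assume "\<not> thesis"
  then have none: "\<And>f. f \<in> dual K M \<Longrightarrow> lin R K f w = \<zero>" using that by blast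
  let ?L = "submods (tuples R K) (scals R K)" and ?lg = "lg (tuples R K) (scals R K)"
    and ?F = "carrier (tuples R K)"
  interpret T: op_group "tuples R K" "scals R K" by (rule op_group_tuples)
  have dual_lg: "?lg (dual K N) + ?lg N = ?lg ?F" if N: "N \<in> ?L" for N
  proof -
    have "fin (tuples R K) (scals R K) N" by (rule fin_submod_tuples[OF K N])
    then obtain i where i: "series ?L {\<zero>\<^bsub>tuples R K\<^esub>} N i" by (auto simp: fin_def finlen_def)
    have "finlen ?L N ?F" using T.fin_sub(2)[OF fin_tuples[OF K] N submodsD(1)[OF N]] .
    then obtain j where j: "series ?L N ?F j" by (auto simp: finlen_def)
    have len: "i = ?lg N" "j = len ?L N ?F" using T.series_len[OF i] T.series_len[OF j] by (auto simp: lg_def)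
    have sum: "?lg ?F = ?lg N + j" using T.fin_sub(3)[OF fin_tuples[OF K] N submodsD(1)[OF N]] len by simp
    have d0: "dual K {\<zero>\<^bsub>tuples R K\<^esub>} = ?F"
    proof -
      have "lin R K f \<zero>\<^bsub>tuples R K\<^esub> = \<zero>" if f: "f \<in> ?F" for f
      proof -
        interpret e: op_hom "tuples R K" "scals R K" R "mults R" "lin R K f"
          using K f by (intro lin_hom) auto
        show ?thesis by (rule e.f_zero)
      qed
      then show ?thesis by (auto simp: dual_def simp del: tuples_simps)
    qed
    have "dual K ?F = {\<zero>\<^bsub>tuples R K\<^esub>}"
    proof
      show "dual K ?F \<subseteq> {\<zero>\<^bsub>tuples R K\<^esub>}"
      proof
        fix f assume f: "f \<in> dual K ?F"
        then have fc: "f \<in> ?F" by (simp add: dual_def)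
        have "f l = \<zero>" if l: "l \<in> K" for l
        proof -
          have "\<zero> = lin R K f (single R K l \<one>)" using f single_closed[OF one_closed, of K l] by (simp add: dual_def del: tuples_simps)
          also have "\<dots> = \<one> \<otimes> f l" by (rule lin_single[OF K _ l one_closed]) (use fc in auto)
          also have "\<dots> = f l" using fc l by (auto simp: PiE_iff)
          finally show ?thesis by simp
        qed
        then show "f \<in> {\<zero>\<^bsub>tuples R K\<^esub>}" using fc by (auto simp: fun_eq_iff PiE_def extensional_def)
      qed
      show "{\<zero>\<^bsub>tuples R K\<^esub>} \<subseteq> dual K ?F"
        using submodsD(2)[OF dual_submod[OF K, of ?F]] by auto
    qed
    then have "?lg (dual K ?F) = 0" using T.fin_zero(2) by simp
    then show ?thesis using dual_series[OF K i] dual_series[OF K j] d0 len sum by simp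
  qed
  let ?M' = "span (tuples R K) (scals R K) (insert w M)"
  have sub: "insert w M \<subseteq> ?F" using w submodsD(1)[OF M] by auto
  have M': "?M' \<in> ?L" "insert w M \<subseteq> ?M'" using T.span_submod[OF sub] T.span_superset by auto
  have "dual K M \<subseteq> dual K ?M'"
  proof
    fix f assume f: "f \<in> dual K M"
    then have fc: "f \<in> ?F" "f \<in> K \<rightarrow> carrier R" by (auto simp: dual_def)
    have "insert w M \<subseteq> syz R K f"
      using f none[OF f] sub by (auto simp: syz_def dual_def simp del: tuples_simps)
    then have "?M' \<subseteq> syz R K f" by (rule T.span_least[OF syz_submod[OF K fc(2)]])
    then show "f \<in> dual K ?M'" using fc(1) by (auto simp: dual_def syz_def)
  qed
  then have "?lg (dual K M) \<le> ?lg (dual K ?M')"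
    using dual_submod[OF K] submodsD(1)[OF M] submodsD(1)[OF M'(1)]
    by (intro T.lg_mono fin_submod_tuples[OF K]) auto
  then have "?lg ?M' \<le> ?lg M" using dual_lg[OF M] dual_lg[OF M'(1)] by linarith
  moreover have "?lg M \<le> ?lg ?M'" using M' by (intro T.lg_mono fin_submod_tuples[OF K] M) auto
  ultimately have "M = ?M'" using M' M by (intro T.lg_eq_imp_eq fin_submod_tuples[OF K]) auto
  then show False using M' w by auto
qed

text \<open>Otherwise some functional kills the Koszul relations but not this vector. One of its
  coefficients then does not kill the socle, so it is a unit, and the Koszul relations make every
  generator a multiple of a single one, against minimality.\<close>

lemma soc_single_koszul:
  assumes K: "finite K" "x \<in> K \<rightarrow> carrier R" "Idl (x ` K) = \<mm>" and e: "edim R \<ge> 2"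
    and i: "i \<in> K" and d: "d \<in> soc R"
  shows "single R K i d \<in> koszul R K x"
proof (rule ccontr)
  assume no: "single R K i d \<notin> koszul R K x"
  have dc: "d \<in> carrier R" using d by (simp add: soc_def)
  obtain f where f: "f \<in> dual K (koszul R K x)" "lin R K f (single R K i d) \<noteq> \<zero>"
    using exists_separating_functional[OF K(1) koszul_submod[OF K(2)] single_closed[OF dc] no] .
  have fc: "f \<in> carrier (tuples R K)" "f \<in> K \<rightarrow> carrier R" using f by (auto simp: dual_def)
  interpret h: op_hom "tuples R K" "scals R K" R "mults R" "lin R K f"
    using K fc by (intro lin_hom)
  have fi: "f i \<in> carrier R" "x i \<in> carrier R" using fc(2) i K by auto
  have "lin R K f (single R K i d) = d \<otimes> f i" by (rule lin_single[OF K(1) fc(2) i dc])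
  then have "f i \<otimes> d \<noteq> \<zero>" using f fi dc m_comm by simp
  then have "f i \<notin> \<mm>" using d by (auto simp: soc_def)
  then have u: "f i \<in> Units R" using Units_iff fi by simp
  have xl: "x l \<in> Idl {x i}" if l: "l \<in> K" for l
  proof -
    have lc: "f l \<in> carrier R" "x l \<in> carrier R" using fc(2) l K by auto
    have "\<zero> = lin R K f (kos R K x i l)"
      using f kos_koszul[OF i l, of x] by (simp add: dual_def cring_axioms)
    also have "\<dots> = x l \<otimes> f i \<ominus> x i \<otimes> f l"
      unfolding kos_def using h.f_diff[OF single_closed[OF lc(2)] single_closed[OF fi(2)]]
        lin_single[OF K(1) fc(2) i lc(2)] lin_single[OF K(1) fc(2) l fi(2)] by simp
    finally have z: "\<zero> = x l \<otimes> f i \<ominus> x i \<otimes> f l" .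
    have "x l \<otimes> f i = x i \<otimes> f l"
      by (rule minus_zero_eqI[OF z[symmetric]]) (use lc fi in simp_all)
    then have "inv (f i) \<otimes> (f i \<otimes> x l) = inv (f i) \<otimes> (x i \<otimes> f l)" using m_comm lc fi by simp
    then have "x l = (inv (f i) \<otimes> f l) \<otimes> x i"
      using u lc fi Units_inv_closed[OF u] by (simp add: m_assoc[symmetric]) (simp add: m_ac)
    then show ?thesis
      using u lc fi ideal.I_l_closed[OF genideal_ideal[of "{x i}"], of "x i"] genideal_self[of "{x i}"] by auto
  qed
  have "Idl {x i} = \<mm>"
  proof
    show "Idl {x i} \<subseteq> \<mm>"
      using genideal_self[of "x ` K"] K i by (intro genideal_minimal ideal_max_ideal) auto
    show "\<mm> \<subseteq> Idl {x i}"
      unfolding K(3)[symmetric] using xl fi by (intro genideal_minimal genideal_ideal) auto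
  qed
  then have "edim R \<le> card {x i}" unfolding edim_def using fi by (intro min_gens_le_card) auto
  then show False using e by simp
qed

end

section \<open>Fibre squares of local rings\<close>

context cring
begin

lemma lin_add_fun:
  assumes "x \<in> I \<rightarrow> carrier R" "v \<in> I \<rightarrow> carrier R" "w \<in> I \<rightarrow> carrier R"
  shows "lin R I x (\<lambda>i. v i \<oplus> w i) = lin R I x v \<oplus> lin R I x w"
proof -
  have "lin R I x (\<lambda>i. v i \<oplus> w i) = (\<Oplus>i\<in>I. v i \<otimes> x i \<oplus> w i \<otimes> x i)"
    unfolding lin_def using assms by (intro finsum_cong') (auto simp: l_distr Pi_def)
  also have "\<dots> = lin R I x v \<oplus> lin R I x w"
    unfolding lin_def using assms by (intro finsum_addf) auto
  finally show ?thesis .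
qed

lemma lin_scal_fun:
  assumes "finite I" "x \<in> I \<rightarrow> carrier R" "v \<in> I \<rightarrow> carrier R" "a \<in> carrier R"
  shows "lin R I x (\<lambda>i. a \<otimes> v i) = a \<otimes> lin R I x v"
proof -
  have "lin R I x (\<lambda>i. a \<otimes> v i) = (\<Oplus>i\<in>I. a \<otimes> (v i \<otimes> x i))"
    unfolding lin_def using assms by (intro finsum_cong') (auto simp: m_assoc Pi_def)
  also have "\<dots> = a \<otimes> lin R I x v"
    unfolding lin_def using assms by (intro finsum_rdistr[symmetric]) auto
  finally show ?thesis .
qed

lemma lin_delta_fun:
  assumes "finite I" "x \<in> I \<rightarrow> carrier R" "k \<in> I"
  shows "lin R I x (\<lambda>i. if i = k then \<one> else \<zero>) = x k"
proof -
  have "lin R I x (\<lambda>i. if i = k then \<one> else \<zero>) = (\<Oplus>i\<in>I. if k = i then x i else \<zero>)"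
    unfolding lin_def using assms by (intro finsum_cong') (auto simp: Pi_iff)
  also have "\<dots> = x k" using assms by (intro finsum_singleton) auto
  finally show ?thesis .
qed

lemma lin_zero_fun:
  assumes "x \<in> I \<rightarrow> carrier R"
  shows "lin R I x (\<lambda>i. \<zero>) = \<zero>"
proof -
  have "lin R I x (\<lambda>i. \<zero>) = (\<Oplus>i\<in>I. \<zero>)"
    unfolding lin_def using assms by (intro finsum_cong') (auto simp: Pi_iff)
  then show ?thesis by simp
qed

lemma lin_mem_fun:
  assumes "ideal J R" "finite K" "x \<in> K \<rightarrow> carrier R" "v \<in> K \<rightarrow> carrier R"
    and "\<And>i. i \<in> K \<Longrightarrow> v i \<otimes> x i \<in> J"
  shows "lin R K x v \<in> J"
proof -
  have "lin R K x v = lin R K x (restrict v K)"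
    unfolding lin_def using assms(3,4) by (intro finsum_cong') (auto simp: Pi_iff)
  moreover have "restrict v K \<in> carrier (tuples R K)" using assms(4) by simp
  ultimately show ?thesis using lin_mem[OF assms(1-3), of "restrict v K"] assms(5) by simp
qed

lemma single_hom: "op_hom R (mults R) (tuples R K) (scals R K) (single R K i)"
proof (intro op_hom.intro op_hom_axioms.intro op_group_mults op_group_tuples)
  show "semilinear R (mults R) (tuples R K) (scals R K) (single R K i)"
    unfolding semilinear_def mults_def scals_def single_def by (auto simp: fun_eq_iff)
qed

lemma kos_swap:
  assumes "x \<in> K \<rightarrow> carrier R" "i \<in> K" "j \<in> K"
  shows "kos R K x i j = \<ominus>\<^bsub>tuples R K\<^esub> kos R K x j i"
proof -
  have "x i \<in> carrier R" "x j \<in> carrier R" using assms by auto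
  then show ?thesis
    unfolding tuples_minus[OF kos_closed[OF assms(1,3,2)]]
    by (simp add: kos_eq fun_eq_iff a_minus_def minus_add a_comm)
qed

end

text \<open>Two local rings glued along their residue fields, presented through the two projections of
  the glued ring; the symmetric form halves the work below.\<close>

locale fibre_square = R: local_ring R + S: local_ring S + \<alpha>: ring_epi P R \<alpha> + \<beta>: ring_epi P S \<beta>
  for P (structure) and R and S and \<alpha> and \<beta> +
  assumes compat: "a \<in> carrier P \<Longrightarrow> \<alpha> a \<in> max_ideal R \<longleftrightarrow> \<beta> a \<in> max_ideal S"
    and jointly_injective: "\<lbrakk>a \<in> carrier P; \<alpha> a = \<zero>\<^bsub>R\<^esub>; \<beta> a = \<zero>\<^bsub>S\<^esub>\<rbrakk> \<Longrightarrow> a = \<zero>"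
    and left_lift: "r \<in> max_ideal R \<Longrightarrow> \<exists>a\<in>carrier P. \<alpha> a = r \<and> \<beta> a = \<zero>\<^bsub>S\<^esub>"
    and right_lift: "s \<in> max_ideal S \<Longrightarrow> \<exists>a\<in>carrier P. \<alpha> a = \<zero>\<^bsub>R\<^esub> \<and> \<beta> a = s"
begin

lemma swap: "fibre_square P S R \<beta> \<alpha>"
  by unfold_locales (use compat jointly_injective left_lift right_lift in blast)+

lemma eq_if_projections_eq:
  assumes "a \<in> carrier P" "b \<in> carrier P" "\<alpha> a = \<alpha> b" "\<beta> a = \<beta> b"
  shows "a = b"
proof -
  have "\<alpha> (a \<ominus> b) = \<zero>\<^bsub>R\<^esub>" "\<beta> (a \<ominus> b) = \<zero>\<^bsub>S\<^esub>"
    using assms by (simp_all add: a_minus_def R.r_neg S.r_neg)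
  then have "a \<ominus> b = \<zero>" using assms by (intro jointly_injective) auto
  then show ?thesis using assms \<alpha>.R.minus_zero_eqI by blast
qed

definition "pullback A C = {a \<in> carrier P. \<alpha> a \<in> A \<and> \<beta> a \<in> C}"

lemma pullback_length:
  assumes A: "ideal A R" "A \<subseteq> max_ideal R" "fin R (mults R) A"
    and C: "ideal C S" "C \<subseteq> max_ideal S" "fin S (mults S) C"
  shows "pullback A C \<in> submods P (mults P)" "fin P (mults P) (pullback A C)"
    "lg P (mults P) (pullback A C) = lg R (mults R) A + lg S (mults S) C"
proof -
  interpret a: op_hom P "mults P" R "mults R" \<alpha> by (rule \<alpha>.mults_hom)
  interpret b: op_hom P "mults P" S "mults S" \<beta> by (rule \<beta>.mults_hom)
  have E: "pullback A C = {x \<in> carrier P. \<alpha> x \<in> A} \<inter> {x \<in> carrier P. \<beta> x \<in> C}"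
    by (auto simp: pullback_def)
  show sub: "pullback A C \<in> submods P (mults P)"
    unfolding E using A(1) C(1)
    by (intro a.G.inter_submod a.vimage_submod b.vimage_submod)
      (simp_all add: R.ideal_iff_submod S.ideal_iff_submod)
  have A0: "\<zero>\<^bsub>R\<^esub> \<in> A" "\<zero>\<^bsub>S\<^esub> \<in> C"
    using additive_subgroup.zero_closed[OF ideal.axioms(1)[OF A(1)]]
      additive_subgroup.zero_closed[OF ideal.axioms(1)[OF C(1)]] by auto
  have imgA: "\<alpha> ` pullback A C = A"
  proof
    show "A \<subseteq> \<alpha> ` pullback A C"
    proof
      fix r assume r: "r \<in> A"
      then obtain a where "a \<in> carrier P" "\<alpha> a = r" "\<beta> a = \<zero>\<^bsub>S\<^esub>" using left_lift A(2) by blast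
      then show "r \<in> \<alpha> ` pullback A C" using r A0 by (intro image_eqI[of _ _ a]) (auto simp: pullback_def)
    qed
  qed (auto simp: pullback_def)
  let ?N = "pullback A C \<inter> a.ker"
  have N: "?N \<in> submods P (mults P)" by (rule a.G.inter_submod[OF sub a.ker_submod])
  have imgC: "\<beta> ` ?N = C"
  proof
    show "C \<subseteq> \<beta> ` ?N"
    proof
      fix s assume s: "s \<in> C"
      then obtain a where "a \<in> carrier P" "\<alpha> a = \<zero>\<^bsub>R\<^esub>" "\<beta> a = s" using right_lift C(2) by blast
      then show "s \<in> \<beta> ` ?N"
        using s A0 by (intro image_eqI[of _ _ a]) (auto simp: pullback_def a.ker_def)
    qed
  qed (auto simp: pullback_def)
  have "?N \<inter> b.ker = {\<zero>}"
  proof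
    show "?N \<inter> b.ker \<subseteq> {\<zero>}"
      using jointly_injective by (auto simp: a.ker_def b.ker_def)
    show "{\<zero>} \<subseteq> ?N \<inter> b.ker" using submodsD(2)[OF N] submodsD(2)[OF b.ker_submod] by simp
  qed
  then have "fin P (mults P) ?N" "lg P (mults P) ?N = lg S (mults S) C"
    using b.rank_nullity[OF N] imgC C(3) a.G.fin_zero by simp_all
  then show "fin P (mults P) (pullback A C)"
    "lg P (mults P) (pullback A C) = lg R (mults R) A + lg S (mults S) C"
    using a.rank_nullity[OF sub] imgA A(3) by simp_all
qed

end

lemma (in ring_epi) coord_kos:
  assumes x: "x \<in> K \<rightarrow> carrier R" and I: "I \<subseteq> K" and k: "k \<in> K" "k' \<in> K"
  shows "(\<lambda>l\<in>I. \<phi> (kos R K x k k' l)) =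
    (\<lambda>l\<in>I. (if l = k then \<phi> (x k') else \<zero>\<^bsub>W\<^esub>) \<ominus>\<^bsub>W\<^esub> (if l = k' then \<phi> (x k) else \<zero>\<^bsub>W\<^esub>))"
proof -
  have "x k \<in> carrier R" "x k' \<in> carrier R" using x k by auto
  then show ?thesis
    using I by (subst R.kos_eq) (auto simp: fun_eq_iff a_minus_def)
qed

lemma (in ring_epi) coord_koszul:
  assumes x: "x \<in> K \<rightarrow> carrier R" and I: "I \<subseteq> K" and z: "\<And>k. k \<in> K - I \<Longrightarrow> \<phi> (x k) = \<zero>\<^bsub>W\<^esub>"
  shows "(\<lambda>v. \<lambda>l\<in>I. \<phi> (v l)) ` koszul R K x \<subseteq> koszul W I (\<lambda>l. \<phi> (x l))"
proof -
  interpret h: op_hom "tuples R K" "scals R K" "tuples W I" "scals W I" "\<lambda>v. \<lambda>l\<in>I. \<phi> (v l)"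
    by (rule tuples_hom[OF I])
  let ?y = "\<lambda>l. \<phi> (x l)"
  have y: "?y \<in> I \<rightarrow> carrier W" using x I by auto
  have "koszul R K x \<subseteq> {v \<in> carrier (tuples R K). (\<lambda>l\<in>I. \<phi> (v l)) \<in> koszul W I ?y}"
  proof (rule R.koszul_least[OF h.vimage_submod[OF W.koszul_submod[OF y]]])
    fix k k' assume k: "k \<in> K" "k' \<in> K"
    have c: "?y k \<in> carrier W" "?y k' \<in> carrier W" using x k by auto
    have "(\<lambda>l\<in>I. \<phi> (kos R K x k k' l)) \<in> koszul W I ?y"
    proof (cases "k \<in> I \<and> k' \<in> I")
      case True
      then have "(\<lambda>l\<in>I. \<phi> (kos R K x k k' l)) = kos W I ?y k k'"
        using kos_map[OF x I] by simp
      then show ?thesis using W.kos_koszul[of k I k' ?y] True by simp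
    next
      case False
      then have "(\<lambda>l\<in>I. \<phi> (kos R K x k k' l)) = \<zero>\<^bsub>tuples W I\<^esub>"
        unfolding coord_kos[OF x I k] using z[of k] z[of k'] k by (auto simp: fun_eq_iff a_minus_def)
      then show ?thesis using submodsD(2)[OF W.koszul_submod[OF y]] by (simp only:)
    qed
    then show "kos R K x k k' \<in> {v \<in> carrier (tuples R K). (\<lambda>l\<in>I. \<phi> (v l)) \<in> koszul W I ?y}"
      using R.kos_closed[OF x k] by blast
  qed
  then show ?thesis by blast
qed

locale fibre_generators = fibre_square P R S \<alpha> \<beta>
  for P (structure) and R and S and \<alpha> and \<beta> +
  fixes I J :: "'i set" and z :: "'i \<Rightarrow> _"
  assumes finite_I: "finite I" and finite_J: "finite J" and disjoint: "I \<inter> J = {}"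
    and z_closed: "z k \<in> carrier P"
    and z_I: "k \<in> I \<Longrightarrow> \<beta> (z k) = \<zero>\<^bsub>S\<^esub>" and z_J: "k \<in> J \<Longrightarrow> \<alpha> (z k) = \<zero>\<^bsub>R\<^esub>"
    and gen_R: "Idl\<^bsub>R\<^esub> ((\<lambda>k. \<alpha> (z k)) ` I) = max_ideal R"
    and gen_S: "Idl\<^bsub>S\<^esub> ((\<lambda>k. \<beta> (z k)) ` J) = max_ideal S"
    and card_I: "card I = edim R" and card_J: "card J = edim S"
begin

lemma swap_generators: "fibre_generators P S R \<beta> \<alpha> J I z"
  by (intro fibre_generators.intro swap fibre_generators_axioms.intro)
    (use finite_I finite_J disjoint z_closed z_I z_J gen_R gen_S card_I card_J in auto)

abbreviation "K \<equiv> I \<union> J"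
abbreviation "xR \<equiv> \<lambda>k. \<alpha> (z k)"
abbreviation "yS \<equiv> \<lambda>k. \<beta> (z k)"
abbreviation "B \<equiv> koszul P K z"

lemma closed: "z \<in> K \<rightarrow> carrier P" "xR \<in> A \<rightarrow> carrier R" "yS \<in> A \<rightarrow> carrier S"
  using z_closed by auto

lemma z_max: "k \<in> K \<Longrightarrow> \<alpha> (z k) \<in> max_ideal R" "k \<in> K \<Longrightarrow> \<beta> (z k) \<in> max_ideal S"
proof -
  have "xR ` I \<subseteq> carrier R" "yS ` J \<subseteq> carrier S" using z_closed by auto
  then have *: "k \<in> I \<Longrightarrow> \<alpha> (z k) \<in> max_ideal R" "k \<in> J \<Longrightarrow> \<beta> (z k) \<in> max_ideal S" for k
    using R.genideal_self[of "xR ` I"] S.genideal_self[of "yS ` J"] gen_R gen_S by auto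
  show "k \<in> K \<Longrightarrow> \<alpha> (z k) \<in> max_ideal R" "k \<in> K \<Longrightarrow> \<beta> (z k) \<in> max_ideal S"
    using *[of k] compat[OF z_closed, of k] by auto
qed

lemma max_pullback_submod: "pullback (max_ideal R) (max_ideal S) \<in> submods P (mults P)"
proof -
  interpret a: op_hom P "mults P" R "mults R" \<alpha> by (rule \<alpha>.mults_hom)
  have "pullback (max_ideal R) (max_ideal S) = {x \<in> carrier P. \<alpha> x \<in> max_ideal R}"
    using compat by (auto simp: pullback_def)
  then show ?thesis using a.vimage_submod[of "max_ideal R"] R.ideal_max_ideal by (simp add: R.ideal_iff_submod)
qed

lemma B_max:
  assumes v: "v \<in> B" and l: "l \<in> K"
  shows "v l \<in> carrier P" "\<alpha> (v l) \<in> max_ideal R" "\<beta> (v l) \<in> max_ideal S"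
proof -
  let ?M = "pullback (max_ideal R) (max_ideal S)"
  have M: "ideal ?M P" using max_pullback_submod by (simp add: \<alpha>.R.ideal_iff_submod)
  have zM: "z k \<in> ?M" if "k \<in> K" for k using z_max[OF that] z_closed by (simp add: pullback_def)
  have "B \<subseteq> tuples_in P K K ?M"
  proof (rule \<alpha>.R.koszul_least[OF \<alpha>.R.tuples_in_submod[OF M]])
    fix k k' assume k: "k \<in> K" "k' \<in> K"
    have "kos P K z k k' l \<in> ?M" if "l \<in> K" for l
    proof -
      have "(if l = k then z k' else \<zero>) \<in> ?M" "(if l = k' then z k else \<zero>) \<in> ?M"
        using zM[OF k(1)] zM[OF k(2)] submodsD(2)[OF max_pullback_submod] by auto
      then have "(if l = k then z k' else \<zero>) \<ominus> (if l = k' then z k else \<zero>) \<in> ?M"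
        by (rule submodsD(7)[OF max_pullback_submod])
      then show ?thesis using that z_closed by (simp only: \<alpha>.R.kos_eq restrict_apply if_True)
    qed
    then show "kos P K z k k' \<in> tuples_in P K K ?M"
      using \<alpha>.R.kos_closed[OF closed(1) k] by (simp add: tuples_in_def)
  qed
  then have "v l \<in> ?M" using v l by (auto simp: tuples_in_def)
  then show "v l \<in> carrier P" "\<alpha> (v l) \<in> max_ideal R" "\<beta> (v l) \<in> max_ideal S"
    by (auto simp: pullback_def)
qed

text \<open>The coefficients of the mixed Koszul relations, as far as the projections see them.\<close>

lemma B_mixed_coefficients:
  assumes "v \<in> B"
  shows "\<exists>c. (\<forall>i j. c i j \<in> carrier P) \<and> (\<forall>i\<in>I. \<beta> (v i) = lin S J yS (\<lambda>j. \<beta> (c i j))) \<and>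
    (\<forall>j\<in>J. \<alpha> (v j) = \<ominus>\<^bsub>R\<^esub> lin R I xR (\<lambda>i. \<alpha> (c i j)))"
proof -
  let ?H = "\<lambda>v c. (\<forall>i j. c i j \<in> carrier P) \<and> (\<forall>i\<in>I. \<beta> (v i) = lin S J yS (\<lambda>j. \<beta> (c i j))) \<and>
    (\<forall>j\<in>J. \<alpha> (v j) = \<ominus>\<^bsub>R\<^esub> lin R I xR (\<lambda>i. \<alpha> (c i j)))"
  let ?N = "{v \<in> carrier (tuples P K). \<exists>c. ?H v c}"
  interpret T: op_group "tuples P K" "scals P K" by (rule \<alpha>.R.op_group_tuples)
  have NI: "v \<in> ?N" if "v \<in> carrier (tuples P K)" "?H v c" for v c
    using that by blast
  have scal: "?H (\<lambda>l\<in>K. a \<otimes> v l) (\<lambda>i j. a \<otimes> c i j)"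
    if a: "a \<in> carrier P" and v: "v \<in> carrier (tuples P K)" and H: "?H v c" for a v c
  proof (intro conjI allI ballI)
    have c: "c i j \<in> carrier P" for i j using H by blast
    have vl: "v l \<in> carrier P" if "l \<in> K" for l using v that by (simp add: PiE_iff)
    show "a \<otimes> c i j \<in> carrier P" for i j using a c by simp
    show "\<beta> ((\<lambda>l\<in>K. a \<otimes> v l) i) = lin S J yS (\<lambda>j. \<beta> (a \<otimes> c i j))" if i: "i \<in> I" for i
    proof -
      have "lin S J yS (\<lambda>j. \<beta> (a \<otimes> c i j)) = lin S J yS (\<lambda>j. \<beta> a \<otimes>\<^bsub>S\<^esub> \<beta> (c i j))" using a c by simp
      also have "\<dots> = \<beta> a \<otimes>\<^bsub>S\<^esub> lin S J yS (\<lambda>j. \<beta> (c i j))"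
        by (rule S.lin_scal_fun[OF finite_J closed(3)]) (use a c in auto)
      finally show ?thesis using H i a vl[of i] by simp
    qed
    show "\<alpha> ((\<lambda>l\<in>K. a \<otimes> v l) j) = \<ominus>\<^bsub>R\<^esub> lin R I xR (\<lambda>i. \<alpha> (a \<otimes> c i j))" if j: "j \<in> J" for j
    proof -
      have "lin R I xR (\<lambda>i. \<alpha> (a \<otimes> c i j)) = lin R I xR (\<lambda>i. \<alpha> a \<otimes>\<^bsub>R\<^esub> \<alpha> (c i j))" using a c by simp
      also have "\<dots> = \<alpha> a \<otimes>\<^bsub>R\<^esub> lin R I xR (\<lambda>i. \<alpha> (c i j))"
        by (rule R.lin_scal_fun[OF finite_I closed(2)]) (use a c in auto)
      finally show ?thesis
        using H j a vl[of j] R.lin_closed[OF closed(2), of "\<lambda>i. \<alpha> (c i j)" I] c by (simp add: R.r_minus)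
    qed
  qed
  have "?N \<in> submods (tuples P K) (scals P K)"
  proof (rule submodsI)
    have "?H \<zero>\<^bsub>tuples P K\<^esub> (\<lambda>i j. \<zero>)"
      using R.lin_zero_fun[OF closed(2), of I] S.lin_zero_fun[OF closed(3), of J] by simp
    then show "\<zero>\<^bsub>tuples P K\<^esub> \<in> ?N" by (rule NI[OF T.zero_closed])
  next
    fix v w assume "v \<in> ?N" "w \<in> ?N"
    then obtain c d where v: "v \<in> carrier (tuples P K)" "?H v c" and w: "w \<in> carrier (tuples P K)" "?H w d"
      by blast
    have c: "c i j \<in> carrier P" "d i j \<in> carrier P" for i j using v w by blast+
    have vl: "v l \<in> carrier P" "w l \<in> carrier P" if "l \<in> K" for l using v w that by (simp_all add: PiE_iff)
    have "?H (v \<oplus>\<^bsub>tuples P K\<^esub> w) (\<lambda>i j. c i j \<oplus> d i j)"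
    proof (intro conjI allI ballI)
      show "c i j \<oplus> d i j \<in> carrier P" for i j using c by simp
      show "\<beta> ((v \<oplus>\<^bsub>tuples P K\<^esub> w) i) = lin S J yS (\<lambda>j. \<beta> (c i j \<oplus> d i j))" if i: "i \<in> I" for i
      proof -
        have "lin S J yS (\<lambda>j. \<beta> (c i j \<oplus> d i j)) = lin S J yS (\<lambda>j. \<beta> (c i j) \<oplus>\<^bsub>S\<^esub> \<beta> (d i j))" using c by simp
        also have "\<dots> = lin S J yS (\<lambda>j. \<beta> (c i j)) \<oplus>\<^bsub>S\<^esub> lin S J yS (\<lambda>j. \<beta> (d i j))"
          by (rule S.lin_add_fun[OF closed(3)]) (use c in auto)
        finally show ?thesis using v(2) w(2) i vl[of i] by simp
      qed
      show "\<alpha> ((v \<oplus>\<^bsub>tuples P K\<^esub> w) j) = \<ominus>\<^bsub>R\<^esub> lin R I xR (\<lambda>i. \<alpha> (c i j \<oplus> d i j))" if j: "j \<in> J" for j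
      proof -
        have lc: "lin R I xR (\<lambda>i. \<alpha> (c i j)) \<in> carrier R" "lin R I xR (\<lambda>i. \<alpha> (d i j)) \<in> carrier R"
          by (rule R.lin_closed[OF closed(2)]; use c in auto)+
        have "lin R I xR (\<lambda>i. \<alpha> (c i j \<oplus> d i j)) = lin R I xR (\<lambda>i. \<alpha> (c i j) \<oplus>\<^bsub>R\<^esub> \<alpha> (d i j))" using c by simp
        also have "\<dots> = lin R I xR (\<lambda>i. \<alpha> (c i j)) \<oplus>\<^bsub>R\<^esub> lin R I xR (\<lambda>i. \<alpha> (d i j))"
          by (rule R.lin_add_fun[OF closed(2)]) (use c in auto)
        finally show ?thesis using v(2) w(2) j vl[of j] lc by (simp add: R.minus_add)
      qed
    qed
    then show "v \<oplus>\<^bsub>tuples P K\<^esub> w \<in> ?N" by (rule NI[OF T.a_closed[OF v(1) w(1)]])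
  next
    fix v assume "v \<in> ?N"
    then obtain c where v: "v \<in> carrier (tuples P K)" "?H v c" by blast
    have "\<ominus>\<^bsub>tuples P K\<^esub> v = (\<lambda>l\<in>K. \<ominus> \<one> \<otimes> v l)"
      using v(1) by (auto simp: \<alpha>.R.tuples_minus[OF v(1)] fun_eq_iff PiE_iff \<alpha>.R.l_minus)
    then have "?H (\<ominus>\<^bsub>tuples P K\<^esub> v) (\<lambda>i j. \<ominus> \<one> \<otimes> c i j)"
      using scal[OF _ v, of "\<ominus> \<one>"] by simp
    then show "\<ominus>\<^bsub>tuples P K\<^esub> v \<in> ?N" by (rule NI[OF T.a_inv_closed[OF v(1)]])
  next
    fix u v assume u: "u \<in> scals P K" and "v \<in> ?N"
    then obtain c where v: "v \<in> carrier (tuples P K)" "?H v c" by blast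
    obtain a where a: "a \<in> carrier P" "u = (\<lambda>v. \<lambda>l\<in>K. a \<otimes> v l)" using u by (auto simp: scals_def)
    have "?H (u v) (\<lambda>i j. a \<otimes> c i j)" using scal[OF a(1) v] a(2) by simp
    then show "u v \<in> ?N" by (rule NI[OF T.op_closed[OF u v(1)]])
  qed blast
  moreover have "kos P K z k k' \<in> ?N" if k: "k \<in> K" "k' \<in> K" for k k'
  proof -
    have kos: "kos P K z a b \<in> carrier (tuples P K)" if "a \<in> K" "b \<in> K" for a b
      by (rule \<alpha>.R.kos_closed[OF closed(1) that])
    have val: "kos P K z a b l = (if l = a then z b else \<zero>) \<ominus> (if l = b then z a else \<zero>)" if "l \<in> K" for a b l
      using that z_closed by (subst \<alpha>.R.kos_eq) auto
    have same: "kos P K z a b \<in> ?N" if "a \<in> I \<and> b \<in> I \<or> a \<in> J \<and> b \<in> J" for a b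
    proof -
      have "?H (kos P K z a b) (\<lambda>i j. \<zero>)"
        using that disjoint z_I z_J z_closed R.lin_zero_fun[OF closed(2), of I] S.lin_zero_fun[OF closed(3), of J]
        by (auto simp: val a_minus_def)
      then show ?thesis by (rule NI[rotated]) (use kos that in blast)
    qed
    have mixed: "kos P K z a b \<in> ?N" if ab: "a \<in> I" "b \<in> J" for a b
    proof -
      have ne: "a \<notin> J" "b \<notin> I" "a \<noteq> b" using ab disjoint by auto
      let ?c = "\<lambda>i j. if i = a \<and> j = b then \<one> else \<zero>"
      have "?H (kos P K z a b) ?c"
      proof (intro conjI allI ballI)
        show "?c i j \<in> carrier P" for i j by simp
        show "\<beta> (kos P K z a b i) = lin S J yS (\<lambda>j. \<beta> (?c i j))" if i: "i \<in> I" for i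
        proof (cases "i = a")
          case True
          have "lin S J yS (\<lambda>j. \<beta> (?c i j)) = lin S J yS (\<lambda>j. if j = b then \<one>\<^bsub>S\<^esub> else \<zero>\<^bsub>S\<^esub>)"
            using True by (simp add: if_distrib[of \<beta>] cong: if_cong)
          also have "\<dots> = \<beta> (z b)" by (rule S.lin_delta_fun[OF finite_J closed(3) ab(2)])
          finally show ?thesis using True i ne z_closed by (simp add: val a_minus_def)
        next
          case False
          then have "lin S J yS (\<lambda>j. \<beta> (?c i j)) = \<zero>\<^bsub>S\<^esub>"
            using S.lin_zero_fun[OF closed(3), of J] by simp
          then show ?thesis using False i ne z_closed by (auto simp: val a_minus_def)
        qed
        show "\<alpha> (kos P K z a b j) = \<ominus>\<^bsub>R\<^esub> lin R I xR (\<lambda>i. \<alpha> (?c i j))" if j: "j \<in> J" for j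
        proof (cases "j = b")
          case True
          have "lin R I xR (\<lambda>i. \<alpha> (?c i j)) = lin R I xR (\<lambda>i. if i = a then \<one>\<^bsub>R\<^esub> else \<zero>\<^bsub>R\<^esub>)"
            using True by (simp add: if_distrib[of \<alpha>] cong: if_cong)
          also have "\<dots> = \<alpha> (z a)" by (rule R.lin_delta_fun[OF finite_I closed(2) ab(1)])
          finally show ?thesis using True j ne z_closed by (simp add: val a_minus_def)
        next
          case False
          then have "lin R I xR (\<lambda>i. \<alpha> (?c i j)) = \<zero>\<^bsub>R\<^esub>"
            using R.lin_zero_fun[OF closed(2), of I] by simp
          then show ?thesis using False j ne z_closed by (auto simp: val a_minus_def)
        qed
      qed
      then show ?thesis by (rule NI[rotated]) (use kos ab in blast)
    qed
    consider "k \<in> I \<and> k' \<in> I \<or> k \<in> J \<and> k' \<in> J" | "k \<in> I" "k' \<in> J" | "k \<in> J" "k' \<in> I" using k by blast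
    then show ?thesis
    proof cases
      case 3
      then show ?thesis
        unfolding \<alpha>.R.kos_swap[OF closed(1) k] using mixed[OF 3(2,1)] submodsD(5)[OF calculation] by blast
    qed (use same mixed in blast)+
  qed
  ultimately have "B \<subseteq> ?N" by (rule \<alpha>.R.koszul_least)
  then show ?thesis using assms by blast
qed

end

section \<open>The Koszul module of a fibre square\<close>

lemma coord_eq_zero_iff:
  "(\<lambda>l\<in>I. f l) = \<zero>\<^bsub>tuples W I\<^esub> \<longleftrightarrow> (\<forall>l\<in>I. f l = \<zero>\<^bsub>W\<^esub>)"
  by (simp add: fun_eq_iff restrict_def Ball_def)

lemma (in ring_epi) image_single:
  assumes "i \<in> I" "I \<subseteq> K" "c \<in> carrier R"
  shows "(\<lambda>l\<in>I. \<phi> (single R K i c l)) = single W I i (\<phi> c)"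
  using map_single[of i K I c] assms by (simp add: subsetD)

context fibre_generators
begin

text \<open>A filtration of the Koszul module. Its successive quotients are images under one of the
  projections of one block of coordinates.\<close>

definition "K1 = {v \<in> B. \<forall>i\<in>I. \<alpha> (v i) = \<zero>\<^bsub>R\<^esub>}"
definition "K2 = {v \<in> B. \<forall>i\<in>I. v i = \<zero>}"
definition "K3 = {v \<in> B. (\<forall>i\<in>I. v i = \<zero>) \<and> (\<forall>j\<in>J. \<beta> (v j) = \<zero>\<^bsub>S\<^esub>)}"

lemma B_submod: "B \<in> submods (tuples P K) (scals P K)"
  by (rule \<alpha>.R.koszul_submod[OF closed(1)])

lemma B_closed: "v \<in> B \<Longrightarrow> v \<in> carrier (tuples P K)"
  by (rule submodsD(3)[OF B_submod])

lemma finite_K: "finite K"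
  using finite_I finite_J by simp

lemma kos_val:
  assumes "l \<in> K"
  shows "kos P K z a b l = (if l = a then z b else \<zero>) \<ominus> (if l = b then z a else \<zero>)"
  using assms z_closed by (subst \<alpha>.R.kos_eq) auto

lemma koszul_image: "(\<lambda>v. \<lambda>i\<in>I. \<alpha> (v i)) ` B = koszul R I xR"
proof
  interpret h: op_hom "tuples P K" "scals P K" "tuples R I" "scals R I" "\<lambda>v. \<lambda>l\<in>I. \<alpha> (v l)"
    by (rule \<alpha>.tuples_hom) simp
  show "(\<lambda>v. \<lambda>i\<in>I. \<alpha> (v i)) ` B \<subseteq> koszul R I xR"
    by (rule \<alpha>.coord_koszul[OF closed(1)]) (use z_J in auto)
  show "koszul R I xR \<subseteq> (\<lambda>v. \<lambda>i\<in>I. \<alpha> (v i)) ` B"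
  proof (rule R.koszul_least[OF h.image_submod[OF B_submod]])
    fix i j assume ij: "i \<in> I" "j \<in> I"
    have "kos R I xR i j = (\<lambda>l\<in>I. \<alpha> (kos P K z i j l))"
      using \<alpha>.kos_map[OF closed(1) _ ij] by simp
    moreover have "kos P K z i j \<in> B" using ij by (intro \<alpha>.R.kos_koszul) auto
    ultimately show "kos R I xR i j \<in> (\<lambda>v. \<lambda>i\<in>I. \<alpha> (v i)) ` B" by (rule image_eqI)
  qed
qed

text \<open>A multiple of a mixed relation by an element of the maximal ideal of one factor has a single
  nonzero coordinate, because the other coordinate lies in the product of the two maximal ideals.\<close>

lemma single_in_B:
  assumes a: "a \<in> carrier P" "\<alpha> a \<in> max_ideal R \<cdot>\<^bsub>R\<^esub> max_ideal R" "\<beta> a = \<zero>\<^bsub>S\<^esub>" and j: "j \<in> J"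
  shows "single P K j a \<in> B"
proof -
  interpret h: op_hom P "mults P" R "mults R" \<alpha> by (rule \<alpha>.mults_hom)
  interpret s: op_hom P "mults P" "tuples P K" "scals P K" "single P K j" by (rule \<alpha>.R.single_hom)
  have "\<exists>a\<in>carrier P. \<alpha> a = r \<and> \<beta> a = \<zero>\<^bsub>S\<^esub> \<and> single P K j a \<in> B"
    if "r \<in> max_ideal R \<cdot>\<^bsub>R\<^esub> max_ideal R" for r
    using that
  proof (induction rule: ideal_prod.induct)
    case (prod b c)
    obtain b' where b': "b' \<in> carrier P" "\<alpha> b' = b" "\<beta> b' = \<zero>\<^bsub>S\<^esub>" using left_lift[OF prod(1)] by blast
    let ?L = "{a \<in> carrier P. \<beta> a = \<zero>\<^bsub>S\<^esub> \<and> single P K j (b' \<otimes> a) \<in> B}"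
    have scal: "single P K j (b' \<otimes> a) = (\<lambda>l\<in>K. b' \<otimes> single P K j a l)" if "a \<in> carrier P" for a
      using \<alpha>.R.scal_single[OF b'(1) that, of K j] by simp
    have "?L \<in> submods P (mults P)"
    proof (rule submodsI)
      show "\<zero> \<in> ?L" using s.f_zero submodsD(2)[OF B_submod] b' by (simp del: tuples_simps)
      show "x \<oplus> y \<in> ?L" if "x \<in> ?L" "y \<in> ?L" for x y
      proof -
        have "single P K j (b' \<otimes> (x \<oplus> y)) = single P K j (b' \<otimes> x) \<oplus>\<^bsub>tuples P K\<^esub> single P K j (b' \<otimes> y)"
          using that b' s.f_add[of "b' \<otimes> x" "b' \<otimes> y"] by (simp add: \<alpha>.R.r_distr del: tuples_simps)
        then show ?thesis using that submodsD(4)[OF B_submod] by simp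
      qed
      show "\<ominus> x \<in> ?L" if "x \<in> ?L" for x
      proof -
        have "single P K j (b' \<otimes> \<ominus> x) = \<ominus>\<^bsub>tuples P K\<^esub> single P K j (b' \<otimes> x)"
          using that b' s.f_minus[of "b' \<otimes> x"] by (simp add: \<alpha>.R.r_minus)
        then show ?thesis using that submodsD(5)[OF B_submod] by simp
      qed
      show "u x \<in> ?L" if h: "u \<in> mults P" "x \<in> ?L" for u x
      proof -
        obtain p where p: "p \<in> carrier P" "u = (\<lambda>x. p \<otimes> x)" using h(1) by (auto simp: mults_def)
        have "b' \<otimes> (p \<otimes> x) = p \<otimes> (b' \<otimes> x)" using p h b' by (simp add: \<alpha>.R.m_lcomm)
        then have "single P K j (b' \<otimes> u x) = (\<lambda>l\<in>K. p \<otimes> single P K j (b' \<otimes> x) l)"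
          using p h b' \<alpha>.R.scal_single[of p "b' \<otimes> x" K j] by simp
        then show ?thesis using h p \<alpha>.R.scal_submod[OF B_submod p(1)] by simp
      qed
    qed blast
    then have "\<alpha> ` ?L \<in> submods R (mults R)" by (rule h.image_submod)
    then have I: "ideal (\<alpha> ` ?L) R" by (simp add: R.ideal_iff_submod)
    have "xR ` I \<subseteq> \<alpha> ` ?L"
    proof (rule image_subsetI)
      fix i assume i: "i \<in> I"
      have ne: "i \<noteq> j" using i j disjoint by auto
      have zero: "b' \<otimes> z j = \<zero>"
        using b' z_J[OF j] z_closed by (intro jointly_injective) auto
      have "(\<lambda>l\<in>K. b' \<otimes> kos P K z j i l) \<in> B"
        using i j by (intro \<alpha>.R.scal_submod[OF B_submod b'(1)] \<alpha>.R.kos_koszul) auto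
      moreover have "(\<lambda>l\<in>K. b' \<otimes> kos P K z j i l) = single P K j (b' \<otimes> z i)"
        using b'(1) z_closed ne zero by (auto simp: fun_eq_iff kos_val single_def a_minus_def \<alpha>.R.r_distr \<alpha>.R.r_minus)
      ultimately show "xR i \<in> \<alpha> ` ?L" using z_closed z_I[OF i] by (intro image_eqI[of _ _ "z i"]) auto
    qed
    then have "max_ideal R \<subseteq> \<alpha> ` ?L" unfolding gen_R[symmetric] by (rule R.genideal_minimal[OF I])
    then obtain a where a: "a \<in> ?L" "c = \<alpha> a" using prod(2) by blast
    then show ?case using b' by (intro bexI[of _ "b' \<otimes> a"]) auto
  next
    case (sum r r')
    then obtain a a' where a: "a \<in> carrier P" "\<alpha> a = r" "\<beta> a = \<zero>\<^bsub>S\<^esub>" "single P K j a \<in> B"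
      and a': "a' \<in> carrier P" "\<alpha> a' = r'" "\<beta> a' = \<zero>\<^bsub>S\<^esub>" "single P K j a' \<in> B" by blast
    have "single P K j (a \<oplus> a') \<in> B"
      unfolding s.f_add[OF a(1) a'(1)] by (rule submodsD(4)[OF B_submod a(4) a'(4)])
    then show ?case using a a' by (intro bexI[of _ "a \<oplus> a'"]) auto
  qed
  from this[OF a(2)] obtain a' where a': "a' \<in> carrier P" "\<alpha> a' = \<alpha> a" "\<beta> a' = \<zero>\<^bsub>S\<^esub>" "single P K j a' \<in> B" by blast
  have "a' = a" using a a' by (intro eq_if_projections_eq) auto
  then show ?thesis using a' by simp
qed

lemma K1_submod: "K1 \<in> submods (tuples P K) (scals P K)"
  and K2_submod: "K2 \<in> submods (tuples P K) (scals P K)"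
  and K3_submod: "K3 \<in> submods (tuples P K) (scals P K)"
proof -
  interpret hA: op_hom "tuples P K" "scals P K" "tuples R I" "scals R I" "\<lambda>v. \<lambda>l\<in>I. \<alpha> (v l)"
    by (rule \<alpha>.tuples_hom) simp
  interpret hB: op_hom "tuples P K" "scals P K" "tuples S I" "scals S I" "\<lambda>v. \<lambda>l\<in>I. \<beta> (v l)"
    by (rule \<beta>.tuples_hom) simp
  interpret hC: op_hom "tuples P K" "scals P K" "tuples S J" "scals S J" "\<lambda>v. \<lambda>l\<in>J. \<beta> (v l)"
    by (rule \<beta>.tuples_hom) simp
  have K1: "K1 = B \<inter> hA.ker"
    using B_closed by (auto simp: K1_def hA.ker_def coord_eq_zero_iff simp del: tuples_simps)
  then show 1: "K1 \<in> submods (tuples P K) (scals P K)"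
    by (simp only: hA.G.inter_submod[OF B_submod hA.ker_submod])
  have zero: "v i = \<zero> \<longleftrightarrow> \<alpha> (v i) = \<zero>\<^bsub>R\<^esub> \<and> \<beta> (v i) = \<zero>\<^bsub>S\<^esub>" if "v \<in> B" "i \<in> I" for v i
    using jointly_injective[of "v i"] B_max(1)[OF that(1), of i] that(2) by auto
  have K2: "K2 = K1 \<inter> hB.ker"
    using B_closed zero by (auto simp: K1_def K2_def hB.ker_def coord_eq_zero_iff simp del: tuples_simps)
  then show 2: "K2 \<in> submods (tuples P K) (scals P K)"
    by (simp only: hA.G.inter_submod[OF 1 hB.ker_submod])
  have K3: "K3 = K2 \<inter> hC.ker"
    using B_closed by (auto simp: K3_def K2_def hC.ker_def coord_eq_zero_iff simp del: tuples_simps)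
  then show "K3 \<in> submods (tuples P K) (scals P K)"
    by (simp only: hA.G.inter_submod[OF 2 hC.ker_submod])
qed

lemma K1_image: "(\<lambda>v. \<lambda>i\<in>I. \<beta> (v i)) ` K1 = tuples_in S I I (max_ideal S)"
proof
  interpret h: op_hom "tuples P K" "scals P K" "tuples S I" "scals S I" "\<lambda>v. \<lambda>l\<in>I. \<beta> (v l)"
    by (rule \<beta>.tuples_hom) simp
  interpret s: op_hom S "mults S" "tuples S I" "scals S I" "single S I i" for i by (rule S.single_hom)
  show "(\<lambda>v. \<lambda>i\<in>I. \<beta> (v i)) ` K1 \<subseteq> tuples_in S I I (max_ideal S)"
    using B_max by (auto simp: K1_def tuples_in_def)
  have im: "(\<lambda>v. \<lambda>i\<in>I. \<beta> (v i)) ` K1 \<in> submods (tuples S I) (scals S I)"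
    by (rule h.image_submod[OF K1_submod])
  have single: "single S I i t \<in> (\<lambda>v. \<lambda>i\<in>I. \<beta> (v i)) ` K1" if i: "i \<in> I" and t: "t \<in> max_ideal S" for i t
  proof -
    let ?N = "{t \<in> carrier S. single S I i t \<in> (\<lambda>v. \<lambda>i\<in>I. \<beta> (v i)) ` K1}"
    have N: "ideal ?N S" using s.vimage_submod[OF im] by (simp only: S.ideal_iff_submod)
    have "yS ` J \<subseteq> ?N"
    proof (rule image_subsetI)
      fix j assume j: "j \<in> J"
      have ne: "j \<notin> I" "i \<noteq> j" using i j disjoint by auto
      have "kos P K z i j \<in> K1"
        using i j ne z_closed z_J[OF j]
        by (auto simp: K1_def kos_val a_minus_def intro!: \<alpha>.R.kos_koszul)
      moreover have "single S I i (yS j) = (\<lambda>l\<in>I. \<beta> (kos P K z i j l))"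
        using ne z_closed by (auto simp: fun_eq_iff kos_val single_def a_minus_def)
      ultimately show "yS j \<in> ?N" using z_closed by (auto intro: image_eqI)
    qed
    then have "max_ideal S \<subseteq> ?N" unfolding gen_S[symmetric] by (rule S.genideal_minimal[OF N])
    then show ?thesis using t by blast
  qed
  show "tuples_in S I I (max_ideal S) \<subseteq> (\<lambda>v. \<lambda>i\<in>I. \<beta> (v i)) ` K1"
  proof
    fix w assume w: "w \<in> tuples_in S I I (max_ideal S)"
    then have wc: "w \<in> carrier (tuples S I)" and wm: "w i \<in> max_ideal S" if "i \<in> I" for i
      using that by (auto simp: tuples_in_def)
    show "w \<in> (\<lambda>v. \<lambda>i\<in>I. \<beta> (v i)) ` K1"
      by (rule S.mem_if_singles_mem[OF im finite_I]) (use w single in \<open>auto simp: tuples_in_def\<close>)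
  qed
qed

lemma K2_image: "(\<lambda>v. \<lambda>j\<in>J. \<beta> (v j)) ` K2 = koszul S J yS"
proof
  interpret h: op_hom "tuples P K" "scals P K" "tuples S J" "scals S J" "\<lambda>v. \<lambda>l\<in>J. \<beta> (v l)"
    by (rule \<beta>.tuples_hom) simp
  have "(\<lambda>v. \<lambda>j\<in>J. \<beta> (v j)) ` B \<subseteq> koszul S J yS"
    by (rule \<beta>.coord_koszul[OF closed(1)]) (use z_I in auto)
  then show "(\<lambda>v. \<lambda>j\<in>J. \<beta> (v j)) ` K2 \<subseteq> koszul S J yS" by (auto simp: K2_def)
  show "koszul S J yS \<subseteq> (\<lambda>v. \<lambda>j\<in>J. \<beta> (v j)) ` K2"
  proof (rule S.koszul_least[OF h.image_submod[OF K2_submod]])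
    fix i j assume ij: "i \<in> J" "j \<in> J"
    have "kos S J yS i j = (\<lambda>l\<in>J. \<beta> (kos P K z i j l))"
      using \<beta>.kos_map[OF closed(1) _ ij] by simp
    moreover have "kos P K z i j \<in> K2"
      using ij disjoint z_closed by (auto simp: K2_def kos_val a_minus_def intro!: \<alpha>.R.kos_koszul)
    ultimately show "kos S J yS i j \<in> (\<lambda>v. \<lambda>j\<in>J. \<beta> (v j)) ` K2" by (rule image_eqI)
  qed
qed

lemma K3_image: "(\<lambda>v. \<lambda>j\<in>J. \<alpha> (v j)) ` K3 = tuples_in R J J (max_ideal R \<cdot>\<^bsub>R\<^esub> max_ideal R)"
proof
  interpret h: op_hom "tuples P K" "scals P K" "tuples R J" "scals R J" "\<lambda>v. \<lambda>l\<in>J. \<alpha> (v l)"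
    by (rule \<alpha>.tuples_hom) simp
  let ?mm = "max_ideal R \<cdot>\<^bsub>R\<^esub> max_ideal R"
  have mm: "ideal ?mm R" using R.prod_max_ideal[OF R.ideal_max_ideal] by simp
  have "\<alpha> (v j) \<in> ?mm" if v: "v \<in> K3" and j: "j \<in> J" for v j
  proof -
    have vB: "v \<in> B" and v0: "\<And>i. i \<in> I \<Longrightarrow> v i = \<zero>" using v by (auto simp: K3_def)
    obtain c where c: "\<And>i j. c i j \<in> carrier P"
      "\<And>i. i \<in> I \<Longrightarrow> \<beta> (v i) = lin S J yS (\<lambda>j. \<beta> (c i j))"
      "\<And>j. j \<in> J \<Longrightarrow> \<alpha> (v j) = \<ominus>\<^bsub>R\<^esub> lin R I xR (\<lambda>i. \<alpha> (c i j))"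
      using B_mixed_coefficients[OF vB] by blast
    have "\<beta> (c i j) \<in> max_ideal S" if i: "i \<in> I" for i
    proof (rule S.minimal_generators_coeffs[OF S.ideal_max_ideal finite_J closed(3) gen_S _ _ _ j])
      show "card J \<le> min_gens S (max_ideal S)" using card_J by (simp add: edim_def)
      show "(\<lambda>j. \<beta> (c i j)) \<in> J \<rightarrow> carrier S" using c(1) by auto
      have "lin S J yS (\<lambda>j. \<beta> (c i j)) = \<zero>\<^bsub>S\<^esub>" using c(2)[OF i] v0[OF i] by simp
      then show "lin S J yS (\<lambda>j. \<beta> (c i j)) \<in> max_ideal S \<cdot>\<^bsub>S\<^esub> max_ideal S"
        using additive_subgroup.zero_closed[OF ideal.axioms(1)[OF S.prod_max_ideal(1)[OF S.ideal_max_ideal]]]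
        by simp
    qed
    then have "\<alpha> (c i j) \<in> max_ideal R" if "i \<in> I" for i using compat[OF c(1)] that by simp
    then have "lin R I xR (\<lambda>i. \<alpha> (c i j)) \<in> ?mm"
      using c(1) z_max(1) by (intro R.lin_mem_fun[OF mm finite_I closed(2)] ideal_prod.prod) auto
    then show ?thesis
      using c(3)[OF j] additive_subgroup.a_inv_closed[OF ideal.axioms(1)[OF mm]] by simp
  qed
  then show "(\<lambda>v. \<lambda>j\<in>J. \<alpha> (v j)) ` K3 \<subseteq> tuples_in R J J ?mm"
    using B_max(1) by (auto simp: tuples_in_def K3_def)
  show "tuples_in R J J ?mm \<subseteq> (\<lambda>v. \<lambda>j\<in>J. \<alpha> (v j)) ` K3"
  proof
    fix w assume w: "w \<in> tuples_in R J J ?mm"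
    show "w \<in> (\<lambda>v. \<lambda>j\<in>J. \<alpha> (v j)) ` K3"
    proof (rule R.mem_if_singles_mem[OF h.image_submod[OF K3_submod] finite_J])
      show "w \<in> carrier (tuples R J)" using w by (simp add: tuples_in_def)
      fix j assume j: "j \<in> J"
      then have wj: "w j \<in> ?mm" using w by (auto simp: tuples_in_def)
      then have "w j \<in> max_ideal R" using R.prod_max_ideal(2)[OF R.ideal_max_ideal] by auto
      then obtain a where a: "a \<in> carrier P" "\<alpha> a = w j" "\<beta> a = \<zero>\<^bsub>S\<^esub>" using left_lift by blast
      have "single P K j a \<in> B" using single_in_B[OF a(1) _ a(3) j] wj a(2) by simp
      then have s1: "single P K j a \<in> K3"
        using j disjoint a by (auto simp: K3_def single_def)
      have s2: "single R J j (w j) = (\<lambda>l\<in>J. \<alpha> (single P K j a l))"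
        using \<alpha>.image_single[OF j _ a(1), of K] a(2) by simp
      show "single R J j (w j) \<in> (\<lambda>v. \<lambda>j\<in>J. \<alpha> (v j)) ` K3"
        unfolding s2 by (rule imageI[OF s1, of "\<lambda>v. \<lambda>j\<in>J. \<alpha> (v j)"])
    qed
  qed
qed

text \<open>The four images along the filtration are the Koszul module of \<open>R\<close>, the tuples over \<open>I\<close> in
  the maximal ideal of \<open>S\<close>, the Koszul module of \<open>S\<close>, and the tuples over \<open>J\<close> in the square of
  the maximal ideal of \<open>R\<close>.\<close>

theorem koszul_length:
  assumes fR: "fin R (mults R) (carrier R)" and fS: "fin S (mults S) (carrier S)"
  shows "fin (tuples P K) (scals P K) B"
    "lg (tuples P K) (scals P K) B = lg (tuples R I) (scals R I) (koszul R I xR) + card I * lg S (mults S) (max_ideal S)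
      + lg (tuples S J) (scals S J) (koszul S J yS) + card J * lg R (mults R) (max_ideal R \<cdot>\<^bsub>R\<^esub> max_ideal R)"
proof -
  interpret hA: op_hom "tuples P K" "scals P K" "tuples R I" "scals R I" "\<lambda>v. \<lambda>l\<in>I. \<alpha> (v l)"
    by (rule \<alpha>.tuples_hom) simp
  interpret hB: op_hom "tuples P K" "scals P K" "tuples S I" "scals S I" "\<lambda>v. \<lambda>l\<in>I. \<beta> (v l)"
    by (rule \<beta>.tuples_hom) simp
  interpret hC: op_hom "tuples P K" "scals P K" "tuples S J" "scals S J" "\<lambda>v. \<lambda>l\<in>J. \<beta> (v l)"
    by (rule \<beta>.tuples_hom) simp
  interpret hD: op_hom "tuples P K" "scals P K" "tuples R J" "scals R J" "\<lambda>v. \<lambda>l\<in>J. \<alpha> (v l)"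
    by (rule \<alpha>.tuples_hom) simp
  let ?mm = "max_ideal R \<cdot>\<^bsub>R\<^esub> max_ideal R"
  have mm: "ideal ?mm R" using R.prod_max_ideal[OF R.ideal_max_ideal] by simp
  have fmm: "fin R (mults R) ?mm"
    by (rule op_group.fin_sub(1)[OF R.op_group_mults fR])
      (use mm additive_subgroup.a_subset[OF ideal.axioms(1)[OF mm]] in \<open>simp_all add: R.ideal_iff_submod\<close>)
  have fm: "fin S (mults S) (max_ideal S)"
    by (rule op_group.fin_sub(1)[OF S.op_group_mults fS])
      (use S.ideal_max_ideal S.max_ideal_closed in \<open>auto simp: S.ideal_iff_submod\<close>)
  have fkR: "fin (tuples R I) (scals R I) (koszul R I xR)"
    by (rule op_group.fin_sub(1)[OF R.op_group_tuples R.tuples_length(1)[OF fR finite_I]])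
      (use R.koszul_submod[OF closed(2)] submodsD(1)[OF R.koszul_submod[OF closed(2)]] in auto)
  have fkS: "fin (tuples S J) (scals S J) (koszul S J yS)"
    by (rule op_group.fin_sub(1)[OF S.op_group_tuples S.tuples_length(1)[OF fS finite_J]])
      (use S.koszul_submod[OF closed(3)] submodsD(1)[OF S.koszul_submod[OF closed(3)]] in auto)
  have zero: "v i = \<zero> \<longleftrightarrow> \<alpha> (v i) = \<zero>\<^bsub>R\<^esub> \<and> \<beta> (v i) = \<zero>\<^bsub>S\<^esub>" if "v \<in> B" "i \<in> K" for v i
    using jointly_injective[of "v i"] B_max(1)[OF that] by auto
  have kA: "B \<inter> hA.ker = K1"
    using B_closed by (auto simp: K1_def hA.ker_def coord_eq_zero_iff simp del: tuples_simps)
  have kB: "K1 \<inter> hB.ker = K2"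
    using B_closed zero by (auto simp: K1_def K2_def hB.ker_def coord_eq_zero_iff simp del: tuples_simps)
  have kC: "K2 \<inter> hC.ker = K3"
    using B_closed by (auto simp: K3_def K2_def hC.ker_def coord_eq_zero_iff simp del: tuples_simps)
  have kD: "K3 \<inter> hD.ker = {\<zero>\<^bsub>tuples P K\<^esub>}"
  proof
    show "K3 \<inter> hD.ker \<subseteq> {\<zero>\<^bsub>tuples P K\<^esub>}"
    proof
      fix v assume "v \<in> K3 \<inter> hD.ker"
      then have v: "v \<in> B" "\<forall>i\<in>I. v i = \<zero>" "\<forall>j\<in>J. \<beta> (v j) = \<zero>\<^bsub>S\<^esub>" "\<forall>j\<in>J. \<alpha> (v j) = \<zero>\<^bsub>R\<^esub>"
        by (simp_all add: K3_def hD.ker_def coord_eq_zero_iff del: tuples_simps)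
      then have "v l = \<zero>" if "l \<in> K" for l using zero[OF v(1) that] that by auto
      then show "v \<in> {\<zero>\<^bsub>tuples P K\<^esub>}"
        using B_closed[OF v(1)] by (auto simp: fun_eq_iff PiE_def extensional_def)
    qed
    show "{\<zero>\<^bsub>tuples P K\<^esub>} \<subseteq> K3 \<inter> hD.ker"
      using submodsD(2)[OF K3_submod] submodsD(2)[OF hD.ker_submod] by blast
  qed
  note D = hD.rank_nullity[OF K3_submod, unfolded kD K3_image]
  note C = hC.rank_nullity[OF K2_submod, unfolded kC K2_image]
  note Bb = hB.rank_nullity[OF K1_submod, unfolded kB K1_image]
  note A = hA.rank_nullity[OF B_submod, unfolded kA koszul_image]
  have tD: "fin (tuples R J) (scals R J) (tuples_in R J J ?mm)"
    "lg (tuples R J) (scals R J) (tuples_in R J J ?mm) = card J * lg R (mults R) ?mm"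
    using R.tuples_in_length[OF mm fmm finite_J order_refl] by auto
  have tB: "fin (tuples S I) (scals S I) (tuples_in S I I (max_ideal S))"
    "lg (tuples S I) (scals S I) (tuples_in S I I (max_ideal S)) = card I * lg S (mults S) (max_ideal S)"
    using S.tuples_in_length[OF S.ideal_max_ideal fm finite_I order_refl] by auto
  have 3: "fin (tuples P K) (scals P K) K3" "lg (tuples P K) (scals P K) K3 = card J * lg R (mults R) ?mm"
    using D tD hA.G.fin_zero by simp_all
  have 2: "fin (tuples P K) (scals P K) K2"
    "lg (tuples P K) (scals P K) K2 = lg (tuples P K) (scals P K) K3 + lg (tuples S J) (scals S J) (koszul S J yS)"
    using C 3 fkS by simp_all
  have 1: "fin (tuples P K) (scals P K) K1"
    "lg (tuples P K) (scals P K) K1 = lg (tuples P K) (scals P K) K2 + card I * lg S (mults S) (max_ideal S)"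
    using Bb 2 tB by simp_all
  show "fin (tuples P K) (scals P K) B" using A 1 fkR by simp
  show "lg (tuples P K) (scals P K) B = lg (tuples R I) (scals R I) (koszul R I xR) + card I * lg S (mults S) (max_ideal S)
      + lg (tuples S J) (scals S J) (koszul S J yS) + card J * lg R (mults R) ?mm"
    using A(4) 1 2 3 fkR by simp
qed

end

section \<open>Koszul homology of a connected sum\<close>

context artin_local_ring
begin

lemma fin_ideal:
  assumes A: "ideal A R" shows "fin R (mults R) A"
  using op_group.fin_sub(1)[OF op_group_mults finite_length _ additive_subgroup.a_subset[OF ideal.axioms(1)[OF A]]] A
  by (simp add: ideal_iff_submod)

lemma length_carrier: "lg R (mults R) (carrier R) = lg R (mults R) \<mm> + 1"
proof -
  interpret M: maximalideal \<mm> R by (rule maximalideal_max_ideal)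
  have sub: "\<mm> \<subseteq> carrier R" using max_ideal_closed by blast
  have "covers (submods R (mults R)) \<mm> (carrier R)"
    unfolding covers_def
    using ideal_max_ideal oneideal M.I_notcarr M.I_maximal sub
    by (auto simp: ideal_iff_submod[symmetric])
  then have "len (submods R (mults R)) \<mm> (carrier R) = 1"
    by (rule modular_family.series_len[OF modular_ideals series_covers])
  then show ?thesis
    using op_group.fin_sub(3)[OF op_group_mults finite_length _ sub] ideal_max_ideal
    by (simp add: ideal_iff_submod)
qed

lemma length_max_ideal: "lg R (mults R) \<mm> = lg R (mults R) (\<mm> \<cdot> \<mm>) + edim R"
proof -
  have "\<mm> \<cdot> \<mm> \<in> submods R (mults R)" "\<mm> \<cdot> \<mm> \<subseteq> \<mm>"
    using prod_max_ideal[OF ideal_max_ideal] by (simp_all add: ideal_iff_submod)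
  then show ?thesis
    using op_group.fin_sub(3)[OF op_group_mults fin_ideal[OF ideal_max_ideal]]
      min_gens_eq_len(2)[OF ideal_max_ideal] by (simp add: edim_def)
qed

lemma koszul_homology_length:
  assumes K: "finite K" "x \<in> K \<rightarrow> carrier R" "Idl (x ` K) = \<mm>"
  shows "fin (tuples R K) (scals R K) (koszul R K x)"
    "lg (tuples R K) (scals R K) (koszul R K x) +
      len (submods (tuples R K) (scals R K)) (koszul R K x) (syz R K x) + lg R (mults R) \<mm>
     = card K * (lg R (mults R) \<mm> + 1)"
proof -
  interpret h: op_hom "tuples R K" "scals R K" R "mults R" "lin R K x"
    using K by (intro lin_hom)
  have f: "fin (tuples R K) (scals R K) (carrier (tuples R K))"
    by (rule tuples_length(1)[OF finite_length K(1)])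
  have ker: "carrier (tuples R K) \<inter> h.ker = syz R K x" unfolding h.ker_def syz_def by blast
  have img: "lin R K x ` carrier (tuples R K) = \<mm>" using lin_image[OF K(1,2)] K(3) by simp
  have 1: "card K * (lg R (mults R) \<mm> + 1) = lg (tuples R K) (scals R K) (syz R K x) + lg R (mults R) \<mm>"
    using h.rank_nullity(4)[OF h.G.carrier_submod disjI1[OF f], unfolded ker img]
      tuples_length(2)[OF finite_length K(1)] length_carrier by simp
  have fs: "fin (tuples R K) (scals R K) (syz R K x)"
    using h.rank_nullity(3)[OF h.G.carrier_submod disjI1[OF f], unfolded ker] .
  note k = h.G.fin_sub[OF fs koszul_submod[OF K(2)] koszul_le_syz[OF K(1,2)]]
  show "fin (tuples R K) (scals R K) (koszul R K x)" by (rule k(1))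
  show "lg (tuples R K) (scals R K) (koszul R K x) +
      len (submods (tuples R K) (scals R K)) (koszul R K x) (syz R K x) + lg R (mults R) \<mm>
     = card K * (lg R (mults R) \<mm> + 1)"
    using 1 k(3) by simp
qed

end

context fibre_generators
begin

lemma koszul_trivial: "card I < 2 \<Longrightarrow> koszul R I xR = {\<zero>\<^bsub>tuples R I\<^esub>}"
proof
  assume c: "card I < 2"
  interpret T: op_group "tuples R I" "scals R I" by (rule R.op_group_tuples)
  show "koszul R I xR \<subseteq> {\<zero>\<^bsub>tuples R I\<^esub>}"
  proof (rule R.koszul_least[OF T.zero_submod])
    fix i j assume ij: "i \<in> I" "j \<in> I"
    then have "i = j" using c finite_I by (metis One_nat_def card_le_Suc0_iff_eq less_2_cases_iff less_one order_refl zero_le)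
    then have "kos R I xR i j = \<zero>\<^bsub>tuples R I\<^esub>"
      using z_closed by (subst R.kos_eq) (auto simp: fun_eq_iff a_minus_def R.r_neg)
    then show "kos R I xR i j \<in> {\<zero>\<^bsub>tuples R I\<^esub>}" by simp
  qed
  show "{\<zero>\<^bsub>tuples R I\<^esub>} \<subseteq> koszul R I xR" using submodsD(2)[OF R.koszul_submod[OF closed(2)]] by simp
qed

lemma soc_single_in_B:
  assumes G: "gorenstein_artin_local_ring R" and c: "2 \<le> card I" and i: "i \<in> I"
    and a: "a \<in> carrier P" "\<alpha> a \<in> soc R" "\<alpha> a \<in> max_ideal R" "\<beta> a \<in> max_ideal S \<cdot>\<^bsub>S\<^esub> max_ideal S"
  shows "single P K i a \<in> B"
proof -
  interpret hA: op_hom "tuples P K" "scals P K" "tuples R I" "scals R I" "\<lambda>v. \<lambda>l\<in>I. \<alpha> (v l)"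
    by (rule \<alpha>.tuples_hom) simp
  interpret hb: op_hom "tuples P K" "scals P K" "tuples S K" "scals S K" "\<lambda>v. \<lambda>l\<in>K. \<beta> (v l)"
    by (rule \<beta>.tuples_hom) simp
  interpret hD: op_hom "tuples P K" "scals P K" "tuples R J" "scals R J" "\<lambda>v. \<lambda>l\<in>J. \<alpha> (v l)"
    by (rule \<alpha>.tuples_hom) simp
  interpret s: op_hom P "mults P" "tuples P K" "scals P K" "single P K i" by (rule \<alpha>.R.single_hom)
  let ?Y = "B \<inter> hb.ker \<inter> hD.ker"
  have Y: "?Y \<in> submods (tuples P K) (scals P K)"
    by (intro hA.G.inter_submod B_submod hb.ker_submod hD.ker_submod)
  have sub: "koszul R I xR \<subseteq> (\<lambda>v. \<lambda>l\<in>I. \<alpha> (v l)) ` ?Y"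
  proof (rule R.koszul_least[OF hA.image_submod[OF Y]])
    fix k k' assume k: "k \<in> I" "k' \<in> I"
    have "kos P K z k k' \<in> B" using k by (intro \<alpha>.R.kos_koszul) auto
    moreover have "\<forall>l\<in>K. \<beta> (kos P K z k k' l) = \<zero>\<^bsub>S\<^esub>"
      using k z_I z_closed by (auto simp: kos_val a_minus_def)
    moreover have "\<forall>l\<in>J. \<alpha> (kos P K z k k' l) = \<zero>\<^bsub>R\<^esub>"
      using k disjoint by (auto simp: kos_val a_minus_def)
    ultimately have Y: "kos P K z k k' \<in> ?Y"
      using B_closed[of "kos P K z k k'"]
      by (simp add: hb.ker_def hD.ker_def coord_eq_zero_iff del: tuples_simps)
    have eq: "kos R I xR k k' = (\<lambda>l\<in>I. \<alpha> (kos P K z k k' l))"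
      using \<alpha>.kos_map[OF closed(1) _ k] by simp
    show "kos R I xR k k' \<in> (\<lambda>v. \<lambda>l\<in>I. \<alpha> (v l)) ` ?Y"
      unfolding eq by (rule imageI[OF Y, of "\<lambda>v. \<lambda>l\<in>I. \<alpha> (v l)"])
  qed
  have "single R I i (\<alpha> a) \<in> koszul R I xR"
    using gorenstein_artin_local_ring.soc_single_koszul[OF G finite_I closed(2) gen_R _ i a(2)] c card_I by simp
  then have "single R I i (\<alpha> a) \<in> (\<lambda>v. \<lambda>l\<in>I. \<alpha> (v l)) ` ?Y" using sub by (rule rev_subsetD)
  then obtain v where v: "v \<in> ?Y" "single R I i (\<alpha> a) = (\<lambda>l\<in>I. \<alpha> (v l))" by (rule imageE)
  have vB: "v \<in> B" "\<And>l. l \<in> K \<Longrightarrow> \<beta> (v l) = \<zero>\<^bsub>S\<^esub>" "\<And>l. l \<in> J \<Longrightarrow> \<alpha> (v l) = \<zero>\<^bsub>R\<^esub>"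
    using v(1) by (simp_all add: hb.ker_def hD.ker_def coord_eq_zero_iff del: tuples_simps)
  have va: "\<alpha> (v l) = (if l = i then \<alpha> a else \<zero>\<^bsub>R\<^esub>)" if "l \<in> I" for l
    using fun_cong[OF v(2), of l] that by (simp add: single_def)
  obtain a1 where a1: "a1 \<in> carrier P" "\<alpha> a1 = \<alpha> a" "\<beta> a1 = \<zero>\<^bsub>S\<^esub>" using left_lift[OF a(3)] by blast
  have "v = single P K i a1"
  proof (rule ext)
    fix l show "v l = single P K i a1 l"
    proof (cases "l \<in> K")
      case True
      have "\<alpha> (v l) = \<alpha> (single P K i a1 l)" "\<beta> (v l) = \<beta> (single P K i a1 l)"
        using True va[of l] vB(2,3)[of l] a1 i disjoint by (auto simp: single_def)
      moreover have "single P K i a1 l \<in> carrier P" using True a1 by (simp add: single_def)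
      ultimately show ?thesis using B_max(1)[OF vB(1) True] by (intro eq_if_projections_eq)
    next
      case False
      then show ?thesis using B_closed[OF vB(1)] by (auto simp: single_def PiE_def extensional_def)
    qed
  qed
  then have s1: "single P K i a1 \<in> B" using vB(1) by simp
  let ?a2 = "a \<ominus> a1"
  have a2: "?a2 \<in> carrier P" "\<alpha> ?a2 = \<zero>\<^bsub>R\<^esub>" "\<beta> ?a2 = \<beta> a"
    using a a1 by (auto simp: a_minus_def R.r_neg)
  have s2: "single P K i ?a2 \<in> B"
    using fibre_generators.single_in_B[OF swap_generators a2(1) _ a2(2) i] a2(3) a(4)
    by (simp add: Un_commute)
  have "a = a1 \<oplus> ?a2" using a(1) a1(1) by (simp add: a_minus_def \<alpha>.R.a_lcomm \<alpha>.R.r_neg)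
  then have "single P K i a = single P K i a1 \<oplus>\<^bsub>tuples P K\<^esub> single P K i ?a2"
    using s.f_add[OF a1(1) a2(1)] by metis
  then show ?thesis using submodsD(4)[OF B_submod s1 s2] by metis
qed

end

locale glued = fibre_generators P R S \<alpha> \<beta> I J z + RG: gorenstein_artin_local_ring R +
    SG: gorenstein_artin_local_ring S + Q: artin_local_ring Q + \<theta>: ring_epi P Q \<theta>
  for P (structure) and R and S and \<alpha> and \<beta> and I J :: "'i set" and z :: "'i \<Rightarrow> _" and Q and \<theta> +
  assumes ker_soc: "\<lbrakk>a \<in> carrier P; \<theta> a = \<zero>\<^bsub>Q\<^esub>\<rbrakk> \<Longrightarrow> \<alpha> a \<in> soc R \<and> \<beta> a \<in> soc S"
    and ker_graph: "\<lbrakk>a \<in> carrier P; \<theta> a = \<zero>\<^bsub>Q\<^esub>\<rbrakk> \<Longrightarrow> \<alpha> a = \<zero>\<^bsub>R\<^esub> \<longleftrightarrow> \<beta> a = \<zero>\<^bsub>S\<^esub>"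
    and ker_onto_soc: "r \<in> soc R \<Longrightarrow> \<exists>a\<in>carrier P. \<theta> a = \<zero>\<^bsub>Q\<^esub> \<and> \<alpha> a = r"
    and soc_R: "soc R \<subseteq> max_ideal R \<cdot>\<^bsub>R\<^esub> max_ideal R"
    and soc_S: "soc S \<subseteq> max_ideal S \<cdot>\<^bsub>S\<^esub> max_ideal S"
begin

definition "D = {a \<in> carrier P. \<theta> a = \<zero>\<^bsub>Q\<^esub>}"

lemma D_submod: "D \<in> submods P (mults P)"
  and D_length: "fin P (mults P) D" "lg P (mults P) D = 1"
proof -
  interpret t: op_hom P "mults P" Q "mults Q" \<theta> by (rule \<theta>.mults_hom)
  interpret a: op_hom P "mults P" R "mults R" \<alpha> by (rule \<alpha>.mults_hom)
  show D: "D \<in> submods P (mults P)" using t.ker_submod by (simp add: D_def t.ker_def)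
  have "D \<inter> a.ker = {\<zero>}"
  proof
    show "D \<inter> a.ker \<subseteq> {\<zero>}"
    proof
      fix x assume "x \<in> D \<inter> a.ker"
      then have x: "x \<in> carrier P" "\<theta> x = \<zero>\<^bsub>Q\<^esub>" "\<alpha> x = \<zero>\<^bsub>R\<^esub>" by (auto simp: D_def a.ker_def)
      then show "x \<in> {\<zero>}" using jointly_injective ker_graph by simp
    qed
    show "{\<zero>} \<subseteq> D \<inter> a.ker" using submodsD(2)[OF D] submodsD(2)[OF a.ker_submod] by simp
  qed
  moreover have "\<alpha> ` D = soc R"
    using ker_soc ker_onto_soc by (auto simp: D_def image_iff)
  ultimately show "fin P (mults P) D" "lg P (mults P) D = 1"
    using a.rank_nullity[OF D] RG.soc_length t.G.fin_zero by simp_all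
qed

lemma soc_max: "soc R \<subseteq> max_ideal R" "soc S \<subseteq> max_ideal S"
  using soc_R soc_S R.prod_max_ideal(2)[OF R.ideal_max_ideal] S.prod_max_ideal(2)[OF S.ideal_max_ideal] by auto

lemma max_ideal_Q_iff:
  assumes a: "a \<in> carrier P"
  shows "\<theta> a \<in> max_ideal Q \<longleftrightarrow> \<alpha> a \<in> max_ideal R"
proof -
  have dir: "\<theta> a \<in> max_ideal Q" if a: "a \<in> carrier P" "\<alpha> a \<in> max_ideal R" for a
  proof (rule ccontr)
    assume "\<theta> a \<notin> max_ideal Q"
    then have "\<theta> a \<in> Units Q" using Q.Units_iff a by simp
    then obtain c where c: "c \<in> carrier Q" "\<theta> a \<otimes>\<^bsub>Q\<^esub> c = \<one>\<^bsub>Q\<^esub>" by (auto simp: Units_def)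
    then obtain b where b: "b \<in> carrier P" "c = \<theta> b" using \<theta>.surj by auto
    have "\<theta> (\<one> \<ominus> a \<otimes> b) = \<zero>\<^bsub>Q\<^esub>" using a b c by (simp add: a_minus_def Q.r_neg)
    moreover have "\<one> \<ominus> a \<otimes> b \<in> carrier P" using a b by simp
    ultimately have "\<alpha> (\<one> \<ominus> a \<otimes> b) \<in> max_ideal R" using ker_soc soc_max(1) by blast
    moreover have "\<alpha> (a \<otimes> b) \<in> max_ideal R" using a b ideal.I_r_closed[OF R.ideal_max_ideal] by simp
    ultimately have "\<alpha> (\<one> \<ominus> a \<otimes> b) \<oplus>\<^bsub>R\<^esub> \<alpha> (a \<otimes> b) \<in> max_ideal R"
      by (rule additive_subgroup.a_closed[OF ideal.axioms(1)[OF R.ideal_max_ideal]])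
    moreover have "\<alpha> (\<one> \<ominus> a \<otimes> b) \<oplus>\<^bsub>R\<^esub> \<alpha> (a \<otimes> b) = \<one>\<^bsub>R\<^esub>"
      using a b by (simp add: a_minus_def R.a_assoc R.l_neg)
    ultimately show False using R.one_notin_max_ideal by simp
  qed
  show ?thesis
  proof
    assume m: "\<theta> a \<in> max_ideal Q"
    show "\<alpha> a \<in> max_ideal R"
    proof (rule ccontr)
      assume "\<alpha> a \<notin> max_ideal R"
      then have "\<alpha> a \<in> Units R" using R.Units_iff a by simp
      then obtain c where c: "c \<in> carrier R" "\<alpha> a \<otimes>\<^bsub>R\<^esub> c = \<one>\<^bsub>R\<^esub>" by (auto simp: Units_def)
      then obtain b where b: "b \<in> carrier P" "c = \<alpha> b" using \<alpha>.surj by auto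
      have e0: "\<alpha> (\<one> \<ominus> a \<otimes> b) = \<zero>\<^bsub>R\<^esub>" using a b c by (simp add: a_minus_def R.r_neg)
      have "\<theta> (\<one> \<ominus> a \<otimes> b) \<in> max_ideal Q"
      proof (rule dir)
        show "\<one> \<ominus> a \<otimes> b \<in> carrier P" using a b by simp
        show "\<alpha> (\<one> \<ominus> a \<otimes> b) \<in> max_ideal R"
          unfolding e0 by (rule additive_subgroup.zero_closed[OF ideal.axioms(1)[OF R.ideal_max_ideal]])
      qed
      moreover have "\<theta> (a \<otimes> b) \<in> max_ideal Q" using a b m ideal.I_r_closed[OF Q.ideal_max_ideal] by simp
      ultimately have "\<theta> (\<one> \<ominus> a \<otimes> b) \<oplus>\<^bsub>Q\<^esub> \<theta> (a \<otimes> b) \<in> max_ideal Q"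
        by (rule additive_subgroup.a_closed[OF ideal.axioms(1)[OF Q.ideal_max_ideal]])
      moreover have "\<theta> (\<one> \<ominus> a \<otimes> b) \<oplus>\<^bsub>Q\<^esub> \<theta> (a \<otimes> b) = \<one>\<^bsub>Q\<^esub>"
        using a b by (simp add: a_minus_def Q.a_assoc Q.l_neg)
      ultimately show False using Q.one_notin_max_ideal by simp
    qed
  qed (use dir a in blast)
qed

abbreviation "M \<equiv> pullback (max_ideal R) (max_ideal S)"
abbreviation "E \<equiv> pullback (max_ideal R \<cdot>\<^bsub>R\<^esub> max_ideal R) (max_ideal S \<cdot>\<^bsub>S\<^esub> max_ideal S)"

lemma image_M: "\<theta> ` M = max_ideal Q"
proof
  show "\<theta> ` M \<subseteq> max_ideal Q" using max_ideal_Q_iff by (auto simp: pullback_def)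
  show "max_ideal Q \<subseteq> \<theta> ` M"
  proof
    fix c assume c: "c \<in> max_ideal Q"
    then have "c \<in> \<theta> ` carrier P" using Q.max_ideal_closed \<theta>.surj by auto
    then obtain a where a: "a \<in> carrier P" "c = \<theta> a" by auto
    then have "a \<in> M" using c max_ideal_Q_iff[OF a(1)] compat[OF a(1)] by (simp add: pullback_def)
    then show "c \<in> \<theta> ` M" using a(2) by simp
  qed
qed

lemma mm_ideals:
  "ideal (max_ideal R \<cdot>\<^bsub>R\<^esub> max_ideal R) R" "max_ideal R \<cdot>\<^bsub>R\<^esub> max_ideal R \<subseteq> max_ideal R"
  "ideal (max_ideal S \<cdot>\<^bsub>S\<^esub> max_ideal S) S" "max_ideal S \<cdot>\<^bsub>S\<^esub> max_ideal S \<subseteq> max_ideal S"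
  using R.prod_max_ideal[OF R.ideal_max_ideal] S.prod_max_ideal[OF S.ideal_max_ideal] by auto

lemma max_ideal_Q_length:
  "lg Q (mults Q) (max_ideal Q) + 1 = lg R (mults R) (max_ideal R) + lg S (mults S) (max_ideal S)"
proof -
  interpret t: op_hom P "mults P" Q "mults Q" \<theta> by (rule \<theta>.mults_hom)
  note m = pullback_length[OF R.ideal_max_ideal order_refl RG.fin_ideal[OF R.ideal_max_ideal]
      S.ideal_max_ideal order_refl SG.fin_ideal[OF S.ideal_max_ideal]]
  have "M \<inter> t.ker = D" using ker_soc soc_max by (auto simp: D_def t.ker_def pullback_def)
  then show ?thesis using t.rank_nullity(4)[OF m(1)] m D_length image_M by simp
qed

lemma max_ideal_square_Q_length:
  "lg Q (mults Q) (max_ideal Q \<cdot>\<^bsub>Q\<^esub> max_ideal Q) + 1 \<le>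
    lg R (mults R) (max_ideal R \<cdot>\<^bsub>R\<^esub> max_ideal R) + lg S (mults S) (max_ideal S \<cdot>\<^bsub>S\<^esub> max_ideal S)"
proof -
  interpret t: op_hom P "mults P" Q "mults Q" \<theta> by (rule \<theta>.mults_hom)
  note e = pullback_length[OF mm_ideals(1,2) RG.fin_ideal[OF mm_ideals(1)] mm_ideals(3,4) SG.fin_ideal[OF mm_ideals(3)]]
  have E: "\<theta> ` E \<in> submods Q (mults Q)" by (rule t.image_submod[OF e(1)])
  have "c \<in> \<theta> ` E" if "c \<in> max_ideal Q \<cdot>\<^bsub>Q\<^esub> max_ideal Q" for c
    using that
  proof (induction rule: ideal_prod.induct)
    case (prod c d)
    then obtain a b where ab: "a \<in> M" "c = \<theta> a" "b \<in> M" "d = \<theta> b" using image_M by blast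
    have "a \<otimes> b \<in> E" using ab by (auto simp: pullback_def intro: ideal_prod.prod)
    moreover have "c \<otimes>\<^bsub>Q\<^esub> d = \<theta> (a \<otimes> b)" using ab by (simp add: pullback_def)
    ultimately show ?case by (rule image_eqI[rotated])
  next
    case (sum c d)
    then show ?case using submodsD(4)[OF E] by blast
  qed
  then have "lg Q (mults Q) (max_ideal Q \<cdot>\<^bsub>Q\<^esub> max_ideal Q) \<le> lg Q (mults Q) (\<theta> ` E)"
    using Q.prod_max_ideal(1)[OF Q.ideal_max_ideal] t.rank_nullity(2)[OF e(1) disjI1[OF e(2)]]
    by (intro t.H.lg_mono) (auto simp: Q.ideal_iff_submod)
  moreover have "E \<inter> t.ker = D" using ker_soc soc_R soc_S by (auto simp: D_def t.ker_def pullback_def)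
  ultimately show ?thesis using t.rank_nullity(4)[OF e(1)] e D_length by simp
qed

lemma gen_Q: "Idl\<^bsub>Q\<^esub> ((\<lambda>k. \<theta> (z k)) ` K) = max_ideal Q"
proof
  interpret t: op_hom P "mults P" Q "mults Q" \<theta> by (rule \<theta>.mults_hom)
  interpret a: op_hom P "mults P" R "mults R" \<alpha> by (rule \<alpha>.mults_hom)
  interpret b: op_hom P "mults P" S "mults S" \<beta> by (rule \<beta>.mults_hom)
  have carr: "(\<lambda>k. \<theta> (z k)) ` K \<subseteq> carrier Q" using z_closed by auto
  let ?G = "Idl\<^bsub>Q\<^esub> ((\<lambda>k. \<theta> (z k)) ` K)"
  have G: "ideal ?G Q" "(\<lambda>k. \<theta> (z k)) ` K \<subseteq> ?G" using Q.genideal_ideal[OF carr] Q.genideal_self[OF carr] by auto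
  show "?G \<subseteq> max_ideal Q"
    using z_max z_closed max_ideal_Q_iff by (intro Q.genideal_minimal Q.ideal_max_ideal) auto
  let ?N = "{a \<in> carrier P. \<theta> a \<in> ?G}"
  have N: "?N \<in> submods P (mults P)" using t.vimage_submod[of ?G] G by (simp add: Q.ideal_iff_submod)
  have left: "max_ideal R \<subseteq> \<alpha> ` (?N \<inter> b.ker)"
  proof -
    have "ideal (\<alpha> ` (?N \<inter> b.ker)) R"
      using a.image_submod[OF t.G.inter_submod[OF N b.ker_submod]] by (simp only: R.ideal_iff_submod)
    then show ?thesis
      unfolding gen_R[symmetric] using G z_closed z_I
      by (intro R.genideal_minimal) (auto simp: b.ker_def intro!: imageI)
  qed
  have right: "max_ideal S \<subseteq> \<beta> ` (?N \<inter> a.ker)"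
  proof -
    have "ideal (\<beta> ` (?N \<inter> a.ker)) S"
      using b.image_submod[OF t.G.inter_submod[OF N a.ker_submod]] by (simp only: S.ideal_iff_submod)
    then show ?thesis
      unfolding gen_S[symmetric] using G z_closed z_J
      by (intro S.genideal_minimal) (auto simp: a.ker_def intro!: imageI)
  qed
  have "M \<subseteq> ?N"
  proof
    fix x assume x: "x \<in> M"
    then have xc: "x \<in> carrier P" "\<alpha> x \<in> max_ideal R" "\<beta> x \<in> max_ideal S" by (auto simp: pullback_def)
    obtain u where u: "u \<in> ?N" "u \<in> b.ker" "\<alpha> x = \<alpha> u" using left xc(2) by blast
    obtain w where w: "w \<in> ?N" "w \<in> a.ker" "\<beta> x = \<beta> w" using right xc(3) by blast
    have uw: "u \<in> carrier P" "\<beta> u = \<zero>\<^bsub>S\<^esub>" "w \<in> carrier P" "\<alpha> w = \<zero>\<^bsub>R\<^esub>"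
      using u(2) w(2) by (auto simp: a.ker_def b.ker_def)
    have "x = u \<oplus> w" using xc uw u(3) w(3) by (intro eq_if_projections_eq) auto
    then show "x \<in> ?N" using submodsD(4)[OF N u(1) w(1)] by simp
  qed
  then show "max_ideal Q \<subseteq> ?G" unfolding image_M[symmetric] by blast
qed

lemma card_K: "card K = card I + card J"
  using card_Un_disjoint[OF finite_I finite_J disjoint] .

lemma edim_Q: "edim Q = card K"
proof (rule antisym)
  have "edim Q \<le> card ((\<lambda>k. \<theta> (z k)) ` K)"
    unfolding edim_def using gen_Q finite_K z_closed by (intro Q.min_gens_le_card) auto
  also have "\<dots> \<le> card K" by (rule card_image_le[OF finite_K])
  finally show "edim Q \<le> card K" .
  show "card K \<le> edim Q"
    using max_ideal_Q_length max_ideal_square_Q_length Q.length_max_ideal RG.length_max_ideal SG.length_max_ideal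
      card_I card_J card_K by linarith
qed

text \<open>The coordinates at which the Koszul module contains vectors from the kernel of the map onto
  \<open>Q\<close>. A factor with a single generator has no Koszul relations of its own to reach its socle.\<close>

definition "K' = (if 2 \<le> card I then I else {}) \<union> (if 2 \<le> card J then J else {})"

lemma koszul_meets_kernel:
  "B \<inter> {v \<in> carrier (tuples P K). (\<lambda>l\<in>K. \<theta> (v l)) = \<zero>\<^bsub>tuples Q K\<^esub>} = tuples_in P K K' D"
proof
  show "B \<inter> {v \<in> carrier (tuples P K). (\<lambda>l\<in>K. \<theta> (v l)) = \<zero>\<^bsub>tuples Q K\<^esub>} \<subseteq> tuples_in P K K' D"
  proof
    fix v assume "v \<in> B \<inter> {v \<in> carrier (tuples P K). (\<lambda>l\<in>K. \<theta> (v l)) = \<zero>\<^bsub>tuples Q K\<^esub>}"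
    then have v: "v \<in> B" "v \<in> carrier (tuples P K)" "\<forall>l\<in>K. \<theta> (v l) = \<zero>\<^bsub>Q\<^esub>"
      unfolding coord_eq_zero_iff by blast+
    have vD: "v l \<in> D" if "l \<in> K" for l using v that B_max(1)[OF v(1) that] by (simp add: D_def)
    have 1: "v i = \<zero>" if c: "card I < 2" and i: "i \<in> I" for i
    proof -
      have "(\<lambda>l\<in>I. \<alpha> (v l)) \<in> koszul R I xR"
        unfolding koszul_image[symmetric] by (rule imageI[OF v(1), of "\<lambda>v. \<lambda>l\<in>I. \<alpha> (v l)"])
      then have "(\<lambda>l\<in>I. \<alpha> (v l)) = \<zero>\<^bsub>tuples R I\<^esub>" unfolding koszul_trivial[OF c] by blast
      then have "\<alpha> (v i) = \<zero>\<^bsub>R\<^esub>" using i unfolding coord_eq_zero_iff by blast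
      then show ?thesis using vD[of i] i ker_graph jointly_injective by (simp add: D_def)
    qed
    have 2: "v j = \<zero>" if c: "card J < 2" and j: "j \<in> J" for j
    proof -
      have "(\<lambda>l\<in>J. \<beta> (v l)) \<in> koszul S J yS"
        using fibre_generators.koszul_image[OF swap_generators] imageI[OF v(1), of "\<lambda>v. \<lambda>l\<in>J. \<beta> (v l)"]
        by (simp add: Un_commute)
      then have "(\<lambda>l\<in>J. \<beta> (v l)) = \<zero>\<^bsub>tuples S J\<^esub>"
        unfolding fibre_generators.koszul_trivial[OF swap_generators c] by blast
      then have "\<beta> (v j) = \<zero>\<^bsub>S\<^esub>" using j unfolding coord_eq_zero_iff by blast
      then show ?thesis using vD[of j] j ker_graph jointly_injective by (simp add: D_def)
    qed
    have "v l = \<zero>" if "l \<in> K - K'" for l using that 1[of l] 2[of l] by (auto simp: K'_def split: if_splits)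
    then show "v \<in> tuples_in P K K' D" using v(2) vD by (auto simp: tuples_in_def)
  qed
  show "tuples_in P K K' D \<subseteq> B \<inter> {v \<in> carrier (tuples P K). (\<lambda>l\<in>K. \<theta> (v l)) = \<zero>\<^bsub>tuples Q K\<^esub>}"
  proof
    fix v assume v: "v \<in> tuples_in P K K' D"
    have vc: "v \<in> carrier (tuples P K)" using v by (simp add: tuples_in_def)
    have D0: "\<zero> \<in> D" by (rule submodsD(2)[OF D_submod])
    have vD: "v l \<in> D" if "l \<in> K" for l using v that D0 by (cases "l \<in> K'") (auto simp: tuples_in_def)
    have "v \<in> B"
    proof (rule \<alpha>.R.mem_if_singles_mem[OF B_submod finite_K vc])
      fix l assume l: "l \<in> K"
      have a: "v l \<in> carrier P" "\<alpha> (v l) \<in> soc R" "\<beta> (v l) \<in> soc S"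
        using vD[OF l] ker_soc by (auto simp: D_def)
      note a' = subsetD[OF soc_max(1) a(2)] subsetD[OF soc_max(2) a(3)] subsetD[OF soc_R a(2)] subsetD[OF soc_S a(3)]
      show "single P K l (v l) \<in> B"
      proof (cases "l \<in> K'")
        case True
        then have "2 \<le> card I \<and> l \<in> I \<or> 2 \<le> card J \<and> l \<in> J" by (auto simp: K'_def split: if_splits)
        then show ?thesis
        proof
          assume "2 \<le> card I \<and> l \<in> I"
          then show ?thesis
            using soc_single_in_B[OF RG.gorenstein_artin_local_ring_axioms _ _ a(1,2) a'(1,4)] by simp
        next
          assume "2 \<le> card J \<and> l \<in> J"
          then show ?thesis
            using fibre_generators.soc_single_in_B[OF swap_generators SG.gorenstein_artin_local_ring_axioms _ _ a(1,3) a'(2,3)]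
            by (simp add: Un_commute)
        qed
      next
        case False
        then have "v l = \<zero>" using v l by (auto simp: tuples_in_def)
        then have "single P K l (v l) = \<zero>\<^bsub>tuples P K\<^esub>" by (auto simp: single_def fun_eq_iff)
        then show ?thesis using submodsD(2)[OF B_submod] by metis
      qed
    qed
    then show "v \<in> B \<inter> {v \<in> carrier (tuples P K). (\<lambda>l\<in>K. \<theta> (v l)) = \<zero>\<^bsub>tuples Q K\<^esub>}"
      using vc vD unfolding coord_eq_zero_iff D_def by blast
  qed
qed

text \<open>Both modules have their lengths determined by those over \<open>R\<close> and \<open>S\<close>, the syzygies by rank
  and nullity and the Koszul module by the filtration. The product term comes from the mixed
  relations, and \<open>phi\<close> from the coordinates at which the kernel meets the Koszul module.\<close>

theorem koszul_homology_Q: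
  assumes "1 \<le> card I" "1 \<le> card J"
  shows "int (len (submods (tuples Q K) (scals Q K)) (koszul Q K (\<lambda>k. \<theta> (z k))) (syz Q K (\<lambda>k. \<theta> (z k)))) =
    int (len (submods (tuples R I) (scals R I)) (koszul R I xR) (syz R I xR)) +
    int (len (submods (tuples S J) (scals S J)) (koszul S J yS) (syz S J yS)) +
    int (card I) * int (card J) + phi (card I) (card J)"
proof -
  interpret h: op_hom "tuples P K" "scals P K" "tuples Q K" "scals Q K" "\<lambda>v. \<lambda>l\<in>K. \<theta> (v l)"
    by (rule \<theta>.tuples_hom) simp
  have D: "ideal D P" using D_submod by (simp add: \<alpha>.R.ideal_iff_submod)
  have sub: "finite K'" "K' \<subseteq> K" using finite_I finite_J by (auto simp: K'_def)
  have cK': "card K' = (if 2 \<le> card I then card I else 0) + (if 2 \<le> card J then card J else 0)"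
    unfolding K'_def using finite_I finite_J disjoint by (simp add: card_Un_disjoint)
  have t: "lg (tuples P K) (scals P K) (tuples_in P K K' D) = card K'"
    using \<alpha>.R.tuples_in_length[OF D D_length(1) sub] D_length(2) by simp
  note Bl = koszul_length[OF RG.finite_length SG.finite_length]
  have "B \<inter> h.ker = tuples_in P K K' D" using koszul_meets_kernel unfolding h.ker_def .
  then have 1: "lg (tuples P K) (scals P K) B = card K' + lg (tuples Q K) (scals Q K) (koszul Q K (\<lambda>k. \<theta> (z k)))"
    using h.rank_nullity(4)[OF B_submod disjI1[OF Bl(1)]] t \<theta>.koszul_map[OF closed(1)] by simp
  have zQ: "(\<lambda>k. \<theta> (z k)) \<in> K \<rightarrow> carrier Q" using z_closed by auto
  note hQ = Q.koszul_homology_length(2)[OF finite_K zQ gen_Q]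
  note hR = RG.koszul_homology_length(2)[OF finite_I closed(2) gen_R]
  note hS = SG.koszul_homology_length(2)[OF finite_J closed(3) gen_S]
  have r: "lg R (mults R) (max_ideal R) = lg R (mults R) (max_ideal R \<cdot>\<^bsub>R\<^esub> max_ideal R) + card I"
    using RG.length_max_ideal card_I by simp
  have s: "lg S (mults S) (max_ideal S) = lg S (mults S) (max_ideal S \<cdot>\<^bsub>S\<^esub> max_ideal S) + card J"
    using SG.length_max_ideal card_J by simp
  define m n r2 s2 q bQ bR bS hq hr hs where defs: "m = int (card I)" "n = int (card J)"
    "r2 = int (lg R (mults R) (max_ideal R \<cdot>\<^bsub>R\<^esub> max_ideal R))"
    "s2 = int (lg S (mults S) (max_ideal S \<cdot>\<^bsub>S\<^esub> max_ideal S))"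
    "q = int (lg Q (mults Q) (max_ideal Q))"
    "bQ = int (lg (tuples Q K) (scals Q K) (koszul Q K (\<lambda>k. \<theta> (z k))))"
    "bR = int (lg (tuples R I) (scals R I) (koszul R I xR))"
    "bS = int (lg (tuples S J) (scals S J) (koszul S J yS))"
    "hq = int (len (submods (tuples Q K) (scals Q K)) (koszul Q K (\<lambda>k. \<theta> (z k))) (syz Q K (\<lambda>k. \<theta> (z k))))"
    "hr = int (len (submods (tuples R I) (scals R I)) (koszul R I xR) (syz R I xR))"
    "hs = int (len (submods (tuples S J) (scals S J)) (koszul S J yS) (syz S J yS))"
  have iR: "int (lg R (mults R) (max_ideal R)) = r2 + m" using r by (simp add: defs)
  have iS: "int (lg S (mults S) (max_ideal S)) = s2 + n" using s by (simp add: defs)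
  have iK: "int (card K) = m + n" using card_K by (simp add: defs)
  have eq: "q + 1 = (r2 + m) + (s2 + n)"
    using arg_cong[OF max_ideal_Q_length, of int] iR iS by (simp add: defs)
  have eQ: "bQ + hq + q = (m + n) * (q + 1)"
    using arg_cong[OF hQ, of int] iK by (simp add: defs algebra_simps)
  have eR: "bR + hr + (r2 + m) = m * (r2 + m + 1)"
    using arg_cong[OF hR, of int] iR by (simp add: defs algebra_simps)
  have eS: "bS + hs + (s2 + n) = n * (s2 + n + 1)"
    using arg_cong[OF hS, of int] iS by (simp add: defs algebra_simps)
  have eB: "int (card K') + bQ = bR + m * (s2 + n) + bS + n * r2"
    using arg_cong[OF Bl(2), of int] arg_cong[OF 1, of int] iS by (simp add: defs)
  have eK: "int (card K') = m + n + phi (card I) (card J) - 1"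
    using assms cK' by (auto simp: phi_def defs split: if_splits)
  have q: "q = r2 + m + s2 + n - 1" using eq by simp
  have "hq = (m + n) * (q + 1) - q - bQ" using eQ by simp
  also have "\<dots> = (m + n) * (q + 1) - q + (m + n + phi (card I) (card J) - 1) - (bR + m * (s2 + n) + bS + n * r2)"
    using eB eK by simp
  also have "\<dots> = hr + hs + m * n + phi (card I) (card J)"
  proof -
    have "hr = m * (r2 + m + 1) - (r2 + m) - bR" "hs = n * (s2 + n + 1) - (s2 + n) - bS" using eR eS by simp_all
    then show ?thesis unfolding q by (simp add: algebra_simps)
  qed
  finally show ?thesis by (simp add: defs)
qed

end

section \<open>Coefficient fields when the maximal ideal has square zero\<close>

text \<open>Lists of coefficients, lowest degree first, represent polynomials.\<close>

primrec ev :: "('a, 'm) ring_scheme \<Rightarrow> 'a list \<Rightarrow> 'a \<Rightarrow> 'a"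
  where "ev R [] x = \<zero>\<^bsub>R\<^esub>" | "ev R (c # cs) x = c \<oplus>\<^bsub>R\<^esub> x \<otimes>\<^bsub>R\<^esub> ev R cs x"

text \<open>The value of the derivative.\<close>

primrec dv :: "('a, 'm) ring_scheme \<Rightarrow> 'a list \<Rightarrow> 'a \<Rightarrow> 'a"
  where "dv R [] x = \<zero>\<^bsub>R\<^esub>" | "dv R (c # cs) x = ev R cs x \<oplus>\<^bsub>R\<^esub> x \<otimes>\<^bsub>R\<^esub> dv R cs x"

context cring
begin

lemma ev_closed [simp]: "set cs \<subseteq> carrier R \<Longrightarrow> x \<in> carrier R \<Longrightarrow> ev R cs x \<in> carrier R"
  by (induction cs) auto

lemma dv_closed [simp]: "set cs \<subseteq> carrier R \<Longrightarrow> x \<in> carrier R \<Longrightarrow> dv R cs x \<in> carrier R"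
  by (induction cs) auto

lemma ev_snoc:
  assumes "set cs \<subseteq> carrier R" "u \<in> carrier R" "x \<in> carrier R"
  shows "ev R (cs @ [u]) x = ev R cs x \<oplus> x [^] length cs \<otimes> u"
  using assms(1)
proof (induction cs)
  case Nil
  then show ?case using assms by simp
next
  case (Cons c cs)
  define e q where "e = ev R cs x" "q = x [^] length cs"
  have car: "e \<in> carrier R" "q \<in> carrier R" "c \<in> carrier R" using Cons assms by (auto simp: e_q_def)
  have "c \<oplus> x \<otimes> (e \<oplus> q \<otimes> u) = (c \<oplus> x \<otimes> e) \<oplus> (q \<otimes> x) \<otimes> u"
    using car assms by algebra
  then show ?case using Cons by (simp add: e_q_def)
qed

lemma ev_sub_scal:
  assumes "length xs = length ys" "set xs \<subseteq> carrier R" "set ys \<subseteq> carrier R" "u \<in> carrier R" "x \<in> carrier R"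
  shows "ev R (map2 (\<lambda>a b. a \<ominus> u \<otimes> b) xs ys) x = ev R xs x \<ominus> u \<otimes> ev R ys x"
  using assms(1-3)
proof (induction xs ys rule: list_induct2)
  case Nil
  then show ?case using assms by (simp add: a_minus_def)
next
  case (Cons a as b bs)
  define e f where "e = ev R as x" "f = ev R bs x"
  have car: "e \<in> carrier R" "f \<in> carrier R" "a \<in> carrier R" "b \<in> carrier R" using Cons assms by (auto simp: e_f_def)
  have "(a \<ominus> u \<otimes> b) \<oplus> x \<otimes> (e \<ominus> u \<otimes> f) = (a \<oplus> x \<otimes> e) \<ominus> u \<otimes> (b \<oplus> x \<otimes> f)"
    using car assms by algebra
  then show ?case using Cons by (simp add: e_f_def)
qed

lemma ev_scal:
  assumes "set cs \<subseteq> carrier R" "u \<in> carrier R" "x \<in> carrier R"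
  shows "ev R (map (\<lambda>c. u \<otimes> c) cs) x = u \<otimes> ev R cs x"
  using assms(1)
proof (induction cs)
  case (Cons c cs)
  then show ?case using assms by (simp add: r_distr m_lcomm)
qed (use assms in simp)

text \<open>Taylor expansion at an element of square zero.\<close>

lemma ev_shift:
  assumes "set cs \<subseteq> carrier R" "x \<in> carrier R" "t \<in> carrier R" "t \<otimes> t = \<zero>"
  shows "ev R cs (x \<oplus> t) = ev R cs x \<oplus> dv R cs x \<otimes> t"
  using assms(1)
proof (induction cs)
  case Nil
  then show ?case using assms by simp
next
  case (Cons c cs)
  define e f where "e = ev R cs x" "f = dv R cs x"
  have car: "e \<in> carrier R" "f \<in> carrier R" "c \<in> carrier R" using Cons assms by (auto simp: e_f_def)
  have "c \<oplus> (x \<oplus> t) \<otimes> (e \<oplus> f \<otimes> t) = ((c \<oplus> x \<otimes> e) \<oplus> (e \<oplus> x \<otimes> f) \<otimes> t) \<oplus> f \<otimes> (t \<otimes> t)"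
    using car assms(2,3) by algebra
  then show ?case using Cons assms car by (simp add: e_f_def)
qed

lemma dv_snoc:
  assumes C: "subring C R" and cs: "set cs \<subseteq> C" and u: "u \<in> C" and x: "x \<in> carrier R"
  shows "\<exists>gs. set gs \<subseteq> C \<and> length gs = length cs \<and> dv R (cs @ [u]) x = ev R gs x \<and>
    (gs \<noteq> [] \<longrightarrow> last gs = [length cs] \<cdot> u)"
  using cs
proof (induction cs)
  case Nil
  then show ?case using x by (intro exI[of _ "[]"]) simp
next
  case (Cons c cs)
  then obtain gs where gs: "set gs \<subseteq> C" "length gs = length cs" "dv R (cs @ [u]) x = ev R gs x"
    "gs \<noteq> [] \<longrightarrow> last gs = [length cs] \<cdot> u" by auto
  have CR: "C \<subseteq> carrier R" by (rule subringE(1)[OF C])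
  let ?m = "\<ominus> \<one>"
  have m: "?m \<in> C" using subringE(3,5)[OF C] by blast
  let ?hs = "map2 (\<lambda>a b. a \<ominus> ?m \<otimes> b) (cs @ [u]) (\<zero> # gs)"
  have uc: "u \<in> carrier R" using u CR by auto
  have z: "\<zero> \<in> C" by (rule subringE(2)[OF C])
  have sub: "a \<ominus> ?m \<otimes> b \<in> C" if "a \<in> C" "b \<in> C" for a b
    using that m subringE(5,6,7)[OF C] unfolding a_minus_def by blast
  have set: "set ?hs \<subseteq> C"
  proof
    fix w assume "w \<in> set ?hs"
    then obtain a b where ab: "(a, b) \<in> set (zip (cs @ [u]) (\<zero> # gs))" "w = a \<ominus> ?m \<otimes> b" by auto
    have "a \<in> set (cs @ [u])" "b \<in> set (\<zero> # gs)"
      using set_zip_leftD[OF ab(1)] set_zip_rightD[OF ab(1)] .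
    then have "a \<in> C" "b \<in> C" using Cons.prems gs(1) u z by auto
    then show "w \<in> C" using sub ab(2) by simp
  qed
  have "ev R ?hs x = ev R (cs @ [u]) x \<ominus> ?m \<otimes> ev R (\<zero> # gs) x"
    using Cons.prems gs u z CR x by (intro ev_sub_scal) auto
  also have "\<dots> = ev R (cs @ [u]) x \<oplus> x \<otimes> ev R gs x"
  proof -
    have "ev R (cs @ [u]) x \<in> carrier R" "ev R gs x \<in> carrier R"
    proof -
      have "set (cs @ [u]) \<subseteq> carrier R" "set gs \<subseteq> carrier R" using Cons.prems gs(1) uc CR by auto
      then show "ev R (cs @ [u]) x \<in> carrier R" "ev R gs x \<in> carrier R" using x by (simp_all del: set_append)
    qed
    then show ?thesis using x by (simp add: a_minus_def l_minus)
  qed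
  also have "\<dots> = dv R ((c # cs) @ [u]) x" using gs(3) by simp
  finally have eq: "dv R ((c # cs) @ [u]) x = ev R ?hs x" by simp
  have "last ?hs = [length (c # cs)] \<cdot> u"
  proof -
    have len: "length (cs @ [u]) = length (\<zero> # gs)" using gs by simp
    have "last (zip (cs @ [u]) (\<zero> # gs)) = (u, last (\<zero> # gs))"
      using len by (subst last_zip) auto
    then have "last ?hs = u \<ominus> ?m \<otimes> last (\<zero> # gs)"
      using len by (subst last_map) auto
    also have "last (\<zero> # gs) = [length cs] \<cdot> u"
      using gs(2,4) by (cases "gs = []") auto
    also have "u \<ominus> ?m \<otimes> ([length cs] \<cdot> u) = [length (c # cs)] \<cdot> u"
      using uc by (simp add: a_minus_def l_minus add.nat_pow_Suc a_comm)
    finally show ?thesis .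
  qed
  then show ?case using eq set gs(2) by (intro exI[of _ ?hs]) auto
qed

lemma binomial_cring:
  assumes a: "a \<in> carrier R" and b: "b \<in> carrier R"
  shows "(a \<oplus> b) [^] n = (\<Oplus>i\<in>{..n}. [(n choose i)] \<cdot> (a [^] i \<otimes> b [^] (n - i)))"
proof (induction n)
  case 0
  then show ?case using a b by simp
next
  case (Suc n)
  let ?f = "\<lambda>i. [(n choose i)] \<cdot> (a [^] i \<otimes> b [^] (n - i))"
  have fc: "?f \<in> UNIV \<rightarrow> carrier R" using a b by auto
  let ?A = "\<lambda>i. [(n choose i)] \<cdot> (a [^] Suc i \<otimes> b [^] (n - i))"
  let ?B = "\<lambda>i. [(n choose i)] \<cdot> (a [^] i \<otimes> b [^] (Suc n - i))"
  let ?C = "\<lambda>i. [(n choose Suc i)] \<cdot> (a [^] Suc i \<otimes> b [^] (n - i))"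
  have c: "?A \<in> UNIV \<rightarrow> carrier R" "?B \<in> UNIV \<rightarrow> carrier R" "?C \<in> UNIV \<rightarrow> carrier R" using a b by auto
  have cl: "(\<Oplus>i\<in>{..n}. ?A i) \<in> carrier R" "(\<Oplus>i\<in>{..n}. ?B i) \<in> carrier R" "(\<Oplus>i\<in>{..n}. ?C i) \<in> carrier R"
    using c by (auto intro!: finsum_closed)
  have A: "a \<otimes> (\<Oplus>i\<in>{..n}. ?f i) = (\<Oplus>i\<in>{..n}. ?A i)"
    using a b fc by (subst finsum_rdistr) (auto intro!: finsum_cong' simp: add_pow_rdistr m_ac)
  have "b \<otimes> (\<Oplus>i\<in>{..n}. ?f i) = (\<Oplus>i\<in>{..n}. ?B i)"
    using a b fc by (subst finsum_rdistr) (auto intro!: finsum_cong' simp: add_pow_rdistr m_ac Suc_diff_le)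
  also have "\<dots> = (\<Oplus>i\<in>{..Suc n}. ?B i)"
  proof -
    have "?B (Suc n) = \<zero>" unfolding binomial_eq_0[OF lessI] by (rule add.nat_pow_0)
    moreover have "?B \<in> {..Suc n} \<rightarrow> carrier R" using c(2) by auto
    then have "(\<Oplus>i\<in>{..Suc n}. ?B i) = ?B (Suc n) \<oplus> (\<Oplus>i\<in>{..n}. ?B i)" by (rule finsum_Suc)
    ultimately show ?thesis using cl(2) by (metis l_zero)
  qed
  also have "\<dots> = (\<Oplus>i\<in>{..n}. ?C i) \<oplus> b [^] Suc n"
    using finsum_Suc2[of ?B n] c(2) a b by (simp add: Pi_def)
  finally have B: "b \<otimes> (\<Oplus>i\<in>{..n}. ?f i) = (\<Oplus>i\<in>{..n}. ?C i) \<oplus> b [^] Suc n" .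
  let ?T = "\<lambda>i. [(Suc n choose i)] \<cdot> (a [^] i \<otimes> b [^] (Suc n - i))"
  have "(\<Oplus>i\<in>{..Suc n}. ?T i) = (\<Oplus>i\<in>{..n}. ?T (Suc i)) \<oplus> ?T 0"
    using finsum_Suc2[of ?T n] a b by (simp add: Pi_def)
  also have "(\<Oplus>i\<in>{..n}. ?T (Suc i)) = (\<Oplus>i\<in>{..n}. ?A i \<oplus> ?C i)"
    using a b by (intro finsum_cong') (auto simp: add.nat_pow_mult)
  also have "\<dots> = (\<Oplus>i\<in>{..n}. ?A i) \<oplus> (\<Oplus>i\<in>{..n}. ?C i)"
    using c by (intro finsum_addf) auto
  also have "?T 0 = b [^] Suc n" using b by simp
  finally have T: "(\<Oplus>i\<in>{..Suc n}. ?T i) = (\<Oplus>i\<in>{..n}. ?A i) \<oplus> (\<Oplus>i\<in>{..n}. ?C i) \<oplus> b [^] Suc n" .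
  have "(a \<oplus> b) [^] Suc n = (a \<oplus> b) \<otimes> (\<Oplus>i\<in>{..n}. ?f i)"
    using Suc a b by (simp add: m_comm)
  also have "\<dots> = a \<otimes> (\<Oplus>i\<in>{..n}. ?f i) \<oplus> b \<otimes> (\<Oplus>i\<in>{..n}. ?f i)"
    using a b fc by (intro l_distr finsum_closed) auto
  finally show ?case using A B T cl b by (simp add: a_assoc)
qed

lemma frobenius_add:
  assumes q: "Factorial_Ring.prime (q::nat)" "[q] \<cdot> \<one> = \<zero>" and a: "a \<in> carrier R" and b: "b \<in> carrier R"
  shows "(a \<oplus> b) [^] q = a [^] q \<oplus> b [^] q"
proof -
  have q2: "q \<ge> 2" by (rule prime_ge_2_nat[OF q(1)])
  have mult: "[j] \<cdot> c = \<zero>" if h: "q dvd j" "c \<in> carrier R" for j c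
  proof -
    obtain i where i: "j = i * q" using h(1) by (metis dvd_def mult.commute)
    have "[j] \<cdot> c = [i] \<cdot> ([q] \<cdot> (\<one> \<otimes> c))" using h i by (simp add: add.nat_pow_pow mult.commute)
    also have "[q] \<cdot> (\<one> \<otimes> c) = ([q] \<cdot> \<one>) \<otimes> c" using h by (simp add: add_pow_ldistr)
    finally show ?thesis using q h by simp
  qed
  obtain r where r: "q = Suc (Suc r)" using q2 by (metis add_2_eq_Suc le_Suc_ex)
  have dvd: "q dvd (q choose Suc i)" if "i \<le> r" for i
  proof -
    have "Suc i * (q choose Suc i) = q * (Suc r choose i)"
      unfolding r by (rule Suc_times_binomial)
    then have "q dvd Suc i * (q choose Suc i)" by simp
    moreover have "\<not> q dvd Suc i" using that r by (auto dest!: dvd_imp_le)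
    ultimately show ?thesis using q(1) prime_dvd_mult_nat by blast
  qed
  let ?T = "\<lambda>i. [(q choose i)] \<cdot> (a [^] i \<otimes> b [^] (q - i))"
  have T: "?T \<in> UNIV \<rightarrow> carrier R" using a b by auto
  have "(\<Oplus>i\<in>{..q}. ?T i) = ?T q \<oplus> (\<Oplus>i\<in>{..Suc r}. ?T i)"
    using finsum_Suc[of ?T "Suc r"] T r by (simp add: Pi_def)
  also have "(\<Oplus>i\<in>{..Suc r}. ?T i) = (\<Oplus>i\<in>{..r}. ?T (Suc i)) \<oplus> ?T 0"
    using finsum_Suc2[of ?T r] T by (simp add: Pi_def)
  also have "(\<Oplus>i\<in>{..r}. ?T (Suc i)) = (\<Oplus>i\<in>{..r}. \<zero>)"
  proof (rule finsum_cong')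
    show "?T (Suc i) = \<zero>" if "i \<in> {..r}" for i
      using that a b by (intro mult dvd) auto
  qed auto
  finally show ?thesis using binomial_cring[OF a b, of q] a b by simp
qed

end


definition adjoin :: "('a, 'm) ring_scheme \<Rightarrow> 'a set \<Rightarrow> 'a \<Rightarrow> 'a set"
  where "adjoin R C x = {ev R cs x | cs. set cs \<subseteq> C}"

lemma (in cring) adjoin_subring:
  assumes C: "subring C R" and x: "x \<in> carrier R"
  shows "subring (adjoin R C x) R" "C \<subseteq> adjoin R C x" "x \<in> adjoin R C x"
proof -
  note CE = subringE[OF C]
  have CR: "set cs \<subseteq> carrier R" if "set cs \<subseteq> C" for cs using that CE(1) by auto
  have adjI: "ev R cs x \<in> adjoin R C x" if "set cs \<subseteq> C" for cs using that by (auto simp: adjoin_def)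
  have add: "\<exists>zs. set zs \<subseteq> C \<and> ev R zs x = ev R xs x \<oplus> ev R ys x"
    if "set xs \<subseteq> C" "set ys \<subseteq> C" for xs ys
    using that
  proof (induction xs arbitrary: ys)
    case Nil
    then show ?case using CR[of ys] x by (intro exI[of _ ys]) simp
  next
    case (Cons a xs)
    show ?case
    proof (cases ys)
      case Nil
      then show ?thesis using Cons.prems CR[of "a # xs"] x by (intro exI[of _ "a # xs"]) simp
    next
      case (Cons b ys')
      have "set xs \<subseteq> C" "set ys' \<subseteq> C" using Cons.prems Cons by auto
      then obtain zs where zs: "set zs \<subseteq> C" "ev R zs x = ev R xs x \<oplus> ev R ys' x"
        using Cons.IH[of ys'] by blast
      define e f where "e = ev R xs x" "f = ev R ys' x"
      have car: "e \<in> carrier R" "f \<in> carrier R" "a \<in> carrier R" "b \<in> carrier R"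
        using Cons.prems Cons CR[of xs] CR[of ys'] CE(1) x by (auto simp: e_f_def)
      have "(a \<oplus> b) \<oplus> x \<otimes> (e \<oplus> f) = (a \<oplus> x \<otimes> e) \<oplus> (b \<oplus> x \<otimes> f)"
        using car x by algebra
      then have "ev R ((a \<oplus> b) # zs) x = ev R (a # xs) x \<oplus> ev R ys x"
        using zs(2) Cons by (simp add: e_f_def)
      moreover have "set ((a \<oplus> b) # zs) \<subseteq> C" using zs(1) Cons.prems Cons CE(7) by auto
      ultimately show ?thesis by blast
    qed
  qed
  have add': "u \<oplus> v \<in> adjoin R C x" if uv: "u \<in> adjoin R C x" "v \<in> adjoin R C x" for u v
  proof -
    obtain xs ys where "set xs \<subseteq> C" "u = ev R xs x" "set ys \<subseteq> C" "v = ev R ys x"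
      using uv by (auto simp: adjoin_def)
    then show ?thesis using add[of xs ys] by (auto simp: adjoin_def) metis
  qed
  have scal: "c \<otimes> v \<in> adjoin R C x" if cv: "c \<in> C" "v \<in> adjoin R C x" for c v
  proof -
    obtain ys where ys: "set ys \<subseteq> C" "v = ev R ys x" using cv(2) by (auto simp: adjoin_def)
    have "c \<otimes> v = ev R (map (\<lambda>b. c \<otimes> b) ys) x"
      using ev_scal[OF CR[OF ys(1)] _ x, of c] cv(1) CE(1) ys(2) by auto
    moreover have "set (map (\<lambda>b. c \<otimes> b) ys) \<subseteq> C" using ys(1) cv(1) CE(6) by auto
    ultimately show ?thesis using adjI by metis
  qed
  have shift: "x \<otimes> v \<in> adjoin R C x" if v: "v \<in> adjoin R C x" for v
  proof -
    obtain ys where ys: "set ys \<subseteq> C" "v = ev R ys x" using v by (auto simp: adjoin_def)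
    then have "x \<otimes> v = ev R (\<zero> # ys) x" using CR[OF ys(1)] x by simp
    moreover have "set (\<zero> # ys) \<subseteq> C" using ys(1) CE(2) by simp
    ultimately show ?thesis using adjI by metis
  qed
  have mult: "ev R xs x \<otimes> v \<in> adjoin R C x" if "set xs \<subseteq> C" "v \<in> adjoin R C x" for xs v
    using that(1)
  proof (induction xs)
    case Nil
    have "v \<in> carrier R" using that(2) CR x by (auto simp: adjoin_def)
    then have "ev R [] x \<otimes> v = ev R [] x" by simp
    then show ?case using adjI[of "[]"] by simp
  next
    case (Cons a xs)
    have v: "v \<in> carrier R" using that(2) CR x by (auto simp: adjoin_def)
    have "a \<in> C" "set xs \<subseteq> C" using Cons.prems by auto
    then have "a \<in> carrier R" "ev R xs x \<in> carrier R" using CE(1) CR[of xs] x by auto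
    then have "ev R (a # xs) x \<otimes> v = a \<otimes> v \<oplus> x \<otimes> (ev R xs x \<otimes> v)"
      using v x by (simp add: l_distr m_assoc)
    then show ?case using add' scal[OF \<open>a \<in> C\<close> that(2)] shift Cons.IH[OF \<open>set xs \<subseteq> C\<close>] by simp
  qed
  show 1: "C \<subseteq> adjoin R C x"
  proof
    fix c assume c: "c \<in> C"
    then have "ev R [c] x = c" using CE(1) x by auto
    then show "c \<in> adjoin R C x" using adjI[of "[c]"] c by simp
  qed
  have "ev R [\<zero>, \<one>] x = x" using x by simp
  then show "x \<in> adjoin R C x" using adjI[of "[\<zero>, \<one>]"] CE(2,3) by simp
  show "subring (adjoin R C x) R"
  proof (rule subringI)
    show "adjoin R C x \<subseteq> carrier R" using CR x by (auto simp: adjoin_def)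
    show "\<one> \<in> adjoin R C x" using 1 CE(3) by blast
    show "\<ominus> v \<in> adjoin R C x" if v: "v \<in> adjoin R C x" for v
    proof -
      have "v \<in> carrier R" using v CR x by (auto simp: adjoin_def)
      then have "\<ominus> v = (\<ominus> \<one>) \<otimes> v" by (simp add: l_minus)
      then show ?thesis using scal[OF CE(5)[OF CE(3)] v] by simp
    qed
    show "u \<otimes> v \<in> adjoin R C x" if uv: "u \<in> adjoin R C x" "v \<in> adjoin R C x" for u v
      using uv(1) mult[OF _ uv(2)] by (auto simp: adjoin_def[of R C x])
  qed (rule add')
qed

locale residue_square_zero = R: local_ring R + k: field k
  for R (structure) and k +
  fixes p
  assumes p_hom: "p \<in> ring_hom R k" and p_surj: "p ` carrier R = carrier k"
    and p_ker: "a \<in> carrier R \<Longrightarrow> p a = \<zero>\<^bsub>k\<^esub> \<longleftrightarrow> a \<in> max_ideal R"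
    and square_zero: "\<lbrakk>s \<in> max_ideal R; t \<in> max_ideal R\<rbrakk> \<Longrightarrow> s \<otimes> t = \<zero>"
begin

lemma p_ring_hom_cring: "ring_hom_cring R k p"
  by unfold_locales (rule p_hom)

sublocale p: ring_hom_cring R k p by (rule p_ring_hom_cring)

text \<open>Such a subring is embedded into the residue field.\<close>

definition "small C \<longleftrightarrow> subring C R \<and> C \<inter> max_ideal R = {\<zero>}"

lemma p_pow: "x \<in> carrier R \<Longrightarrow> p (x [^] (n::nat)) = p x [^]\<^bsub>k\<^esub> n"
  by (induction n) simp_all

lemma p_ev:
  assumes "set cs \<subseteq> carrier R" "x \<in> carrier R"
  shows "p (ev R cs x) = ev k (map p cs) (p x)"
  using assms(1) by (induction cs) (auto simp: assms(2))

text \<open>A maximal subring meeting the maximal ideal trivially is a field of representatives.\<close>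

context
  fixes C
  assumes C: "small C" and max: "\<forall>C'. small C' \<longrightarrow> C \<subseteq> C' \<longrightarrow> C' = C"
begin

lemma C_subring: "subring C R" and C_meet: "\<lbrakk>c \<in> C; c \<in> max_ideal R\<rbrakk> \<Longrightarrow> c = \<zero>"
  using C by (auto simp: small_def)

lemmas CE = subringE[OF C_subring]

lemma CR: "set cs \<subseteq> C \<Longrightarrow> set cs \<subseteq> carrier R"
  using CE(1) by auto

lemma mem_if_adjoin_small:
  assumes x: "x \<in> carrier R" and *: "\<And>cs. \<lbrakk>set cs \<subseteq> C; ev R cs x \<in> max_ideal R\<rbrakk> \<Longrightarrow> ev R cs x = \<zero>"
  shows "x \<in> C"
proof -
  note A = R.adjoin_subring[OF C_subring x]
  have "\<zero> \<in> max_ideal R" by (rule additive_subgroup.zero_closed[OF ideal.axioms(1)[OF R.ideal_max_ideal]])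
  then have "adjoin R C x \<inter> max_ideal R = {\<zero>}"
    using * subringE(2)[OF A(1)] by (auto simp: adjoin_def)
  then have "small (adjoin R C x)" using A(1) by (simp add: small_def)
  then show ?thesis using max[rule_format, of "adjoin R C x"] A by blast
qed

lemma C_Units: "c \<in> C \<Longrightarrow> c \<noteq> \<zero> \<Longrightarrow> c \<in> Units R"
  using R.Units_iff C_meet CE(1) by blast

lemma inv_mem:
  assumes c: "c \<in> C" "c \<noteq> \<zero>"
  shows "inv c \<in> C"
proof (rule mem_if_adjoin_small)
  have u: "c \<in> Units R" by (rule C_Units[OF c])
  have cc: "c \<in> carrier R" "inv c \<in> carrier R" using u by auto
  then show "inv c \<in> carrier R" by simp
  have clear: "c [^] length cs \<otimes> ev R cs (inv c) \<in> C" if "set cs \<subseteq> C" for cs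
    using that
  proof (induction cs)
    case Nil
    then show ?case using CE(2) cc by simp
  next
    case (Cons b cs)
    define e q where "e = ev R cs (inv c)" "q = c [^] length cs"
    have bc: "b \<in> carrier R" "b \<in> C" using Cons.prems CE(1) by auto
    have car: "e \<in> carrier R" "q \<in> carrier R" using CR[of cs] Cons.prems cc by (auto simp: e_q_def)
    have "c [^] (n::nat) \<in> C" for n by (induction n) (use CE(3,6) c in auto)
    then have q: "q \<in> C" by (simp add: e_q_def)
    have "c [^] length (b # cs) \<otimes> ev R (b # cs) (inv c) = (q \<otimes> c) \<otimes> (b \<oplus> inv c \<otimes> e)"
      by (simp add: e_q_def)
    also have "\<dots> = (q \<otimes> c) \<otimes> b \<oplus> (c \<otimes> inv c) \<otimes> (q \<otimes> e)"
      using car bc cc by (simp add: R.r_distr R.m_ac)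
    also have "\<dots> = (q \<otimes> c) \<otimes> b \<oplus> q \<otimes> e" using u car by simp
    finally show ?case
      using Cons q c bc CE(6,7) by (simp add: e_q_def)
  qed
  fix cs assume cs: "set cs \<subseteq> C" "ev R cs (inv c) \<in> max_ideal R"
  have e: "ev R cs (inv c) \<in> carrier R" using CR[OF cs(1)] cc by simp
  have "c [^] length cs \<otimes> ev R cs (inv c) = \<zero>"
    using clear[OF cs(1)] cs(2) ideal.I_l_closed[OF R.ideal_max_ideal cs(2)] cc by (intro C_meet) auto
  moreover have uu: "c [^] length cs \<in> Units R" by (rule R.Units_pow_closed[OF u])
  ultimately have "inv (c [^] length cs) \<otimes> (c [^] length cs \<otimes> ev R cs (inv c)) = \<zero>" using uu by simp
  then show "ev R cs (inv c) = \<zero>"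
    using uu e R.Units_closed[OF uu] by (simp add: R.m_assoc[symmetric])
qed

definition "rel n x \<longleftrightarrow> (\<exists>cs. set cs \<subseteq> C \<and> length cs = n \<and> x [^] n \<oplus> ev R cs x \<in> max_ideal R)"

text \<open>By \<open>rel n x\<close> the residue of \<open>x\<close> satisfies a monic equation of degree \<open>n\<close> over \<open>C\<close>. A
  shorter nontrivial combination of powers of \<open>x\<close> in the maximal ideal could be made monic, as
  the nonzero elements of \<open>C\<close> are units.\<close>

lemma coefficients_vanish:
  assumes x: "x \<in> carrier R" and no: "\<forall>m<N. \<not> rel m x"
  shows "\<lbrakk>set cs \<subseteq> C; length cs \<le> N; ev R cs x \<in> max_ideal R\<rbrakk> \<Longrightarrow> set cs \<subseteq> {\<zero>} \<and> ev R cs x = \<zero>"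
proof (induction cs rule: rev_induct)
  case (snoc u cs)
  have u: "u \<in> C" "u \<in> carrier R" and cs: "set cs \<subseteq> C" "set cs \<subseteq> carrier R"
    using snoc.prems CR[of "cs @ [u]"] by auto
  have sn: "ev R (cs @ [u]) x = ev R cs x \<oplus> x [^] length cs \<otimes> u" by (rule R.ev_snoc[OF cs(2) u(2) x])
  have e: "ev R cs x \<in> carrier R" using cs x by simp
  have "u = \<zero>"
  proof (rule ccontr)
    assume nz: "u \<noteq> \<zero>"
    then have un: "u \<in> Units R" and iC: "inv u \<in> C" using C_Units inv_mem u by auto
    have ic: "inv u \<in> carrier R" using un by simp
    let ?ds = "map (\<lambda>c. inv u \<otimes> c) cs"
    have "inv u \<otimes> ev R (cs @ [u]) x \<in> max_ideal R"
      by (rule ideal.I_l_closed[OF R.ideal_max_ideal snoc.prems(3) ic])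
    also have "inv u \<otimes> ev R (cs @ [u]) x = (inv u \<otimes> u) \<otimes> x [^] length cs \<oplus> inv u \<otimes> ev R cs x"
      unfolding sn using e u ic x by (simp add: R.r_distr R.m_ac R.a_comm)
    also have "\<dots> = x [^] length cs \<oplus> ev R ?ds x"
      using un x R.ev_scal[OF cs(2) ic x] by simp
    finally have "rel (length cs) x"
      using cs(1) iC CE(6) unfolding rel_def by (intro exI[of _ ?ds]) auto
    then show False using no snoc.prems(2) by simp
  qed
  moreover from this have "ev R (cs @ [u]) x = ev R cs x" unfolding sn using e x by simp
  ultimately show ?case using snoc by simp
qed simp

text \<open>If \<open>x\<close> satisfies its minimal equation exactly and not only modulo the maximal ideal,
  division with remainder by this equation shows that adjoining \<open>x\<close> leaves \<open>C\<close> small.\<close>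

lemma root_mem:
  assumes x: "x \<in> carrier R" and no: "\<forall>m<N. \<not> rel m x"
    and fs: "set fs \<subseteq> C" "length fs = N" "x [^] N \<oplus> ev R fs x = \<zero>"
  shows "x \<in> C"
proof (rule mem_if_adjoin_small[OF x])
  have fR: "set fs \<subseteq> carrier R" by (rule CR[OF fs(1)])
  have ef: "ev R fs x \<in> carrier R" using fR x by simp
  have reduce: "\<exists>ds. set ds \<subseteq> C \<and> length ds = N \<and> ev R cs x = ev R ds x" if "set cs \<subseteq> C" for cs
    using that
  proof (induction cs)
    case Nil
    have "ev R (replicate N \<zero>) x = \<zero>" using x by (induction N) auto
    then show ?case using CE(2) by (intro exI[of _ "replicate N \<zero>"]) auto
  next
    case (Cons c cs)
    then obtain ds where ds: "set ds \<subseteq> C" "length ds = N" "ev R cs x = ev R ds x" by auto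
    obtain gs u where gs: "c # ds = gs @ [u]" by (metis append_butlast_last_id list.distinct(1))
    have len: "length gs = N" using arg_cong[OF gs, of length] ds(2) by simp
    have "set (gs @ [u]) \<subseteq> C" using Cons.prems ds(1) unfolding gs[symmetric] by simp
    then have gC: "set gs \<subseteq> C" "u \<in> C" "set gs \<subseteq> carrier R" "u \<in> carrier R" using CE(1) by auto
    let ?hs = "map2 (\<lambda>a b. a \<ominus> u \<otimes> b) gs fs"
    have eg: "ev R gs x \<in> carrier R" using gC x by simp
    have xN: "x [^] N = \<ominus> ev R fs x"
      using fs(3) ef x by (metis R.minus_equality R.nat_pow_closed)
    have "ev R (c # cs) x = ev R (gs @ [u]) x" using ds(3) gs by (metis ev.simps(2))
    also have "\<dots> = ev R gs x \<oplus> x [^] N \<otimes> u" using R.ev_snoc[OF gC(3,4) x] len by simp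
    also have "\<dots> = ev R gs x \<ominus> u \<otimes> ev R fs x"
      unfolding xN using ef gC eg by (simp add: R.l_minus R.r_minus R.m_comm a_minus_def)
    also have "\<dots> = ev R ?hs x"
      using len fs(2) gC fR x by (intro R.ev_sub_scal[symmetric]) auto
    finally have "ev R (c # cs) x = ev R ?hs x" .
    moreover have "set ?hs \<subseteq> C"
    proof
      fix w assume "w \<in> set ?hs"
      then obtain a b where ab: "(a, b) \<in> set (zip gs fs)" "w = a \<ominus> u \<otimes> b" by auto
      have "a \<in> C" "b \<in> C"
        using set_zip_leftD[OF ab(1)] set_zip_rightD[OF ab(1)] gC(1) fs(1) by auto
      then show "w \<in> C" using ab(2) gC(2) CE(5,6,7) by (simp add: a_minus_def)
    qed
    ultimately show ?case using len fs(2) by (intro exI[of _ ?hs]) auto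
  qed
  fix cs assume cs: "set cs \<subseteq> C" "ev R cs x \<in> max_ideal R"
  then obtain ds where "set ds \<subseteq> C" "length ds = N" "ev R cs x = ev R ds x" using reduce by blast
  then show "ev R cs x = \<zero>" using coefficients_vanish[OF x no, of ds] cs(2) by simp
qed

lemma rel_cong:
  assumes "x \<in> carrier R" "y \<in> carrier R" "p x = p y"
  shows "rel n x \<longleftrightarrow> rel n y"
proof -
  have "x [^] n \<oplus> ev R cs x \<in> max_ideal R \<longleftrightarrow> y [^] n \<oplus> ev R cs y \<in> max_ideal R" if "set cs \<subseteq> C" for cs
  proof -
    have c: "set cs \<subseteq> carrier R" by (rule CR[OF that])
    have "p (x [^] n \<oplus> ev R cs x) = p (y [^] n \<oplus> ev R cs y)"
      using assms c by (simp add: p_ev p_pow)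
    then show ?thesis
      using p_ker[of "x [^] n \<oplus> ev R cs x"] p_ker[of "y [^] n \<oplus> ev R cs y"] assms c by simp
  qed
  then show ?thesis unfolding rel_def by blast
qed

text \<open>If the residue of \<open>a\<close> is transcendental, adjoining \<open>a\<close> leaves \<open>C\<close> small. Otherwise one step
  of Newton approximation moves \<open>a\<close> to a root of its minimal equation, provided that the leading
  coefficient \<open>N\<close> of the derivative is not zero. If it is zero, a power of \<open>a\<close> in \<open>C\<close> already
  gives the minimal equation.\<close>

lemma representative:
  assumes a: "a \<in> carrier R"
    and char: "\<And>N::nat. \<lbrakk>1 \<le> N; [N] \<cdot> \<one> = \<zero>\<rbrakk> \<Longrightarrow> \<exists>j::nat. 1 \<le> j \<and> j \<le> N \<and> a [^] (j::nat) \<in> C"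
  shows "\<exists>c\<in>C. p c = p a"
proof (cases "\<exists>n. rel n a")
  case False
  then have no: "\<forall>m<N. \<not> rel m a" for N by blast
  have "a \<in> C"
  proof (rule mem_if_adjoin_small[OF a])
    show "ev R cs a = \<zero>" if cs: "set cs \<subseteq> C" "ev R cs a \<in> max_ideal R" for cs
      using coefficients_vanish[OF a no cs(1) order.refl cs(2)] by simp
  qed
  then show ?thesis by blast
next
  case True
  define N where "N = (LEAST n. rel n a)"
  have N: "rel N a" and no: "\<forall>m<N. \<not> rel m a"
    unfolding N_def using True by (auto intro: LeastI_ex dest: not_less_Least)
  obtain fs where fs: "set fs \<subseteq> C" "length fs = N" "a [^] N \<oplus> ev R fs a \<in> max_ideal R"
    using N by (auto simp: rel_def)
  have fR: "set fs \<subseteq> carrier R" by (rule CR[OF fs(1)])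
  have N1: "1 \<le> N" using fs R.one_notin_max_ideal a by (cases N) auto
  show ?thesis
  proof (cases "[N] \<cdot> \<one> = \<zero>")
    case True
    then obtain j where j: "1 \<le> j" "j \<le> N" "a [^] j \<in> C" using char[OF N1 True] by blast
    let ?gs = "(\<ominus> (a [^] j)) # replicate (j - 1) \<zero>"
    have rep: "ev R (replicate n \<zero>) a = \<zero>" for n using a by (induction n) auto
    have g: "set ?gs \<subseteq> C" "length ?gs = j" "a [^] j \<oplus> ev R ?gs a = \<zero>"
      using j CE(2,5) a by (auto simp: rep R.r_neg)
    have "\<zero> \<in> max_ideal R" by (rule additive_subgroup.zero_closed[OF ideal.axioms(1)[OF R.ideal_max_ideal]])
    then have "rel j a" using g unfolding rel_def by metis
    then have "j = N" using no j(2) by (cases "j < N") auto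
    then have "a \<in> C" using root_mem[OF a no g(1)] g by simp
    then show ?thesis by blast
  next
    case False
    let ?F = "fs @ [\<one>]"
    have FR: "set ?F \<subseteq> carrier R" using fR by simp
    have Fa: "ev R ?F y = y [^] N \<oplus> ev R fs y" if "y \<in> carrier R" for y
      using R.ev_snoc[OF fR R.one_closed that] fs(2) fR that by (simp add: R.a_comm)
    obtain gs where gs: "set gs \<subseteq> C" "length gs = N" "dv R ?F a = ev R gs a" "gs \<noteq> [] \<longrightarrow> last gs = [N] \<cdot> \<one>"
      using R.dv_snoc[OF C_subring fs(1) CE(3) a] fs(2) by auto
    have "dv R ?F a \<notin> max_ideal R"
    proof
      assume "dv R ?F a \<in> max_ideal R"
      then have "set gs \<subseteq> {\<zero>}" using coefficients_vanish[OF a no gs(1)] gs(2,3) by simp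
      moreover have "gs \<noteq> []" using gs(2) N1 by auto
      ultimately show False using gs(4) False last_in_set by fastforce
    qed
    then have u: "dv R ?F a \<in> Units R" using R.Units_iff R.dv_closed[OF FR a] by simp
    define d t where "d = inv (dv R ?F a)" "t = \<ominus> (d \<otimes> ev R ?F a)"
    have dc: "d \<in> carrier R" using u by (simp add: d_t_def)
    have Fm: "ev R ?F a \<in> max_ideal R" using fs(3) Fa[OF a] by simp
    have "d \<otimes> ev R ?F a \<in> max_ideal R" by (rule ideal.I_l_closed[OF R.ideal_max_ideal Fm dc])
    then have t: "t \<in> max_ideal R"
      unfolding d_t_def(2) by (rule additive_subgroup.a_inv_closed[OF ideal.axioms(1)[OF R.ideal_max_ideal]])
    have tc: "t \<in> carrier R" using t R.max_ideal_closed by simp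
    let ?b = "a \<oplus> t"
    have b: "?b \<in> carrier R" using a tc by simp
    have pb: "p a = p ?b" using a tc t p_ker[OF tc] by simp
    have ec: "ev R ?F a \<in> carrier R" "dv R ?F a \<in> carrier R" using R.ev_closed[OF FR a] R.dv_closed[OF FR a] .
    have "ev R ?F ?b = ev R ?F a \<oplus> dv R ?F a \<otimes> t"
      by (rule R.ev_shift[OF FR a tc square_zero[OF t t]])
    also have "dv R ?F a \<otimes> t = \<ominus> ((dv R ?F a \<otimes> d) \<otimes> ev R ?F a)"
      unfolding d_t_def(2) using ec dc by (simp only: R.r_minus R.m_assoc R.m_closed)
    also have "dv R ?F a \<otimes> d = \<one>" unfolding d_t_def(1) using u by simp
    finally have "ev R ?F ?b = \<zero>" using ec(1) by (simp only: R.l_one R.r_neg)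
    then have root: "?b [^] N \<oplus> ev R fs ?b = \<zero>" using Fa[OF b] by simp
    have "?b \<in> C"
      by (rule root_mem[OF b _ fs(1,2) root]) (use no rel_cong[OF a b pb] in blast)
    then show ?thesis using pb by auto
  qed
qed

end

text \<open>A maximal small subring exists by Zorn's lemma and represents all residues. In prime
  characteristic the search starts from the subring of powers with this prime as exponent, which
  takes care of inseparable residues, and otherwise from the given subfield.\<close>

lemma coefficient_field:
  assumes K: "subfield K R"
  shows "\<exists>\<sigma>. \<sigma> \<in> ring_hom k R \<and> (\<forall>c\<in>carrier k. p (\<sigma> c) = c)"
proof -
  have zm: "\<zero> \<in> max_ideal R" by (rule additive_subgroup.zero_closed[OF ideal.axioms(1)[OF R.ideal_max_ideal]])
  note KE = subringE[OF subfieldE(1)[OF K]]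
  have unit: "c \<in> Units R" if "c \<in> K" "c \<noteq> \<zero>" for c
    using R.subfield_m_inv[OF K, of c] that KE(1) R.Units_inv_inv unfolding Units_def by (auto simp: R.m_comm)
  obtain C0 where C0: "small C0"
    and char: "\<And>(N::nat) a. \<lbrakk>1 \<le> N; [N] \<cdot> \<one> = \<zero>; a \<in> carrier R\<rbrakk> \<Longrightarrow> \<exists>j::nat. 1 \<le> j \<and> j \<le> N \<and> a [^] j \<in> C0"
  proof (cases "\<exists>N::nat. 1 \<le> N \<and> [N] \<cdot> \<one> = \<zero>")
    case False
    have "c = \<zero>" if "c \<in> K" "c \<in> max_ideal R" for c
      using unit[OF that(1)] R.Units_iff[of c] that R.max_ideal_closed by blast
    then have "K \<inter> max_ideal R = {\<zero>}" using zm KE(2) by blast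
    then have "small K" using subfieldE(1)[OF K] by (simp add: small_def)
    then show thesis
    proof (rule that)
      show "\<exists>j::nat. 1 \<le> j \<and> j \<le> N \<and> a [^] j \<in> K" if "1 \<le> (N::nat)" "[N] \<cdot> \<one> = \<zero>" for N a
        using False[unfolded not_ex, rule_format, of N] that by blast
    qed
  next
    case True
    define \<pi> where "\<pi> = (LEAST N::nat. 1 \<le> N \<and> [N] \<cdot> \<one> = \<zero>)"
    have \<pi>: "1 \<le> \<pi>" "[\<pi>] \<cdot> \<one> = \<zero>"
      using LeastI_ex[OF True] unfolding \<pi>_def by auto
    have least: "\<pi> \<le> N" if "1 \<le> (N::nat)" "[N] \<cdot> \<one> = \<zero>" for N
      unfolding \<pi>_def using that by (intro Least_le) simp
    have inK: "[(N::nat)] \<cdot> \<one> \<in> K" for N by (induction N) (auto intro: KE)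
    have one: "\<one> \<noteq> \<zero>" using R.one_notin_max_ideal zm by metis
    have prime: "Factorial_Ring.prime \<pi>"
    proof (subst prime_nat_iff, intro conjI allI impI)
      have "\<pi> \<noteq> 1" using \<pi>(2) one by auto
      then show "1 < \<pi>" using \<pi>(1) by simp
      fix i assume "i dvd \<pi>"
      then obtain j where ij: "\<pi> = i * j" by (auto simp: dvd_def)
      show "i = 1 \<or> i = \<pi>"
      proof (rule ccontr)
        assume "\<not> (i = 1 \<or> i = \<pi>)"
        then have lt: "1 \<le> i" "i < \<pi>" "1 \<le> j" "j < \<pi>" using ij \<pi>(1) by (auto simp: Suc_le_eq intro: Nat.gr0I)
        have "[i] \<cdot> \<one> \<noteq> \<zero>" "[j] \<cdot> \<one> \<noteq> \<zero>" using least[of i] least[of j] lt by auto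
        then have u: "[i] \<cdot> \<one> \<in> Units R" "[j] \<cdot> \<one> \<noteq> \<zero>" using unit[OF inK] by auto
        have "[i] \<cdot> \<one> \<otimes> [j] \<cdot> \<one> = [i] \<cdot> (\<one> \<otimes> [j] \<cdot> \<one>)" by (rule R.add_pow_ldistr) auto
        also have "\<dots> = [(i * j)] \<cdot> \<one>" by (simp add: R.add.nat_pow_pow mult.commute)
        also have "\<dots> = \<zero>" using ij \<pi>(2) by simp
        finally have "inv ([i] \<cdot> \<one>) \<otimes> ([i] \<cdot> \<one> \<otimes> [j] \<cdot> \<one>) = \<zero>" using u(1) by simp
        then show False using u by (simp add: R.m_assoc[symmetric])
      qed
    qed
    have \<pi>2: "2 \<le> \<pi>" by (rule prime_ge_2_nat[OF prime])
    have add: "(a \<oplus> b) [^] \<pi> = a [^] \<pi> \<oplus> b [^] \<pi>" if "a \<in> carrier R" "b \<in> carrier R" for a b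
      by (rule R.frobenius_add[OF prime \<pi>(2) that])
    let ?C = "(\<lambda>r. r [^] \<pi>) ` carrier R"
    have "subring ?C R"
    proof (rule R.subringI)
      show "?C \<subseteq> carrier R" by auto
      show "\<one> \<in> ?C" by (rule image_eqI[of _ _ \<one>]) auto
      fix h assume "h \<in> ?C"
      then obtain r where r: "r \<in> carrier R" "h = r [^] \<pi>" by auto
      have "(\<ominus> r) [^] \<pi> \<oplus> r [^] \<pi> = \<zero>" using add[of "\<ominus> r" r] r \<pi>(1) by (simp add: R.l_neg R.nat_pow_zero)
      then have "\<ominus> h = (\<ominus> r) [^] \<pi>" unfolding r(2) by (rule R.minus_equality) (use r in auto)
      then show "\<ominus> h \<in> ?C" using r by (intro image_eqI[of _ _ "\<ominus> r"]) auto
      fix h' assume "h' \<in> ?C"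
      then obtain r' where r': "r' \<in> carrier R" "h' = r' [^] \<pi>" by auto
      show "h \<otimes> h' \<in> ?C"
        using r r' by (intro image_eqI[of _ _ "r \<otimes> r'"]) (auto simp: R.nat_pow_distrib)
      show "h \<oplus> h' \<in> ?C"
        using r r' by (intro image_eqI[of _ _ "r \<oplus> r'"]) (auto simp: add)
    qed
    moreover have "r [^] \<pi> = \<zero>" if r: "r \<in> carrier R" "r [^] \<pi> \<in> max_ideal R" for r
    proof -
      have "r \<in> max_ideal R"
      proof (rule ccontr)
        assume "r \<notin> max_ideal R"
        then have "r [^] \<pi> \<in> Units R" using R.Units_iff r(1) by (intro R.Units_pow_closed) blast
        then show False using R.Units_iff[of "r [^] \<pi>"] r by blast
      qed
      then have "r \<otimes> r = \<zero>" using square_zero by blast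
      moreover obtain n where "\<pi> = Suc (Suc n)" using \<pi>2 by (metis add_2_eq_Suc le_Suc_ex)
      ultimately show ?thesis using r(1) by (simp add: R.m_assoc)
    qed
    moreover have "\<zero> \<in> ?C" using \<pi>(1) by (intro image_eqI[of _ _ \<zero>]) (auto simp: R.nat_pow_zero)
    ultimately have "small ?C" using zm by (auto simp: small_def)
    moreover have "\<exists>j::nat. 1 \<le> j \<and> j \<le> N \<and> a [^] j \<in> ?C" if "1 \<le> (N::nat)" "[N] \<cdot> \<one> = \<zero>" "a \<in> carrier R" for N a
      using least[OF that(1,2)] \<pi>(1) that(3) by (intro exI[of _ \<pi>]) auto
    ultimately show thesis by (rule that)
  qed
  let ?A = "{C. small C \<and> C0 \<subseteq> C}"
  have "\<exists>M\<in>?A. \<forall>C'\<in>?A. M \<subseteq> C' \<longrightarrow> C' = M"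
  proof (rule subset_Zorn_nonempty)
    show "?A \<noteq> {}" using C0 by auto
    fix F assume F: "F \<noteq> {}" "subset.chain ?A F"
    have sm: "subring C R" "C \<inter> max_ideal R = {\<zero>}" "C0 \<subseteq> C" if "C \<in> F" for C
      using F(2) that by (auto simp: subset.chain_def small_def)
    have tot: "C \<subseteq> C' \<or> C' \<subseteq> C" if "C \<in> F" "C' \<in> F" for C C'
      using F(2) that by (auto simp: subset_chain_def)
    have pair: "\<exists>C\<in>F. u \<in> C \<and> v \<in> C" if "u \<in> \<Union>F" "v \<in> \<Union>F" for u v
      using that tot by blast
    obtain C1 where C1: "C1 \<in> F" using F(1) by auto
    have "subring (\<Union>F) R"
    proof (rule R.subringI)
      show "\<Union>F \<subseteq> carrier R" using subringE(1)[OF sm(1)] by blast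
      show "\<one> \<in> \<Union>F" using subringE(3)[OF sm(1)[OF C1]] C1 by blast
      show "\<ominus> u \<in> \<Union>F" if "u \<in> \<Union>F" for u using subringE(5)[OF sm(1)] that by blast
      show "u \<otimes> v \<in> \<Union>F" if "u \<in> \<Union>F" "v \<in> \<Union>F" for u v
        using pair[OF that] subringE(6)[OF sm(1)] by blast
      show "u \<oplus> v \<in> \<Union>F" if "u \<in> \<Union>F" "v \<in> \<Union>F" for u v
        using pair[OF that] subringE(7)[OF sm(1)] by blast
    qed
    moreover have "\<Union>F \<inter> max_ideal R = {\<zero>}" using sm(2) C1 by blast
    moreover have "C0 \<subseteq> \<Union>F" using sm(3) C1 by blast
    ultimately show "\<Union>F \<in> ?A" by (simp add: small_def)
  qed
  then obtain C where M: "C \<in> ?A" "\<forall>C'\<in>?A. C \<subseteq> C' \<longrightarrow> C' = C" by (rule bexE)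
  have C: "small C" "C0 \<subseteq> C" using M(1) by auto
  have max: "\<forall>C'. small C' \<longrightarrow> C \<subseteq> C' \<longrightarrow> C' = C"
  proof (intro allI impI)
    fix C' assume "small C'" "C \<subseteq> C'"
    then have "C' \<in> ?A" using C(2) by (simp add: order.trans[OF C(2)])
    then show "C' = C" using M(2) \<open>C \<subseteq> C'\<close> by simp
  qed
  note CE = subringE[OF C_subring[OF C(1) max]]
  have "\<exists>c\<in>C. p c = x" if x: "x \<in> carrier k" for x
  proof -
    have "x \<in> p ` carrier R" using x p_surj by simp
    then obtain a where a: "a \<in> carrier R" "x = p a" by (rule imageE)
    have ch: "\<exists>j::nat. 1 \<le> j \<and> j \<le> N \<and> a [^] j \<in> C" if N: "1 \<le> (N::nat)" "[N] \<cdot> \<one> = \<zero>" for N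
      using char[OF N a(1)] C(2) by blast
    show ?thesis unfolding a(2) by (rule representative[OF C(1) max a(1)]) (rule ch)
  qed
  then obtain \<sigma> where \<sigma>: "\<And>x. x \<in> carrier k \<Longrightarrow> \<sigma> x \<in> C" "\<And>x. x \<in> carrier k \<Longrightarrow> p (\<sigma> x) = x" by metis
  have uniq: "c = c'" if c: "c \<in> C" "c' \<in> C" "p c = p c'" for c c'
  proof -
    have cc: "c \<in> carrier R" "c' \<in> carrier R" using c CE(1) by auto
    have "p (c \<ominus> c') = \<zero>\<^bsub>k\<^esub>" using cc c(3) by (simp add: a_minus_def k.r_neg)
    then have "c \<ominus> c' \<in> max_ideal R" using p_ker[of "c \<ominus> c'"] cc by simp
    moreover have "c \<ominus> c' \<in> C" using c CE(5,7) by (simp add: a_minus_def)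
    ultimately have "c \<ominus> c' = \<zero>" by (intro C_meet[OF C(1) max])
    then show ?thesis by (rule R.minus_zero_eqI[OF _ cc])
  qed
  have \<sigma>R: "\<sigma> x \<in> carrier R" if "x \<in> carrier k" for x using \<sigma>(1)[OF that] CE(1) by blast
  have "\<sigma> \<in> ring_hom k R"
    by (rule ring_hom_memI; (rule uniq)?) (auto simp: \<sigma> \<sigma>R intro: CE)
  then show ?thesis using \<sigma>(2) by blast
qed

end

section \<open>Connected sums as quotients of fibre squares\<close>

lemma (in cring) reindex_koszul_homology:
  assumes h: "bij_betw h B A" and A: "finite A" and x: "x \<in> A \<rightarrow> carrier R"
  shows "len (submods (tuples R A) (scals R A)) (koszul R A x) (syz R A x) =
    len (submods (tuples R B) (scals R B)) (koszul R B (\<lambda>i. x (h i))) (syz R B (\<lambda>i. x (h i)))"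
proof -
  have hA: "h i \<in> A" if "i \<in> B" for i using bij_betwE[OF h] that by blast
  have inj: "inj_on h B" and img: "h ` B = A" using h by (auto simp: bij_betw_def)
  have heq: "h i = h j \<longleftrightarrow> i = j" if "i \<in> B" "j \<in> B" for i j using inj_on_eq_iff[OF inj that] .
  have xh: "(\<lambda>i. x (h i)) \<in> B \<rightarrow> carrier R" using x hA by auto
  define f where "f = (\<lambda>v::_ \<Rightarrow> 'a. \<lambda>i\<in>B. v (h i))"
  interpret f: op_hom "tuples R A" "scals R A" "tuples R B" "scals R B" f
  proof (intro op_hom.intro op_hom_axioms.intro op_group_tuples)
    show "semilinear (tuples R A) (scals R A) (tuples R B) (scals R B) f"
      unfolding semilinear_def scals_def f_def by (auto simp: fun_eq_iff PiE_iff Pi_iff hA)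
  qed
  have ext: "v = w" if vw: "v \<in> (\<Pi>\<^sub>E i\<in>A. carrier R)" "w \<in> (\<Pi>\<^sub>E i\<in>A. carrier R)" "f v = f w" for v w
  proof (rule PiE_ext[OF vw(1,2)])
    fix a assume "a \<in> A"
    then obtain i where "i \<in> B" "a = h i" using img by auto
    then show "v a = w a" using fun_cong[OF vw(3), of i] by (simp add: f_def)
  qed
  have z: "f (\<lambda>i\<in>A. \<zero>) = (\<lambda>i\<in>B. \<zero>)" using hA by (auto simp: f_def fun_eq_iff)
  have ker: "f.ker \<subseteq> {\<lambda>i\<in>A. \<zero>}"
  proof
    fix v assume "v \<in> f.ker"
    then have "v \<in> (\<Pi>\<^sub>E i\<in>A. carrier R)" "f v = f (\<lambda>i\<in>A. \<zero>)" using z by (simp_all add: f.ker_def)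
    then show "v \<in> {\<lambda>i\<in>A. \<zero>}" using ext[of v "\<lambda>i\<in>A. \<zero>"] by simp
  qed
  have kos: "f (kos R A x (h i) (h j)) = kos R B (\<lambda>i. x (h i)) i j" if ij: "i \<in> B" "j \<in> B" for i j
  proof -
    have c: "x (h i) \<in> carrier R" "x (h j) \<in> carrier R" using xh ij by auto
    show ?thesis
      unfolding kos_eq[of x "h i" "h j", OF c] kos_eq[of "\<lambda>i. x (h i)" i j, OF c] f_def
      using ij by (auto simp: fun_eq_iff hA heq)
  qed
  have "f ` {kos R A x i j | i j. i \<in> A \<and> j \<in> A} = {kos R B (\<lambda>i. x (h i)) i j | i j. i \<in> B \<and> j \<in> B}"
  proof (intro equalityI subsetI)
    fix w assume "w \<in> f ` {kos R A x i j | i j. i \<in> A \<and> j \<in> A}"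
    then obtain i j where "i \<in> B" "j \<in> B" "w = f (kos R A x (h i) (h j))" unfolding img[symmetric] by auto
    then show "w \<in> {kos R B (\<lambda>i. x (h i)) i j | i j. i \<in> B \<and> j \<in> B}" using kos by auto
  next
    fix w assume "w \<in> {kos R B (\<lambda>i. x (h i)) i j | i j. i \<in> B \<and> j \<in> B}"
    then obtain i j where "i \<in> B" "j \<in> B" "w = f (kos R A x (h i) (h j))" using kos by auto
    then show "w \<in> f ` {kos R A x i j | i j. i \<in> A \<and> j \<in> A}" using hA by auto
  qed
  then have 1: "f ` koszul R A x = koszul R B (\<lambda>i. x (h i))"
    unfolding koszul_def f.image_span[OF kos_set_closed[OF x]] by simp
  have lin: "lin R B (\<lambda>i. x (h i)) (f v) = lin R A x v" if v: "v \<in> (\<Pi>\<^sub>E i\<in>A. carrier R)" for v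
  proof -
    have "lin R A x v = (\<Oplus>i\<in>B. v (h i) \<otimes> x (h i))"
      unfolding lin_def img[symmetric] using v x img inj by (intro finsum_reindex) (auto simp: PiE_iff Pi_iff)
    also have "\<dots> = lin R B (\<lambda>i. x (h i)) (f v)"
      unfolding lin_def f_def using v x hA by (intro finsum_cong') (auto simp: PiE_iff Pi_iff)
    finally show ?thesis by simp
  qed
  have 2: "f ` syz R A x = syz R B (\<lambda>i. x (h i))"
  proof (intro equalityI subsetI)
    fix w assume "w \<in> f ` syz R A x"
    then obtain v where "v \<in> (\<Pi>\<^sub>E i\<in>A. carrier R)" "lin R A x v = \<zero>" "w = f v" by (auto simp: syz_def)
    then show "w \<in> syz R B (\<lambda>i. x (h i))" using lin f.f_closed[of v] by (simp add: syz_def)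
  next
    fix w assume "w \<in> syz R B (\<lambda>i. x (h i))"
    then have w: "w \<in> (\<Pi>\<^sub>E i\<in>B. carrier R)" "lin R B (\<lambda>i. x (h i)) w = \<zero>" by (auto simp: syz_def)
    define v where "v = (\<lambda>a\<in>A. w (inv_into B h a))"
    have v: "v \<in> (\<Pi>\<^sub>E i\<in>A. carrier R)"
      using w(1) inv_into_into[of _ h B] unfolding v_def img by (auto simp: PiE_iff)
    have "f v i = w i" for i
      using w(1) hA by (cases "i \<in> B") (auto simp: f_def v_def inv_into_f_f[OF inj] PiE_iff extensional_def)
    then have "f v = w" by (simp add: fun_eq_iff)
    then show "w \<in> f ` syz R A x" using v lin[OF v] w(2) by (auto simp: syz_def intro!: image_eqI[of _ _ v])
  qed
  have "f.ker \<inter> syz R A x \<subseteq> koszul R A x"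
    using ker submodsD(2)[OF koszul_submod[OF x]] by auto
  then show ?thesis
    using f.len_interval(1)[OF koszul_submod[OF x] syz_submod[OF A x] koszul_le_syz[OF A x]] 1 2 by simp
qed

context local_ring
begin

lemma residue_kernel:
  assumes "field k" and p: "residue_projection R k p" and a: "a \<in> carrier R"
  shows "p a = \<zero>\<^bsub>k\<^esub> \<longleftrightarrow> a \<in> \<mm>"
proof -
  interpret k: field k by fact
  interpret p: ring_hom_cring R k p
    by unfold_locales (use p in \<open>simp add: residue_projection_def\<close>)
  have unit: "p u \<noteq> \<zero>\<^bsub>k\<^esub>" if u: "u \<in> Units R" for u
  proof
    assume "p u = \<zero>\<^bsub>k\<^esub>"
    moreover have "p u \<otimes>\<^bsub>k\<^esub> p (inv u) = p (u \<otimes> inv u)"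
      using u by (intro p.hom_mult[symmetric]) auto
    ultimately show False using u by simp
  qed
  show ?thesis
  proof
    show "a \<in> \<mm>" if "p a = \<zero>\<^bsub>k\<^esub>" using unit Units_iff[OF a] that by blast
    show "p a = \<zero>\<^bsub>k\<^esub>" if am: "a \<in> \<mm>"
    proof (rule ccontr)
      assume "p a \<noteq> \<zero>\<^bsub>k\<^esub>"
      then have pu: "p a \<in> Units k" using a by (simp add: k.field_Units)
      then have "inv\<^bsub>k\<^esub> p a \<in> p ` carrier R" using p by (simp add: residue_projection_def)
      then obtain b where b: "b \<in> carrier R" "p b = inv\<^bsub>k\<^esub> p a" by auto
      have "\<one> \<ominus> b \<otimes> a \<in> Units R"
        by (rule one_minus_Units[OF ideal.I_l_closed[OF ideal_max_ideal am b(1)]])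
      moreover have "p (\<one> \<ominus> b \<otimes> a) = \<zero>\<^bsub>k\<^esub>"
        using a b pu by (simp add: a_minus_def k.r_neg)
      ultimately show False using unit by blast
    qed
  qed
qed

lemma max_ideal_nonzero:
  assumes "field k" and p: "residue_projection R k p" and "\<not> R \<simeq> k"
  shows "\<mm> \<noteq> {\<zero>}"
proof
  assume m: "\<mm> = {\<zero>}"
  interpret k: field k by fact
  interpret p: ring_hom_cring R k p
    by unfold_locales (use p in \<open>simp add: residue_projection_def\<close>)
  have "inj_on p (carrier R)"
  proof (rule inj_onI)
    fix a b assume ab: "a \<in> carrier R" "b \<in> carrier R" "p a = p b"
    then have "p (a \<ominus> b) = \<zero>\<^bsub>k\<^esub>" by (simp add: a_minus_def k.r_neg)
    then have "a \<ominus> b = \<zero>" using residue_kernel[OF assms(1,2), of "a \<ominus> b"] ab m by simp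
    then show "a = b" by (rule minus_zero_eqI[OF _ ab(1,2)])
  qed
  then have "p \<in> ring_iso R k" using p by (simp add: ring_iso_def residue_projection_def bij_betw_def)
  then show False using assms(3) by (auto simp: is_ring_iso_def)
qed

lemma soc_subset_max_ideal:
  assumes "\<mm> \<noteq> {\<zero>}"
  shows "soc R \<subseteq> \<mm>"
proof
  fix a assume a: "a \<in> soc R"
  have "\<zero> \<in> \<mm>" by (rule additive_subgroup.zero_closed[OF ideal.axioms(1)[OF ideal_max_ideal]])
  then obtain t where t: "t \<in> \<mm>" "t \<noteq> \<zero>" using assms by blast
  have c: "a \<in> carrier R" "t \<in> carrier R" "t \<otimes> a = \<zero>" using a t max_ideal_closed by (auto simp: soc_def)
  show "a \<in> \<mm>"
  proof (rule ccontr)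
    assume "a \<notin> \<mm>"
    then have u: "a \<in> Units R" using Units_iff c by blast
    have "t = t \<otimes> (a \<otimes> inv a)" using u c(2) by simp
    also have "\<dots> = (t \<otimes> a) \<otimes> inv a" using u c(1,2) by (intro m_assoc[symmetric]) auto
    also have "\<dots> = \<zero>" using c(3) u by simp
    finally show False using t(2) by simp
  qed
qed

end

text \<open>A nonzero ideal of least length is killed by the maximal ideal, so it lies in the socle,
  which has length one.\<close>

lemma (in gorenstein_artin_local_ring) soc_subset_ideal:
  assumes A: "ideal A R" "A \<noteq> {\<zero>}"
  shows "soc R \<subseteq> A"
proof -
  let ?L = "lg R (mults R)"
  let ?F = "\<lambda>B. ideal B R \<and> B \<noteq> {\<zero>} \<and> B \<subseteq> A"
  note og = op_group_mults
  have fin: "fin R (mults R) B" if "ideal B R" for B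
    using that by (intro op_group.fin_sub(1)[OF og finite_length]) (auto simp: ideal_iff_submod submodsD(1))
  obtain B where B: "ideal B R" "B \<noteq> {\<zero>}" "B \<subseteq> A" and least: "\<And>C. ?F C \<Longrightarrow> ?L B \<le> ?L C"
    using ex_has_least_nat[of ?F A ?L] A by blast
  note mB = prod_max_ideal[OF B(1)]
  have "\<mm> \<cdot> B = {\<zero>}"
  proof (rule ccontr)
    assume "\<mm> \<cdot> B \<noteq> {\<zero>}"
    then have "?L B \<le> ?L (\<mm> \<cdot> B)" using mB B(3) by (intro least) auto
    moreover have "?L (\<mm> \<cdot> B) \<le> ?L B"
      using mB(1) by (intro op_group.lg_mono[OF og fin[OF B(1)] _ mB(2)]) (simp add: ideal_iff_submod)
    ultimately have eq: "\<mm> \<cdot> B = B"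
      using mB(1) by (intro op_group.lg_eq_imp_eq[OF og fin[OF B(1)] _ mB(2)]) (auto simp: ideal_iff_submod)
    have "B \<subseteq> set_add R {\<zero>} (\<mm> \<cdot> B)"
    proof
      fix b assume "b \<in> B"
      then have "b = \<zero> \<oplus> b" "b \<in> \<mm> \<cdot> B" using eq ideal.Icarr[OF B(1)] by auto
      then show "b \<in> set_add R {\<zero>} (\<mm> \<cdot> B)" unfolding mem_set_add by blast
    qed
    then have "B \<subseteq> {\<zero>}" by (rule Nakayama[OF zeroideal B(1)])
    then show False using B(2) additive_subgroup.zero_closed[OF ideal.axioms(1)[OF B(1)]] by blast
  qed
  then have "B \<subseteq> soc R"
    using ideal.Icarr[OF B(1)] ideal_prod.prod[of _ \<mm> _ B R] unfolding soc_def by blast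
  moreover have "?L B \<noteq> 0"
  proof
    assume "?L B = 0"
    then have "{\<zero>} = B"
      using op_group.fin_zero(2)[OF og] additive_subgroup.zero_closed[OF ideal.axioms(1)[OF B(1)]]
      by (intro op_group.lg_eq_imp_eq[OF og fin[OF B(1)] op_group.zero_submod[OF og]]) auto
    then show False using B(2) by simp
  qed
  moreover have "?L B \<le> 1"
    using op_group.lg_mono[OF og soc_length(1) _ \<open>B \<subseteq> soc R\<close>] B(1) soc_length(2) by (simp add: ideal_iff_submod)
  ultimately have "B = soc R"
    using B(1) soc_length(2)
    by (intro op_group.lg_eq_imp_eq[OF og soc_length(1)]) (auto simp: ideal_iff_submod)
  then show ?thesis using B(3) by simp
qed

lemma fibre_product_simps:
  "carrier (fibre_product R p S q) = {(r, s). r \<in> carrier R \<and> s \<in> carrier S \<and> p r = q s}"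
  "\<one>\<^bsub>fibre_product R p S q\<^esub> = (\<one>\<^bsub>R\<^esub>, \<one>\<^bsub>S\<^esub>)" "\<zero>\<^bsub>fibre_product R p S q\<^esub> = (\<zero>\<^bsub>R\<^esub>, \<zero>\<^bsub>S\<^esub>)"
  "(r, s) \<otimes>\<^bsub>fibre_product R p S q\<^esub> (r', s') = (r \<otimes>\<^bsub>R\<^esub> r', s \<otimes>\<^bsub>S\<^esub> s')"
  "(r, s) \<oplus>\<^bsub>fibre_product R p S q\<^esub> (r', s') = (r \<oplus>\<^bsub>R\<^esub> r', s \<oplus>\<^bsub>S\<^esub> s')"
  by (simp_all add: fibre_product_def RDirProd_def DirProd_def monoid.defs)

locale residue_fibre = R: local_ring R + S: local_ring S + k: field k for R and S and k +
  fixes p q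
  assumes p: "residue_projection R k p" and q: "residue_projection S k q"
begin

sublocale p: ring_hom_cring R k p
  by unfold_locales (use p in \<open>simp add: residue_projection_def\<close>)

sublocale q: ring_hom_cring S k q
  by unfold_locales (use q in \<open>simp add: residue_projection_def\<close>)

abbreviation "P \<equiv> fibre_product R p S q"

lemma p_onto: "c \<in> carrier k \<Longrightarrow> \<exists>r\<in>carrier R. p r = c"
proof -
  assume "c \<in> carrier k"
  then have "c \<in> p ` carrier R" using p by (simp add: residue_projection_def)
  then show ?thesis by auto
qed

lemma q_onto: "c \<in> carrier k \<Longrightarrow> \<exists>s\<in>carrier S. q s = c"
proof -
  assume "c \<in> carrier k"
  then have "c \<in> q ` carrier S" using q by (simp add: residue_projection_def)
  then show ?thesis by auto
qed

lemma p_kernel: "r \<in> carrier R \<Longrightarrow> p r = \<zero>\<^bsub>k\<^esub> \<longleftrightarrow> r \<in> max_ideal R"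
  by (rule R.residue_kernel[OF k.field_axioms p])

lemma q_kernel: "s \<in> carrier S \<Longrightarrow> q s = \<zero>\<^bsub>k\<^esub> \<longleftrightarrow> s \<in> max_ideal S"
  by (rule S.residue_kernel[OF k.field_axioms q])

lemma cring_fibre_product: "cring P"
proof (intro cringI abelian_groupI comm_monoidI)
  fix x assume "x \<in> carrier P"
  then obtain r s where x: "x = (r, s)" "r \<in> carrier R" "s \<in> carrier S" "p r = q s"
    by (auto simp: fibre_product_simps)
  then have "(\<ominus>\<^bsub>R\<^esub> r, \<ominus>\<^bsub>S\<^esub> s) \<in> carrier P" "(\<ominus>\<^bsub>R\<^esub> r, \<ominus>\<^bsub>S\<^esub> s) \<oplus>\<^bsub>P\<^esub> x = \<zero>\<^bsub>P\<^esub>"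
    by (auto simp: fibre_product_simps R.l_neg S.l_neg)
  then show "\<exists>y\<in>carrier P. y \<oplus>\<^bsub>P\<^esub> x = \<zero>\<^bsub>P\<^esub>" by blast
qed (auto simp: fibre_product_simps R.a_ac S.a_ac R.m_ac S.m_ac R.l_distr S.l_distr R.r_distr S.r_distr)

sublocale P: cring P by (rule cring_fibre_product)

lemma fibre_square_fibre_product: "fibre_square P R S fst snd"
proof (intro fibre_square.intro ring_epi.intro ring_epi_axioms.intro fibre_square_axioms.intro
    P.cring_axioms R.local_ring_axioms S.local_ring_axioms R.cring_axioms S.cring_axioms)
  show "fst \<in> ring_hom P R" "snd \<in> ring_hom P S"
    by (auto intro!: ring_hom_memI simp: fibre_product_simps)
  show "fst ` carrier P = carrier R"
  proof (intro equalityI subsetI)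
    fix r assume r: "r \<in> carrier R"
    then obtain s where "s \<in> carrier S" "q s = p r" using q_onto[of "p r"] by auto
    then have "(r, s) \<in> carrier P" using r by (simp add: fibre_product_simps)
    then show "r \<in> fst ` carrier P" by force
  qed (auto simp: fibre_product_simps)
  show "snd ` carrier P = carrier S"
  proof (intro equalityI subsetI)
    fix s assume s: "s \<in> carrier S"
    then obtain r where "r \<in> carrier R" "p r = q s" using p_onto[of "q s"] by auto
    then have "(r, s) \<in> carrier P" using s by (simp add: fibre_product_simps)
    then show "s \<in> snd ` carrier P" by force
  qed (auto simp: fibre_product_simps)
  show "fst a \<in> max_ideal R \<longleftrightarrow> snd a \<in> max_ideal S" if "a \<in> carrier P" for a
    using that p_kernel[of "fst a"] q_kernel[of "snd a"] by (auto simp: fibre_product_simps)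
  show "a = \<zero>\<^bsub>P\<^esub>" if "a \<in> carrier P" "fst a = \<zero>\<^bsub>R\<^esub>" "snd a = \<zero>\<^bsub>S\<^esub>" for a
    using that by (auto simp: fibre_product_simps prod_eq_iff)
  show "\<exists>a\<in>carrier P. fst a = r \<and> snd a = \<zero>\<^bsub>S\<^esub>" if "r \<in> max_ideal R" for r
    using that p_kernel R.max_ideal_closed[OF that]
    by (intro bexI[of _ "(r, \<zero>\<^bsub>S\<^esub>)"]) (auto simp: fibre_product_simps)
  show "\<exists>a\<in>carrier P. fst a = \<zero>\<^bsub>R\<^esub> \<and> snd a = s" if "s \<in> max_ideal S" for s
  proof -
    have s: "s \<in> carrier S" by (rule S.max_ideal_closed[OF that])
    have "q s = \<zero>\<^bsub>k\<^esub>" using q_kernel[OF s] that by (rule iffD2)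
    then show ?thesis
      using s by (intro bexI[of _ "(\<zero>\<^bsub>R\<^esub>, s)"]) (simp_all add: fibre_product_simps)
  qed
qed

text \<open>The kernel consists of the multiples of \<open>(d, -e)\<close>, and these form the graph of a bijection
  between the two socles.\<close>

lemma connected_sum_projection:
  assumes GR: "gorenstein_artin_local_ring R" and GS: "gorenstein_artin_local_ring S"
    and mR: "max_ideal R \<noteq> {\<zero>\<^bsub>R\<^esub>}" and mS: "max_ideal S \<noteq> {\<zero>\<^bsub>S\<^esub>}"
    and d: "d \<in> carrier R" "soc R = Idl\<^bsub>R\<^esub> {d}" and e: "e \<in> carrier S" "soc S = Idl\<^bsub>S\<^esub> {e}"
    and Q: "cring Q" "Q \<simeq> connected_sum R p d S q e"
  obtains \<theta> where "ring_epi P Q \<theta>"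
    "\<And>a. \<lbrakk>a \<in> carrier P; \<theta> a = \<zero>\<^bsub>Q\<^esub>\<rbrakk> \<Longrightarrow> fst a \<in> soc R \<and> snd a \<in> soc S"
    "\<And>a. \<lbrakk>a \<in> carrier P; \<theta> a = \<zero>\<^bsub>Q\<^esub>\<rbrakk> \<Longrightarrow> fst a = \<zero>\<^bsub>R\<^esub> \<longleftrightarrow> snd a = \<zero>\<^bsub>S\<^esub>"
    "\<And>r. r \<in> soc R \<Longrightarrow> \<exists>a\<in>carrier P. \<theta> a = \<zero>\<^bsub>Q\<^esub> \<and> fst a = r"
    "\<And>s. s \<in> soc S \<Longrightarrow> \<exists>a\<in>carrier P. \<theta> a = \<zero>\<^bsub>Q\<^esub> \<and> snd a = s"
proof -
  interpret GR: gorenstein_artin_local_ring R by fact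
  interpret GS: gorenstein_artin_local_ring S by fact
  interpret Q: cring Q by fact
  have sd: "d \<in> soc R" and se: "e \<in> soc S" using d e R.genideal_self[of "{d}"] S.genideal_self[of "{e}"] by auto
  have md: "d \<in> max_ideal R" "e \<in> max_ideal S"
    using sd se R.soc_subset_max_ideal[OF mR] S.soc_subset_max_ideal[OF mS] by auto
  have nz: "d \<noteq> \<zero>\<^bsub>R\<^esub>" "e \<noteq> \<zero>\<^bsub>S\<^esub>"
    using GR.soc_nonzero GS.soc_nonzero d(2) e(2) R.genideal_zero S.genideal_zero by auto
  let ?u = "(d, \<ominus>\<^bsub>S\<^esub> e)"
  have mem: "(d, \<zero>\<^bsub>S\<^esub>) \<in> carrier P" "(\<zero>\<^bsub>R\<^esub>, e) \<in> carrier P" "(\<zero>\<^bsub>R\<^esub>, \<ominus>\<^bsub>S\<^esub> e) \<in> carrier P" "?u \<in> carrier P"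
    using p_kernel[OF d(1)] q_kernel[OF e(1)] md d(1) e(1) by (auto simp: fibre_product_simps)
  have "\<ominus>\<^bsub>P\<^esub> (\<zero>\<^bsub>R\<^esub>, e) = (\<zero>\<^bsub>R\<^esub>, \<ominus>\<^bsub>S\<^esub> e)"
    using e(1) by (intro P.minus_equality mem) (simp add: fibre_product_simps S.l_neg)
  then have u: "(d, \<zero>\<^bsub>S\<^esub>) \<ominus>\<^bsub>P\<^esub> (\<zero>\<^bsub>R\<^esub>, e) = ?u"
    using d(1) e(1) by (simp add: a_minus_def fibre_product_simps)
  let ?J = "PIdl\<^bsub>P\<^esub> ?u"
  have J: "ideal ?J P" by (rule P.cgenideal_ideal[OF mem(4)])
  have "connected_sum R p d S q e = P Quot ?J"
    unfolding connected_sum_def Let_def u P.cgenideal_eq_genideal[OF mem(4)] ..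
  then have "P Quot ?J \<simeq> Q" using Q ring_iso_sym[OF Q.ring_axioms] by simp
  then obtain \<theta> where \<theta>: "ring_epi P Q \<theta>" "?J = {a \<in> carrier P. \<theta> a = \<zero>\<^bsub>Q\<^esub>}"
    using ring_epi_of_iso[OF P.cring_axioms Q(1) J] by blast
  have ker: "a \<in> carrier P \<and> \<theta> a = \<zero>\<^bsub>Q\<^esub> \<longleftrightarrow> (\<exists>r s. (r, s) \<in> carrier P \<and> a = (r \<otimes>\<^bsub>R\<^esub> d, s \<otimes>\<^bsub>S\<^esub> \<ominus>\<^bsub>S\<^esub> e))" for a
  proof -
    have "a \<in> carrier P \<and> \<theta> a = \<zero>\<^bsub>Q\<^esub> \<longleftrightarrow> a \<in> ?J" using \<theta>(2) by blast
    also have "\<dots> \<longleftrightarrow> (\<exists>b\<in>carrier P. a = b \<otimes>\<^bsub>P\<^esub> ?u)" unfolding cgenideal_def by blast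
    also have "\<dots> \<longleftrightarrow> (\<exists>r s. (r, s) \<in> carrier P \<and> a = (r \<otimes>\<^bsub>R\<^esub> d, s \<otimes>\<^bsub>S\<^esub> \<ominus>\<^bsub>S\<^esub> e))"
      unfolding Bex_def split_paired_Ex fibre_product_simps(4) ..
    finally show ?thesis .
  qed
  have socR: "soc R = PIdl\<^bsub>R\<^esub> d" and socS: "soc S = PIdl\<^bsub>S\<^esub> e"
    using d e R.cgenideal_eq_genideal S.cgenideal_eq_genideal by auto
  have rd: "r \<otimes>\<^bsub>R\<^esub> d = \<zero>\<^bsub>R\<^esub> \<longleftrightarrow> r \<in> max_ideal R" if r: "r \<in> carrier R" for r
  proof
    show "r \<otimes>\<^bsub>R\<^esub> d = \<zero>\<^bsub>R\<^esub>" if "r \<in> max_ideal R" using sd that by (simp add: soc_def)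
    show "r \<in> max_ideal R" if "r \<otimes>\<^bsub>R\<^esub> d = \<zero>\<^bsub>R\<^esub>"
    proof (rule ccontr)
      assume "r \<notin> max_ideal R"
      then have "r \<in> Units R" using R.Units_iff r by blast
      then have "inv\<^bsub>R\<^esub> r \<otimes>\<^bsub>R\<^esub> (r \<otimes>\<^bsub>R\<^esub> d) = d" using d(1) r by (simp add: R.m_assoc[symmetric])
      then show False using that nz \<open>r \<in> Units R\<close> by simp
    qed
  qed
  have se0: "s \<otimes>\<^bsub>S\<^esub> \<ominus>\<^bsub>S\<^esub> e = \<zero>\<^bsub>S\<^esub> \<longleftrightarrow> s \<in> max_ideal S" if s: "s \<in> carrier S" for s
  proof
    show "s \<otimes>\<^bsub>S\<^esub> \<ominus>\<^bsub>S\<^esub> e = \<zero>\<^bsub>S\<^esub>" if "s \<in> max_ideal S" using se that s e(1) by (simp add: soc_def S.r_minus)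
    show "s \<in> max_ideal S" if "s \<otimes>\<^bsub>S\<^esub> \<ominus>\<^bsub>S\<^esub> e = \<zero>\<^bsub>S\<^esub>"
    proof (rule ccontr)
      assume "s \<notin> max_ideal S"
      then have "s \<in> Units S" using S.Units_iff s by blast
      then have "inv\<^bsub>S\<^esub> s \<otimes>\<^bsub>S\<^esub> (s \<otimes>\<^bsub>S\<^esub> \<ominus>\<^bsub>S\<^esub> e) = \<ominus>\<^bsub>S\<^esub> e" using e(1) s by (simp add: S.m_assoc[symmetric])
      then have "\<ominus>\<^bsub>S\<^esub> e = \<zero>\<^bsub>S\<^esub>" using that \<open>s \<in> Units S\<close> by simp
      then show False using nz(2) e(1) S.minus_minus[OF e(1)] S.minus_zero by metis
    qed
  qed
  show thesis
  proof (rule that[OF \<theta>(1)])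
    fix a assume "a \<in> carrier P" "\<theta> a = \<zero>\<^bsub>Q\<^esub>"
    then obtain r s where rs: "r \<in> carrier R" "s \<in> carrier S" "p r = q s" "a = (r \<otimes>\<^bsub>R\<^esub> d, s \<otimes>\<^bsub>S\<^esub> \<ominus>\<^bsub>S\<^esub> e)"
      using ker[of a] by (auto simp: fibre_product_simps)
    have "r \<otimes>\<^bsub>R\<^esub> d \<in> soc R" by (rule ideal.I_l_closed[OF GR.soc_ideal sd rs(1)])
    moreover have "\<ominus>\<^bsub>S\<^esub> e \<in> soc S" by (rule additive_subgroup.a_inv_closed[OF ideal.axioms(1)[OF GS.soc_ideal] se])
    then have "s \<otimes>\<^bsub>S\<^esub> \<ominus>\<^bsub>S\<^esub> e \<in> soc S" by (rule ideal.I_l_closed[OF GS.soc_ideal _ rs(2)])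
    ultimately show "fst a \<in> soc R \<and> snd a \<in> soc S" using rs(4) by simp
    show "fst a = \<zero>\<^bsub>R\<^esub> \<longleftrightarrow> snd a = \<zero>\<^bsub>S\<^esub>"
      unfolding rs(4) fst_conv snd_conv rd[OF rs(1)] se0[OF rs(2)]
      using p_kernel[OF rs(1)] q_kernel[OF rs(2)] rs(3) by simp
  next
    fix r assume "r \<in> soc R"
    then obtain t where t: "t \<in> carrier R" "r = t \<otimes>\<^bsub>R\<^esub> d" unfolding socR cgenideal_def by blast
    then obtain s where "s \<in> carrier S" "q s = p t" using q_onto[of "p t"] by auto
    then have "(t, s) \<in> carrier P" using t by (simp add: fibre_product_simps)
    then have "(t \<otimes>\<^bsub>R\<^esub> d, s \<otimes>\<^bsub>S\<^esub> \<ominus>\<^bsub>S\<^esub> e) \<in> carrier P \<and> \<theta> (t \<otimes>\<^bsub>R\<^esub> d, s \<otimes>\<^bsub>S\<^esub> \<ominus>\<^bsub>S\<^esub> e) = \<zero>\<^bsub>Q\<^esub>"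
      using ker by blast
    then show "\<exists>a\<in>carrier P. \<theta> a = \<zero>\<^bsub>Q\<^esub> \<and> fst a = r" using t(2) by force
  next
    fix s assume "s \<in> soc S"
    then obtain t where t: "t \<in> carrier S" "s = t \<otimes>\<^bsub>S\<^esub> e" unfolding socS cgenideal_def by blast
    then obtain r where r: "r \<in> carrier R" "p r = q t" using p_onto[of "q t"] by auto
    have "(\<ominus>\<^bsub>R\<^esub> r, \<ominus>\<^bsub>S\<^esub> t) \<in> carrier P" using t r by (simp add: fibre_product_simps)
    then have "(\<ominus>\<^bsub>R\<^esub> r \<otimes>\<^bsub>R\<^esub> d, \<ominus>\<^bsub>S\<^esub> t \<otimes>\<^bsub>S\<^esub> \<ominus>\<^bsub>S\<^esub> e) \<in> carrier P \<and>
        \<theta> (\<ominus>\<^bsub>R\<^esub> r \<otimes>\<^bsub>R\<^esub> d, \<ominus>\<^bsub>S\<^esub> t \<otimes>\<^bsub>S\<^esub> \<ominus>\<^bsub>S\<^esub> e) = \<zero>\<^bsub>Q\<^esub>"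
      using ker by blast
    moreover have "\<ominus>\<^bsub>S\<^esub> t \<otimes>\<^bsub>S\<^esub> \<ominus>\<^bsub>S\<^esub> e = s" using t e(1) by (simp add: S.l_minus S.r_minus)
    ultimately show "\<exists>a\<in>carrier P. \<theta> a = \<zero>\<^bsub>Q\<^esub> \<and> snd a = s" by force
  qed
qed

end

text \<open>If the kernel covers the whole maximal ideal of \<open>R\<close>, a ring section of the residue
  projection of \<open>R\<close> lifts \<open>S\<close> into \<open>P\<close>, and this lift is a complement of the kernel.\<close>

lemma (in fibre_square) iso_of_section:
  assumes \<theta>: "ring_epi P Q \<theta>" and p: "p \<in> ring_hom R k" and q: "q \<in> ring_hom S k"
    and \<sigma>: "\<sigma> \<in> ring_hom k R" "\<And>c. c \<in> carrier k \<Longrightarrow> p (\<sigma> c) = c" and k: "cring k"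
    and p_kernel: "\<And>r. r \<in> carrier R \<Longrightarrow> p r = \<zero>\<^bsub>k\<^esub> \<longleftrightarrow> r \<in> max_ideal R"
    and agree: "\<And>a. a \<in> carrier P \<Longrightarrow> p (\<alpha> a) = q (\<beta> a)"
    and glue: "\<And>r s. \<lbrakk>r \<in> carrier R; s \<in> carrier S; p r = q s\<rbrakk> \<Longrightarrow> \<exists>a\<in>carrier P. \<alpha> a = r \<and> \<beta> a = s"
    and ker_max: "\<And>a. \<lbrakk>a \<in> carrier P; \<theta> a = \<zero>\<^bsub>Q\<^esub>\<rbrakk> \<Longrightarrow> \<alpha> a \<in> max_ideal R"
    and ker_graph: "\<And>a. \<lbrakk>a \<in> carrier P; \<theta> a = \<zero>\<^bsub>Q\<^esub>\<rbrakk> \<Longrightarrow> \<alpha> a = \<zero>\<^bsub>R\<^esub> \<longleftrightarrow> \<beta> a = \<zero>\<^bsub>S\<^esub>"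
    and ker_onto: "\<And>r. r \<in> max_ideal R \<Longrightarrow> \<exists>a\<in>carrier P. \<theta> a = \<zero>\<^bsub>Q\<^esub> \<and> \<alpha> a = r"
  shows "S \<simeq> Q"
proof -
  interpret k: cring k by fact
  interpret \<theta>: ring_epi P Q \<theta> by fact
  interpret p: ring_hom_cring R k p by unfold_locales (rule p)
  interpret q: ring_hom_cring S k q by unfold_locales (rule q)
  interpret \<sigma>: ring_hom_cring k R \<sigma> by unfold_locales (rule \<sigma>(1))
  have "\<forall>s\<in>carrier S. \<exists>a\<in>carrier P. \<alpha> a = \<sigma> (q s) \<and> \<beta> a = s"
    using \<sigma>(2) by (intro ballI glue) auto
  then obtain l where l: "\<And>s. s \<in> carrier S \<Longrightarrow> l s \<in> carrier P"
    "\<And>s. s \<in> carrier S \<Longrightarrow> \<alpha> (l s) = \<sigma> (q s)" "\<And>s. s \<in> carrier S \<Longrightarrow> \<beta> (l s) = s"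
    by (metis (no_types))
  have lh: "l \<in> ring_hom S P"
    by (rule ring_hom_memI; (rule eq_if_projections_eq)?) (auto simp: l)
  interpret l: ring_hom_cring S P l by unfold_locales (rule lh)
  have "inj_on (\<lambda>s. \<theta> (l s)) (carrier S)"
  proof (rule inj_onI)
    fix s t assume st: "s \<in> carrier S" "t \<in> carrier S" "\<theta> (l s) = \<theta> (l t)"
    let ?c = "s \<ominus>\<^bsub>S\<^esub> t"
    have c: "?c \<in> carrier S" using st by simp
    have lc: "l ?c \<in> carrier P" "\<alpha> (l ?c) = \<sigma> (q ?c)" "\<beta> (l ?c) = ?c" using l c by auto
    have ker: "\<theta> (l ?c) = \<zero>\<^bsub>Q\<^esub>" using st by (simp add: a_minus_def \<theta>.W.r_neg)
    have "q ?c = \<zero>\<^bsub>k\<^esub>"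
    proof -
      have am: "\<alpha> (l ?c) \<in> max_ideal R" by (rule ker_max[OF lc(1) ker])
      have "p (\<alpha> (l ?c)) = \<zero>\<^bsub>k\<^esub>" using p_kernel[OF R.max_ideal_closed[OF am]] am by (rule iffD2)
      then show ?thesis unfolding agree[OF lc(1)] lc(3) .
    qed
    then have "\<alpha> (l ?c) = \<zero>\<^bsub>R\<^esub>" using lc(2) by simp
    then have "?c = \<zero>\<^bsub>S\<^esub>" using ker_graph[OF lc(1) ker] lc(3) by simp
    then show "s = t" by (rule S.minus_zero_eqI[OF _ st(1,2)])
  qed
  moreover have "(\<lambda>s. \<theta> (l s)) ` carrier S = carrier Q"
  proof (intro equalityI subsetI)
    fix w assume "w \<in> carrier Q"
    then obtain a where a: "a \<in> carrier P" "w = \<theta> a" using \<theta>.surj by auto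
    define r where "r = \<alpha> a \<ominus>\<^bsub>R\<^esub> \<sigma> (q (\<beta> a))"
    have r: "r \<in> carrier R" using a by (simp add: r_def)
    have "p r = \<zero>\<^bsub>k\<^esub>" using a agree[of a] by (simp add: r_def a_minus_def \<sigma>(2) k.r_neg)
    then have rm: "r \<in> max_ideal R" using p_kernel r by blast
    then obtain b where b: "b \<in> carrier P" "\<theta> b = \<zero>\<^bsub>Q\<^esub>" "\<alpha> b = r" using ker_onto by blast
    have qb: "q (\<beta> b) = \<zero>\<^bsub>k\<^esub>" using agree[OF b(1)] b(3) \<open>p r = \<zero>\<^bsub>k\<^esub>\<close> by simp
    let ?c = "a \<ominus> b"
    have c: "?c \<in> carrier P" "\<beta> ?c \<in> carrier S" using a b by auto
    have car: "\<alpha> a \<in> carrier R" "\<sigma> (q (\<beta> a)) \<in> carrier R" using a by auto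
    have "\<alpha> ?c = \<alpha> a \<ominus>\<^bsub>R\<^esub> r" using a b by (simp add: a_minus_def)
    also have "\<dots> = \<sigma> (q (\<beta> a))"
      unfolding r_def using car by (simp add: a_minus_def R.minus_add R.a_assoc[symmetric] R.r_neg)
    also have "q (\<beta> a) = q (\<beta> ?c)" using a b qb by (simp add: a_minus_def)
    finally have "l (\<beta> ?c) = ?c" using c l by (intro eq_if_projections_eq) auto
    then have "w = \<theta> (l (\<beta> ?c))" using a b by (simp add: a_minus_def)
    then show "w \<in> (\<lambda>s. \<theta> (l s)) ` carrier S" using c(2) by blast
  qed auto
  ultimately have "(\<lambda>s. \<theta> (l s)) \<in> ring_iso S Q"
    by (auto simp: ring_iso_def bij_betw_def intro!: ring_hom_memI)
  then show ?thesis by (auto simp: is_ring_iso_def)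
qed

context residue_fibre
begin

lemma swap_residue_fibre: "residue_fibre S R k q p"
  by unfold_locales (rule q, rule p)

lemma residue_square_zero_left:
  assumes "ideal_power R (max_ideal R) 2 = {\<zero>\<^bsub>R\<^esub>}"
  shows "residue_square_zero R k p"
proof (intro residue_square_zero.intro residue_square_zero_axioms.intro R.local_ring_axioms k.field_axioms)
  show "s \<otimes>\<^bsub>R\<^esub> t = \<zero>\<^bsub>R\<^esub>" if "s \<in> max_ideal R" "t \<in> max_ideal R" for s t
    using assms ideal_prod.prod[OF that, of R] R.ideal_power_two[OF R.ideal_max_ideal] by auto
qed (use p p_kernel in \<open>auto simp: residue_projection_def\<close>)

lemma soc_subset_square:
  assumes "gorenstein_artin_local_ring R" "ideal_power R (max_ideal R) 2 \<noteq> {\<zero>\<^bsub>R\<^esub>}"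
  shows "soc R \<subseteq> max_ideal R \<cdot>\<^bsub>R\<^esub> max_ideal R"
  using gorenstein_artin_local_ring.soc_subset_ideal[OF assms(1) R.prod_max_ideal(1)[OF R.ideal_max_ideal]]
    assms(2) R.ideal_power_two[OF R.ideal_max_ideal] by simp

lemma soc_eq_max_ideal:
  assumes "ideal_power R (max_ideal R) 2 = {\<zero>\<^bsub>R\<^esub>}" "max_ideal R \<noteq> {\<zero>\<^bsub>R\<^esub>}"
  shows "soc R = max_ideal R"
proof
  interpret sq: residue_square_zero R k p by (rule residue_square_zero_left[OF assms(1)])
  show "soc R \<subseteq> max_ideal R" by (rule R.soc_subset_max_ideal[OF assms(2)])
  show "max_ideal R \<subseteq> soc R" using sq.square_zero R.max_ideal_closed by (auto simp: soc_def)
qed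

end

text \<open>The maximal ideal of \<open>R\<close> is its socle here, so the kernel covers it.\<close>

lemma (in fibre_square) trivial_if_square_zero:
  assumes res: "residue_fibre R S k p q" and agree: "\<And>a. a \<in> carrier P \<Longrightarrow> p (\<alpha> a) = q (\<beta> a)"
    and glue: "\<And>r s. \<lbrakk>r \<in> carrier R; s \<in> carrier S; p r = q s\<rbrakk> \<Longrightarrow> \<exists>a\<in>carrier P. \<alpha> a = r \<and> \<beta> a = s"
    and m: "ideal_power R (max_ideal R) 2 = {\<zero>\<^bsub>R\<^esub>}" "max_ideal R \<noteq> {\<zero>\<^bsub>R\<^esub>}" and K: "subfield F R"
    and \<theta>: "ring_epi P Q \<theta>"
    and ker_soc: "\<And>a. \<lbrakk>a \<in> carrier P; \<theta> a = \<zero>\<^bsub>Q\<^esub>\<rbrakk> \<Longrightarrow> \<alpha> a \<in> soc R"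
    and ker_graph: "\<And>a. \<lbrakk>a \<in> carrier P; \<theta> a = \<zero>\<^bsub>Q\<^esub>\<rbrakk> \<Longrightarrow> \<alpha> a = \<zero>\<^bsub>R\<^esub> \<longleftrightarrow> \<beta> a = \<zero>\<^bsub>S\<^esub>"
    and ker_onto: "\<And>r. r \<in> soc R \<Longrightarrow> \<exists>a\<in>carrier P. \<theta> a = \<zero>\<^bsub>Q\<^esub> \<and> \<alpha> a = r"
  shows "S \<simeq> Q"
proof -
  interpret res: residue_fibre R S k p q by fact
  interpret sq: residue_square_zero R k p by (rule res.residue_square_zero_left[OF m(1)])
  obtain \<sigma> where \<sigma>: "\<sigma> \<in> ring_hom k R" "\<And>c. c \<in> carrier k \<Longrightarrow> p (\<sigma> c) = c"
    using sq.coefficient_field[OF K] by blast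
  have soc: "soc R = max_ideal R" by (rule res.soc_eq_max_ideal[OF m])
  show ?thesis
    by (rule iso_of_section[OF \<theta> res.p.homh res.q.homh \<sigma> res.k.cring_axioms res.p_kernel agree glue
        ker_soc[unfolded soc] ker_graph ker_onto[unfolded soc]])
qed

theorem proposition3p5:
  fixes k :: "('k, 'l) ring_scheme"
    and Q :: "('q, 'q1) ring_scheme" and R :: "('r, 'r1) ring_scheme"
    and S :: "('s, 's1) ring_scheme"
    and Q' :: "('qt, 'q2) ring_scheme" and R' :: "('rt, 'r2) ring_scheme"
    and S' :: "('st, 's2) ring_scheme"
    and pQ :: "'q \<Rightarrow> 'k" and pR :: "'r \<Rightarrow> 'k" and pS :: "'s \<Rightarrow> 'k"
    and IQ :: "'qt set" and IR :: "'rt set" and IS :: "'st set"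
    and m n :: nat
  assumes "field k"
    and "gorenstein_artin_local_ring Q" and "residue_projection Q k pQ"
    and "gorenstein_artin_local_ring R" and "residue_projection R k pR"
    and "gorenstein_artin_local_ring S" and "residue_projection S k pS"
    and "cohen_presentation Q Q' IQ"
    and "cohen_presentation R R' IR"
    and "cohen_presentation S S' IS"
    and "m = edim R" and "n = edim S"
    and "nontrivial_connected_sum Q k R pR S pS"
    and length_two_R: "ideal_power R (max_ideal R) 2 = {\<zero>\<^bsub>R\<^esub>} \<Longrightarrow> \<exists>K. subfield K R"
    and length_two_S: "ideal_power S (max_ideal S) 2 = {\<zero>\<^bsub>S\<^esub>} \<Longrightarrow> \<exists>K. subfield K S"
  shows "int (min_gens Q' IQ) =
           int (min_gens R' IR) + int (min_gens S' IS) + int m * int n + phi m n"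
proof -
  interpret Q: gorenstein_artin_local_ring Q by fact
  interpret R: gorenstein_artin_local_ring R by fact
  interpret S: gorenstein_artin_local_ring S by fact
  interpret k: field k by fact
  interpret F: residue_fibre R S k pR pS by unfold_locales (use assms in auto)
  interpret sq: fibre_square F.P R S fst snd by (rule F.fibre_square_fibre_product)
  have nontrivial: "\<not> R \<simeq> Q" "\<not> Q \<simeq> S" and nk: "\<not> R \<simeq> k" "\<not> S \<simeq> k"
    using assms(13) by (auto simp: nontrivial_connected_sum_def is_connected_sum_def)
  obtain d e where de: "d \<in> carrier R" "soc R = Idl\<^bsub>R\<^esub> {d}" "e \<in> carrier S" "soc S = Idl\<^bsub>S\<^esub> {e}"
    "Q \<simeq> connected_sum R pR d S pS e"
    using assms(13) by (auto simp: nontrivial_connected_sum_def is_connected_sum_def)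
  have mR: "max_ideal R \<noteq> {\<zero>\<^bsub>R\<^esub>}" and mS: "max_ideal S \<noteq> {\<zero>\<^bsub>S\<^esub>}"
    using R.max_ideal_nonzero[OF assms(1,5) nk(1)] S.max_ideal_nonzero[OF assms(1,7) nk(2)] by auto
  show ?thesis
  proof (rule F.connected_sum_projection[OF assms(4,6) mR mS de(1-4) Q.cring_axioms de(5)])
    fix \<theta>
    assume \<theta>: "ring_epi F.P Q \<theta>"
      and ker_soc: "\<And>a. \<lbrakk>a \<in> carrier F.P; \<theta> a = \<zero>\<^bsub>Q\<^esub>\<rbrakk> \<Longrightarrow> fst a \<in> soc R \<and> snd a \<in> soc S"
      and ker_graph: "\<And>a. \<lbrakk>a \<in> carrier F.P; \<theta> a = \<zero>\<^bsub>Q\<^esub>\<rbrakk> \<Longrightarrow> fst a = \<zero>\<^bsub>R\<^esub> \<longleftrightarrow> snd a = \<zero>\<^bsub>S\<^esub>"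
      and onto_R: "\<And>r. r \<in> soc R \<Longrightarrow> \<exists>a\<in>carrier F.P. \<theta> a = \<zero>\<^bsub>Q\<^esub> \<and> fst a = r"
      and onto_S: "\<And>s. s \<in> soc S \<Longrightarrow> \<exists>a\<in>carrier F.P. \<theta> a = \<zero>\<^bsub>Q\<^esub> \<and> snd a = s"
    have agree: "pR (fst a) = pS (snd a)" if "a \<in> carrier F.P" for a
      using that by (auto simp: fibre_product_simps)
    have glue: "\<exists>a\<in>carrier F.P. fst a = r \<and> snd a = s"
      if "r \<in> carrier R" "s \<in> carrier S" "pR r = pS s" for r s
      using that by (intro bexI[of _ "(r, s)"]) (auto simp: fibre_product_simps)
    \<comment> \<open>With square zero the maximal ideal of \<^term>\<open>R\<close> would be its socle, and the sum trivial.\<close>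
    have sqR: "ideal_power R (max_ideal R) 2 \<noteq> {\<zero>\<^bsub>R\<^esub>}"
    proof
      assume z: "ideal_power R (max_ideal R) 2 = {\<zero>\<^bsub>R\<^esub>}"
      then obtain L where L: "subfield L R" using length_two_R by blast
      have "S \<simeq> Q"
        by (rule sq.trivial_if_square_zero[OF F.residue_fibre_axioms agree glue z mR L \<theta> _ ker_graph onto_R])
          (use ker_soc in auto)
      then show False using nontrivial(2) ring_iso_sym[OF S.ring_axioms] by blast
    qed
    have sqS: "ideal_power S (max_ideal S) 2 \<noteq> {\<zero>\<^bsub>S\<^esub>}"
    proof
      assume z: "ideal_power S (max_ideal S) 2 = {\<zero>\<^bsub>S\<^esub>}"
      then obtain L where L: "subfield L S" using length_two_S by blast
      have "R \<simeq> Q"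
        by (rule fibre_square.trivial_if_square_zero[OF sq.swap F.swap_residue_fibre _ _ z mS L \<theta> _ _ onto_S])
          (use agree glue ker_soc ker_graph in \<open>auto, metis+\<close>)
      then show False using nontrivial(1) by blast
    qed
    interpret F': residue_fibre S R k pS pR by (rule F.swap_residue_fibre)
    obtain x where x: "x \<in> UNIV \<rightarrow> carrier R" "Idl\<^bsub>R\<^esub> (x ` {..<edim R}) = max_ideal R"
      using R.min_gens_family[OF R.ideal_max_ideal] unfolding edim_def by blast
    obtain y where y: "y \<in> UNIV \<rightarrow> carrier S" "Idl\<^bsub>S\<^esub> (y ` {..<edim S}) = max_ideal S"
      using S.min_gens_family[OF S.ideal_max_ideal] unfolding edim_def by blast
    have xm: "x i \<in> max_ideal R" if "i < m" for i
      using R.genideal_self[of "x ` {..<m}"] x that assms(11) by auto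
    have ym: "y i \<in> max_ideal S" if "i < n" for i
      using S.genideal_self[of "y ` {..<n}"] y that assms(12) by auto
    \<comment> \<open>The generators of the two maximal ideals, placed one after the other in the fibre product.\<close>
    define z where "z = (\<lambda>i. if i < m then (x i, \<zero>\<^bsub>S\<^esub>)
      else if i < m + n then (\<zero>\<^bsub>R\<^esub>, y (i - m)) else (\<zero>\<^bsub>R\<^esub>, \<zero>\<^bsub>S\<^esub>))"
    let ?I = "{..<m}" and ?J = "{m..<m + n}"
    have px: "pR (x i) = \<zero>\<^bsub>k\<^esub>" if "i < m" for i
    proof -
      have "x i \<in> carrier R" using x(1) by auto
      then show ?thesis using F.p_kernel[of "x i"] xm[OF that] by simp
    qed
    have py: "pS (y i) = \<zero>\<^bsub>k\<^esub>" if "i < n" for i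
    proof -
      have "y i \<in> carrier S" using y(1) by auto
      then show ?thesis using F.q_kernel[of "y i"] ym[OF that] by simp
    qed
    have zP: "z i \<in> carrier F.P" for i
    proof (cases "i < m")
      case True
      then show ?thesis using x(1) px[of i] by (simp add: z_def fibre_product_simps Pi_iff)
    next
      case False
      show ?thesis
      proof (cases "i < m + n")
        case True
        then have "pS (y (i - m)) = \<zero>\<^bsub>k\<^esub>" using False by (intro py) simp
        then show ?thesis using False True y(1) by (simp add: z_def fibre_product_simps Pi_iff)
      next
        case False
        then show ?thesis by (simp add: z_def fibre_product_simps)
      qed
    qed
    have shift: "bij_betw (\<lambda>i. i - m) ?J {..<n}"
      by (rule bij_betw_byWitness[of _ "\<lambda>i. i + m"]) auto
    have imgR: "(\<lambda>i. fst (z i)) ` ?I = x ` ?I" by (auto simp: z_def)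
    have "(\<lambda>i. snd (z i)) ` ?J = (\<lambda>i. y (i - m)) ` ?J" by (intro image_cong) (auto simp: z_def)
    also have "\<dots> = y ` (\<lambda>i. i - m) ` ?J" by (simp add: image_image)
    also have "(\<lambda>i. i - m) ` ?J = {..<n}" by (rule bij_betw_imp_surj_on[OF shift])
    finally have imgS: "(\<lambda>i. snd (z i)) ` ?J = y ` {..<n}" .
    interpret G: glued F.P R S fst snd ?I ?J z Q \<theta>
    proof (intro glued.intro fibre_generators.intro fibre_generators_axioms.intro glued_axioms.intro
        F.fibre_square_fibre_product assms(4,6) Q.artin_local_ring_axioms \<theta>)
      show "Idl\<^bsub>R\<^esub> ((\<lambda>i. fst (z i)) ` ?I) = max_ideal R" unfolding imgR using x(2) assms(11) by simp
      show "Idl\<^bsub>S\<^esub> ((\<lambda>i. snd (z i)) ` ?J) = max_ideal S" unfolding imgS using y(2) assms(12) by simp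
      show "soc R \<subseteq> max_ideal R \<cdot>\<^bsub>R\<^esub> max_ideal R" by (rule F.soc_subset_square[OF assms(4) sqR])
      show "soc S \<subseteq> max_ideal S \<cdot>\<^bsub>S\<^esub> max_ideal S" by (rule F'.soc_subset_square[OF assms(6) sqS])
    qed (use zP assms(11,12) ker_soc ker_graph onto_R in \<open>auto simp: z_def\<close>)
    have pos: "1 \<le> card ?I" "1 \<le> card ?J"
    proof -
      have "m \<noteq> 0"
      proof
        assume "m = 0"
        then have "max_ideal R \<subseteq> {\<zero>\<^bsub>R\<^esub>}"
          using R.genideal_minimal[OF R.zeroideal, of "{}"] x(2) assms(11) by simp
        then show False using mR additive_subgroup.zero_closed[OF ideal.axioms(1)[OF R.ideal_max_ideal]] by blast
      qed
      moreover have "n \<noteq> 0"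
      proof
        assume "n = 0"
        then have "max_ideal S \<subseteq> {\<zero>\<^bsub>S\<^esub>}"
          using S.genideal_minimal[OF S.zeroideal, of "{}"] y(2) assms(12) by simp
        then show False using mS additive_subgroup.zero_closed[OF ideal.axioms(1)[OF S.ideal_max_ideal]] by blast
      qed
      ultimately show "1 \<le> card ?I" "1 \<le> card ?J" by auto
    qed
    have union: "?I \<union> ?J = {..<m + n}" by auto
    have edim_Q: "edim Q = m + n" using G.edim_Q G.card_K by simp
    interpret \<theta>: ring_epi F.P Q \<theta> by (rule \<theta>)
    have zQ: "(\<lambda>i. \<theta> (z i)) \<in> UNIV \<rightarrow> carrier Q" using zP by auto
    have numQ: "min_gens Q' IQ = len (submods (tuples Q {..<m + n}) (scals Q {..<m + n}))
        (koszul Q {..<m + n} (\<lambda>i. \<theta> (z i))) (syz Q {..<m + n} (\<lambda>i. \<theta> (z i)))"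
      using cohen_presentation_min_gens(2)[OF Q.local_ring_axioms assms(8) zQ] G.gen_Q
      unfolding union edim_Q by simp
    have numR: "min_gens R' IR = len (submods (tuples R ?I) (scals R ?I))
        (koszul R ?I (\<lambda>i. fst (z i))) (syz R ?I (\<lambda>i. fst (z i)))"
    proof -
      have eq: "fst (z i) = x i" if "i \<in> ?I" for i using that by (simp add: z_def)
      have "koszul R ?I (\<lambda>i. fst (z i)) = koszul R ?I x" by (rule koszul_cong[OF eq])
      moreover have "syz R ?I (\<lambda>i. fst (z i)) = syz R ?I x" by (rule R.syz_cong[OF eq]) (use x(1) in auto)
      ultimately show ?thesis
        using cohen_presentation_min_gens(2)[OF R.local_ring_axioms assms(9) x] assms(11) by simp
    qed
    have numS: "min_gens S' IS = len (submods (tuples S ?J) (scals S ?J))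
        (koszul S ?J (\<lambda>i. snd (z i))) (syz S ?J (\<lambda>i. snd (z i)))"
    proof -
      have eq: "snd (z i) = y (i - m)" if "i \<in> ?J" for i using that by (simp add: z_def)
      have "koszul S ?J (\<lambda>i. snd (z i)) = koszul S ?J (\<lambda>i. y (i - m))" by (rule koszul_cong[OF eq])
      moreover have "syz S ?J (\<lambda>i. snd (z i)) = syz S ?J (\<lambda>i. y (i - m))"
        by (rule S.syz_cong[OF eq]) (use y(1) in auto)
      moreover have "y \<in> {..<n} \<rightarrow> carrier S" using y(1) by auto
      ultimately show ?thesis
        using cohen_presentation_min_gens(2)[OF S.local_ring_axioms assms(10) y] assms(12)
          S.reindex_koszul_homology[OF shift finite_lessThan, of y] by simp
    qed
    show ?thesis
      using G.koszul_homology_Q[OF pos] unfolding union numQ numR numS by simp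
  qed
qed

end
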